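(* Let $(X,\omega)$ be a complex Hermitian manifold with $\dim_{\mathbb C}X=n\ge2$. For any $C^\infty$ function $\eta$ on $X$ such that $\eta>0$ or $\eta<0$ and any $k\in\{0,\dots,2n\}$, the following rough $\eta$-Bochner-Kodaira-Nakano identity holds on the $C^\infty$ $k$-forms on $X$: $$\Delta_\eta=\overline\Delta_{-\eta}+i\,\big[[D_\eta,\overline D_{-\eta}],\Lambda\big]+[\overline D_{-\eta},\overline\tau_{-\eta}^\star]-[D_\eta,\tau_\eta^\star]+n\,\Big[D_\eta,\ \tfrac1\eta\,[\,i\,\overline d_{-\eta}\eta\wedge\cdot\,,\Lambda]\Big]+n\,\Big[\overline D_{-\eta},\ \tfrac1\eta\,[\,i\,d_\eta\eta\wedge\cdot\,,\Lambda]\Big].$$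
   Context: $\eta$ is real-valued and $\eta>0$ (resp. $\eta<0$) means at every point. The Hermitian metric is identified with its positive definite $(1,1)$-form $\omega$, normalized so that $\omega=i\sum_j\zeta_j\wedge\bar\zeta_j$ for a local orthonormal coframe of $(1,0)$-forms. $\star$ denotes the formal adjoint for the $L^2$-inner product induced by $\omega$ (pointwise adjoint for zero-order operators); $\Lambda$ is the adjoint of $\omega\wedge\cdot$; $[A,B]=AB-(-1)^{ab}BA$ is the graded commutator of operators of degrees $a,b$. The conjugate of an operator $P$ is $\overline P u=\overline{P\bar u}$. $\theta_\eta$ acts on $(p,q)$-forms as multiplication by $\eta^p$ (extended linearly), and $D_\eta:=\theta_\eta d\theta_\eta^{-1}$; $\overline D_{-\eta}$ is the conjugate of $D_{-\eta}$. Explicitly, on $(p,q)$-forms, $$D_\eta=\eta\partial+\bar\partial-p\,\partial\eta\wedge\cdot-\tfrac p\eta\,\bar\partial\eta\wedge\cdot,\qquad \overline D_{-\eta}=\partial-\eta\bar\partial-\tfrac q\eta\,\partial\eta\wedge\cdot+q\,\bar\partial\eta\wedge\cdot.$$ Also $d_\eta\eta=\eta\,\partial\eta+\bar\partial\eta$ and $\overline d_{-\eta}\eta=\partial\eta-\eta\,\bar\partial\eta$ (with $d_\eta=\eta\partial+\bar\partial$, $\overline d_{-\eta}=\partial-\eta\bar\partial$). The $\eta$-torsion operator is $\tau_\eta=[\Lambda,D_\eta\omega\wedge\cdot]$, and $\overline\tau_{-\eta}=[\Lambda,\overline D_{-\eta}\omega\wedge\cdot]$ is the conjugate of $\tau_{-\eta}$.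 The Laplacians are $\Delta_\eta=[D_\eta,D_\eta^\star]$ and $\overline\Delta_{-\eta}=[\overline D_{-\eta},\overline D_{-\eta}^\star]$. *)

theory Defs
  imports "HOL-Analysis.Analysis" "HOL-Library.Function_Algebras"
begin

section \<open>Smooth maps between open sets of normed spaces\<close>

fun Ck_on :: "nat \<Rightarrow> 'a::real_normed_vector set \<Rightarrow> ('a \<Rightarrow> 'b::real_normed_vector) \<Rightarrow> bool" where
  "Ck_on 0 S f \<longleftrightarrow> continuous_on S f"
| "Ck_on (Suc k) S f \<longleftrightarrow>
     (\<forall>x\<in>S. f differentiable (at x)) \<and> (\<forall>v. Ck_on k S (\<lambda>x. frechet_derivative f (at x) v))"

text \<open>Only used for open \<open>S\<close> and finite-dimensional domains, where iterated directional
  derivatives determine all higher Frechet derivatives.\<close>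

definition smooth_on :: "'a::real_normed_vector set \<Rightarrow> ('a \<Rightarrow> 'b::real_normed_vector) \<Rightarrow> bool" where
  "smooth_on S f \<longleftrightarrow> (\<forall>k. Ck_on k S f)"

definition holomorphic_map_on :: "(complex^'n::finite) set \<Rightarrow> (complex^'n \<Rightarrow> complex^'n) \<Rightarrow> bool" where
  "holomorphic_map_on S f \<longleftrightarrow> smooth_on S f \<and>
     (\<forall>z\<in>S. \<forall>c v. frechet_derivative f (at z) (c *s v) = c *s frechet_derivative f (at z) v)"


section \<open>Complex manifolds\<close>

text \<open>The manifold is the whole (Hausdorff, second countable) type \<open>'a\<close>; its complex dimension
  is \<open>CARD('n)\<close>. A chart is a domain together with a coordinate map.\<close>

type_synonym ('a, 'n) chart = "'a set \<times> ('a \<Rightarrow> complex^'n)"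

abbreviation cdom :: "('a, 'n) chart \<Rightarrow> 'a set" where "cdom c \<equiv> fst c"
abbreviation cmap :: "('a, 'n) chart \<Rightarrow> 'a \<Rightarrow> complex^'n" where "cmap c \<equiv> snd c"

definition cimg :: "('a, 'n) chart \<Rightarrow> (complex^'n) set" where
  "cimg c = cmap c ` cdom c"

definition cinv :: "('a, 'n) chart \<Rightarrow> complex^'n \<Rightarrow> 'a" where
  "cinv c = inv_into (cdom c) (cmap c)"

definition complex_atlas ::
    "('a::{t2_space, second_countable_topology}, 'n::finite) chart set \<Rightarrow> bool" where
  "complex_atlas A \<longleftrightarrow>
     (\<Union>c\<in>A. cdom c) = UNIV \<and>
     (\<forall>c\<in>A. open (cdom c) \<and> open (cimg c) \<and> (\<exists>g. homeomorphism (cdom c) (cimg c) (cmap c) g)) \<and>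
     (\<forall>c\<in>A. \<forall>c'\<in>A. holomorphic_map_on (cmap c ` (cdom c \<inter> cdom c')) (cmap c' \<circ> cinv c))"

definition chart_at :: "('a, 'n) chart set \<Rightarrow> 'a \<Rightarrow> ('a, 'n) chart" where
  "chart_at A x = (SOME c. c \<in> A \<and> x \<in> cdom c)"

definition smooth_fun :: "('a, 'n::finite) chart set \<Rightarrow> ('a \<Rightarrow> 'b::real_normed_vector) \<Rightarrow> bool" where
  "smooth_fun A f \<longleftrightarrow> (\<forall>c\<in>A. smooth_on (cimg c) (f \<circ> cinv c))"


section \<open>The complexified exterior algebra of one cotangent space\<close>

text \<open>In a chart with coordinates \<open>z\<close>, an element of the complexified exterior algebra of the cotangent
  space is given by its coefficients: \<open>\<alpha> I J\<close> is the coefficient of \<open>dz\<^sub>I \<and> dzbar\<^sub>J\<close>, where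
  \<open>dz\<^sub>I\<close> and \<open>dzbar\<^sub>J\<close> are wedge products taken in increasing order of the indices (hence the
  linear order on \<open>'n\<close>). The term is of type \<open>(card I, card J)\<close>.\<close>

type_synonym 'n ext = "'n set \<Rightarrow> 'n set \<Rightarrow> complex"

text \<open>\<open>dz\<^sub>I \<and> dz\<^sub>K = shuffle_sign I K dz\<^bsub>I \<union> K\<^esub>\<close> for disjoint \<open>I\<close>, \<open>K\<close>.\<close>

definition shuffle_sign :: "'n::linorder set \<Rightarrow> 'n set \<Rightarrow> complex" where
  "shuffle_sign I K = (-1) ^ card {(i, k). i \<in> I \<and> k \<in> K \<and> k < i}"

text \<open>The factor \<open>(-1) ^ (card L * card (I - K))\<close> comes from moving \<open>dzbar\<^sub>L\<close> past
  \<open>dz\<^bsub>I - K\<^esub>\<close>.\<close>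

definition wedge :: "'n::{finite, linorder} ext \<Rightarrow> 'n ext \<Rightarrow> 'n ext" where
  "wedge \<alpha> \<beta> I J = (\<Sum>K\<in>Pow I. \<Sum>L\<in>Pow J.
     (-1) ^ (card L * card (I - K)) * shuffle_sign K (I - K) * shuffle_sign L (J - L)
       * \<alpha> K L * \<beta> (I - K) (J - L))"

definition dz :: "'n \<Rightarrow> 'n ext" where
  "dz j = (\<lambda>I J. if I = {j} \<and> J = {} then 1 else 0)"

definition dzbar :: "'n \<Rightarrow> 'n ext" where
  "dzbar j = (\<lambda>I J. if I = {} \<and> J = {j} then 1 else 0)"

text \<open>The determinant of the submatrix with rows \<open>I\<close> and columns \<open>K\<close>, both in increasing order;
  0 if that submatrix is not square.\<close>

definition minor :: "complex^'n::{finite, linorder}^'n::{finite, linorder} \<Rightarrow> 'n set \<Rightarrow> 'n set \<Rightarrow> complex" where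
  "minor B I K = (if card I = card K then
     (\<Sum>p | p permutes {..<card I}. of_int (sign p) *
        (\<Prod>a<card I. B $ (sorted_list_of_set I ! a) $ (sorted_list_of_set K ! p a))) else 0)"

text \<open>Pull-back by a \<open>\<complex>\<close>-linear map with matrix \<open>B\<close>: the algebra homomorphism with
  \<open>dz\<^sub>j \<mapsto> \<Sum>\<^sub>k B\<^sub>j\<^sub>k dz\<^sub>k\<close> and \<open>dzbar\<^sub>j \<mapsto> \<Sum>\<^sub>k cnj B\<^sub>j\<^sub>k dzbar\<^sub>k\<close>.\<close>

definition pull :: "complex^'n::{finite, linorder}^'n::{finite, linorder} \<Rightarrow> 'n ext \<Rightarrow> 'n ext" where
  "pull B \<alpha> K L = (\<Sum>I\<in>UNIV. \<Sum>J\<in>UNIV. \<alpha> I J * minor B I K * cnj (minor B J L))"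


section \<open>Differential forms\<close>

text \<open>A differential form (a sum of forms of all degrees) is given by its coefficients in every
  chart of the atlas, compatibly with the changes of coordinates. So that equality of functions is
  equality of forms, the coefficients are 0 outside the domain of the chart.\<close>

type_synonym ('a, 'n) form = "('a, 'n) chart \<Rightarrow> 'a \<Rightarrow> 'n ext"

text \<open>The entry \<open>(j, k)\<close> is the derivative of the coordinate \<open>j\<close> of \<open>c'\<close> with respect to the
  coordinate \<open>k\<close> of \<open>c\<close>.\<close>

definition jacobian :: "('a, 'n::finite) chart \<Rightarrow> ('a, 'n) chart \<Rightarrow> 'a \<Rightarrow> complex^'n^'n" where
  "jacobian c c' x =
     (\<chi> j k. frechet_derivative (cmap c' \<circ> cinv c) (at (cmap c x)) (axis k 1) $ j)"

definition smooth_form :: "('a, 'n::{finite, linorder}) chart set \<Rightarrow> ('a, 'n) form \<Rightarrow> bool" where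
  "smooth_form A u \<longleftrightarrow>
     (\<forall>c x. \<not> (c \<in> A \<and> x \<in> cdom c) \<longrightarrow> u c x = 0) \<and>
     (\<forall>c\<in>A. \<forall>I J. smooth_on (cimg c) (\<lambda>z. u c (cinv c z) I J)) \<and>
     (\<forall>c\<in>A. \<forall>c'\<in>A. \<forall>x\<in>cdom c \<inter> cdom c'. u c x = pull (jacobian c c' x) (u c' x))"

definition of_degree :: "nat \<Rightarrow> ('a, 'n) form \<Rightarrow> bool" where
  "of_degree k u \<longleftrightarrow> (\<forall>c x I J. u c x I J \<noteq> 0 \<longrightarrow> card I + card J = k)"

definition of_type :: "nat \<Rightarrow> nat \<Rightarrow> ('a, 'n) form \<Rightarrow> bool" where
  "of_type p q u \<longleftrightarrow> (\<forall>c x I J. u c x I J \<noteq> 0 \<longrightarrow> card I = p \<and> card J = q)"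

definition form_of_fun :: "('a, 'n) chart set \<Rightarrow> ('a \<Rightarrow> complex) \<Rightarrow> ('a, 'n) form" where
  "form_of_fun A f =
     (\<lambda>c x I J. if c \<in> A \<and> x \<in> cdom c \<and> I = {} \<and> J = {} then f x else 0)"

definition compactly_supported :: "('a::topological_space, 'n) form \<Rightarrow> bool" where
  "compactly_supported u \<longleftrightarrow> compact (closure {x. \<exists>c. u c x \<noteq> 0})"

definition fwedge ::
    "('a, 'n::{finite, linorder}) form \<Rightarrow> ('a, 'n) form \<Rightarrow> ('a, 'n) form" (infixr \<open>\<and>\<and>\<close> 72) where
  "u \<and>\<and> v = (\<lambda>c x. wedge (u c x) (v c x))"

definition fscale :: "('a \<Rightarrow> complex) \<Rightarrow> ('a, 'n) form \<Rightarrow> ('a, 'n) form" where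
  "fscale f u = (\<lambda>c x I J. f x * u c x I J)"

text \<open>The sign comes from rewriting \<open>dzbar\<^sub>J \<and> dz\<^sub>I\<close> as a multiple of \<open>dz\<^sub>I \<and> dzbar\<^sub>J\<close>.\<close>

definition conj_form :: "('a, 'n) form \<Rightarrow> ('a, 'n) form" where
  "conj_form u = (\<lambda>c x I J. (-1) ^ (card I * card J) * cnj (u c x J I))"

text \<open>The Wirtinger derivatives of \<open>f\<close> at \<open>x\<close> in the chart \<open>c\<close>.\<close>

definition wirt :: "('a, 'n::finite) chart \<Rightarrow> 'n \<Rightarrow> ('a \<Rightarrow> complex) \<Rightarrow> 'a \<Rightarrow> complex" where
  "wirt c j f x = (let D = frechet_derivative (f \<circ> cinv c) (at (cmap c x))
     in (D (axis j 1) - \<i> * D (axis j \<i>)) / 2)"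

definition wirtbar :: "('a, 'n::finite) chart \<Rightarrow> 'n \<Rightarrow> ('a \<Rightarrow> complex) \<Rightarrow> 'a \<Rightarrow> complex" where
  "wirtbar c j f x = (let D = frechet_derivative (f \<circ> cinv c) (at (cmap c x))
     in (D (axis j 1) + \<i> * D (axis j \<i>)) / 2)"

definition del :: "('a, 'n::{finite, linorder}) form \<Rightarrow> ('a, 'n) form" where
  "del u = (\<lambda>c x. if x \<in> cdom c
     then \<Sum>j\<in>UNIV. wedge (dz j) (\<lambda>I J. wirt c j (\<lambda>y. u c y I J) x) else 0)"

definition delbar :: "('a, 'n::{finite, linorder}) form \<Rightarrow> ('a, 'n) form" where
  "delbar u = (\<lambda>c x. if x \<in> cdom c
     then \<Sum>j\<in>UNIV. wedge (dzbar j) (\<lambda>I J. wirtbar c j (\<lambda>y. u c y I J) x) else 0)"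

definition ext_d :: "('a, 'n::{finite, linorder}) form \<Rightarrow> ('a, 'n) form" where
  "ext_d u = del u + delbar u"


section \<open>Hermitian metrics and the induced inner products\<close>

text \<open>The matrix \<open>H\<close> of a (1,1)-form \<open>\<omega> = i \<Sum>\<^sub>j\<^sub>k H\<^sub>j\<^sub>k dz\<^sub>j \<and> dzbar\<^sub>k\<close>.\<close>

definition herm_mat :: "'n ext \<Rightarrow> complex^'n::finite^'n::finite" where
  "herm_mat \<alpha> = (\<chi> j k. - \<i> * \<alpha> {j} {k})"

definition hermitian_metric ::
    "('a, 'n::{finite, linorder}) chart set \<Rightarrow> ('a, 'n) form \<Rightarrow> bool" where
  "hermitian_metric A \<omega> \<longleftrightarrow> smooth_form A \<omega> \<and> of_type 1 1 \<omega> \<and>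
     (\<forall>c\<in>A. \<forall>x\<in>cdom c. \<forall>v. v \<noteq> 0 \<longrightarrow>
        (let q = (\<Sum>j\<in>UNIV. \<Sum>k\<in>UNIV. herm_mat (\<omega> c x) $ j $ k * v $ j * cnj (v $ k))
         in Im q = 0 \<and> Re q > 0))"

text \<open>If \<open>\<omega> = i \<Sum>\<^sub>j \<zeta>\<^sub>j \<and> cnj \<zeta>\<^sub>j\<close> with \<open>\<zeta>\<close> orthonormal and \<open>\<zeta> = B dz\<close>, then \<open>H\<^sup>T = B\<^sup>* B\<close>, so
  the Gram matrix of the \<open>dz\<^sub>j\<close>, with entries \<open>\<langle>dz\<^sub>j, dz\<^sub>k\<rangle>\<close>, is \<open>B\<^sup>-\<^sup>1 (B\<^sup>-\<^sup>1)\<^sup>* = (H\<^sup>T)\<^sup>-\<^sup>1\<close>; that of the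
  \<open>dzbar\<^sub>j\<close> is its conjugate, and \<open>dz\<^sub>j\<close>, \<open>dzbar\<^sub>k\<close> are orthogonal.\<close>

definition gram :: "'n ext \<Rightarrow> complex^'n::finite^'n::finite" where
  "gram w = matrix_inv (transpose (herm_mat w))"

text \<open>The inner product on the exterior algebra: products of covectors have inner product
  \<open>\<langle>\<alpha>\<^sub>1 \<and> \<dots> \<and> \<alpha>\<^sub>k, \<beta>\<^sub>1 \<and> \<dots> \<and> \<beta>\<^sub>k\<rangle> = det \<langle>\<alpha>\<^sub>a, \<beta>\<^sub>b\<rangle>\<close>, so the products of an orthonormal coframe
  and its conjugate are orthonormal. Antilinear in the second argument.\<close>

definition ext_inner :: "'n::{finite, linorder} ext \<Rightarrow> 'n ext \<Rightarrow> 'n ext \<Rightarrow> complex" where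
  "ext_inner w \<alpha> \<beta> = (\<Sum>I\<in>UNIV. \<Sum>J\<in>UNIV. \<Sum>K\<in>UNIV. \<Sum>L\<in>UNIV.
     \<alpha> I J * cnj (\<beta> K L) * minor (gram w) I K * cnj (minor (gram w) J L))"

text \<open>The value at \<open>x\<close> does not depend on the chart at \<open>x\<close>.\<close>

definition inner_at :: "('a, 'n::{finite, linorder}) chart set \<Rightarrow> ('a, 'n) form \<Rightarrow>
    'a \<Rightarrow> ('a, 'n) form \<Rightarrow> ('a, 'n) form \<Rightarrow> complex" where
  "inner_at A \<omega> x u v = (let c = chart_at A x in ext_inner (\<omega> c x) (u c x) (v c x))"

text \<open>The volume form \<open>\<omega>\<^sup>n / n!\<close> equals \<open>det H \<Prod>\<^sub>j (i dz\<^sub>j \<and> dzbar\<^sub>j) = 2\<^sup>n det H dx\<^sub>1 \<and> dy\<^sub>1 \<and> \<dots> \<and> dx\<^sub>n \<and> dy\<^sub>n\<close>.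
  The associated measure is the unique Borel measure with this density in every chart.\<close>

definition is_volume_measure :: "('a::topological_space, 'n::finite) chart set \<Rightarrow> ('a, 'n) form \<Rightarrow>
    'a measure \<Rightarrow> bool" where
  "is_volume_measure A \<omega> M \<longleftrightarrow> sets M = sets borel \<and>
     (\<forall>c\<in>A. \<forall>B\<in>sets borel. B \<subseteq> cdom c \<longrightarrow>
        emeasure M B = (\<integral>\<^sup>+ z. ennreal (2 ^ CARD('n) * Re (det (herm_mat (\<omega> c (cinv c z)))))
          * indicator (cmap c ` B) z \<partial>lborel))"

definition volume_measure ::
    "('a::topological_space, 'n::finite) chart set \<Rightarrow> ('a, 'n) form \<Rightarrow> 'a measure" where
  "volume_measure A \<omega> = (THE M. is_volume_measure A \<omega> M)"

definition L2_inner :: "('a::topological_space, 'n::{finite, linorder}) chart set \<Rightarrow> ('a, 'n) form \<Rightarrow>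
    ('a, 'n) form \<Rightarrow> ('a, 'n) form \<Rightarrow> complex" where
  "L2_inner A \<omega> u v = (LINT x|volume_measure A \<omega>. inner_at A \<omega> x u v)"


section \<open>Operators on forms\<close>

type_synonym ('a, 'n) oper = "('a, 'n) form \<Rightarrow> ('a, 'n) form"

definition formal_adjoint :: "('a::topological_space, 'n::{finite, linorder}) chart set \<Rightarrow>
    ('a, 'n) form \<Rightarrow> ('a, 'n) oper \<Rightarrow> ('a, 'n) oper" where
  "formal_adjoint A \<omega> P v = (THE w. smooth_form A w \<and>
     (\<forall>u. smooth_form A u \<and> compactly_supported u \<longrightarrow>
        L2_inner A \<omega> (P u) v = L2_inner A \<omega> u w))"

text \<open>For operators of order zero.\<close>

definition pointwise_adjoint :: "('a::topological_space, 'n::{finite, linorder}) chart set \<Rightarrow>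
    ('a, 'n) form \<Rightarrow> ('a, 'n) oper \<Rightarrow> ('a, 'n) oper" where
  "pointwise_adjoint A \<omega> P v = (THE w. smooth_form A w \<and>
     (\<forall>u. smooth_form A u \<longrightarrow> (\<forall>x. inner_at A \<omega> x (P u) v = inner_at A \<omega> x u w)))"

text \<open>\<open>gcomm a b P Q\<close> is the graded commutator of operators \<open>P\<close>, \<open>Q\<close> of degrees \<open>a\<close>, \<open>b\<close>.\<close>

definition gcomm :: "int \<Rightarrow> int \<Rightarrow> ('a, 'n) oper \<Rightarrow> ('a, 'n) oper \<Rightarrow> ('a, 'n) oper" where
  "gcomm a b P Q = (\<lambda>u. P (Q u) - fscale (\<lambda>_. (-1) powi (a * b)) (Q (P u)))"

definition conj_op :: "('a, 'n) oper \<Rightarrow> ('a, 'n) oper" where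
  "conj_op P u = conj_form (P (conj_form u))"

definition mult_op :: "('a \<Rightarrow> complex) \<Rightarrow> ('a, 'n) oper \<Rightarrow> ('a, 'n) oper" where
  "mult_op f P = (\<lambda>u. fscale f (P u))"

definition lefschetz_adj :: "('a::topological_space, 'n::{finite, linorder}) chart set \<Rightarrow>
    ('a, 'n) form \<Rightarrow> ('a, 'n) oper" where
  "lefschetz_adj A \<omega> = pointwise_adjoint A \<omega> (\<lambda>u. \<omega> \<and>\<and> u)"

definition theta :: "('a \<Rightarrow> real) \<Rightarrow> ('a, 'n) oper" where
  "theta \<eta> u = (\<lambda>c x I J. of_real (\<eta> x) ^ card I * u c x I J)"

text \<open>The inverse of \<open>theta \<eta>\<close> is \<open>theta (1 / \<eta>)\<close>, as \<open>\<eta>\<close> has no zeros.\<close>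

definition D_eta :: "('a \<Rightarrow> real) \<Rightarrow> ('a, 'n::{finite, linorder}) oper" where
  "D_eta \<eta> u = theta \<eta> (ext_d (theta (\<lambda>x. 1 / \<eta> x) u))"

definition Dbar_neg :: "('a \<Rightarrow> real) \<Rightarrow> ('a, 'n::{finite, linorder}) oper" where
  "Dbar_neg \<eta> = conj_op (D_eta (\<lambda>x. - \<eta> x))"

text \<open>The 1-forms \<open>\<eta> \<partial>\<eta> + \<partial>bar \<eta>\<close> and \<open>\<partial>\<eta> - \<eta> \<partial>bar \<eta>\<close>.\<close>

definition d_eta_eta ::
    "('a, 'n::{finite, linorder}) chart set \<Rightarrow> ('a \<Rightarrow> real) \<Rightarrow> ('a, 'n) form" where
  "d_eta_eta A \<eta> = (let e = form_of_fun A (\<lambda>x. of_real (\<eta> x))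
     in fscale (\<lambda>x. of_real (\<eta> x)) (del e) + delbar e)"

definition dbar_neg_eta ::
    "('a, 'n::{finite, linorder}) chart set \<Rightarrow> ('a \<Rightarrow> real) \<Rightarrow> ('a, 'n) form" where
  "dbar_neg_eta A \<eta> = (let e = form_of_fun A (\<lambda>x. of_real (\<eta> x))
     in del e - fscale (\<lambda>x. of_real (\<eta> x)) (delbar e))"

definition torsion :: "('a::topological_space, 'n::{finite, linorder}) chart set \<Rightarrow>
    ('a, 'n) form \<Rightarrow> ('a \<Rightarrow> real) \<Rightarrow> ('a, 'n) oper" where
  "torsion A \<omega> \<eta> = gcomm (-2) 3 (lefschetz_adj A \<omega>) (\<lambda>u. D_eta \<eta> \<omega> \<and>\<and> u)"

definition torsionbar_neg :: "('a::topological_space, 'n::{finite, linorder}) chart set \<Rightarrow>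
    ('a, 'n) form \<Rightarrow> ('a \<Rightarrow> real) \<Rightarrow> ('a, 'n) oper" where
  "torsionbar_neg A \<omega> \<eta> = gcomm (-2) 3 (lefschetz_adj A \<omega>) (\<lambda>u. Dbar_neg \<eta> \<omega> \<and>\<and> u)"

definition Laplace_eta :: "('a::topological_space, 'n::{finite, linorder}) chart set \<Rightarrow>
    ('a, 'n) form \<Rightarrow> ('a \<Rightarrow> real) \<Rightarrow> ('a, 'n) oper" where
  "Laplace_eta A \<omega> \<eta> = gcomm 1 (-1) (D_eta \<eta>) (formal_adjoint A \<omega> (D_eta \<eta>))"

definition Laplacebar_neg :: "('a::topological_space, 'n::{finite, linorder}) chart set \<Rightarrow>
    ('a, 'n) form \<Rightarrow> ('a \<Rightarrow> real) \<Rightarrow> ('a, 'n) oper" where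
  "Laplacebar_neg A \<omega> \<eta> = gcomm 1 (-1) (Dbar_neg \<eta>) (formal_adjoint A \<omega> (Dbar_neg \<eta>))"

end

theory Submission
  imports Defs "Jordan_Normal_Form.Determinant"
begin

text \<open>The formal adjoint of \<open>d\<close> is computed in a chart. The derivative of the inner product induced by \<open>\<omega>\<close>
  in a direction \<open>D\<close> is governed by the operator \<open>[D \<Lambda>, \<omega> \<and> \<cdot>]\<close>. With the pointwise relations
  \<open>[\<Lambda>, dzbar\<^sub>j \<and> \<cdot>] = i (dz\<^sub>j \<and> \<cdot>)\<^sup>\<star>\<close>, their adjoints and conjugates, and the divergence theorem, this gives
  \<open>d\<^sup>\<star> = - i [\<Lambda>, \<partial> - \<partial>bar] - [(d\<omega> \<and> \<cdot>)\<^sup>\<star>, \<omega> \<and> \<cdot>]\<close>. As \<open>\<theta>\<^sub>\<eta>\<close> is pointwise self-adjoint,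
  \<open>D\<^sub>\<eta>\<^sup>\<star> = \<theta>\<^sub>\<eta>\<^sup>-\<^sup>1 d\<^sup>\<star> \<theta>\<^sub>\<eta>\<close>, and moving \<open>\<theta>\<^sub>\<eta>\<close> through this formula turns it into
  \<open>D\<^sub>\<eta>\<^sup>\<star> = i [Dbar\<^sub>-\<^sub>\<eta>, \<Lambda>] - \<tau>\<^sub>\<eta>\<^sup>\<star> + (n / \<eta>) [i dbar\<^sub>-\<^sub>\<eta> \<eta> \<and> \<cdot>, \<Lambda>]\<close>: the factor \<open>n\<close> comes from
  \<open>[\<Lambda>, \<omega> \<and> \<cdot>] = n - p - q\<close>, and all terms in \<open>p\<close> and \<open>q\<close> cancel. The conjugate of this formula for \<open>- \<eta>\<close>
  is the one for the adjoint of \<open>Dbar\<^sub>-\<^sub>\<eta>\<close>. After substituting both in the two Laplacians, the claim is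
  the graded Jacobi identity for \<open>D\<^sub>\<eta>\<close>, \<open>Dbar\<^sub>-\<^sub>\<eta>\<close> and \<open>\<Lambda>\<close>.\<close>

section \<open>Minors\<close>

no_notation vec_index (infixl \<open>$\<close> 100)
no_notation scalar_prod (infix \<open>\<bullet>\<close> 70)

text \<open>Coordinate coframes are kept throughout: a metric that is not Kaehler has no holomorphic
  coordinates in which it is flat to first order, and orthonormal frames would have to be
  differentiated as well. The metric therefore enters only through its Gram matrix and the minors of
  it. Operators are identified by a uniqueness principle: they are determined by the value on 1 and
  by the way they pass the multiplications by \<open>dz j\<close> and \<open>dzbar j\<close>. This
  replaces the Cauchy-Binet formula and also the differentiation of minors: the Gram operator times
  the volume density has logarithmic derivative \<open>[Lam, LH dH]\<close>, whose scalar part is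
  the contribution of the density; its adjoint is, up to sign, the operator named above. Adjoints
  and the volume measure are definite descriptions, so each needs existence and uniqueness. The
  measure is glued from the charts, which works since the real Jacobian of a holomorphic map is the
  squared modulus of the complex one; a formal adjoint is unique because a difference of candidates
  can be tested against its own multiples by bump functions.\<close>

lemma sorted_list_of_set_remove_nth:
  fixes K :: "'a::{finite, linorder} set"
  assumes "b < card K" "c < card K - 1"
  shows "sorted_list_of_set (K - {sorted_list_of_set K ! b}) ! c =
         sorted_list_of_set K ! (if c < b then c else Suc c)"
proof -
  let ?l = "sorted_list_of_set K"
  have l: "length ?l = card K" "distinct ?l" "sorted ?l" "set ?l = K" by auto
  have *: "?l = take b ?l @ ?l ! b # drop (Suc b) ?l"
    using assms l by (simp add: id_take_nth_drop)
  have d: "distinct (take b ?l @ ?l ! b # drop (Suc b) ?l)" using * l(2) by metis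
  have "sorted_list_of_set (K - {?l ! b}) = remove1 (?l ! b) ?l"
    by (simp add: sorted_list_of_set_remove)
  also have "\<dots> = remove1 (?l ! b) (take b ?l @ ?l ! b # drop (Suc b) ?l)" using * by metis
  also have "\<dots> = take b ?l @ drop (Suc b) ?l"
    using d by (auto simp: remove1_append)
  finally show ?thesis using assms l by (auto simp: nth_append min_def)
qed

text \<open>Laplace expansion takes its sign from the position of a column, the exterior algebra
  from the number of smaller indices; this translates one into the other.\<close>

lemma card_less_nth_sorted_list_of_set:
  fixes K :: "'a::{finite, linorder} set"
  assumes "b < card K"
  shows "card {k \<in> K. k < sorted_list_of_set K ! b} = b"
proof -
  let ?l = "sorted_list_of_set K"
  have l: "length ?l = card K" "sorted_wrt (<) ?l" "set ?l = K" by auto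
  have "{k \<in> K. k < ?l ! b} = (!) ?l ` {..<b}"
  proof safe
    fix k assume "k \<in> K" "k < ?l ! b"
    then obtain i where i: "i < card K" "k = ?l ! i" using l by (metis in_set_conv_nth)
    have "i < b" using \<open>k < ?l ! b\<close> i assms l
      by (metis linorder_neqE_nat less_asym' sorted_wrt_nth_less order_less_irrefl)
    then show "k \<in> (!) ?l ` {..<b}" using i by auto
  next
    fix i assume "i < b" then show "?l ! i \<in> K" "?l ! i < ?l ! b" using assms l
       by (metis (no_types, lifting) dual_order.strict_trans nth_mem)
          (metis \<open>i < b\<close> assms l(1,2) sorted_wrt_nth_less)
  qed
  moreover have "inj_on ((!) ?l) {..<b}" using assms l(1)
    by (auto simp: inj_on_def nth_eq_iff_index_eq)
  ultimately show ?thesis by (simp add: card_image)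
qed

text \<open>A matrix type whose dimensions are values, because the size of a minor varies with
  \<open>I\<close> and cannot be an index type.\<close>

definition submat :: "complex^'n::{finite, linorder}^'n::{finite, linorder} \<Rightarrow> 'n set \<Rightarrow> 'n set \<Rightarrow> complex mat" where
  "submat B I K = mat (card I) (card K)
     (\<lambda>(a, b). B $ (sorted_list_of_set I ! a) $ (sorted_list_of_set K ! b))"

lemma minor_eq_det: "card I = card K \<Longrightarrow> minor B I K = det (submat B I K)"
  unfolding minor_def submat_def by (subst det_def'[where n = "card I"]) (auto simp: lessThan_atLeast0 intro!: sum.cong prod.cong dest: permutes_in_image)

lemma minor_empty [simp]: "minor B {} {} = 1"
  by (simp add: minor_def)

lemma minor_card: "card I \<noteq> card K \<Longrightarrow> minor B I K = 0"
  by (simp add: minor_def)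

text \<open>Laplace expansion along the first row, since \<open>i\<close> precedes all of
  \<open>I\<close>; taking a least \<open>i\<close> avoids a sign from the row. It is the seed of
  the homomorphism property of \<open>pull\<close>.\<close>

lemma minor_expand:
  fixes B :: "complex^'n::{finite, linorder}^'n::{finite, linorder}"
  assumes i: "\<And>k. k \<in> I \<Longrightarrow> i < k"
  shows "minor B (insert i I) K =
    (\<Sum>k\<in>K. (-1) ^ card {l \<in> K. l < k} * B $ i $ k * minor B I (K - {k}))"
proof (cases "card K = Suc (card I)")
  case False
  have iI: "i \<notin> I" using i by blast
  have "minor B I (K - {k}) = 0" if "k \<in> K" for k
    using that False by (intro minor_card) (metis card_Suc_Diff1 finite)
  moreover have "minor B (insert i I) K = 0" using False iI by (intro minor_card) auto
  ultimately show ?thesis by simp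
next
  case True
  have iI: "i \<notin> I" using i by blast
  let ?m = "card K"
  let ?l = "sorted_list_of_set K"
  have eq: "sorted_list_of_set (insert i I) = i # sorted_list_of_set I"
  proof -
    have "Min (insert i I) = i" using i by (intro Min_eqI) (auto intro: less_imp_le)
    moreover have "insert i I - {i} = I" using iI by auto
    ultimately show ?thesis using sorted_list_of_set_nonempty[of "insert i I"] by simp
  qed
  have c: "submat B (insert i I) K \<in> carrier_mat ?m ?m" using True iI by (simp add: submat_def)
  have del: "mat_delete (submat B (insert i I) K) 0 b = submat B I (K - {?l ! b})" if b: "b < ?m" for b
  proof (rule eq_matI)
    have bK: "?l ! b \<in> K" using b by (metis nth_mem set_sorted_list_of_set finite length_sorted_list_of_set)
    fix x y assume "x < dim_row (submat B I (K - {?l ! b}))" "y < dim_col (submat B I (K - {?l ! b}))"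
    then have xy: "x < card I" "y < card K - 1" using bK by (auto simp: submat_def)
    show "mat_delete (submat B (insert i I) K) 0 b $$ (x, y) = submat B I (K - {?l ! b}) $$ (x, y)"
      using xy b bK True iI eq sorted_list_of_set_remove_nth[OF b xy(2)]
      by (auto simp: mat_delete_def submat_def)
  next
    have bK: "?l ! b \<in> K" using b by (metis nth_mem set_sorted_list_of_set finite length_sorted_list_of_set)
    show "dim_row (mat_delete (submat B (insert i I) K) 0 b) = dim_row (submat B I (K - {?l ! b}))"
      "dim_col (mat_delete (submat B (insert i I) K) 0 b) = dim_col (submat B I (K - {?l ! b}))"
      using bK iI by (auto simp: submat_def)
  qed
  have cd: "card I = card (K - {?l ! b})" if b: "b < ?m" for b
  proof -
    have bK: "?l ! b \<in> K" using b by (metis nth_mem set_sorted_list_of_set finite length_sorted_list_of_set)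
    then show ?thesis using True by simp
  qed
  have "minor B (insert i I) K = det (submat B (insert i I) K)"
    using True iI by (intro minor_eq_det) simp
  also have "\<dots> = (\<Sum>b<?m. submat B (insert i I) K $$ (0, b) * cofactor (submat B (insert i I) K) 0 b)"
    using True by (intro laplace_expansion_row[OF c]) auto
  also have "\<dots> = (\<Sum>b<?m. (-1) ^ b * B $ i $ (?l ! b) * minor B I (K - {?l ! b}))"
  proof (intro sum.cong refl)
    fix b assume "b \<in> {..<?m}"
    then have b: "b < ?m" by simp
    have "submat B (insert i I) K $$ (0, b) = B $ i $ (?l ! b)"
      using b True iI by (simp add: submat_def eq)
    then show "submat B (insert i I) K $$ (0, b) * cofactor (submat B (insert i I) K) 0 b
        = (-1) ^ b * B $ i $ (?l ! b) * minor B I (K - {?l ! b})"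
      using b by (simp add: cofactor_def del minor_eq_det[OF cd[OF b]])
  qed
  also have "\<dots> = (\<Sum>b<?m. (-1) ^ card {l \<in> K. l < ?l ! b} * B $ i $ (?l ! b) * minor B I (K - {?l ! b}))"
    by (intro sum.cong refl) (simp add: card_less_nth_sorted_list_of_set)
  also have "\<dots> = (\<Sum>k\<in>K. (-1) ^ card {l \<in> K. l < k} * B $ i $ k * minor B I (K - {k}))"
  proof (rule sum.reindex_bij_betw)
    show "bij_betw ((!) ?l) {..<?m} K" by (rule bij_betw_nth) auto
  qed
  finally show ?thesis .
qed

lemma minor_transpose: "minor (\<chi> i j. B $ j $ i) K I = minor B I K"
proof (cases "card I = card K")
  case True
  have "submat (\<chi> i j. B $ j $ i) K I = transpose_mat (submat B I K)"
    by (auto simp: submat_def intro!: eq_matI)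
  moreover have "submat B I K \<in> carrier_mat (card I) (card I)" using True by (simp add: submat_def)
  ultimately show ?thesis using True by (simp add: minor_eq_det det_transpose)
qed (simp add: minor_card)

lemma minor_cnj: "minor (\<chi> i j. cnj (B $ i $ j)) I K = cnj (minor B I K)"
  by (simp add: minor_def)

text \<open>Conjugation by the bijection \<open>l\<close> turns permutations of the index type into
  permutations of an initial segment of the naturals and preserves signs. It links the determinant
  indexed by a type with the one for which Laplace expansion and block matrices are used.\<close>

lemma det_eq_mat_det:
  fixes B :: "'a::comm_ring_1^'n::finite^'n"
  assumes b: "bij_betw l {..<CARD('n)} UNIV"
  shows "Determinants.det B = Determinant.det (Matrix.mat CARD('n) CARD('n) (\<lambda>(a, b). B $ l a $ l b))"
proof -
  let ?N = "{..<CARD('n)}"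
  have inj: "inj_on l ?N" using b by (simp add: bij_betw_def)
  have "Determinants.det B = (\<Sum>p | p permutes ?N. of_int (sign (map_permutation ?N l p)) *
      (\<Prod>i\<in>UNIV. B $ i $ map_permutation ?N l p i))"
    unfolding Determinants.det_def
  proof (rule sum.reindex_bij_betw[symmetric])
    have "map_permutation ?N l = (\<lambda>\<pi> x. if x \<in> UNIV then l (\<pi> (inv_into ?N l x)) else x)"
      using b by (auto simp: map_permutation_def restrict_id_def fun_eq_iff bij_betw_def)
    then show "bij_betw (map_permutation ?N l) {p. p permutes ?N} {p. p permutes UNIV}"
      using bij_betw_permutations[OF b] by simp
  qed
  also have "\<dots> = (\<Sum>p | p permutes ?N. of_int (sign p) * (\<Prod>a<CARD('n). B $ l a $ l (p a)))"
  proof (intro sum.cong refl arg_cong2[where f = "(*)"])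
    fix p assume "p \<in> {p. p permutes ?N}"
    then have p: "p permutes ?N" by simp
    show "(of_int (sign (map_permutation ?N l p)) :: 'a) = of_int (sign p)"
      using sign_map_permutation[OF inj p] by simp
    have "(\<Prod>i\<in>UNIV. B $ i $ map_permutation ?N l p i) = (\<Prod>a\<in>?N. B $ l a $ map_permutation ?N l p (l a))"
      by (rule prod.reindex_bij_betw[OF b, symmetric])
    also have "\<dots> = (\<Prod>a\<in>?N. B $ l a $ l (p a))"
      by (intro prod.cong refl) (simp add: map_permutation_apply[OF inj])
    finally show "(\<Prod>i\<in>UNIV. B $ i $ map_permutation ?N l p i) = (\<Prod>a<CARD('n). B $ l a $ l (p a))" .
  qed
  also have "\<dots> = Determinant.det (Matrix.mat CARD('n) CARD('n) (\<lambda>(a, b). B $ l a $ l b))"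
    by (subst det_def'[where n = "CARD('n)"])
      (auto simp: lessThan_atLeast0 intro!: sum.cong prod.cong dest: permutes_in_image)
  finally show ?thesis .
qed

lemma minor_UNIV:
  fixes B :: "complex^'n::{finite, linorder}^'n::{finite, linorder}"
  shows "minor B UNIV UNIV = Determinants.det B"
proof -
  have "bij_betw ((!) (sorted_list_of_set (UNIV :: 'n set))) {..<CARD('n)} UNIV" by (rule bij_betw_nth) auto
  from det_eq_mat_det[OF this, of B] show ?thesis by (simp add: minor_eq_det submat_def)
qed

hide_const (open) Determinant.det Matrix.row Matrix.mat Matrix.vec Matrix.col Matrix.dim_vec Matrix.transpose_mat

hide_fact (open) Matrix.vec_eq_iff Matrix.transpose_mat_def

lemma vector_eqI: "(\<And>i. v $ i = w $ i) \<Longrightarrow> v = w"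
  and matrix_eqI: "(\<And>i j. A $ i $ j = B $ i $ j) \<Longrightarrow> A = B"
  by (simp_all add: vec_eq_iff)

section \<open>Operators on the exterior algebra\<close>

lemma sum_fun_apply: "(\<Sum>a\<in>A. f a) x = (\<Sum>a\<in>A. f a x)"
  by (induction A rule: infinite_finite_induct) auto

definition scl :: "complex \<Rightarrow> 'n ext \<Rightarrow> 'n ext" where
  "scl c \<alpha> = (\<lambda>I J. c * \<alpha> I J)"

lemma scl_apply [simp]: "scl c \<alpha> I J = c * \<alpha> I J"
  by (simp add: scl_def)

lemma scl_simps:
  "scl c (\<alpha> + \<beta>) = scl c \<alpha> + scl c \<beta>" "scl c (\<alpha> - \<beta>) = scl c \<alpha> - scl c \<beta>"
  "scl (a + b) \<alpha> = scl a \<alpha> + scl b \<alpha>" "scl (a - b) \<alpha> = scl a \<alpha> - scl b \<alpha>"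
  "scl a (scl b \<alpha>) = scl (a * b) \<alpha>" "scl 1 \<alpha> = \<alpha>" "scl 0 \<alpha> = 0" "scl c 0 = 0"
  "scl (-1) \<alpha> = - \<alpha>" "scl (- a) \<alpha> = - scl a \<alpha>" "scl a (- \<alpha>) = - scl a \<alpha>"
  by (auto simp: fun_eq_iff algebra_simps)

lemma scl_sum: "scl c (\<Sum>a\<in>A. f a) = (\<Sum>a\<in>A. scl c (f a))"
  by (auto simp: fun_eq_iff sum_fun_apply sum_distrib_left)

text \<open>The complex linear operators on the exterior algebra form a ring. Below, \<open>E j\<close>, \<open>Eb j\<close> are the exterior
  multiplications by \<open>dz\<^sub>j\<close>, \<open>dzbar\<^sub>j\<close> and \<open>C j\<close>, \<open>Cb j\<close> the dual contractions in the basis \<open>bas I J\<close>, that is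
  \<open>dz\<^sub>I \<and> dzbar\<^sub>J\<close>; \<open>wd \<alpha>\<close> is \<open>\<alpha> \<and> \<cdot>\<close>, \<open>sc a\<close> a scalar, \<open>pl B\<close> the pull-back, and \<open>dag\<close> the adjoint for
  the inner product \<open>ip\<close> with orthonormal basis \<open>bas\<close>. For a metric \<open>w\<close>, \<open>adj w\<close> is the adjoint for
  \<open>ext_inner w\<close>; \<open>Es w j\<close>, \<open>Ebs w j\<close>, \<open>Lam w\<close> are the adjoints of \<open>E j\<close>, \<open>Eb j\<close>, \<open>wd w\<close>. \<open>LH A\<close> is the
  multiplication by the (1,1)-form with matrix \<open>A\<close>, and \<open>Np\<close>, \<open>Nq\<close> act on \<open>(p, q)\<close>-forms as \<open>p\<close>, \<open>q\<close>.\<close>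

typedef 'n lop = "{p :: 'n ext \<Rightarrow> 'n ext.
    (\<forall>\<alpha> \<beta>. p (\<alpha> + \<beta>) = p \<alpha> + p \<beta>) \<and> (\<forall>c \<alpha>. p (scl c \<alpha>) = scl c (p \<alpha>))}"
  morphisms ap Lop
  by (rule exI[of _ id]) auto

setup_lifting type_definition_lop

lemma ap_add: "ap p (\<alpha> + \<beta>) = ap p \<alpha> + ap p \<beta>" and ap_scl: "ap p (scl c \<alpha>) = scl c (ap p \<alpha>)"
  using ap[of p] by auto

lemma ap_0 [simp]: "ap p 0 = 0"
  using ap_scl[of p 0 0] by (simp add: scl_simps)

lemma ap_minus: "ap p (- \<alpha>) = - ap p \<alpha>"
  using ap_scl[of p "-1" \<alpha>] by (simp add: scl_simps)

lemma ap_diff: "ap p (\<alpha> - \<beta>) = ap p \<alpha> - ap p \<beta>"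
  using ap_add[of p \<alpha> "- \<beta>"] by (simp add: ap_minus)

lemma ap_sum: "ap p (\<Sum>a\<in>A. f a) = (\<Sum>a\<in>A. ap p (f a))"
  using sum_comp_morphism[of "ap p" f A] by (simp add: ap_add o_def)

instantiation lop :: (type) ring_1
begin
lift_definition zero_lop :: "'a lop" is "\<lambda>_. 0" by (auto simp: scl_simps)
lift_definition one_lop :: "'a lop" is "\<lambda>\<alpha>. \<alpha>" by auto
lift_definition plus_lop :: "'a lop \<Rightarrow> 'a lop \<Rightarrow> 'a lop" is "\<lambda>p q \<alpha>. p \<alpha> + q \<alpha>"
  by (auto simp: scl_simps)
lift_definition minus_lop :: "'a lop \<Rightarrow> 'a lop \<Rightarrow> 'a lop" is "\<lambda>p q \<alpha>. p \<alpha> - q \<alpha>"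
  by (auto simp: scl_simps)
lift_definition uminus_lop :: "'a lop \<Rightarrow> 'a lop" is "\<lambda>p \<alpha>. - p \<alpha>"
  by (auto simp: scl_simps)
lift_definition times_lop :: "'a lop \<Rightarrow> 'a lop \<Rightarrow> 'a lop" is "\<lambda>p q \<alpha>. p (q \<alpha>)"
  by auto
instance
proof
  show "(0::'a lop) \<noteq> 1"
    by transfer (auto simp: fun_eq_iff intro!: exI[of _ "\<lambda>_ _. 1"])
qed (transfer, auto simp: fun_eq_iff)+
end

lift_definition sc :: "complex \<Rightarrow> 'a lop" is scl
  by (auto simp: scl_simps mult.commute)

lemma ap_simps [simp]:
  "ap 0 \<alpha> = 0" "ap 1 \<alpha> = \<alpha>" "ap (p + q) \<alpha> = ap p \<alpha> + ap q \<alpha>" "ap (p - q) \<alpha> = ap p \<alpha> - ap q \<alpha>"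
  "ap (- p) \<alpha> = - ap p \<alpha>" "ap (p * q) \<alpha> = ap p (ap q \<alpha>)" "ap (sc c) \<alpha> = scl c \<alpha>"
  by (transfer, simp)+

lemma ap_sum_left: "ap (\<Sum>a\<in>A. f a) \<alpha> = (\<Sum>a\<in>A. ap (f a) \<alpha>)"
  using sum_comp_morphism[of "\<lambda>p. ap p \<alpha>" f A] by (simp add: o_def)

lemma lop_eqI: "(\<And>\<alpha>. ap p \<alpha> = ap q \<alpha>) \<Longrightarrow> p = q"
  by (simp add: ap_inject[symmetric] fun_eq_iff)

lemma sc_comm: "sc c * p = p * sc c"
  by (rule lop_eqI) (simp add: ap_scl)

lemma sc_left_commute: "p * (sc c * q) = sc c * (p * q)"
  by (metis mult.assoc sc_comm)

lemma sc_mult: "sc a * sc b = sc (a * b)"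
  by (rule lop_eqI) (simp add: scl_simps)

lemma sc_mult_left: "sc a * (sc b * p) = sc (a * b) * p"
  by (simp add: sc_mult mult.assoc[symmetric])

lemma sc_simps [simp]: "sc 1 = 1" "sc 0 = 0" "sc (- a) = - sc a"
  by (rule lop_eqI, simp add: scl_simps)+

lemma sc_add: "sc (a + b) = sc a + sc b"
  by (rule lop_eqI, simp add: scl_simps)

lemma sc_sum: "sc (\<Sum>a\<in>A. f a) = (\<Sum>a\<in>A. sc (f a))"
  by (induction A rule: infinite_finite_induct) (auto simp: sc_add)

lemma sc_of_nat: "sc (of_nat k) = of_nat k"
  by (induction k) (auto simp: sc_add)

definition oneE :: "'n ext" where
  "oneE = (\<lambda>I J. if I = {} \<and> J = {} then 1 else 0)"

definition bas :: "'n set \<Rightarrow> 'n set \<Rightarrow> 'n ext" where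
  "bas K L = (\<lambda>I J. if I = K \<and> J = L then 1 else 0)"

lemma bas_empty: "bas {} {} = oneE"
  by (simp add: bas_def oneE_def)

lemma bas_expand:
  fixes \<alpha> :: "'n::finite ext"
  shows "\<alpha> = (\<Sum>K\<in>UNIV. \<Sum>L\<in>UNIV. scl (\<alpha> K L) (bas K L))"
proof (intro ext)
  fix I J
  have "(\<Sum>K\<in>UNIV. \<Sum>L\<in>UNIV. scl (\<alpha> K L) (bas K L)) I J =
        (\<Sum>K\<in>UNIV. \<Sum>L\<in>UNIV. if K = I then (if L = J then \<alpha> K L else 0) else 0)"
    unfolding sum_fun_apply by (intro sum.cong refl) (auto simp: bas_def)
  also have "\<dots> = (\<Sum>K\<in>UNIV. if K = I then (\<Sum>L\<in>UNIV. (if L = J then \<alpha> K L else 0)) else 0)"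
    by (intro sum.cong refl) auto
  also have "\<dots> = \<alpha> I J" by simp
  finally show "\<alpha> I J = (\<Sum>K\<in>UNIV. \<Sum>L\<in>UNIV. scl (\<alpha> K L) (bas K L)) I J" by simp
qed

lemma ap_bas_expand:
  fixes \<alpha> :: "'n::finite ext"
  shows "ap p \<alpha> = (\<Sum>K\<in>UNIV. \<Sum>L\<in>UNIV. scl (\<alpha> K L) (ap p (bas K L)))"
  by (subst bas_expand) (simp add: ap_sum ap_scl)

section \<open>Exterior multiplications, contractions and their anticommutation relations\<close>

definition sg :: "'n::{finite, linorder} \<Rightarrow> 'n set \<Rightarrow> complex" where
  "sg j I = (-1) ^ card {k \<in> I. k < j}"

lemma sg_mult_self [simp]: "sg j I * sg j I = 1" "sg j I * (sg j I * x) = x"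
  by (auto simp: sg_def power_mult_distrib[symmetric] mult.assoc[symmetric])

lemma cnj_sg [simp]: "cnj (sg j I) = sg j I"
  by (simp add: sg_def)

lemma sg_insert: "k \<notin> I \<Longrightarrow> sg j (insert k I) = (if k < j then - sg j I else sg j I)"
proof -
  assume k: "k \<notin> I"
  have "{l \<in> insert k I. l < j} = (if k < j then insert k {l \<in> I. l < j} else {l \<in> I. l < j})" by auto
  then show ?thesis using k by (simp add: sg_def)
qed

lemma sg_remove: "k \<in> I \<Longrightarrow> sg j (I - {k}) = (if k < j then - sg j I else sg j I)"
  using sg_insert[of k "I - {k}" j] by (auto simp: insert_absorb split: if_splits)

lift_definition E :: "'n::{finite, linorder} \<Rightarrow> 'n lop" is
  "\<lambda>j \<beta> I J. if j \<in> I then sg j I * \<beta> (I - {j}) J else 0"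
  by (auto simp: fun_eq_iff algebra_simps)

text \<open>The factor \<open>(-1) ^ card I\<close> comes from moving \<open>dzbar j\<close> past
  the holomorphic part with index set \<open>I\<close>.\<close>

lift_definition Eb :: "'n::{finite, linorder} \<Rightarrow> 'n lop" is
  "\<lambda>j \<beta> I J. if j \<in> J then (-1) ^ card I * sg j J * \<beta> I (J - {j}) else 0"
  by (auto simp: fun_eq_iff algebra_simps)

lift_definition C :: "'n::{finite, linorder} \<Rightarrow> 'n lop" is
  "\<lambda>j \<beta> I J. if j \<notin> I then sg j I * \<beta> (insert j I) J else 0"
  by (auto simp: fun_eq_iff algebra_simps)

lift_definition Cb :: "'n::{finite, linorder} \<Rightarrow> 'n lop" is
  "\<lambda>j \<beta> I J. if j \<notin> J then (-1) ^ card I * sg j J * \<beta> I (insert j J) else 0"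
  by (auto simp: fun_eq_iff algebra_simps)

lemma ap_E: "ap (E j) \<beta> I J = (if j \<in> I then sg j I * \<beta> (I - {j}) J else 0)"
  by (simp add: E.rep_eq)
lemma ap_Eb: "ap (Eb j) \<beta> I J = (if j \<in> J then (-1) ^ card I * sg j J * \<beta> I (J - {j}) else 0)"
  by (simp add: Eb.rep_eq)
lemma ap_C: "ap (C j) \<beta> I J = (if j \<notin> I then sg j I * \<beta> (insert j I) J else 0)"
  by (simp add: C.rep_eq)
lemma ap_Cb: "ap (Cb j) \<beta> I J = (if j \<notin> J then (-1) ^ card I * sg j J * \<beta> I (insert j J) else 0)"
  by (simp add: Cb.rep_eq)

lemmas ap_gen = ap_E ap_Eb ap_C ap_Cb

lemma neg1_card_remove: "finite I \<Longrightarrow> j \<in> I \<Longrightarrow> (-1::complex) ^ (card I - Suc 0) = - ((-1) ^ card I)"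
  using card_Suc_Diff1[of I j] by (cases "card I") auto

lemma neg1_sq [simp]: "(-1::complex) ^ k * (-1) ^ k = 1" "(-1::complex) ^ k * ((-1) ^ k * x) = x"
  "(-1::complex) ^ k * (y * ((-1) ^ k * x)) = y * x"
proof -
  show 1: "(-1::complex) ^ k * (-1) ^ k = 1" by (simp add: power_mult_distrib[symmetric])
  show "(-1::complex) ^ k * ((-1) ^ k * x) = x" using 1 by (simp add: mult.assoc[symmetric])
  show "(-1::complex) ^ k * (y * ((-1) ^ k * x)) = y * x"
    using 1 by (metis mult.assoc mult.commute mult.left_neutral)
qed

text \<open>With the next six lemmas these are the canonical anticommutation relations. Most of the
  later algebra rests on them and does not return to coefficients and signs.\<close>

lemma E_E: "E j * E k = - (E k * E j)"
  by (rule lop_eqI) (auto simp: fun_eq_iff ap_gen sg_remove Diff_insert2[symmetric] Diff_insert[symmetric] insert_commute)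

lemma Eb_Eb: "Eb j * Eb k = - (Eb k * Eb j)"
  by (rule lop_eqI) (auto simp: fun_eq_iff ap_gen sg_remove Diff_insert2[symmetric] Diff_insert[symmetric] insert_commute)

lemma Eb_E: "Eb j * E k = - (E k * Eb j)"
  by (rule lop_eqI) (auto simp: fun_eq_iff ap_gen neg1_card_remove)

lemma C_E: "C j * E k = sc (if j = k then 1 else 0) - E k * C j"
  by (rule lop_eqI) (auto simp: fun_eq_iff ap_gen sg_insert sg_remove insert_Diff_if insert_absorb scl_simps)

lemma Cb_Eb: "Cb j * Eb k = sc (if j = k then 1 else 0) - Eb k * Cb j"
  by (rule lop_eqI) (auto simp: fun_eq_iff ap_gen sg_insert sg_remove insert_Diff_if insert_absorb scl_simps)

lemma C_Eb: "C j * Eb k = - (Eb k * C j)"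
  by (rule lop_eqI) (auto simp: fun_eq_iff ap_gen)

lemma Cb_E: "Cb j * E k = - (E k * Cb j)"
  by (rule lop_eqI) (auto simp: fun_eq_iff ap_gen neg1_card_remove)

lemma C_oneE [simp]: "ap (C j) oneE = 0" and Cb_oneE [simp]: "ap (Cb j) oneE = 0"
  by (auto simp: fun_eq_iff ap_gen oneE_def)

lemma remove_eq_iff: "i \<notin> I \<Longrightarrow> i \<in> K \<and> K - {i} = I \<longleftrightarrow> K = insert i I"
  by blast

lemma sg_insert_min: "(\<And>k. k \<in> I \<Longrightarrow> i < k) \<Longrightarrow> sg i (insert i I) = 1"
proof -
  assume i: "\<And>k. k \<in> I \<Longrightarrow> i < k"
  have "{k \<in> insert i I. k < i} = {}" by (auto dest: i order.asym)
  then show ?thesis by (simp only: sg_def card.empty power_0)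
qed

lemma E_bas: "(\<And>k. k \<in> I \<Longrightarrow> i < k) \<Longrightarrow> ap (E i) (bas I L) = bas (insert i I) L"
proof (intro ext)
  fix K M assume i: "\<And>k. k \<in> I \<Longrightarrow> i < k"
  have "i \<notin> I" using i[of i] by blast
  note K = remove_eq_iff[OF this, of K]
  show "ap (E i) (bas I L) K M = bas (insert i I) L K M"
  proof (cases "K = insert i I")
    case True
    then show ?thesis using K sg_insert_min[OF i] by (simp add: ap_E bas_def)
  next
    case False
    then show ?thesis using K by (simp add: ap_E bas_def)
  qed
qed

lemma Eb_bas: "(\<And>k. k \<in> L \<Longrightarrow> i < k) \<Longrightarrow> ap (Eb i) (bas I L) = scl ((-1) ^ card I) (bas I (insert i L))"
proof (intro ext)
  fix K M assume i: "\<And>k. k \<in> L \<Longrightarrow> i < k"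
  have "i \<notin> L" using i[of i] by blast
  note K = remove_eq_iff[OF this, of M]
  show "ap (Eb i) (bas I L) K M = scl ((-1) ^ card I) (bas I (insert i L)) K M"
  proof (cases "M = insert i L")
    case True
    then show ?thesis using K sg_insert_min[OF i] by (simp add: ap_Eb bas_def)
  next
    case False
    then show ?thesis using K by (simp add: ap_Eb bas_def)
  qed
qed

text \<open>The exterior algebra is generated from 1 by left multiplications. Basis elements are
  built with the least index added last, so that \<open>E\<close> produces no sign and
  \<open>Eb\<close> only the sign from passing the \<open>dz\<close> part.\<close>

lemma ext_induct [case_names one add scl E Eb]:
  fixes \<alpha> :: "'n::{finite, linorder} ext"
  assumes one: "P oneE" and add: "\<And>\<alpha> \<beta>. P \<alpha> \<Longrightarrow> P \<beta> \<Longrightarrow> P (\<alpha> + \<beta>)"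
    and scl: "\<And>c \<alpha>. P \<alpha> \<Longrightarrow> P (scl c \<alpha>)"
    and E: "\<And>j \<alpha>. P \<alpha> \<Longrightarrow> P (ap (E j) \<alpha>)" and Eb: "\<And>j \<alpha>. P \<alpha> \<Longrightarrow> P (ap (Eb j) \<alpha>)"
  shows "P \<alpha>"
proof -
  have P0: "P 0" using scl[OF one, of 0] by (simp add: scl_simps)
  have 1: "P (bas {} L)" for L
    using finite[of L]
  proof (induction L rule: finite_linorder_min_induct)
    case (insert b A)
    then show ?case using Eb[of "bas {} A" b] by (simp add: Eb_bas scl_simps)
  qed (simp_all add: bas_empty one)
  have 2: "P (bas K L)" for K L
    using finite[of K]
  proof (induction K rule: finite_linorder_min_induct)
    case (insert b A)
    then show ?case using E[of "bas A L" b] by (simp add: E_bas)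
  qed (simp_all add: 1)
  have sum: "P (\<Sum>a\<in>A. f a)" if "\<And>a. P (f a)" for A :: "'n set set" and f
    using that by (rule_tac finite_induct[of A "\<lambda>A. P (sum f A)"]) (simp_all add: P0 add)
  show ?thesis by (subst bas_expand) (intro sum scl 2)
qed

text \<open>The uniqueness principle in its basic form: the kernel of \<open>p\<close> is a subspace
  that contains 1 and is stable under the generators. It is applied to differences of operators that
  pass the generators in the same way.\<close>

lemma lop_eq_0I:
  assumes "ap p oneE = 0" "\<And>j \<alpha>. ap p \<alpha> = 0 \<Longrightarrow> ap p (ap (E j) \<alpha>) = 0"
    "\<And>j \<alpha>. ap p \<alpha> = 0 \<Longrightarrow> ap p (ap (Eb j) \<alpha>) = 0"
  shows "p = 0"
proof (rule lop_eqI)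
  fix \<alpha> show "ap p \<alpha> = ap 0 \<alpha>"
  proof (rule ext_induct[where P = "\<lambda>\<alpha>. ap p \<alpha> = ap 0 \<alpha>"])
  qed (simp_all add: assms ap_add ap_scl scl_simps)
qed

section \<open>The wedge product in terms of the generators\<close>

lemma wedge_add_right: "wedge \<alpha> (\<beta> + \<gamma>) = wedge \<alpha> \<beta> + wedge \<alpha> \<gamma>"
  by (intro ext) (simp add: wedge_def distrib_left sum.distrib)

lemma wedge_add_left: "wedge (\<alpha> + \<beta>) \<gamma> = wedge \<alpha> \<gamma> + wedge \<beta> \<gamma>"
  by (intro ext) (simp add: wedge_def distrib_left distrib_right sum.distrib)

lemma wedge_scl_right: "wedge \<alpha> (scl c \<beta>) = scl c (wedge \<alpha> \<beta>)"
  by (intro ext) (simp add: wedge_def sum_distrib_left mult_ac)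

lemma wedge_scl_left: "wedge (scl c \<alpha>) \<beta> = scl c (wedge \<alpha> \<beta>)"
  by (intro ext) (simp add: wedge_def sum_distrib_left mult_ac)

lift_definition wd :: "'n::{finite, linorder} ext \<Rightarrow> 'n lop" is wedge
  by (simp add: wedge_add_right wedge_scl_right)

lemma ap_wd [simp]: "ap (wd \<alpha>) \<beta> = wedge \<alpha> \<beta>"
  by (simp add: wd.rep_eq)

lemma wd_add: "wd (\<alpha> + \<beta>) = wd \<alpha> + wd \<beta>" and wd_scl: "wd (scl c \<alpha>) = sc c * wd \<alpha>"
  by (rule lop_eqI, simp add: wedge_add_left wedge_scl_left)+

lemma wd_0 [simp]: "wd 0 = 0"
  using wd_scl[of 0 0] by (simp add: scl_simps)

lemma wd_minus: "wd (- \<alpha>) = - wd \<alpha>"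
  using wd_scl[of "-1" \<alpha>] by (simp add: scl_simps)

lemma wd_diff: "wd (\<alpha> - \<beta>) = wd \<alpha> - wd \<beta>"
  using wd_add[of \<alpha> "- \<beta>"] by (simp add: wd_minus)

lemma wd_sum: "wd (\<Sum>a\<in>A. f a) = (\<Sum>a\<in>A. wd (f a))"
  using sum_comp_morphism[of wd f A] by (simp add: wd_add o_def)

lemma wedge_bas_left:
  "wedge (bas K L) \<beta> I J = (if K \<subseteq> I \<and> L \<subseteq> J then (-1) ^ (card L * card (I - K)) * shuffle_sign K (I - K) * shuffle_sign L (J - L)
        * \<beta> (I - K) (J - L) else 0)"
proof -
  have "wedge (bas K L) \<beta> I J = (\<Sum>K'\<in>Pow I. \<Sum>L'\<in>Pow J. if K' = K then (if L' = L then
     (-1) ^ (card L * card (I - K)) * shuffle_sign K (I - K) * shuffle_sign L (J - L)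
        * \<beta> (I - K) (J - L) else 0) else 0)"
    unfolding wedge_def by (intro sum.cong refl) (auto simp: bas_def)
  also have "\<dots> = (\<Sum>K'\<in>Pow I. if K' = K then (\<Sum>L'\<in>Pow J. if L' = L then
     (-1) ^ (card L * card (I - K)) * shuffle_sign K (I - K) * shuffle_sign L (J - L)
        * \<beta> (I - K) (J - L) else 0) else 0)"
    by (intro sum.cong refl) auto
  also have "\<dots> = (if K \<subseteq> I \<and> L \<subseteq> J then (-1) ^ (card L * card (I - K)) * shuffle_sign K (I - K) * shuffle_sign L (J - L)
        * \<beta> (I - K) (J - L) else 0)"
    by (simp add: sum.delta)
  finally show ?thesis .
qed

lemma dz_eq_bas: "dz j = bas {j} {}" and dzbar_eq_bas: "dzbar j = bas {} {j}"
  by (auto simp: dz_def dzbar_def bas_def)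

lemma shuffle_sign_empty [simp]: "shuffle_sign {} K = 1" "shuffle_sign K {} = 1"
  by (auto simp: shuffle_sign_def)

text \<open>The inversions of \<open>insert i I\<close> against \<open>K\<close> split into those
  that involve \<open>i\<close> and those that involve \<open>I\<close>.\<close>

lemma shuffle_sign_insert:
  assumes "i \<notin> I"
  shows "shuffle_sign (insert i I) (K :: 'n::{finite, linorder} set) = sg i K * shuffle_sign I K"
proof -
  have "{(a, k). a \<in> insert i I \<and> k \<in> K \<and> k < a} = Pair i ` {k \<in> K. k < i} \<union> {(a, k). a \<in> I \<and> k \<in> K \<and> k < a}"
    by auto
  moreover have "card (Pair i ` {k \<in> K. k < i} \<union> {(a, k). a \<in> I \<and> k \<in> K \<and> k < a}) =
     card (Pair i ` {k \<in> K. k < i}) + card {(a, k). a \<in> I \<and> k \<in> K \<and> k < a}"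
    using assms by (intro card_Un_disjoint) auto
  moreover have "card (Pair i ` {k \<in> K. k < i}) = card {k \<in> K. k < i}"
    by (intro card_image) (auto simp: inj_on_def)
  ultimately show ?thesis by (simp add: shuffle_sign_def sg_def power_add)
qed

lemma sg_remove_self: "sg j (I - {j}) = sg j I"
proof -
  have "{k \<in> I - {j}. k < j} = {k \<in> I. k < j}" by auto
  then show ?thesis by (simp add: sg_def)
qed

lemma wd_dz: "wd (dz j) = E j"
  by (rule lop_eqI)
     (auto simp: fun_eq_iff dz_eq_bas wedge_bas_left ap_E shuffle_sign_insert sg_remove_self)

lemma wd_dzbar: "wd (dzbar j) = Eb j"
  by (rule lop_eqI)
     (auto simp: fun_eq_iff dzbar_eq_bas wedge_bas_left ap_Eb shuffle_sign_insert sg_remove_self)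

lemma wd_oneE: "wd oneE = 1"
  by (rule lop_eqI) (auto simp: fun_eq_iff bas_empty[symmetric] wedge_bas_left)

lemma sg_Un: "K \<inter> M = {} \<Longrightarrow> sg j (K \<union> M) = sg j K * sg j M"
proof -
  assume "K \<inter> M = {}"
  then have "card ({k \<in> K. k < j} \<union> {k \<in> M. k < j}) = card {k \<in> K. k < j} + card {k \<in> M. k < j}"
    by (intro card_Un_disjoint) auto
  moreover have "{k \<in> K \<union> M. k < j} = {k \<in> K. k < j} \<union> {k \<in> M. k < j}" by auto
  ultimately show ?thesis by (simp add: sg_def power_add)
qed

lemma E_bas': "ap (E j) (bas K L) = (if j \<in> K then 0 else scl (sg j K) (bas (insert j K) L))"
proof (cases "j \<in> K")
  case False
  have "ap (E j) (bas K L) I M = scl (sg j K) (bas (insert j K) L) I M" for I M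
    using remove_eq_iff[OF False, of I] sg_remove_self[of j "insert j K"] False
    by (cases "I = insert j K") (simp_all add: ap_gen bas_def)
  with False show ?thesis by (simp only: if_False fun_eq_iff simp_thms)
next
  case True
  then have "\<not> (j \<in> I \<and> I - {j} = K)" for I by blast
  with True show ?thesis by (auto simp: fun_eq_iff ap_gen bas_def)
qed

lemma Eb_bas': "ap (Eb j) (bas K L) = (if j \<in> L then 0 else scl ((-1) ^ card K * sg j L) (bas K (insert j L)))"
proof (cases "j \<in> L")
  case False
  have "ap (Eb j) (bas K L) I M = scl ((-1) ^ card K * sg j L) (bas K (insert j L)) I M" for I M
    using remove_eq_iff[OF False, of M] sg_remove_self[of j "insert j L"] False
    by (cases "M = insert j L") (simp_all add: ap_gen bas_def)
  with False show ?thesis by (simp only: if_False fun_eq_iff simp_thms)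
next
  case True
  then have "\<not> (j \<in> M \<and> M - {j} = L)" for M by blast
  with True show ?thesis by (auto simp: fun_eq_iff ap_gen bas_def)
qed

lemma ext_induct_bas:
  fixes \<alpha> :: "'n::finite ext"
  assumes "\<And>K L. P (bas K L)" "\<And>\<alpha> \<beta>. P \<alpha> \<Longrightarrow> P \<beta> \<Longrightarrow> P (\<alpha> + \<beta>)" "\<And>c \<alpha>. P \<alpha> \<Longrightarrow> P (scl c \<alpha>)"
  shows "P \<alpha>"
proof -
  have P0: "P 0" using assms(3)[OF assms(1), of 0] by (simp add: scl_simps)
  have sum: "P (\<Sum>a\<in>A. f a)" if "\<And>a. P (f a)" for A :: "'n set set" and f
    using that by (rule_tac finite_induct[of A "\<lambda>A. P (sum f A)"]) (simp_all add: P0 assms)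
  show ?thesis by (subst bas_expand) (intro sum assms)
qed

lemma wedge_0 [simp]: "wedge 0 \<beta> = 0"
  by (metis ap_wd ap_simps(1) wd_0)

text \<open>Associativity with a generator on the left. By \<open>ext_induct\<close> this case is
  enough for the multiplicativity of conjugation and of the pull-back.\<close>

lemma wd_E: "wd (ap (E j) \<alpha>) = E j * wd \<alpha>"
proof (rule ext_induct_bas[where P = "\<lambda>\<alpha>. wd (ap (E j) \<alpha>) = E j * wd \<alpha>"])
  fix K L
  show "wd (ap (E j) (bas K L)) = E j * wd (bas K L)"
  proof (rule lop_eqI, intro ext)
    fix \<beta> I J
    show "ap (wd (ap (E j) (bas K L))) \<beta> I J = ap (E j * wd (bas K L)) \<beta> I J"
    proof (cases "j \<notin> K \<and> insert j K \<subseteq> I \<and> L \<subseteq> J")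
      case True
      have "I = insert j K \<union> (I - insert j K)" using True by blast
      then have "sg j I = sg j (insert j K) * sg j (I - insert j K)"
        by (metis sg_Un Diff_disjoint)
      then have s: "sg j I = sg j K * sg j (I - insert j K)"
        using sg_remove_self[of j "insert j K"] True by simp
      have d: "I - insert j K = I - {j} - K" by blast
      show ?thesis using True s
        by (auto simp: E_bas' wedge_scl_left wedge_bas_left ap_E shuffle_sign_insert d subset_Diff_insert)
    next
      case False
      then show ?thesis
        by (auto simp: E_bas' wedge_scl_left wedge_bas_left ap_E subset_Diff_insert)
    qed
  qed
qed (simp_all add: ap_add ap_scl wd_add wd_scl distrib_left sc_left_commute)

lemma wd_Eb: "wd (ap (Eb j) \<alpha>) = Eb j * wd \<alpha>"
proof (rule ext_induct_bas[where P = "\<lambda>\<alpha>. wd (ap (Eb j) \<alpha>) = Eb j * wd \<alpha>"])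
  fix K L
  show "wd (ap (Eb j) (bas K L)) = Eb j * wd (bas K L)"
  proof (rule lop_eqI, intro ext)
    fix \<beta> I J
    show "ap (wd (ap (Eb j) (bas K L))) \<beta> I J = ap (Eb j * wd (bas K L)) \<beta> I J"
    proof (cases "j \<notin> L \<and> insert j L \<subseteq> J \<and> K \<subseteq> I")
      case True
      have "J = insert j L \<union> (J - insert j L)" using True by blast
      then have "sg j J = sg j (insert j L) * sg j (J - insert j L)"
        by (metis sg_Un Diff_disjoint)
      then have s: "sg j J = sg j L * sg j (J - insert j L)"
        using sg_remove_self[of j "insert j L"] True by simp
      have d: "J - insert j L = J - {j} - L" by blast
      \<comment> \<open>Splits the sign \<open>(-1) ^ card I\<close> of \<open>Eb j\<close> into the
        one at \<open>K\<close>, which belongs to the left factor, and the one from moving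
        \<open>dzbar j\<close> past the holomorphic indices of the right factor.\<close>
      have c: "card I = card K + card (I - K)"
        using True by (metis card_Diff_subset card_mono finite le_add_diff_inverse)
      show ?thesis using True s
        by (auto simp: Eb_bas' wedge_scl_left wedge_bas_left ap_Eb shuffle_sign_insert d subset_Diff_insert c power_add)
    next
      case False
      then show ?thesis
        by (auto simp: Eb_bas' wedge_scl_left wedge_bas_left ap_Eb subset_Diff_insert)
    qed
  qed
qed (simp_all add: ap_add ap_scl wd_add wd_scl distrib_left sc_left_commute)

lemma wedge_oneE [simp]: "wedge oneE \<beta> = \<beta>"
  using arg_cong[OF wd_oneE, of "\<lambda>p. ap p \<beta>"] by simp

section \<open>Complex conjugation on the exterior algebra\<close>

definition cj :: "'n ext \<Rightarrow> 'n ext" where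
  "cj \<alpha> = (\<lambda>I J. (-1) ^ (card I * card J) * cnj (\<alpha> J I))"

lemma cj_simps:
  "cj (\<alpha> + \<beta>) = cj \<alpha> + cj \<beta>" "cj (\<alpha> - \<beta>) = cj \<alpha> - cj \<beta>" "cj (- \<alpha>) = - cj \<alpha>"
  "cj (scl c \<alpha>) = scl (cnj c) (cj \<alpha>)" "cj (cj \<alpha>) = \<alpha>" "cj oneE = oneE" "cj 0 = 0"
  by (auto simp: cj_def fun_eq_iff algebra_simps oneE_def)

lemma cj_sum: "cj (\<Sum>a\<in>A. f a) = (\<Sum>a\<in>A. cj (f a))"
  using sum_comp_morphism[of cj f A] by (simp add: o_def cj_simps)

lemma cj_E: "cj (ap (E j) \<alpha>) = ap (Eb j) (cj \<alpha>)"
proof (intro ext)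
  fix I J :: "'a set"
  \<comment> \<open>Removing \<open>j\<close> from \<open>J\<close> changes the sign in
    \<open>cj\<close> by \<open>(-1) ^ card I\<close>, which is the sign built into
    \<open>Eb\<close>.\<close>
  have "(-1::complex) ^ (card I * card J) = (-1) ^ card I * (-1) ^ (card I * (card J - Suc 0))" if "j \<in> J"
  proof -
    have "card J = Suc (card J - Suc 0)" using that by (metis Suc_pred' card_gt_0_iff empty_iff finite One_nat_def)
    then show ?thesis by (metis mult_Suc_right power_add)
  qed
  then show "cj (ap (E j) \<alpha>) I J = ap (Eb j) (cj \<alpha>) I J"
    by (auto simp: cj_def ap_gen)
qed

lemma cj_Eb: "cj (ap (Eb j) \<alpha>) = ap (E j) (cj \<alpha>)"
  by (metis cj_E cj_simps(5))

lemma cj_C: "cj (ap (C j) \<alpha>) = ap (Cb j) (cj \<alpha>)"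
  by (auto simp: cj_def ap_gen fun_eq_iff power_add)

lemma wedge_E: "wedge (ap (E j) \<alpha>) \<beta> = ap (E j) (wedge \<alpha> \<beta>)"
  and wedge_Eb: "wedge (ap (Eb j) \<alpha>) \<beta> = ap (Eb j) (wedge \<alpha> \<beta>)"
  using wd_E[of j \<alpha>] wd_Eb[of j \<alpha>] by (metis ap_simps(6) ap_wd)+

lemma cj_wedge: "cj (wedge \<alpha> \<beta>) = wedge (cj \<alpha>) (cj \<beta>)"
proof (rule ext_induct[where P = "\<lambda>\<alpha>. cj (wedge \<alpha> \<beta>) = wedge (cj \<alpha>) (cj \<beta>)"])
qed (simp_all add: wedge_E wedge_Eb cj_E cj_Eb cj_simps wedge_add_left wedge_scl_left)

section \<open>The reference inner product and its adjoints\<close>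

definition ip :: "'n::finite ext \<Rightarrow> 'n ext \<Rightarrow> complex" where
  "ip \<alpha> \<beta> = (\<Sum>I\<in>UNIV. \<Sum>J\<in>UNIV. \<alpha> I J * cnj (\<beta> I J))"

lemma ip_simps:
  "ip (\<alpha> + \<beta>) \<gamma> = ip \<alpha> \<gamma> + ip \<beta> \<gamma>" "ip \<gamma> (\<alpha> + \<beta>) = ip \<gamma> \<alpha> + ip \<gamma> \<beta>"
  "ip (\<alpha> - \<beta>) \<gamma> = ip \<alpha> \<gamma> - ip \<beta> \<gamma>" "ip \<gamma> (\<alpha> - \<beta>) = ip \<gamma> \<alpha> - ip \<gamma> \<beta>"
  "ip (- \<alpha>) \<gamma> = - ip \<alpha> \<gamma>" "ip \<gamma> (- \<alpha>) = - ip \<gamma> \<alpha>"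
  "ip (scl c \<alpha>) \<gamma> = c * ip \<alpha> \<gamma>" "ip \<gamma> (scl c \<alpha>) = cnj c * ip \<gamma> \<alpha>"
  "ip 0 \<gamma> = 0" "ip \<gamma> 0 = 0"
  by (simp_all add: ip_def algebra_simps sum.distrib sum_distrib_left sum_subtractf sum_negf)

lemma ip_sum: "ip (\<Sum>a\<in>A. f a) \<gamma> = (\<Sum>a\<in>A. ip (f a) \<gamma>)" "ip \<gamma> (\<Sum>a\<in>A. f a) = (\<Sum>a\<in>A. ip \<gamma> (f a))"
  using sum_comp_morphism[of "\<lambda>\<alpha>. ip \<alpha> \<gamma>" f A] sum_comp_morphism[of "ip \<gamma>" f A]
  by (simp_all add: o_def ip_simps)

lemma ip_cnj: "cnj (ip \<alpha> \<beta>) = ip \<beta> \<alpha>"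
  by (simp add: ip_def mult.commute)

lemma ip_bas_left: "ip (bas K L) \<beta> = cnj (\<beta> K L)"
proof -
  have "ip (bas K L) \<beta> = (\<Sum>I\<in>UNIV. if I = K then \<Sum>J\<in>UNIV. if J = L then cnj (\<beta> I J) else 0 else 0)"
    unfolding ip_def
  proof (intro sum.cong refl)
    fix I :: "'a set"
    have "(\<Sum>J\<in>UNIV. bas K L I J * cnj (\<beta> I J)) = (\<Sum>J\<in>UNIV. if J = L then (if I = K then cnj (\<beta> I J) else 0) else 0)"
      by (intro sum.cong refl) (simp add: bas_def)
    then show "(\<Sum>J\<in>UNIV. bas K L I J * cnj (\<beta> I J)) =
      (if I = K then \<Sum>J\<in>UNIV. if J = L then cnj (\<beta> I J) else 0 else 0)" by simp
  qed
  then show ?thesis by simp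
qed

lemma ip_bas_right: "ip \<beta> (bas K L) = \<beta> K L"
  by (metis ip_bas_left ip_cnj complex_cnj_cnj)

lemma ip_eqI: "(\<And>\<alpha>. ip \<alpha> \<beta> = ip \<alpha> \<gamma>) \<Longrightarrow> \<beta> = \<gamma>"
  by (metis ip_bas_left complex_cnj_cancel_iff ext)

lemma ip_self: "ip \<alpha> \<alpha> = of_real (\<Sum>I\<in>UNIV. \<Sum>J\<in>UNIV. (cmod (\<alpha> I J))\<^sup>2)"
  by (simp add: ip_def complex_norm_square[symmetric] mult.commute)

lemma ip_self_pos: "\<alpha> \<noteq> 0 \<Longrightarrow> Re (ip \<alpha> \<alpha>) > 0"
proof -
  assume "\<alpha> \<noteq> 0"
  then obtain I J where IJ: "\<alpha> I J \<noteq> 0" by (auto simp: fun_eq_iff)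
  have "0 < (\<Sum>J\<in>UNIV. (cmod (\<alpha> I J))\<^sup>2)"
    by (rule sum_pos2[of _ J]) (use IJ in auto)
  then have "0 < (\<Sum>I\<in>UNIV. \<Sum>J\<in>UNIV. (cmod (\<alpha> I J))\<^sup>2)"
    by (rule_tac sum_pos2[of _ I]) (auto intro: sum_nonneg)
  then show ?thesis by (simp add: ip_self)
qed

lemma ip_self_Im [simp]: "Im (ip \<alpha> \<alpha>) = 0"
  by (simp add: ip_self)

lemma ip_self_nonneg: "Re (ip \<alpha> \<alpha>) \<ge> 0"
  by (simp add: ip_self sum_nonneg)

text \<open>The conjugate transpose of the matrix of \<open>p\<close> in the basis
  \<open>bas\<close>.\<close>

lift_definition dag :: "'n::finite lop \<Rightarrow> 'n lop" is
  "\<lambda>p \<beta> K L. \<Sum>I\<in>UNIV. \<Sum>J\<in>UNIV. cnj (p (bas K L) I J) * \<beta> I J"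
  by (auto simp: fun_eq_iff algebra_simps sum.distrib sum_distrib_left)

lemma ip_ap: "ip (ap p \<alpha>) \<beta> = ip \<alpha> (ap (dag p) \<beta>)"
proof -
  have "ip (ap p \<alpha>) \<beta> = (\<Sum>K\<in>UNIV. \<Sum>L\<in>UNIV. \<alpha> K L * ip (ap p (bas K L)) \<beta>)"
    by (subst ap_bas_expand) (simp add: ip_sum ip_simps)
  also have "\<dots> = ip \<alpha> (ap (dag p) \<beta>)"
    by (simp add: ip_def dag.rep_eq sum_distrib_left mult_ac)
  finally show ?thesis .
qed

lemma dagI: "(\<And>\<alpha> \<beta>. ip (ap p \<alpha>) \<beta> = ip \<alpha> (ap q \<beta>)) \<Longrightarrow> dag p = q"
  by (rule lop_eqI, rule ip_eqI) (simp add: ip_ap)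

lemma dagI_bas: "(\<And>K L I J. ap p (bas K L) I J = cnj (ap q (bas I J) K L)) \<Longrightarrow> dag p = q"
proof (rule lop_eqI)
  fix \<alpha> assume *: "\<And>K L I J. ap p (bas K L) I J = cnj (ap q (bas I J) K L)"
  have "ap q \<alpha> K L = (\<Sum>I\<in>UNIV. \<Sum>J\<in>UNIV. \<alpha> I J * ap q (bas I J) K L)" for K L
    by (subst ap_bas_expand) (simp add: sum_fun_apply)
  then show "ap (dag p) \<alpha> = ap q \<alpha>"
    by (intro ext) (simp add: dag.rep_eq * mult.commute)
qed

lemma dag_dag [simp]: "dag (dag p) = p"
  by (rule dagI) (metis ip_ap ip_cnj)

lemma dag_simps [simp]:
  "dag (p + q) = dag p + dag q" "dag (p - q) = dag p - dag q" "dag (- p) = - dag p"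
  "dag (p * q) = dag q * dag p" "dag (sc c) = sc (cnj c)" "dag 1 = 1" "dag 0 = 0"
  by (rule dagI, simp add: ip_simps ip_ap)+

lemma dag_sum: "dag (\<Sum>a\<in>A. f a) = (\<Sum>a\<in>A. dag (f a))"
  using sum_comp_morphism[of dag f A] by (simp add: o_def)

lemma dag_E [simp]: "dag (E j) = C j"
proof (rule dagI_bas)
  fix K L I J :: "'a set"
  have "j \<in> I \<and> I - {j} = K \<longleftrightarrow> j \<notin> K \<and> insert j K = I" by blast
  then show "ap (E j) (bas K L) I J = cnj (ap (C j) (bas I J) K L)"
    using sg_remove_self[of j I] by (auto simp: ap_gen bas_def)
qed

lemma dag_Eb [simp]: "dag (Eb j) = Cb j"
proof (rule dagI_bas)
  fix K L I J :: "'a set"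
  have "j \<in> J \<and> J - {j} = L \<longleftrightarrow> j \<notin> L \<and> insert j L = J" by blast
  then show "ap (Eb j) (bas K L) I J = cnj (ap (Cb j) (bas I J) K L)"
    using sg_remove_self[of j J] by (auto simp: ap_gen bas_def)
qed

section \<open>Pull-back by a linear map\<close>

lift_definition pl :: "complex^'n::{finite, linorder}^'n::{finite, linorder} \<Rightarrow> 'n lop" is pull
  by (auto simp: pull_def fun_eq_iff algebra_simps sum.distrib sum_distrib_left)

lemma ap_pl [simp]: "ap (pl B) \<alpha> = pull B \<alpha>"
  by (simp add: pl.rep_eq)

lemma pull_linear: "pull B (\<alpha> + \<beta>) = pull B \<alpha> + pull B \<beta>" "pull B (scl c \<alpha>) = scl c (pull B \<alpha>)"
  "pull B 0 = 0"  "pull B (\<alpha> - \<beta>) = pull B \<alpha> - pull B \<beta>" "pull B (- \<alpha>) = - pull B \<alpha>"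
  by (simp_all only: ap_pl[symmetric] ap_add ap_scl ap_0 ap_diff ap_minus)

lemma pull_sum: "pull B (\<Sum>a\<in>A. f a) = (\<Sum>a\<in>A. pull B (f a))"
  by (simp only: ap_pl[symmetric] ap_sum)

lemma sc_norm:
  "E j * sc c = sc c * E j" "E j * (sc c * q) = sc c * (E j * q)"
  "Eb j * sc c = sc c * Eb j" "Eb j * (sc c * q) = sc c * (Eb j * q)"
  "C j * sc c = sc c * C j" "C j * (sc c * q) = sc c * (C j * q)"
  "Cb j * sc c = sc c * Cb j" "Cb j * (sc c * q) = sc c * (Cb j * q)"
  "pl B * sc c = sc c * pl B" "pl B * (sc c * q) = sc c * (pl B * q)"
  "wd \<alpha> * sc c = sc c * wd \<alpha>" "wd \<alpha> * (sc c * q) = sc c * (wd \<alpha> * q)"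
  "sc a * sc b = sc (a * b)" "sc a * (sc b * q) = sc (a * b) * q"
  by (rule sc_comm[symmetric] sc_left_commute sc_mult sc_mult_left)+

lemma pull_bas: "pull B (bas I J) K L = minor B I K * cnj (minor B J L)"
proof -
  have "pull B (bas I J) K L = (\<Sum>I'\<in>UNIV. if I' = I then (\<Sum>J'\<in>UNIV. if J' = J then minor B I K * cnj (minor B J L) else 0) else 0)"
    unfolding pull_def
  proof (intro sum.cong refl)
    fix I'
    have "(\<Sum>J'\<in>UNIV. bas I J I' J' * minor B I' K * cnj (minor B J' L)) =
       (\<Sum>J'\<in>UNIV. if J' = J then (if I' = I then minor B I K * cnj (minor B J L) else 0) else 0)"
      by (intro sum.cong refl) (simp add: bas_def)
    then show "(\<Sum>J'\<in>UNIV. bas I J I' J' * minor B I' K * cnj (minor B J' L)) =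
       (if I' = I then (\<Sum>J'\<in>UNIV. if J' = J then minor B I K * cnj (minor B J L) else 0) else 0)" by simp
  qed
  then show ?thesis by simp
qed

lemma pull_oneE [simp]: "pull B oneE = oneE"
proof (intro ext)
  fix K L
  show "pull B oneE K L = oneE K L"
    unfolding bas_empty[symmetric] pull_bas
    by (cases "K = {}"; cases "L = {}") (simp_all add: minor_card bas_def)
qed

lemma cj_bas: "cj (bas I J) = scl ((-1) ^ (card I * card J)) (bas J I)"
  by (auto simp: cj_def bas_def fun_eq_iff mult.commute)

lemma cj_pull: "cj (pull B \<alpha>) = pull B (cj \<alpha>)"
proof (rule ext_induct_bas[where P = "\<lambda>\<alpha>. cj (pull B \<alpha>) = pull B (cj \<alpha>)"])
  fix I J
  show "cj (pull B (bas I J)) = pull B (cj (bas I J))"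
  proof (intro ext)
    fix K L
    have "pull B (cj (bas I J)) K L = (-1) ^ (card I * card J) * (minor B J K * cnj (minor B I L))"
      by (simp only: cj_bas pull_linear scl_apply pull_bas)
    moreover have "cj (pull B (bas I J)) K L = (-1) ^ (card K * card L) * cnj (minor B I L * cnj (minor B J K))"
      by (simp only: cj_def pull_bas)
    \<comment> \<open>One side carries the conjugation sign of \<open>K\<close>, \<open>L\<close>,
      the other that of \<open>I\<close>, \<open>J\<close>; they agree wherever the minors are
      nonzero.\<close>
    ultimately show "cj (pull B (bas I J)) K L = pull B (cj (bas I J)) K L"
      by (cases "card I = card L \<and> card J = card K") (auto simp: minor_card mult_ac)
  qed
qed (simp_all add: pull_linear cj_simps)

text \<open>Exterior multiplication by the pull-back of \<open>dz j\<close>.\<close>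

definition rowE :: "complex^'n::{finite, linorder}^'n::{finite, linorder} \<Rightarrow> 'n \<Rightarrow> 'n lop" where
  "rowE B j = (\<Sum>k\<in>UNIV. sc (B $ j $ k) * E k)"

lemma ap_rowE: "ap (rowE B j) \<alpha> I L = (\<Sum>k\<in>I. B $ j $ k * (sg k I * \<alpha> (I - {k}) L))"
  unfolding rowE_def ap_sum_left sum_fun_apply
  by (rule sum.mono_neutral_cong_right) (auto simp: ap_E)

lemma sc_E_swap: "sc a * E k * (sc b * E l) = - (sc b * E l * (sc a * E k))"
proof -
  have "sc a * E k * (sc b * E l) = sc (a * b) * (E k * E l)"
    by (simp only: mult.assoc sc_norm)
  also have "\<dots> = - (sc (b * a) * (E l * E k))"
    using E_E[of k l] by (metis mult.commute mult_minus_right)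
  also have "\<dots> = - (sc b * E l * (sc a * E k))"
    by (simp only: mult.assoc sc_norm)
  finally show ?thesis .
qed

lemma rowE_swap: "rowE B i * rowE B j = - (rowE B j * rowE B i)"
proof -
  have "rowE B i * rowE B j = (\<Sum>k\<in>UNIV. \<Sum>l\<in>UNIV. sc (B $ i $ k) * E k * (sc (B $ j $ l) * E l))"
    by (simp add: rowE_def sum_product)
  also have "\<dots> = (\<Sum>k\<in>UNIV. \<Sum>l\<in>UNIV. - (sc (B $ j $ l) * E l * (sc (B $ i $ k) * E k)))"
    by (intro sum.cong refl sc_E_swap)
  also have "\<dots> = - (rowE B j * rowE B i)"
    unfolding rowE_def sum_product sum_negf by (subst sum.swap) simp
  finally show ?thesis .
qed

lemma pull_bas_insert:
  assumes "\<And>k. k \<in> I \<Longrightarrow> j < k"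
  shows "pull B (bas (insert j I) L) = ap (rowE B j) (pull B (bas I L))"
  by (intro ext) (simp add: pull_bas minor_expand[OF assms] ap_rowE sum_distrib_right sum_distrib_left sg_def mult_ac)

lemma double_eq_0: "(x::'n ext) = - x \<Longrightarrow> x = 0"
proof (intro ext)
  fix I J assume "x = - x"
  then have "x I J = - x I J" by (metis uminus_apply)
  then show "x I J = 0 I J" by simp
qed

text \<open>Minors are expanded only along a least row, so the general case is an induction on
  \<open>I\<close> that compares \<open>j\<close> with the least element \<open>i\<close>. Below
  \<open>i\<close> the expansion applies directly; at \<open>i\<close> both sides vanish, because
  \<open>rowE B i\<close> has square 0; above \<open>i\<close> the two factors are exchanged by
  anticommutation, which reduces to \<open>I\<close> without \<open>i\<close>.\<close>

lemma pull_E_bas: "pull B (ap (E j) (bas I L)) = ap (rowE B j) (pull B (bas I L))"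
proof -
  define P where "P I \<longleftrightarrow> (\<forall>j. pull B (ap (E j) (bas I L)) = ap (rowE B j) (pull B (bas I L)))" for I
  have "P I"
    using finite[of I]
  proof (rule finite_linorder_min_induct)
    show "P {}" unfolding P_def
    proof
      fix j
      show "pull B (ap (E j) (bas {} L)) = ap (rowE B j) (pull B (bas {} L))"
        using pull_bas_insert[of "{}" j B L] by (simp add: E_bas' sg_def scl_simps)
    qed
  next
    fix i I assume "finite I" and min: "\<forall>a\<in>I. i < a" and "P I"
    then have IH: "pull B (ap (E j) (bas I L)) = ap (rowE B j) (pull B (bas I L))" for j
      by (simp add: P_def)
    have i: "\<And>k. k \<in> I \<Longrightarrow> i < k" using min by blast
    have iI: "i \<notin> I" using min by blast
    have sw: "ap (rowE B j) (ap (rowE B i) \<alpha>) = - ap (rowE B i) (ap (rowE B j) \<alpha>)" for j i \<alpha>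
      using arg_cong[OF rowE_swap[of B j i], of "\<lambda>p. ap p \<alpha>"] by simp
    note step = pull_bas_insert[OF i, where L = L and B = B]
    show "P (insert i I)" unfolding P_def
    proof
      fix j
      consider "j < i" | "j = i" | "i < j" by force
      then show "pull B (ap (E j) (bas (insert i I) L)) = ap (rowE B j) (pull B (bas (insert i I) L))"
      proof cases
        case 1
        then have "k \<in> insert i I \<Longrightarrow> j < k" for k using i by force
        then show ?thesis by (simp only: E_bas pull_bas_insert)
      next
        case 2
        have "ap (rowE B i) (ap (rowE B i) (pull B (bas I L))) = 0"
          using sw[of i i] by (rule double_eq_0)
        with 2 show ?thesis by (simp only: E_bas' step pull_linear insertI1 if_True)
      next
        case 3
        show ?thesis
        proof (cases "j \<in> I")
          case True
          then have "ap (rowE B j) (pull B (bas I L)) = 0"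
            using IH[of j] by (simp only: E_bas' pull_linear if_True)
          then have "ap (rowE B j) (ap (rowE B i) (pull B (bas I L))) = 0"
            by (simp only: sw[of j i] ap_0 minus_zero)
          then show ?thesis using True by (simp only: E_bas' step pull_linear insert_iff if_True simp_thms)
        next
          case False
          have i': "\<And>k. k \<in> insert j I \<Longrightarrow> i < k" using i 3 by blast
          have "ap (E j) (bas (insert i I) L) = scl (- sg j I) (bas (insert i (insert j I)) L)"
            using False 3 iI by (simp add: E_bas' sg_insert insert_commute)
          then have "pull B (ap (E j) (bas (insert i I) L)) = scl (- sg j I) (ap (rowE B i) (pull B (bas (insert j I) L)))"
            by (simp only: pull_linear pull_bas_insert[OF i'])
          also have "\<dots> = - ap (rowE B i) (pull B (ap (E j) (bas I L)))"
            using False by (simp only: E_bas' pull_linear ap_scl scl_simps if_False)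
          also have "\<dots> = ap (rowE B j) (pull B (bas (insert i I) L))"
            by (simp only: IH step sw[of j i])
          finally show ?thesis .
        qed
      qed
    qed
  qed
  then show ?thesis by (simp add: P_def)
qed

lemma pl_E: "pl B * E j = rowE B j * pl B"
proof (rule lop_eqI)
  fix \<alpha>
  show "ap (pl B * E j) \<alpha> = ap (rowE B j * pl B) \<alpha>"
  proof (rule ext_induct_bas[where P = "\<lambda>\<alpha>. ap (pl B * E j) \<alpha> = ap (rowE B j * pl B) \<alpha>"])
  qed (simp_all add: pull_E_bas ap_add ap_scl pull_linear)
qed

definition rowEb :: "complex^'n::{finite, linorder}^'n::{finite, linorder} \<Rightarrow> 'n \<Rightarrow> 'n lop" where
  "rowEb B j = (\<Sum>k\<in>UNIV. sc (cnj (B $ j $ k)) * Eb k)"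

lemma cj_rowE: "cj (ap (rowE B j) \<alpha>) = ap (rowEb B j) (cj \<alpha>)"
  by (simp add: rowE_def rowEb_def ap_sum_left cj_sum cj_simps cj_E)

text \<open>The conjugate of \<open>pl_E\<close>, as \<open>pull\<close> commutes with
  \<open>cj\<close> and conjugation exchanges \<open>E j\<close> with \<open>Eb j\<close>.\<close>

lemma pl_Eb: "pl B * Eb j = rowEb B j * pl B"
proof (rule lop_eqI)
  fix \<alpha>
  have "pull B (ap (E j) (cj \<alpha>)) = ap (rowE B j) (pull B (cj \<alpha>))"
    using arg_cong[OF pl_E[of B j], of "\<lambda>p. ap p (cj \<alpha>)"] by simp
  then have "cj (pull B (ap (E j) (cj \<alpha>))) = cj (ap (rowE B j) (pull B (cj \<alpha>)))" by simp
  then show "ap (pl B * Eb j) \<alpha> = ap (rowEb B j * pl B) \<alpha>"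
    by (simp add: cj_pull cj_E cj_rowE cj_simps)
qed

lemma lop_eqI_gen:
  assumes "ap p oneE = ap q oneE"
    and "\<And>j. p * E j = R j * p" "\<And>j. q * E j = R j * q"
    and "\<And>j. p * Eb j = S j * p" "\<And>j. q * Eb j = S j * q"
  shows "p = q"
proof -
  have "p - q = 0"
  proof (rule lop_eq_0I)
    show "ap (p - q) oneE = 0" using assms(1) by simp
    fix j \<alpha> assume *: "ap (p - q) \<alpha> = 0"
    have "ap (p - q) (ap (E j) \<alpha>) = ap ((p - q) * E j) \<alpha>" by simp
    also have "(p - q) * E j = R j * (p - q)" by (simp only: left_diff_distrib right_diff_distrib assms)
    also have "ap \<dots> \<alpha> = 0" using * by (simp del: ap_simps(4))
    finally show "ap (p - q) (ap (E j) \<alpha>) = 0" .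
    have "ap (p - q) (ap (Eb j) \<alpha>) = ap ((p - q) * Eb j) \<alpha>" by simp
    also have "(p - q) * Eb j = S j * (p - q)" by (simp only: left_diff_distrib right_diff_distrib assms)
    also have "ap \<dots> \<alpha> = 0" using * by (simp del: ap_simps(4))
    finally show "ap (p - q) (ap (Eb j) \<alpha>) = 0" .
  qed
  then show ?thesis by simp
qed

lemma pl_E': "pl B * (E j * q) = rowE B j * (pl B * q)" and pl_Eb': "pl B * (Eb j * q) = rowEb B j * (pl B * q)"
  by (simp_all only: mult.assoc[symmetric] pl_E pl_Eb)

text \<open>The function \<open>f\<close> is the identity for \<open>rowE\<close> and
  \<open>cnj\<close> for \<open>rowEb\<close>.\<close>

lemma sum_matrix_mult:
  fixes X :: "'n::finite \<Rightarrow> 'k lop"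
  shows "(\<Sum>k\<in>UNIV. \<Sum>l\<in>UNIV. sc (f (B $ j $ k) * f (A $ k $ l)) * X l) = (\<Sum>l\<in>UNIV. sc (\<Sum>k\<in>UNIV. f (B $ j $ k) * f (A $ k $ l)) * X l)"
  by (subst sum.swap) (simp add: sc_sum sum_distrib_right)

text \<open>On coefficients this is the Cauchy-Binet formula; here both sides merely pass the
  generators in the same way. The order is reversed because pull-back is contravariant.\<close>

lemma pl_mult: "pl A * pl B = pl (B ** A)"
proof (rule lop_eqI_gen)
  fix j
  have "pl A * pl B * E j = pl A * (rowE B j * pl B)"
    by (simp only: mult.assoc pl_E)
  also have "\<dots> = (\<Sum>k\<in>UNIV. sc (B $ j $ k) * (pl A * E k)) * pl B"
    by (simp add: rowE_def sum_distrib_left sum_distrib_right sc_norm mult.assoc)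
  also have "\<dots> = (\<Sum>k\<in>UNIV. \<Sum>l\<in>UNIV. sc (B $ j $ k * A $ k $ l) * E l) * (pl A * pl B)"
    by (simp add: pl_E' rowE_def sum_distrib_left sum_distrib_right mult.assoc sc_norm)
  also have "\<dots> = rowE (B ** A) j * (pl A * pl B)"
    using sum_matrix_mult[of "\<lambda>x. x" B j A E] by (simp add: rowE_def matrix_matrix_mult_def)
  finally show "pl A * pl B * E j = rowE (B ** A) j * (pl A * pl B)" .
  have "pl A * pl B * Eb j = pl A * (rowEb B j * pl B)"
    by (simp only: mult.assoc pl_Eb)
  also have "\<dots> = (\<Sum>k\<in>UNIV. sc (cnj (B $ j $ k)) * (pl A * Eb k)) * pl B"
    by (simp add: rowEb_def sum_distrib_left sum_distrib_right sc_norm mult.assoc)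
  also have "\<dots> = (\<Sum>k\<in>UNIV. \<Sum>l\<in>UNIV. sc (cnj (B $ j $ k) * cnj (A $ k $ l)) * Eb l) * (pl A * pl B)"
    by (simp add: pl_Eb' rowEb_def sum_distrib_left sum_distrib_right mult.assoc sc_norm)
  also have "\<dots> = rowEb (B ** A) j * (pl A * pl B)"
    using sum_matrix_mult[of cnj B j A Eb] by (simp add: rowEb_def matrix_matrix_mult_def cnj_sum)
  finally show "pl A * pl B * Eb j = rowEb (B ** A) j * (pl A * pl B)" .
qed (simp_all add: pl_E pl_Eb)

lemma pl_1: "pl (Finite_Cartesian_Product.mat 1) = 1"
proof (rule lop_eqI_gen)
  have "sc (if j = k then 1 else 0) * X k = (if k = j then X k else 0)" for j k :: 'a and X :: "'a \<Rightarrow> 'a lop"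
    by auto
  then have "rowE (Finite_Cartesian_Product.mat 1) j = E j" "rowEb (Finite_Cartesian_Product.mat 1) j = Eb j" for j :: 'a
    by (simp_all add: rowE_def rowEb_def Finite_Cartesian_Product.mat_def if_distrib[of cnj] cong: if_cong)
  then show "1 * E j = rowE (Finite_Cartesian_Product.mat 1) j * 1"
     "1 * Eb j = rowEb (Finite_Cartesian_Product.mat 1) j * 1" for j :: 'a by simp_all
qed (simp_all add: pl_E pl_Eb)

definition adjm :: "complex^'n^'m \<Rightarrow> complex^'m^'n" where
  "adjm B = (\<chi> i j. cnj (B $ j $ i))"

lemma minor_adjm: "minor (adjm B) I K = cnj (minor B K I)"
proof -
  have "adjm B = (\<chi> i j. cnj ((\<chi> i j. B $ j $ i) $ i $ j))" by (simp add: adjm_def)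
  then show ?thesis by (metis minor_cnj minor_transpose)
qed

lemma dag_pl: "dag (pl B) = pl (adjm B)"
  by (rule dagI_bas) (simp add: pull_bas minor_adjm)

lemma pull_pull: "pull A (pull B \<alpha>) = pull (B ** A) \<alpha>"
  using arg_cong[OF pl_mult[of A B], of "\<lambda>p. ap p \<alpha>"] by simp

lemma pull_wedge: "pull B (wedge \<alpha> \<beta>) = wedge (pull B \<alpha>) (pull B \<beta>)"
proof (rule ext_induct[where P = "\<lambda>\<alpha>. pull B (wedge \<alpha> \<beta>) = wedge (pull B \<alpha>) (pull B \<beta>)"])
  fix j \<alpha> assume *: "pull B (wedge \<alpha> \<beta>) = wedge (pull B \<alpha>) (pull B \<beta>)"
  have E: "pull B (ap (E j) \<gamma>) = ap (rowE B j) (pull B \<gamma>)" "pull B (ap (Eb j) \<gamma>) = ap (rowEb B j) (pull B \<gamma>)" for \<gamma>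
    using arg_cong[OF pl_E[of B j], of "\<lambda>p. ap p \<gamma>"] arg_cong[OF pl_Eb[of B j], of "\<lambda>p. ap p \<gamma>"] by simp_all
  have W: "ap (rowE B j) (wedge \<gamma> \<delta>) = wedge (ap (rowE B j) \<gamma>) \<delta>"
    "ap (rowEb B j) (wedge \<gamma> \<delta>) = wedge (ap (rowEb B j) \<gamma>) \<delta>" for \<gamma> \<delta>
  proof -
    have "wd (ap (rowE B j) \<gamma>) = rowE B j * wd \<gamma>" "wd (ap (rowEb B j) \<gamma>) = rowEb B j * wd \<gamma>"
      by (simp_all add: rowE_def rowEb_def ap_sum_left wd_sum wd_scl wd_E wd_Eb sum_distrib_right mult.assoc)
    then show "ap (rowE B j) (wedge \<gamma> \<delta>) = wedge (ap (rowE B j) \<gamma>) \<delta>"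
    "ap (rowEb B j) (wedge \<gamma> \<delta>) = wedge (ap (rowEb B j) \<gamma>) \<delta>"
      by (metis ap_simps(6) ap_wd)+
  qed
  show "pull B (wedge (ap (E j) \<alpha>) \<beta>) = wedge (pull B (ap (E j) \<alpha>)) (pull B \<beta>)"
    "pull B (wedge (ap (Eb j) \<alpha>) \<beta>) = wedge (pull B (ap (Eb j) \<alpha>)) (pull B \<beta>)"
    by (simp_all only: wedge_E wedge_Eb E * W)
qed (simp_all add: wedge_add_left wedge_scl_left pull_linear)

section \<open>Hermitian metrics on a vector space\<close>

type_synonym 'n cvec = "(complex, 'n) Finite_Cartesian_Product.vec"
type_synonym 'n cmat = "('n cvec, 'n) Finite_Cartesian_Product.vec"

abbreviation mI :: "complex^'n^'n" where "mI \<equiv> Finite_Cartesian_Product.mat 1"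
abbreviation mT :: "complex^'n^'m \<Rightarrow> complex^'m^'n" where "mT \<equiv> Finite_Cartesian_Product.transpose"

definition hform :: "complex^'n::finite^'n::finite \<Rightarrow> complex^'n \<Rightarrow> complex^'n \<Rightarrow> complex" where
  "hform H u v = (\<Sum>j\<in>UNIV. \<Sum>k\<in>UNIV. H $ j $ k * u $ j * cnj (v $ k))"

text \<open>The value of a Hermitian metric at one point. Only realness and positivity on the
  diagonal are asked for; the Hermitian symmetry of the matrix follows by polarisation.\<close>

definition metric :: "'n::{finite, linorder} ext \<Rightarrow> bool" where
  "metric w \<longleftrightarrow> (\<forall>I J. w I J \<noteq> 0 \<longrightarrow> card I = 1 \<and> card J = 1) \<and>
     (\<forall>v. v \<noteq> 0 \<longrightarrow> Im (hform (herm_mat w) v v) = 0 \<and> Re (hform (herm_mat w) v v) > 0)"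

lemma hform_simps:
  "hform H (u + u') v = hform H u v + hform H u' v" "hform H u (v + v') = hform H u v + hform H u v'"
  "hform H (u - u') v = hform H u v - hform H u' v" "hform H u (v - v') = hform H u v - hform H u v'"
  "hform H (c *s u) v = c * hform H u v" "hform H u (c *s v) = cnj c * hform H u v"
  "hform H 0 v = 0" "hform H v 0 = 0"
  by (simp_all add: hform_def algebra_simps sum.distrib sum_subtractf sum_distrib_left)

lemma hform_sum: "hform H (\<Sum>a\<in>A. f a) v = (\<Sum>a\<in>A. hform H (f a) v)" "hform H v (\<Sum>a\<in>A. f a) = (\<Sum>a\<in>A. hform H v (f a))"
  using sum_comp_morphism[of "\<lambda>u. hform H u v" f A] sum_comp_morphism[of "hform H v" f A]
  by (simp_all add: o_def hform_simps)

lemma hform_axis: "hform H (axis j 1) (axis k 1) = H $ j $ k"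
proof -
  have "hform H (axis j 1) (axis k 1) = (\<Sum>a\<in>UNIV. \<Sum>b\<in>UNIV. if b = k then (if a = j then H $ a $ b else 0) else 0)"
    unfolding hform_def by (intro sum.cong refl) (simp add: axis_def)
  then show ?thesis by simp
qed

context
  fixes H :: "complex^'n::finite^'n::finite"
  assumes pos: "\<And>v. v \<noteq> 0 \<Longrightarrow> Im (hform H v v) = 0 \<and> Re (hform H v v) > 0"
begin

lemma hform_real: "Im (hform H v v) = 0"
  using pos[of v] by (cases "v = 0") (simp_all add: hform_simps)

text \<open>Polarisation: realness of the form on \<open>u + v\<close> settles the imaginary part,
  realness on \<open>u\<close> plus i times \<open>v\<close> the real part.\<close>

lemma hform_cnj: "cnj (hform H u v) = hform H v u"
proof (rule complex_eqI)
  have "Im (hform H (u + v) (u + v)) = 0" "Im (hform H (u + \<i> *s v) (u + \<i> *s v)) = 0"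
    "Im (hform H u u) = 0" "Im (hform H v v) = 0" by (rule hform_real)+
  then show "Re (cnj (hform H u v)) = Re (hform H v u)" "Im (cnj (hform H u v)) = Im (hform H v u)"
    by (simp_all add: hform_simps)
qed

text \<open>Gram-Schmidt on the coordinate vectors. The support condition gives the new vector the
  coordinate 1 at \<open>s\<close>, so it is nonzero and can be normalised without an argument about
  linear independence.\<close>

lemma gram_schmidt_hform:
  "\<exists>p. (\<forall>a\<in>S. \<forall>j. j \<notin> S \<longrightarrow> p a $ j = 0) \<and> (\<forall>a\<in>S. \<forall>b\<in>S. hform H (p a) (p b) = (if a = b then 1 else 0))"
  using finite[of S]
proof (induction S rule: finite_induct)
  case (insert s S)
  then obtain p where p: "\<And>a j. a \<in> S \<Longrightarrow> j \<notin> S \<Longrightarrow> p a $ j = 0"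
    "\<And>a b. a \<in> S \<Longrightarrow> b \<in> S \<Longrightarrow> hform H (p a) (p b) = (if a = b then 1 else 0)" by blast
  define v where "v = axis s 1 - (\<Sum>b\<in>S. hform H (axis s 1) (p b) *s p b)"
  have vs: "v $ s = 1" using p(1) insert.hyps by (simp add: v_def)
  then have "v \<noteq> 0" by auto
  then have vv: "Im (hform H v v) = 0" "Re (hform H v v) > 0" using pos by auto
  have vp: "hform H v (p b) = 0" if "b \<in> S" for b
  proof -
    have "(\<Sum>a\<in>S. hform H (axis s 1) (p a) * hform H (p a) (p b)) = (\<Sum>a\<in>S. if a = b then hform H (axis s 1) (p a) else 0)"
      using p(2) that by (intro sum.cong refl) auto
    then show ?thesis using that by (simp add: v_def hform_simps hform_sum)
  qed
  have pv: "hform H (p b) v = 0" if "b \<in> S" for b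
    using vp[OF that] hform_cnj[of v "p b"] by simp
  define r where "r = complex_of_real (1 / sqrt (Re (hform H v v)))"
  have "r * (r * hform H v v) = 1"
  proof -
    have "hform H v v = of_real (Re (hform H v v))" using vv by (simp add: complex_eq_iff)
    then have "r * (r * hform H v v) = of_real (1 / sqrt (Re (hform H v v)) * (1 / sqrt (Re (hform H v v)) * Re (hform H v v)))"
      unfolding r_def by (metis of_real_mult)
    also have "1 / sqrt (Re (hform H v v)) * (1 / sqrt (Re (hform H v v)) * Re (hform H v v)) = 1"
      using vv(2) by (simp add: field_simps)
    finally show ?thesis by simp
  qed
  moreover have "cnj r = r" by (simp add: r_def)
  ultimately have rr: "hform H (r *s v) (r *s v) = 1" by (simp only: hform_simps)
  show ?case
  proof (intro exI[of _ "p(s := r *s v)"] conjI ballI allI impI)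
    fix a j assume "a \<in> insert s S" "j \<notin> insert s S"
    then show "(p(s := r *s v)) a $ j = 0"
      using p(1) by (auto simp: v_def axis_def)
  next
    fix a b assume "a \<in> insert s S" "b \<in> insert s S"
    then show "hform H ((p(s := r *s v)) a) ((p(s := r *s v)) b) = (if a = b then 1 else 0)"
      using p(2) rr vp pv insert.hyps by (auto simp: hform_simps)
  qed
qed auto

text \<open>The rows of \<open>P\<close> form an orthonormal basis, so
  \<open>P ** (H ** adjm P) = mI\<close>; a one-sided inverse of a square matrix is two-sided, which
  lets \<open>P\<close> move to the other end of the product.\<close>

lemma hform_factor: "\<exists>P :: 'n cmat. H ** (adjm P ** P) = mI \<and> adjm P ** P ** H = mI"
proof -
  obtain p :: "'n \<Rightarrow> complex^'n" where p: "\<And>a b. hform H (p a) (p b) = (if a = b then 1 else 0)"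
    using gram_schmidt_hform[of UNIV] by auto
  define P :: "'n cmat" where "P = (\<chi> a. p a)"
  have "P ** (H ** adjm P) = mI"
  proof (intro vec_eq_iff[THEN iffD2] allI)
    fix a b
    have "(P ** (H ** adjm P)) $ a $ b = hform H (p a) (p b)"
      by (simp add: P_def matrix_matrix_mult_def adjm_def hform_def sum_distrib_left mult_ac)
    then show "(P ** (H ** adjm P)) $ a $ b = mI $ a $ b"
      by (simp add: p Finite_Cartesian_Product.mat_def)
  qed
  then have "(H ** adjm P) ** P = mI" by (simp only: matrix_left_right_inverse)
  then have "H ** (adjm P ** P) = mI" by (simp add: matrix_mul_assoc)
  moreover from this have "(adjm P ** P) ** H = mI" by (simp only: matrix_left_right_inverse)
  ultimately show ?thesis by blast
qed

end

lemma adjm_mult: "adjm (A ** B) = adjm B ** adjm A"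
  by (simp add: adjm_def matrix_matrix_mult_def vec_eq_iff mult.commute)

lemma mT_mult: "mT (A ** B) = mT B ** (mT A :: complex^_^_)"
  by (rule matrix_transpose_mul)

lemma det_cnj: "det (\<chi> i j. cnj (B $ i $ j)) = cnj (det B)"
  by (simp add: Determinants.det_def)

lemma det_adjm: "det (adjm B) = cnj (det B)"
proof -
  have "adjm B = (\<chi> i j. cnj (mT B $ i $ j))" by (simp add: adjm_def Finite_Cartesian_Product.transpose_def)
  then show ?thesis by (simp add: det_cnj)
qed

lemma matrix_inv_eq: "A ** B = mI \<Longrightarrow> matrix_inv A = (B :: complex^'n::finite^'n::finite)"
proof -
  assume *: "A ** B = mI"
  then have "B ** A = mI" by (simp only: matrix_left_right_inverse)
  with * have "A ** matrix_inv A = mI \<and> matrix_inv A ** A = mI" unfolding matrix_inv_def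
    by (intro someI[where P = "\<lambda>B. A ** B = mI \<and> B ** A = mI"]) simp
  then have "matrix_inv A ** A = mI" by simp
  have "matrix_inv A = matrix_inv A ** (A ** B)" using * by simp
  also have "\<dots> = B" by (simp add: matrix_mul_assoc \<open>matrix_inv A ** A = mI\<close>)
  finally show ?thesis .
qed

context
  fixes w :: "'n::{finite, linorder} ext"
  assumes w: "metric w"
begin

lemma metric_pos: "v \<noteq> 0 \<Longrightarrow> Im (hform (herm_mat w) v v) = 0 \<and> Re (hform (herm_mat w) v v) > 0"
  using w by (simp add: metric_def)

lemma herm_cnj: "cnj (herm_mat w $ j $ k) = herm_mat w $ k $ j"
  using hform_cnj[OF metric_pos, of "axis j 1" "axis k 1"] by (simp add: hform_axis)

text \<open>The factor \<open>B\<close> is the conjugate of \<open>P\<close> from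
  \<open>hform_factor\<close>, because \<open>gram\<close> inverts the transpose of the metric.
  Positivity of the inner product in every degree and of the determinant both come from this
  factorisation.\<close>

lemma gram_factor: "\<exists>B :: 'n cmat. gram w = adjm B ** B \<and> gram w ** mT (herm_mat w) = mI \<and> mT (herm_mat w) ** gram w = mI"
proof -
  obtain P :: "'n cmat" where P: "herm_mat w ** (adjm P ** P) = mI" "adjm P ** P ** herm_mat w = mI" using hform_factor[OF metric_pos] by blast
  define B :: "'n cmat" where "B = (\<chi> i j. cnj (P $ i $ j))"
  have B: "adjm B ** B = mT (adjm P ** P)"
    by (simp add: B_def adjm_def matrix_matrix_mult_def vec_eq_iff Finite_Cartesian_Product.transpose_def mult.commute)
  have "mT (herm_mat w) ** (adjm B ** B) = mI" "(adjm B ** B) ** mT (herm_mat w) = mI" unfolding B mT_mult[symmetric] P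
    by (simp_all add: transpose_mat)
  moreover from this have "gram w = adjm B ** B" unfolding gram_def by (intro matrix_inv_eq)
  ultimately show ?thesis by (intro exI[of _ B] conjI) simp_all
qed

lemma gram_inv: "gram w ** mT (herm_mat w) = mI" "mT (herm_mat w) ** gram w = mI"
  using gram_factor by auto

lemma gram_herm: "adjm (gram w) = gram w"
proof -
  have "adjm (adjm B) = B" for B :: "'n cmat" by (simp add: adjm_def)
  then show ?thesis using gram_factor adjm_mult by metis
qed

lemma gram_cnj: "cnj (gram w $ j $ k) = gram w $ k $ j"
  using gram_herm by (metis (no_types, lifting) adjm_def vec_lambda_beta)

text \<open>By \<open>gram_factor\<close> the determinant of the Gram matrix is the squared modulus
  of \<open>det B\<close>, and that of the metric is its inverse.\<close>

lemma det_herm: "Im (det (herm_mat w)) = 0" "Re (det (herm_mat w)) > 0"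
  and det_gram: "det (herm_mat w) * det (gram w) = 1"
proof -
  obtain B where B: "gram w = adjm (B :: 'n cmat) ** B" "mT (herm_mat w) ** gram w = mI" using gram_factor by blast
  let ?b = "det B"
  have 1: "det (herm_mat w) * det (gram w) = 1"
    using arg_cong[OF B(2), of det] by (simp add: det_mul Determinants.det_transpose det_I)
  moreover have 2: "det (gram w) = of_real ((cmod ?b)\<^sup>2)"
    unfolding complex_norm_square using B(1) by (simp add: det_mul det_adjm mult.commute)
  ultimately have b: "cmod ?b \<noteq> 0" by auto
  have "det (herm_mat w) = of_real (1 / (cmod ?b)\<^sup>2)"
    using 1 2 b by (simp add: field_simps)
  then show "Im (det (herm_mat w)) = 0" "Re (det (herm_mat w)) > 0" using b by simp_all
  show "det (herm_mat w) * det (gram w) = 1" by (rule 1)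
qed

end

section \<open>Forms of type (1,1), adjoints for a metric and the Lefschetz relations\<close>

lemma type11_expand:
  assumes "\<And>I J. w I J \<noteq> 0 \<Longrightarrow> card I = 1 \<and> card J = 1"
  shows "w = (\<Sum>j\<in>UNIV. \<Sum>k\<in>UNIV. scl (w {j} {k}) (ap (E j) (ap (Eb k) oneE)))"
proof (intro ext)
  fix I J
  have E: "ap (E j) (ap (Eb k) oneE) = bas {j} {k}" for j k
    by (simp add: bas_empty[symmetric] Eb_bas' E_bas' sg_def scl_simps)
  show "w I J = (\<Sum>j\<in>UNIV. \<Sum>k\<in>UNIV. scl (w {j} {k}) (ap (E j) (ap (Eb k) oneE))) I J"
  proof (cases "card I = 1 \<and> card J = 1")
    case True
    then obtain a b where ab: "I = {a}" "J = {b}" by (metis card_1_singletonE)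
    have "(\<Sum>j\<in>UNIV. \<Sum>k\<in>UNIV. scl (w {j} {k}) (bas {j} {k})) I J =
      (\<Sum>j\<in>UNIV. \<Sum>k\<in>UNIV. if k = b then (if j = a then w {j} {k} else 0) else 0)"
      unfolding sum_fun_apply by (intro sum.cong refl) (simp add: bas_def ab)
    then show ?thesis by (simp add: E ab)
  next
    case False
    then have "bas {j} {k} I J = 0" for j k by (auto simp: bas_def)
    then show ?thesis using assms[of I J] False by (auto simp: E sum_fun_apply)
  qed
qed

definition LH :: "complex^'n::{finite, linorder}^'n::{finite, linorder} \<Rightarrow> 'n lop" where
  "LH H = (\<Sum>j\<in>UNIV. \<Sum>k\<in>UNIV. sc (\<i> * H $ j $ k) * (E j * Eb k))"

lemma wd_type11:
  assumes "\<And>I J. w I J \<noteq> 0 \<Longrightarrow> card I = 1 \<and> card J = 1"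
  shows "wd w = LH (herm_mat w)"
  by (subst type11_expand[OF assms])
    (simp_all add: LH_def herm_mat_def wd_sum wd_scl wd_E wd_Eb wd_oneE)

text \<open>The Gram operator of \<open>ext_inner w\<close> relative to \<open>ip\<close>. Its
  matrix consists of minors of the Gram matrix, so it is itself a pull-back and passes the
  generators in a known way.\<close>

definition Mop :: "'n::{finite, linorder} ext \<Rightarrow> 'n lop" where "Mop w = pl (gram w)"

text \<open>The first factor is the inverse of \<open>Mop w\<close>, so this is the reference
  adjoint conjugated by the Gram operator.\<close>

definition adj :: "'n::{finite, linorder} ext \<Rightarrow> 'n lop \<Rightarrow> 'n lop" where
  "adj w p = pl (mT (herm_mat w)) * dag p * Mop w"

definition Lam :: "'n::{finite, linorder} ext \<Rightarrow> 'n lop" where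
  "Lam w = adj w (wd w)"

text \<open>The indices of the Gram matrix stand in opposite order in \<open>Es\<close> and
  \<open>Ebs\<close>, because the Gram matrix of the \<open>dzbar j\<close> is the conjugate, hence
  the transpose, of that of the \<open>dz j\<close>.\<close>

definition Es :: "'n::{finite, linorder} ext \<Rightarrow> 'n \<Rightarrow> 'n lop" where
  "Es w j = (\<Sum>k\<in>UNIV. sc (gram w $ k $ j) * C k)"

definition Ebs :: "'n::{finite, linorder} ext \<Rightarrow> 'n \<Rightarrow> 'n lop" where
  "Ebs w j = (\<Sum>k\<in>UNIV. sc (gram w $ j $ k) * Cb k)"

definition Np :: "'n::{finite, linorder} lop" where "Np = (\<Sum>j\<in>UNIV. E j * C j)"
definition Nq :: "'n::{finite, linorder} lop" where "Nq = (\<Sum>j\<in>UNIV. Eb j * Cb j)"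

lemma sum_swap_pairs:
  "(\<Sum>a\<in>P. \<Sum>b\<in>Q. \<Sum>c\<in>R. \<Sum>d\<in>S. f a b c d) = (\<Sum>c\<in>R. \<Sum>d\<in>S. \<Sum>a\<in>P. \<Sum>b\<in>Q. f a b c d)"
proof -
  have "(\<Sum>a\<in>P. \<Sum>b\<in>Q. \<Sum>c\<in>R. \<Sum>d\<in>S. f a b c d) = (\<Sum>a\<in>P. \<Sum>c\<in>R. \<Sum>b\<in>Q. \<Sum>d\<in>S. f a b c d)"
    by (rule sum.cong[OF refl]) (rule sum.swap)
  also have "\<dots> = (\<Sum>c\<in>R. \<Sum>a\<in>P. \<Sum>b\<in>Q. \<Sum>d\<in>S. f a b c d)" by (rule sum.swap)
  also have "\<dots> = (\<Sum>c\<in>R. \<Sum>a\<in>P. \<Sum>d\<in>S. \<Sum>b\<in>Q. f a b c d)"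
    by (rule sum.cong[OF refl], rule sum.cong[OF refl]) (rule sum.swap)
  also have "\<dots> = (\<Sum>c\<in>R. \<Sum>d\<in>S. \<Sum>a\<in>P. \<Sum>b\<in>Q. f a b c d)"
    by (rule sum.cong[OF refl]) (rule sum.swap)
  finally show ?thesis .
qed

lemma ext_inner_eq: "ext_inner w \<alpha> \<beta> = ip (ap (Mop w) \<alpha>) \<beta>"
proof -
  have "ip (ap (Mop w) \<alpha>) \<beta> = (\<Sum>K\<in>UNIV. \<Sum>L\<in>UNIV. \<Sum>I\<in>UNIV. \<Sum>J\<in>UNIV.
     \<alpha> I J * cnj (\<beta> K L) * minor (gram w) I K * cnj (minor (gram w) J L))"
    by (simp add: ip_def Mop_def pull_def sum_distrib_left mult_ac)
  also have "\<dots> = ext_inner w \<alpha> \<beta>"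
    unfolding ext_inner_def by (rule sum_swap_pairs)
  finally show ?thesis by simp
qed

lemma ext_inner_simps:
  "ext_inner w (\<alpha> + \<beta>) \<gamma> = ext_inner w \<alpha> \<gamma> + ext_inner w \<beta> \<gamma>"
  "ext_inner w \<gamma> (\<alpha> + \<beta>) = ext_inner w \<gamma> \<alpha> + ext_inner w \<gamma> \<beta>"
  "ext_inner w (\<alpha> - \<beta>) \<gamma> = ext_inner w \<alpha> \<gamma> - ext_inner w \<beta> \<gamma>"
  "ext_inner w \<gamma> (\<alpha> - \<beta>) = ext_inner w \<gamma> \<alpha> - ext_inner w \<gamma> \<beta>"
  "ext_inner w (- \<alpha>) \<gamma> = - ext_inner w \<alpha> \<gamma>" "ext_inner w \<gamma> (- \<alpha>) = - ext_inner w \<gamma> \<alpha>"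
  "ext_inner w (scl c \<alpha>) \<gamma> = c * ext_inner w \<alpha> \<gamma>" "ext_inner w \<gamma> (scl c \<alpha>) = cnj c * ext_inner w \<gamma> \<alpha>"
  "ext_inner w 0 \<gamma> = 0" "ext_inner w \<gamma> 0 = 0"
  by (simp_all only: ext_inner_eq ip_simps ap_add ap_diff ap_minus ap_scl ap_0)

lemma ext_inner_sum:
  "ext_inner w (\<Sum>a\<in>A. f a) \<gamma> = (\<Sum>a\<in>A. ext_inner w (f a) \<gamma>)"
  "ext_inner w \<gamma> (\<Sum>a\<in>A. f a) = (\<Sum>a\<in>A. ext_inner w \<gamma> (f a))"
  by (simp_all only: ext_inner_eq ip_sum ap_sum)

context
  fixes w :: "'n::{finite, linorder} ext"
  assumes w: "metric w"
begin

lemma Mop_inv: "Mop w * pl (mT (herm_mat w)) = 1" "pl (mT (herm_mat w)) * Mop w = 1"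
  by (simp_all add: Mop_def pl_mult gram_inv[OF w] pl_1)

lemma dag_Mop: "dag (Mop w) = Mop w"
  by (simp add: Mop_def dag_pl gram_herm[OF w])

lemma ext_inner_cnj: "cnj (ext_inner w \<alpha> \<beta>) = ext_inner w \<beta> \<alpha>"
  by (simp only: ext_inner_eq ip_cnj) (simp add: ip_ap dag_Mop)

lemma ext_inner_nondeg: "(\<And>\<alpha>. ext_inner w \<alpha> \<beta> = ext_inner w \<alpha> \<gamma>) \<Longrightarrow> \<beta> = \<gamma>"
proof (rule ip_eqI)
  fix \<alpha> assume "\<And>\<alpha>. ext_inner w \<alpha> \<beta> = ext_inner w \<alpha> \<gamma>"
  from this[of "ap (pl (mT (herm_mat w))) \<alpha>"] show "ip \<alpha> \<beta> = ip \<alpha> \<gamma>"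
    using arg_cong[OF Mop_inv(1), of "\<lambda>p. ap p \<alpha>"] by (simp add: ext_inner_eq)
qed

text \<open>With \<open>gram w = adjm B ** B\<close> the Gram operator is
  \<open>pl B * dag (pl B)\<close>, so \<open>ext_inner w\<close> on the diagonal is the reference
  norm of the image under the injective operator \<open>dag (pl B)\<close>.\<close>

lemma ext_inner_pos: "\<alpha> \<noteq> 0 \<Longrightarrow> Re (ext_inner w \<alpha> \<alpha>) > 0" "Im (ext_inner w \<alpha> \<alpha>) = 0"
  "Re (ext_inner w \<alpha> \<alpha>) \<ge> 0"
proof -
  obtain B :: "'n cmat" where B: "gram w = adjm B ** B" using gram_factor[OF w] by blast
  have M: "Mop w = pl B * dag (pl B)" by (simp add: Mop_def B dag_pl pl_mult)
  have eq: "ext_inner w \<alpha> \<alpha> = ip (ap (dag (pl B)) \<alpha>) (ap (dag (pl B)) \<alpha>)" for \<alpha>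
    by (simp only: ext_inner_eq M ap_simps ip_ap dag_dag)
  show "Im (ext_inner w \<alpha> \<alpha>) = 0" "Re (ext_inner w \<alpha> \<alpha>) \<ge> 0" by (simp_all only: eq ip_self_Im ip_self_nonneg)
  assume "\<alpha> \<noteq> 0"
  have "ap (dag (pl B)) \<alpha> \<noteq> 0"
  proof
    assume "ap (dag (pl B)) \<alpha> = 0"
    then have "ap (pl (mT (herm_mat w)) * (pl B * dag (pl B))) \<alpha> = 0" by (simp only: ap_simps ap_0)
    moreover have "ap (pl (mT (herm_mat w)) * (pl B * dag (pl B))) \<alpha> = \<alpha>"
      using Mop_inv(2) by (simp only: M ap_simps(2))
    ultimately show False using \<open>\<alpha> \<noteq> 0\<close> by simp
  qed
  then show "Re (ext_inner w \<alpha> \<alpha>) > 0" unfolding eq by (rule ip_self_pos)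
qed

lemma ext_inner_adj: "ext_inner w (ap p \<alpha>) \<beta> = ext_inner w \<alpha> (ap (adj w p) \<beta>)"
proof -
  have "ext_inner w \<alpha> (ap (adj w p) \<beta>) = ip \<alpha> (ap (Mop w * pl (mT (herm_mat w)) * dag p * Mop w) \<beta>)"
    by (simp only: ext_inner_eq ip_ap dag_Mop adj_def ap_simps)
  also have "\<dots> = ip \<alpha> (ap (dag p) (ap (Mop w) \<beta>))"
    by (simp only: Mop_inv mult_1_left ap_simps)
  also have "\<dots> = ext_inner w (ap p \<alpha>) \<beta>"
    by (simp only: ext_inner_eq ip_ap dag_Mop)
  finally show ?thesis by simp
qed

lemma adjI: "(\<And>\<alpha> \<beta>. ext_inner w (ap p \<alpha>) \<beta> = ext_inner w \<alpha> (ap q \<beta>)) \<Longrightarrow> adj w p = q"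
  by (rule lop_eqI, rule ext_inner_nondeg) (simp only: ext_inner_adj)

lemma adj_adj: "adj w (adj w p) = p"
  by (rule adjI) (metis ext_inner_adj ext_inner_cnj)

lemma adj_simps:
  "adj w (p + q) = adj w p + adj w q" "adj w (p - q) = adj w p - adj w q" "adj w (- p) = - adj w p"
  "adj w (p * q) = adj w q * adj w p" "adj w (sc c) = sc (cnj c)"
  by (rule adjI, simp only: ap_simps ext_inner_simps ext_inner_adj complex_cnj_cnj)+

lemma adj_0: "adj w 0 = 0"
  by (simp add: adj_def)

lemma adj_sum: "adj w (\<Sum>a\<in>A. f a) = (\<Sum>a\<in>A. adj w (f a))"
  using sum_comp_morphism[of "adj w" f A] by (simp add: o_def adj_simps adj_0)

lemma adj_E: "adj w (E j) = Es w j"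
proof -
  have "C j * Mop w = dag (Mop w * E j)" by (simp add: dag_Mop)
  also have "\<dots> = Mop w * (\<Sum>k\<in>UNIV. sc (gram w $ k $ j) * C k)"
    by (simp add: Mop_def pl_E dag_pl gram_herm[OF w] rowE_def dag_sum gram_cnj[OF w] sc_norm)
  finally have "pl (mT (herm_mat w)) * C j * Mop w = pl (mT (herm_mat w)) * Mop w * Es w j"
    by (simp only: Es_def mult.assoc)
  then show ?thesis by (simp add: adj_def Mop_inv)
qed

lemma adj_Eb: "adj w (Eb j) = Ebs w j"
proof -
  have "Cb j * Mop w = dag (Mop w * Eb j)" by (simp add: dag_Mop)
  also have "\<dots> = Mop w * (\<Sum>k\<in>UNIV. sc (gram w $ j $ k) * Cb k)"
    by (simp add: Mop_def pl_Eb dag_pl gram_herm[OF w] rowEb_def dag_sum sc_norm)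
  finally have "pl (mT (herm_mat w)) * Cb j * Mop w = pl (mT (herm_mat w)) * Mop w * Ebs w j"
    by (simp only: Ebs_def mult.assoc)
  then show ?thesis by (simp add: adj_def Mop_inv)
qed

lemma adj_Es: "adj w (Es w j) = E j" and adj_Ebs: "adj w (Ebs w j) = Eb j"
  using adj_adj adj_E adj_Eb by metis+

lemma wd_metric: "wd w = LH (herm_mat w)"
  by (rule wd_type11) (use w in \<open>auto simp: metric_def\<close>)

lemma adj_Lam: "adj w (Lam w) = LH (herm_mat w)"
  by (simp add: Lam_def adj_adj wd_metric)

lemma adj_LH: "adj w (LH A) = (\<Sum>j\<in>UNIV. \<Sum>k\<in>UNIV. sc (- \<i> * cnj (A $ j $ k)) * (Ebs w k * Es w j))"
  by (simp add: LH_def adj_sum adj_simps adj_E adj_Eb sc_comm[symmetric])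

lemma Es_E: "Es w j * E k = sc (gram w $ k $ j) - E k * Es w j"
proof -
  have "Es w j * E k = (\<Sum>l\<in>UNIV. sc (gram w $ l $ j) * sc (if l = k then 1 else 0)) - E k * Es w j"
    by (simp add: Es_def sum_distrib_left sum_distrib_right mult.assoc C_E right_diff_distrib sum_subtractf sc_norm)
  also have "(\<Sum>l\<in>UNIV. sc (gram w $ l $ j) * sc (if l = k then 1 else 0)) = (\<Sum>l\<in>UNIV. if l = k then sc (gram w $ l $ j) else 0)"
    by (intro sum.cong refl) auto
  finally show ?thesis by simp
qed

lemma Ebs_Eb: "Ebs w j * Eb k = sc (gram w $ j $ k) - Eb k * Ebs w j"
proof -
  have "Ebs w j * Eb k = (\<Sum>l\<in>UNIV. sc (gram w $ j $ l) * sc (if l = k then 1 else 0)) - Eb k * Ebs w j"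
    by (simp add: Ebs_def sum_distrib_left sum_distrib_right mult.assoc Cb_Eb right_diff_distrib sum_subtractf sc_norm)
  also have "(\<Sum>l\<in>UNIV. sc (gram w $ j $ l) * sc (if l = k then 1 else 0)) = (\<Sum>l\<in>UNIV. if l = k then sc (gram w $ j $ l) else 0)"
    by (intro sum.cong refl) auto
  finally show ?thesis by simp
qed

lemma Es_Eb: "Es w j * Eb k = - (Eb k * Es w j)"
  by (simp add: Es_def sum_distrib_left sum_distrib_right mult.assoc C_Eb sum_negf sc_norm)

lemma Ebs_E: "Ebs w j * E k = - (E k * Ebs w j)"
  by (simp add: Ebs_def sum_distrib_left sum_distrib_right mult.assoc Cb_E sum_negf sc_norm)

lemma Es_oneE [simp]: "ap (Es w j) oneE = 0" and Ebs_oneE [simp]: "ap (Ebs w j) oneE = 0"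
  by (simp_all add: Es_def Ebs_def ap_sum_left scl_simps)

text \<open>For an arbitrary matrix \<open>A\<close>, because the derivative of the metric is a (1,1)-form that need not be positive.\<close>

lemma Ebs_LH: "Ebs w j * LH A - LH A * Ebs w j = - (\<Sum>a\<in>UNIV. \<Sum>b\<in>UNIV. sc (\<i> * A $ a $ b * gram w $ j $ b) * E a)"
proof -
  have "Ebs w j * (E a * Eb b) - E a * Eb b * Ebs w j = - (sc (gram w $ j $ b) * E a)" for a b
  proof -
    have "Ebs w j * (E a * Eb b) = - (E a * (Ebs w j * Eb b))"
      by (simp only: mult.assoc[symmetric] Ebs_E mult_minus_left)
    then show ?thesis by (simp add: Ebs_Eb right_diff_distrib mult.assoc sc_norm)
  qed
  note * = this
  have "Ebs w j * LH A - LH A * Ebs w j = (\<Sum>a\<in>UNIV. \<Sum>b\<in>UNIV. sc (\<i> * A $ a $ b) * (Ebs w j * (E a * Eb b) - E a * Eb b * Ebs w j))"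
    by (simp add: LH_def sum_distrib_left sum_distrib_right sum_subtractf right_diff_distrib mult.assoc sc_left_commute)
  then show ?thesis by (simp add: * sum_negf sc_norm)
qed

lemma Es_LH: "Es w j * LH A - LH A * Es w j = (\<Sum>a\<in>UNIV. \<Sum>b\<in>UNIV. sc (\<i> * A $ a $ b * gram w $ a $ j) * Eb b)"
proof -
  have "Es w j * (E a * Eb b) - E a * Eb b * Es w j = sc (gram w $ a $ j) * Eb b" for a b
  proof -
    have "Es w j * (E a * Eb b) = sc (gram w $ a $ j) * Eb b - E a * (Es w j * Eb b)"
      by (simp only: mult.assoc[symmetric] Es_E left_diff_distrib)
    then show ?thesis by (simp add: Es_Eb mult.assoc sc_norm)
  qed
  note * = this
  have "Es w j * LH A - LH A * Es w j = (\<Sum>a\<in>UNIV. \<Sum>b\<in>UNIV. sc (\<i> * A $ a $ b) * (Es w j * (E a * Eb b) - E a * Eb b * Es w j))"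
    by (simp add: LH_def sum_distrib_left sum_distrib_right sum_subtractf right_diff_distrib mult.assoc sc_left_commute)
  then show ?thesis by (simp add: * sc_norm)
qed

lemma gram_herm_sum1: "(\<Sum>b\<in>UNIV. herm_mat w $ a $ b * gram w $ j $ b) = (if a = j then 1 else 0)"
proof -
  have "(gram w ** mT (herm_mat w)) $ j $ a = (\<Sum>b\<in>UNIV. herm_mat w $ a $ b * gram w $ j $ b)"
    by (simp add: matrix_matrix_mult_def Finite_Cartesian_Product.transpose_def mult.commute)
  then show ?thesis by (simp only: gram_inv[OF w] Finite_Cartesian_Product.mat_def vec_lambda_beta eq_commute[of a j])
qed

lemma gram_herm_sum2: "(\<Sum>a\<in>UNIV. herm_mat w $ a $ b * gram w $ a $ j) = (if b = j then 1 else 0)"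
proof -
  have "(mT (herm_mat w) ** gram w) $ b $ j = (\<Sum>a\<in>UNIV. herm_mat w $ a $ b * gram w $ a $ j)"
    by (simp add: matrix_matrix_mult_def Finite_Cartesian_Product.transpose_def mult.commute)
  then show ?thesis by (simp add: gram_inv[OF w] Finite_Cartesian_Product.mat_def)
qed

text \<open>In \<open>Ebs_LH\<close> with the metric itself as matrix, the double sum collapses
  because the Gram matrix is the inverse of its transpose.\<close>

lemma Ebs_L: "Ebs w j * wd w - wd w * Ebs w j = - (sc \<i> * E j)"
proof -
  have "(\<Sum>a\<in>UNIV. \<Sum>b\<in>UNIV. sc (\<i> * herm_mat w $ a $ b * gram w $ j $ b) * E a) =
     (\<Sum>a\<in>UNIV. sc (\<i> * (\<Sum>b\<in>UNIV. herm_mat w $ a $ b * gram w $ j $ b)) * E a)"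
    by (simp add: sc_sum sum_distrib_left sum_distrib_right mult.assoc)
  also have "\<dots> = (\<Sum>a\<in>UNIV. if a = j then sc \<i> * E a else 0)"
    unfolding gram_herm_sum1 by (intro sum.cong refl) auto
  finally show ?thesis by (simp add: wd_metric Ebs_LH)
qed

lemma Es_L: "Es w j * wd w - wd w * Es w j = sc \<i> * Eb j"
proof -
  have "(\<Sum>a\<in>UNIV. \<Sum>b\<in>UNIV. sc (\<i> * herm_mat w $ a $ b * gram w $ a $ j) * Eb b) =
     (\<Sum>b\<in>UNIV. sc (\<i> * (\<Sum>a\<in>UNIV. herm_mat w $ a $ b * gram w $ a $ j)) * Eb b)"
    by (subst sum.swap) (simp add: sc_sum sum_distrib_left sum_distrib_right mult.assoc)
  also have "\<dots> = (\<Sum>b\<in>UNIV. if b = j then sc \<i> * Eb b else 0)"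
    unfolding gram_herm_sum2 by (intro sum.cong refl) auto
  finally show ?thesis by (simp add: wd_metric Es_LH)
qed

text \<open>Taking the adjoint of \<open>Es_L\<close> exchanges \<open>wd w\<close> with
  \<open>Lam w\<close>. Together with \<open>Lam_Eb\<close> this is the pointwise content of the
  Kaehler identities.\<close>

lemma Lam_E: "Lam w * E j - E j * Lam w = - (sc \<i> * Ebs w j)"
proof -
  have "adj w (Es w j * wd w - wd w * Es w j) = adj w (sc \<i> * Eb j)" by (simp only: Es_L)
  then show ?thesis by (simp add: adj_simps adj_Es adj_Eb Lam_def sc_comm)
qed

lemma Lam_Eb: "Lam w * Eb j - Eb j * Lam w = sc \<i> * Es w j"
proof -
  have "adj w (Ebs w j * wd w - wd w * Ebs w j) = adj w (- (sc \<i> * E j))" by (simp only: Ebs_L)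
  then show ?thesis by (simp add: adj_simps adj_Ebs adj_E Lam_def sc_comm)
qed

text \<open>A commutator is a derivation, applied here to each product \<open>E a * Eb b\<close>.
  The scalar part of the result is the trace of \<open>A\<close> against the Gram matrix, which will
  later match the derivative of the volume density.\<close>

lemma Lam_LH: "Lam w * LH A - LH A * Lam w = (\<Sum>a\<in>UNIV. \<Sum>b\<in>UNIV. sc (A $ a $ b) * (sc (gram w $ a $ b) - Eb b * Ebs w a - E a * Es w b))"
proof -
  have "Lam w * (E a * Eb b) - E a * Eb b * Lam w = - sc \<i> * (sc (gram w $ a $ b) - Eb b * Ebs w a - E a * Es w b)" for a b
  proof -
    have "Lam w * (E a * Eb b) - E a * Eb b * Lam w = (Lam w * E a - E a * Lam w) * Eb b + E a * (Lam w * Eb b - Eb b * Lam w)"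
      by (simp add: algebra_simps)
    also have "\<dots> = - sc \<i> * (sc (gram w $ a $ b) - Eb b * Ebs w a - E a * Es w b)"
      unfolding Lam_E Lam_Eb by (simp add: mult.assoc Ebs_Eb right_diff_distrib sc_left_commute)
    finally show ?thesis .
  qed
  note * = this
  have "Lam w * LH A - LH A * Lam w = (\<Sum>a\<in>UNIV. \<Sum>b\<in>UNIV. sc (\<i> * A $ a $ b) * (Lam w * (E a * Eb b) - E a * Eb b * Lam w))"
    by (simp add: LH_def sum_distrib_left sum_distrib_right sum_subtractf right_diff_distrib mult.assoc sc_left_commute)
  also have "\<dots> = (\<Sum>a\<in>UNIV. \<Sum>b\<in>UNIV. sc (A $ a $ b) * (sc (gram w $ a $ b) - Eb b * Ebs w a - E a * Es w b))"
  proof (rule sum.cong[OF refl], rule sum.cong[OF refl])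
    fix a b
    have "\<i> * A $ a $ b * - \<i> = A $ a $ b" by (auto simp: complex_eq_iff)
    then show "sc (\<i> * A $ a $ b) * (Lam w * (E a * Eb b) - E a * Eb b * Lam w) =
      sc (A $ a $ b) * (sc (gram w $ a $ b) - Eb b * Ebs w a - E a * Es w b)"
      unfolding * sc_simps(3)[symmetric] sc_mult_left by (simp only:)
  qed
  finally show ?thesis .
qed

lemma sum_herm_Ebs: "(\<Sum>a\<in>UNIV. sc (herm_mat w $ a $ b) * Ebs w a) = Cb b"
proof -
  have "(\<Sum>a\<in>UNIV. sc (herm_mat w $ a $ b) * Ebs w a) = (\<Sum>l\<in>UNIV. sc (\<Sum>a\<in>UNIV. herm_mat w $ a $ b * gram w $ a $ l) * Cb l)"
    unfolding Ebs_def sum_distrib_left by (subst sum.swap) (simp add: sc_norm sc_sum sum_distrib_right)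
  also have "\<dots> = (\<Sum>l\<in>UNIV. if l = b then Cb l else 0)"
    unfolding gram_herm_sum2 by (intro sum.cong refl) auto
  finally show ?thesis by simp
qed

lemma sum_herm_Es: "(\<Sum>b\<in>UNIV. sc (herm_mat w $ a $ b) * Es w b) = C a"
proof -
  have "(\<Sum>b\<in>UNIV. sc (herm_mat w $ a $ b) * Es w b) = (\<Sum>l\<in>UNIV. sc (\<Sum>b\<in>UNIV. herm_mat w $ a $ b * gram w $ l $ b) * C l)"
    unfolding Es_def sum_distrib_left by (subst sum.swap) (simp add: sc_norm sc_sum sum_distrib_right)
  also have "\<dots> = (\<Sum>l\<in>UNIV. if l = a then C l else 0)"
    unfolding gram_herm_sum1 by (intro sum.cong refl) auto
  finally show ?thesis by simp
qed

text \<open>The Lefschetz sl2 relation, as the case of \<open>Lam_LH\<close> where the matrix is the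
  metric: the scalar part is the trace of the identity, and the contractions collapse to the
  counting operators by \<open>sum_herm_Ebs\<close> and \<open>sum_herm_Es\<close>.\<close>

lemma Lam_L: "Lam w * wd w - wd w * Lam w = of_nat CARD('n) - Np - Nq"
proof -
  have "Lam w * wd w - wd w * Lam w = sc (\<Sum>a\<in>UNIV. \<Sum>b\<in>UNIV. herm_mat w $ a $ b * gram w $ a $ b)
    - (\<Sum>b\<in>UNIV. Eb b * (\<Sum>a\<in>UNIV. sc (herm_mat w $ a $ b) * Ebs w a)) - (\<Sum>a\<in>UNIV. E a * (\<Sum>b\<in>UNIV. sc (herm_mat w $ a $ b) * Es w b))"
  proof -
    have "(\<Sum>b\<in>UNIV. Eb b * (\<Sum>a\<in>UNIV. sc (herm_mat w $ a $ b) * Ebs w a)) =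
       (\<Sum>a\<in>UNIV. \<Sum>b\<in>UNIV. sc (herm_mat w $ a $ b) * (Eb b * Ebs w a))"
      unfolding sum_distrib_left sc_left_commute by (rule sum.swap)
    then show ?thesis
      unfolding wd_metric Lam_LH
      by (simp add: right_diff_distrib sum_subtractf sc_sum sc_mult sum_distrib_left sc_left_commute)
  qed
  also have "(\<Sum>a\<in>UNIV. \<Sum>b\<in>UNIV. herm_mat w $ a $ b * gram w $ a $ b) = of_nat CARD('n)"
    unfolding gram_herm_sum1 by simp
  finally show ?thesis by (simp add: sum_herm_Ebs sum_herm_Es Np_def Nq_def sc_of_nat algebra_simps)
qed

end

text \<open>Multiplication by an element of even degree commutes with all exterior multiplications:
  the two anticommutations cancel in sign.\<close>

lemma LH_E: "LH A * E i = E i * LH A"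
proof -
  have "E a * Eb b * E i = E i * (E a * Eb b)" for a b
    by (simp add: mult.assoc Eb_E) (simp add: mult.assoc[symmetric] E_E[of a i])
  then show ?thesis by (simp add: LH_def sum_distrib_left sum_distrib_right sc_norm mult.assoc)
qed

lemma LH_Eb: "LH A * Eb i = Eb i * LH A"
proof -
  have "E a * Eb b * Eb i = Eb i * (E a * Eb b)" for a b
    using Eb_Eb[of i b] by (simp add: mult.assoc[symmetric] Eb_E) (simp add: mult.assoc)
  then show ?thesis by (simp add: LH_def sum_distrib_left sum_distrib_right sc_norm mult.assoc)
qed

text \<open>\<open>Lam\<close> as a linear function of the Gram matrix, see \<open>Lam_eq\<close>;
  in this form it can be differentiated through the entries of the Gram matrix.\<close>

definition LamG :: "'n::{finite, linorder} cmat \<Rightarrow> 'n lop" where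
  "LamG A = (\<Sum>k\<in>UNIV. \<Sum>l\<in>UNIV. sc (- \<i> * A $ k $ l) * (Cb l * C k))"

text \<open>The infinitesimal variation of the metric: \<open>dH\<close>, \<open>dG\<close>, \<open>dM\<close> stand for the derivatives of the matrix of
  the metric, of the Gram matrix, and of the induced operator on the exterior algebra.\<close>

context
  fixes w :: "'n::{finite, linorder} ext" and dM :: "'n lop" and dG dH :: "'n cmat"
  assumes w: "metric w"
    and dM_oneE: "ap dM oneE = 0"
    and dM_E: "\<And>j. dM * E j = rowE dG j * Mop w + rowE (gram w) j * dM"
    and dM_Eb: "\<And>j. dM * Eb j = rowEb dG j * Mop w + rowEb (gram w) j * dM"
    and dG: "\<And>i c. dG $ i $ c = - (\<Sum>a\<in>UNIV. \<Sum>b\<in>UNIV. gram w $ i $ b * dH $ a $ b * gram w $ a $ c)"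
    and dH: "\<And>a b. cnj (dH $ a $ b) = dH $ b $ a"
begin

abbreviation (input) "trH \<equiv> (\<Sum>a\<in>UNIV. \<Sum>b\<in>UNIV. dH $ a $ b * gram w $ a $ b)"
abbreviation (input) "KH \<equiv> Lam w * LH dH - LH dH * Lam w"

text \<open>By the Jacobi identity: \<open>LH dH\<close> commutes with \<open>E i\<close>, so only
  the commutator of \<open>Lam\<close> with \<open>E i\<close> contributes, and
  \<open>Ebs_LH\<close> evaluates the rest.\<close>

lemma KH_E: "KH * E i - E i * KH = - (\<Sum>a\<in>UNIV. \<Sum>b\<in>UNIV. sc (dH $ a $ b * gram w $ i $ b) * E a)"
proof -
  have "KH * E i - E i * KH = (Lam w * E i - E i * Lam w) * LH dH - LH dH * (Lam w * E i - E i * Lam w)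
     + (Lam w * (LH dH * E i - E i * LH dH) - (LH dH * E i - E i * LH dH) * Lam w)"
    by (simp add: algebra_simps)
  also have "\<dots> = - sc \<i> * (Ebs w i * LH dH - LH dH * Ebs w i)"
    by (simp add: LH_E Lam_E[OF w] algebra_simps sc_left_commute)
  also have "\<dots> = - (\<Sum>a\<in>UNIV. \<Sum>b\<in>UNIV. sc (dH $ a $ b * gram w $ i $ b) * E a)"
    unfolding Ebs_LH[OF w] by (simp add: sum_distrib_left sc_mult_left sum_negf mult.assoc)
  finally show ?thesis .
qed

lemma KH_Eb: "KH * Eb i - Eb i * KH = - (\<Sum>a\<in>UNIV. \<Sum>b\<in>UNIV. sc (dH $ a $ b * gram w $ a $ i) * Eb b)"
proof -
  have "KH * Eb i - Eb i * KH = (Lam w * Eb i - Eb i * Lam w) * LH dH - LH dH * (Lam w * Eb i - Eb i * Lam w)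
     + (Lam w * (LH dH * Eb i - Eb i * LH dH) - (LH dH * Eb i - Eb i * LH dH) * Lam w)"
    by (simp add: algebra_simps)
  also have "\<dots> = sc \<i> * (Es w i * LH dH - LH dH * Es w i)"
    by (simp add: LH_Eb Lam_Eb[OF w] algebra_simps sc_left_commute)
  also have "\<dots> = - (\<Sum>a\<in>UNIV. \<Sum>b\<in>UNIV. sc (dH $ a $ b * gram w $ a $ i) * Eb b)"
    unfolding Es_LH[OF w] by (simp add: sum_distrib_left sc_mult_left sum_negf mult.assoc)
  finally show ?thesis .
qed

lemma KH_oneE: "ap KH oneE = scl trH oneE"
  unfolding Lam_LH[OF w] by (simp add: ap_sum_left Ebs_oneE[OF w] Es_oneE[OF w] scl_simps sum_distrib_left)
   (simp add: fun_eq_iff sum_fun_apply sum_distrib_right)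

lemma Mop_E: "Mop w * E i = rowE (gram w) i * Mop w" and Mop_Eb: "Mop w * Eb i = rowEb (gram w) i * Mop w"
  by (simp_all add: Mop_def pl_E pl_Eb)

text \<open>As \<open>trH\<close> is the logarithmic derivative of the volume density, the left-hand
  side is the derivative of density times Gram operator, divided by the density. The difference of
  the two sides kills 1 and passes the generators like \<open>Mop w\<close>, hence vanishes.\<close>

lemma dM_eq: "dM + sc trH * Mop w = Mop w * KH"
proof -
  define Y where "Y = Mop w * KH - sc trH * Mop w - dM"
  have "Y = 0"
  proof (rule lop_eq_0I)
    show "ap Y oneE = 0" using KH_oneE dM_oneE by (simp add: Y_def Mop_def pull_linear)
  next
    fix i \<alpha> assume Y0: "ap Y \<alpha> = 0"
    have "Mop w * (\<Sum>a\<in>UNIV. \<Sum>b\<in>UNIV. sc (dH $ a $ b * gram w $ i $ b) * E a) = - (rowE dG i * Mop w)"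
    proof -
      have "rowE dG i = - (\<Sum>a\<in>UNIV. \<Sum>b\<in>UNIV. sc (dH $ a $ b * gram w $ i $ b) * rowE (gram w) a)"
      proof -
        have "rowE dG i = - (\<Sum>c\<in>UNIV. \<Sum>a\<in>UNIV. \<Sum>b\<in>UNIV. sc (dH $ a $ b * gram w $ i $ b * gram w $ a $ c) * E c)"
          by (simp add: rowE_def dG sc_sum sum_distrib_right sum_negf mult_ac)
        also have "(\<Sum>c\<in>UNIV. \<Sum>a\<in>UNIV. \<Sum>b\<in>UNIV. sc (dH $ a $ b * gram w $ i $ b * gram w $ a $ c) * E c) =
           (\<Sum>a\<in>UNIV. \<Sum>c\<in>UNIV. \<Sum>b\<in>UNIV. sc (dH $ a $ b * gram w $ i $ b * gram w $ a $ c) * E c)" by (rule sum.swap)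
        also have "\<dots> = (\<Sum>a\<in>UNIV. \<Sum>b\<in>UNIV. \<Sum>c\<in>UNIV. sc (dH $ a $ b * gram w $ i $ b * gram w $ a $ c) * E c)"
          by (rule sum.cong[OF refl]) (rule sum.swap)
        finally show ?thesis by (simp add: rowE_def sum_distrib_left sc_mult_left)
      qed
      then show ?thesis by (simp add: sum_distrib_left sum_distrib_right sc_left_commute mult.assoc Mop_E)
    qed
    moreover have "Mop w * KH * E i = Mop w * E i * KH + Mop w * (KH * E i - E i * KH)" by (simp add: algebra_simps)
    ultimately have "Mop w * KH * E i = rowE (gram w) i * (Mop w * KH) + rowE dG i * Mop w"
      unfolding KH_E by (simp add: Mop_E mult.assoc)
    then have "Y * E i = rowE (gram w) i * Y"
      by (simp add: Y_def left_diff_distrib right_diff_distrib dM_E mult.assoc Mop_E sc_left_commute)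
    then have "ap (Y * E i) \<alpha> = ap (rowE (gram w) i) (ap Y \<alpha>)" by simp
    then show "ap Y (ap (E i) \<alpha>) = 0" by (simp only: ap_simps Y0 ap_0)
  next
    fix i \<alpha> assume Y0: "ap Y \<alpha> = 0"
    have "Mop w * (\<Sum>a\<in>UNIV. \<Sum>b\<in>UNIV. sc (dH $ a $ b * gram w $ a $ i) * Eb b) = - (rowEb dG i * Mop w)"
    proof -
      have "rowEb dG i = - (\<Sum>a\<in>UNIV. \<Sum>b\<in>UNIV. sc (dH $ a $ b * gram w $ a $ i) * rowEb (gram w) b)"
      proof -
        have d: "cnj (dG $ i $ c) = - (\<Sum>a\<in>UNIV. \<Sum>b\<in>UNIV. dH $ a $ b * gram w $ a $ i * cnj (gram w $ b $ c))" for c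
          unfolding dG by (simp add: cnj_sum dH gram_cnj[OF w] mult_ac) (rule sum.swap)
        have "rowEb dG i = - (\<Sum>c\<in>UNIV. \<Sum>a\<in>UNIV. \<Sum>b\<in>UNIV. sc (dH $ a $ b * gram w $ a $ i * cnj (gram w $ b $ c)) * Eb c)"
          by (simp add: rowEb_def d sc_sum sum_distrib_right sum_negf mult_ac)
        also have "(\<Sum>c\<in>UNIV. \<Sum>a\<in>UNIV. \<Sum>b\<in>UNIV. sc (dH $ a $ b * gram w $ a $ i * cnj (gram w $ b $ c)) * Eb c) =
           (\<Sum>a\<in>UNIV. \<Sum>c\<in>UNIV. \<Sum>b\<in>UNIV. sc (dH $ a $ b * gram w $ a $ i * cnj (gram w $ b $ c)) * Eb c)" by (rule sum.swap)
        also have "\<dots> = (\<Sum>a\<in>UNIV. \<Sum>b\<in>UNIV. \<Sum>c\<in>UNIV. sc (dH $ a $ b * gram w $ a $ i * cnj (gram w $ b $ c)) * Eb c)"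
          by (rule sum.cong[OF refl]) (rule sum.swap)
        finally show ?thesis by (simp add: rowEb_def sum_distrib_left sc_mult_left)
      qed
      then show ?thesis by (simp add: sum_distrib_left sum_distrib_right sc_left_commute mult.assoc Mop_Eb)
    qed
    moreover have "Mop w * KH * Eb i = Mop w * Eb i * KH + Mop w * (KH * Eb i - Eb i * KH)" by (simp add: algebra_simps)
    ultimately have "Mop w * KH * Eb i = rowEb (gram w) i * (Mop w * KH) + rowEb dG i * Mop w"
      unfolding KH_Eb by (simp add: Mop_Eb mult.assoc)
    then have "Y * Eb i = rowEb (gram w) i * Y"
      by (simp add: Y_def left_diff_distrib right_diff_distrib dM_Eb mult.assoc Mop_Eb sc_left_commute)
    then have "ap (Y * Eb i) \<alpha> = ap (rowEb (gram w) i) (ap Y \<alpha>)" by simp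
    then show "ap Y (ap (Eb i) \<alpha>) = 0" by (simp only: ap_simps Y0 ap_0)
  qed
  then show ?thesis by (simp add: Y_def algebra_simps)
qed

text \<open>On the product of all \<open>dz j\<close> the Gram operator is the scalar
  \<open>det (gram w)\<close> and the commutator \<open>KH\<close> vanishes, so \<open>dM_eq\<close>
  becomes Jacobi's formula for the derivative of that determinant.\<close>

lemma dM_top:
  assumes "ap dM (bas UNIV {}) = scl d (bas UNIV {})"
  shows "d = - trH * det (gram w)"
proof -
  let ?top = "bas UNIV {} :: 'n ext"
  have E0: "ap (E a) ?top = 0" for a by (simp add: E_bas')
  have "ap (Cb a) ?top = 0" for a by (intro ext) (simp add: ap_Cb bas_def)
  then have Ebs0: "ap (Ebs w a) ?top = 0" for a by (simp add: Ebs_def ap_sum_left scl_simps)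
  have "E a * Es w b = sc (gram w $ a $ b) - Es w b * E a" for a b using Es_E[OF w, of b a] by simp
  then have EEs: "ap (E a) (ap (Es w b) ?top) = scl (gram w $ a $ b) ?top" for a b
    using E0[of a] by (metis (no_types, lifting) ap_simps(4,6,7) ap_0 diff_zero)
  \<comment> \<open>On this form each \<open>E a * Es w b\<close> is the scalar
    \<open>gram w $ a $ b\<close>, which cancels the trace in \<open>Lam_LH\<close>, while the
    contractions with \<open>dzbar\<close> give 0.\<close>
  have K0: "ap KH ?top = 0"
    unfolding Lam_LH[OF w] by (simp add: ap_sum_left Ebs0 EEs scl_simps)
  have M: "ap (Mop w) ?top = scl (det (gram w)) ?top"
  proof (intro ext)
    fix K L
    show "ap (Mop w) ?top K L = scl (det (gram w)) ?top K L"
      using minor_card[of "UNIV::'n set" K "gram w"] minor_card[of "{}::'n set" L "gram w"]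
      unfolding Mop_def ap_pl pull_bas scl_apply
      by (cases "K = UNIV"; cases "L = {}") (auto simp: minor_UNIV bas_def dest: card_eq_UNIV_imp_eq_UNIV[OF finite, OF sym])
  qed
  have "ap (dM + sc trH * Mop w) ?top = ap (Mop w) (ap KH ?top)" by (simp only: dM_eq ap_simps(6))
  then have "scl (d + trH * det (gram w)) ?top = 0"
    by (simp add: K0 assms M scl_simps del: ap_simps(4))
  then have "scl (d + trH * det (gram w)) ?top UNIV {} = 0" by simp
  then show ?thesis by (simp add: bas_def add_eq_0_iff2)
qed

end

lemma Lam_eq: "metric w \<Longrightarrow> Lam w = LamG (gram w)"
proof -
  assume w: "metric w"
  have "Lam w = (\<Sum>k\<in>UNIV. sc (- \<i>) * (Ebs w k * (\<Sum>j\<in>UNIV. sc (herm_mat w $ k $ j) * Es w j)))"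
    unfolding Lam_def wd_metric[OF w] adj_LH[OF w]
    by (subst sum.swap) (simp only: herm_cnj[OF w] sum_distrib_left sc_left_commute[of "Ebs w _"] sc_mult_left)
  then show ?thesis
    unfolding sum_herm_Es[OF w]
    by (simp add: LamG_def Ebs_def sum_distrib_left sum_distrib_right sc_mult_left mult.assoc sum_negf)
qed

text \<open>The assumption on \<open>dG\<close> is the derivative of an inverse matrix:
  \<open>dH\<close> with both indices raised by the Gram matrix, up to sign. Raising both indices is
  also what the adjoint does to multiplication by a (1,1)-form.\<close>

lemma LamG_variation:
  fixes dG dH :: "'n::{finite, linorder} cmat"
  assumes w: "metric w"
    and dG: "\<And>i c. dG $ i $ c = - (\<Sum>a\<in>UNIV. \<Sum>b\<in>UNIV. gram w $ i $ b * dH $ a $ b * gram w $ a $ c)"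
    and dH: "\<And>a b. cnj (dH $ a $ b) = dH $ b $ a"
  shows "LamG dG = - adj w (LH dH)"
proof -
  have "adj w (LH dH) = (\<Sum>j\<in>UNIV. \<Sum>k\<in>UNIV. sc (- \<i> * dH $ k $ j) * (Ebs w k * Es w j))"
    by (simp add: adj_LH[OF w] dH)
  also have "\<dots> = (\<Sum>j\<in>UNIV. \<Sum>k\<in>UNIV. \<Sum>p\<in>UNIV. \<Sum>l\<in>UNIV. sc (- \<i> * (gram w $ p $ j * dH $ k $ j * gram w $ k $ l)) * (Cb l * C p))"
  proof (rule sum.cong[OF refl], rule sum.cong[OF refl])
    fix j k
    have "Ebs w k * Es w j = (\<Sum>p\<in>UNIV. \<Sum>l\<in>UNIV. sc (gram w $ p $ j * gram w $ k $ l) * (Cb l * C p))"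
      unfolding Ebs_def Es_def sum_product by (subst sum.swap) (simp add: mult.assoc sc_norm mult_ac(2))
    then show "sc (- \<i> * dH $ k $ j) * (Ebs w k * Es w j) = (\<Sum>p\<in>UNIV. \<Sum>l\<in>UNIV. sc (- \<i> * (gram w $ p $ j * dH $ k $ j * gram w $ k $ l)) * (Cb l * C p))"
      by (simp add: sum_distrib_left sc_mult_left mult_ac sum_negf)
  qed
  also have "\<dots> = (\<Sum>p\<in>UNIV. \<Sum>l\<in>UNIV. \<Sum>j\<in>UNIV. \<Sum>k\<in>UNIV. sc (- \<i> * (gram w $ p $ j * dH $ k $ j * gram w $ k $ l)) * (Cb l * C p))"
    by (rule sum_swap_pairs)
  also have "\<dots> = - LamG dG"
  proof -
    have "- (\<i> * dG $ p $ l) = (\<Sum>j\<in>UNIV. \<Sum>k\<in>UNIV. \<i> * (gram w $ p $ j * dH $ k $ j * gram w $ k $ l))" for p l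
      unfolding dG by (subst sum.swap) (simp add: sum_distrib_left)
    then show ?thesis
      by (simp add: LamG_def sum_negf sc_sum sum_distrib_right)
  qed
  finally show ?thesis by simp
qed

section \<open>Calculus of smooth functions\<close>

abbreviation fd :: "('a::real_normed_vector \<Rightarrow> 'b::real_normed_vector) \<Rightarrow> 'a \<Rightarrow> 'a \<Rightarrow> 'b" where
  "fd f x \<equiv> frechet_derivative f (at x)"

lemma fd_eq: "(f has_derivative f') (at x) \<Longrightarrow> fd f x = f'"
  using frechet_derivative_at by metis

lemma Ck_on_has_derivative: "Ck_on (Suc k) S f \<Longrightarrow> x \<in> S \<Longrightarrow> (f has_derivative fd f x) (at x)"
  using frechet_derivative_works by auto

lemma Ck_on_cong:
  assumes "open S" "\<And>x. x \<in> S \<Longrightarrow> f x = g x" "Ck_on k S f"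
  shows "Ck_on k S g"
  using assms(2,3)
proof (induction k arbitrary: f g)
  case 0
  then show ?case using continuous_on_cong by fastforce
next
  case (Suc k)
  have *: "(g has_derivative fd f x) (at x)" if "x \<in> S" for x
  proof -
    have "(f has_derivative fd f x) (at x)" using Suc.prems that frechet_derivative_works by auto
    then show ?thesis
      by (rule has_derivative_transform_within_open[OF _ assms(1) that]) (use Suc.prems in auto)
  qed
  then have "fd g x = fd f x" if "x \<in> S" for x using fd_eq that by blast
  moreover have "g differentiable (at x)" if "x \<in> S" for x
    using *[OF that] unfolding differentiable_def by blast
  ultimately show ?case
    using Suc.IH[of "\<lambda>x. fd f x v" "\<lambda>x. fd g x v" for v] Suc.prems by auto
qed

lemma Ck_on_subset: "Ck_on k S f \<Longrightarrow> T \<subseteq> S \<Longrightarrow> Ck_on k T f"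
  by (induction k arbitrary: f) (auto intro: continuous_on_subset)

lemma Ck_on_Suc_D: "Ck_on (Suc k) S f \<Longrightarrow> Ck_on k S f"
proof (induction k arbitrary: f)
  case 0
  then show ?case by (auto intro!: differentiable_imp_continuous_on simp: differentiable_on_def differentiable_at_withinI)
next
  case (Suc k)
  have "\<forall>v. Ck_on (Suc k) S (\<lambda>x. fd f x v)" using Suc.prems Ck_on.simps(2)[of "Suc k" S f] by blast
  then have "\<forall>v. Ck_on k S (\<lambda>x. fd f x v)" using Suc.IH by blast
  then show ?case using Suc.prems by auto
qed

lemma Ck_on_local:
  assumes "\<And>x. x \<in> S \<Longrightarrow> \<exists>T. open T \<and> x \<in> T \<and> Ck_on k T f"
  shows "Ck_on k S f"
  using assms
proof (induction k arbitrary: f)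
  case 0
  have "isCont f x" if "x \<in> S" for x
    using 0[OF that] by (auto simp: continuous_on_eq_continuous_at)
  then show ?case by (auto intro: continuous_at_imp_continuous_on)
next
  case (Suc k)
  have "f differentiable (at x)" if "x \<in> S" for x using Suc.prems[OF that] by auto
  moreover have "Ck_on k S (\<lambda>x. fd f x v)" for v
    by (rule Suc.IH) (use Suc.prems in fastforce)
  ultimately show ?case by simp
qed

lemma Ck_on_const [simp]: "Ck_on k S (\<lambda>x. c)"
  by (induction k arbitrary: c) (auto simp: frechet_derivative_const)

lemma Ck_on_linear:
  assumes "open S" "bounded_linear L" "Ck_on k S f"
  shows "Ck_on k S (\<lambda>x. L (f x))"
  using assms(3)
proof (induction k arbitrary: f)
  case 0
  then show ?case using assms(2) by (auto intro: bounded_linear.continuous_on)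
next
  case (Suc k)
  have *: "((\<lambda>x. L (f x)) has_derivative (\<lambda>v. L (fd f x v))) (at x)" if "x \<in> S" for x
    using Suc.prems that frechet_derivative_works by (auto intro!: bounded_linear.has_derivative[OF assms(2)])
  have "Ck_on k S (\<lambda>x. L (fd f x v))" for v using Suc by auto
  then have "Ck_on k S (\<lambda>x. fd (\<lambda>x. L (f x)) x v)" for v
    by (rule Ck_on_cong[OF assms(1), rotated]) (use fd_eq[OF *] in auto)
  then show ?case using * by (auto simp: differentiable_def)
qed

lemma Ck_on_id: "open S \<Longrightarrow> Ck_on k S (\<lambda>x. x)"
proof (cases k)
  case (Suc m)
  have "fd (\<lambda>x::'a. x) x v = v" for x v using fd_eq[of "\<lambda>x::'a. x" "\<lambda>v. v"] by (auto intro: has_derivative_ident)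
  then show ?thesis using Suc by auto
qed auto

lemma Ck_on_bounded_linear: "open S \<Longrightarrow> bounded_linear L \<Longrightarrow> Ck_on k S L"
  using Ck_on_linear[of S L k "\<lambda>x. x"] Ck_on_id by auto

lemma Ck_on_add:
  assumes "open S" "Ck_on k S f" "Ck_on k S g"
  shows "Ck_on k S (\<lambda>x. f x + g x)"
  using assms(2,3)
proof (induction k arbitrary: f g)
  case 0
  then show ?case by (auto intro: continuous_intros)
next
  case (Suc k)
  have *: "((\<lambda>x. f x + g x) has_derivative (\<lambda>v. fd f x v + fd g x v)) (at x)" if "x \<in> S" for x
    using Suc.prems that frechet_derivative_works by (auto intro!: derivative_intros)
  have "Ck_on k S (\<lambda>x. fd f x v + fd g x v)" for v using Suc by auto
  then have "Ck_on k S (\<lambda>x. fd (\<lambda>x. f x + g x) x v)" for v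
    by (rule Ck_on_cong[OF assms(1), rotated]) (use fd_eq[OF *] in auto)
  then show ?case using * by (auto simp: differentiable_def)
qed

lemma Ck_on_bilinear:
  assumes "open S" "bounded_bilinear B" "Ck_on k S f" "Ck_on k S g"
  shows "Ck_on k S (\<lambda>x. B (f x) (g x))"
  using assms(3,4)
proof (induction k arbitrary: f g)
  case 0
  then show ?case using bounded_bilinear.continuous_on[OF assms(2)] by auto
next
  case (Suc k)
  have *: "((\<lambda>x. B (f x) (g x)) has_derivative (\<lambda>v. B (f x) (fd g x v) + B (fd f x v) (g x))) (at x)" if "x \<in> S" for x
    using Suc.prems that by (intro bounded_bilinear.FDERIV[OF assms(2)] Ck_on_has_derivative)
  have "Ck_on k S (\<lambda>x. B (f x) (fd g x v) + B (fd f x v) (g x))" for v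
    using Suc Ck_on_Suc_D[OF Suc.prems(1)] Ck_on_Suc_D[OF Suc.prems(2)] by (intro Ck_on_add assms(1)) auto
  then have "Ck_on k S (\<lambda>x. fd (\<lambda>x. B (f x) (g x)) x v)" for v
    by (rule Ck_on_cong[OF assms(1), rotated]) (use fd_eq[OF *] in auto)
  then show ?case using * by (auto simp: differentiable_def)
qed

lemma Ck_on_sum:
  assumes "open S" "\<And>a. a \<in> A \<Longrightarrow> Ck_on k S (f a)"
  shows "Ck_on k S (\<lambda>x. \<Sum>a\<in>A. f a x)"
  using assms(2) by (induction A rule: infinite_finite_induct) (auto intro: Ck_on_add assms(1))

text \<open>In the chain rule the derivative of \<open>g\<close> is taken in a direction that varies
  with \<open>x\<close>. Expanding this direction in the basis leaves only derivatives in fixed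
  directions, to which the induction hypothesis applies.\<close>

lemma Ck_on_compose:
  fixes f :: "'a::real_normed_vector \<Rightarrow> 'b::euclidean_space" and g :: "'b \<Rightarrow> 'c::real_normed_vector"
  assumes "open S" "open T" "f ` S \<subseteq> T" "Ck_on k S f" "Ck_on k T g"
  shows "Ck_on k S (\<lambda>x. g (f x))"
  using assms(4,5)
proof (induction k arbitrary: g)
  case 0
  then show ?case using assms(3) by (auto intro: continuous_on_compose2)
next
  case (Suc k)
  have df: "(f has_derivative fd f x) (at x)" if "x \<in> S" for x
    by (rule Ck_on_has_derivative[OF Suc.prems(1) that])
  have dg: "(g has_derivative fd g y) (at y)" if "y \<in> T" for y
    by (rule Ck_on_has_derivative[OF Suc.prems(2) that])
  have *: "((\<lambda>x. g (f x)) has_derivative (\<lambda>v. fd g (f x) (fd f x v))) (at x)" if "x \<in> S" for x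
    using has_derivative_compose[OF df[OF that] dg] that assms(3) by auto
  have **: "fd g (f x) (fd f x v) = (\<Sum>b\<in>Basis. (fd f x v \<bullet> b) *\<^sub>R fd g (f x) b)" if "x \<in> S" for x v
  proof -
    have l: "linear (fd g (f x))" using dg that assms(3) has_derivative_linear by blast
    have "fd g (f x) (fd f x v) = fd g (f x) (\<Sum>b\<in>Basis. (fd f x v \<bullet> b) *\<^sub>R b)"
      by (simp only: euclidean_representation)
    then show ?thesis by (simp only: linear_sum[OF l] linear_scale[OF l])
  qed
  have "Ck_on k S (\<lambda>x. \<Sum>b\<in>Basis. (fd f x v \<bullet> b) *\<^sub>R fd g (f x) b)" for v
  proof (intro Ck_on_sum assms(1) Ck_on_bilinear[OF assms(1) bounded_bilinear_scaleR])
    fix b :: 'b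
    show "Ck_on k S (\<lambda>x. fd f x v \<bullet> b)"
      using Suc.prems by (intro Ck_on_linear[OF assms(1) bounded_linear_inner_left]) auto
    show "Ck_on k S (\<lambda>x. fd g (f x) b)"
      using Suc.IH[of "\<lambda>y. fd g y b"] Suc.prems Ck_on_Suc_D by auto
  qed
  then have "Ck_on k S (\<lambda>x. fd (\<lambda>x. g (f x)) x v)" for v
    by (rule Ck_on_cong[OF assms(1), rotated]) (use fd_eq[OF *] ** in auto)
  then show ?case using * by (auto simp: differentiable_def)
qed

lemma Ck_on_mult:
  fixes f g :: "'a::real_normed_vector \<Rightarrow> 'b::real_normed_algebra"
  shows "open S \<Longrightarrow> Ck_on k S f \<Longrightarrow> Ck_on k S g \<Longrightarrow> Ck_on k S (\<lambda>x. f x * g x)"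
  by (rule Ck_on_bilinear[OF _ bounded_bilinear_mult])

lemma Ck_on_minus: "open S \<Longrightarrow> Ck_on k S f \<Longrightarrow> Ck_on k S (\<lambda>x. - f x)"
  by (rule Ck_on_linear[OF _ bounded_linear_minus[OF bounded_linear_ident]])

lemma Ck_on_inverse:
  fixes f :: "'a::real_normed_vector \<Rightarrow> 'b::real_normed_field"
  assumes "open S" "\<And>x. x \<in> S \<Longrightarrow> f x \<noteq> 0" "Ck_on k S f"
  shows "Ck_on k S (\<lambda>x. inverse (f x))"
  using assms(3)
proof (induction k)
  case 0
  then show ?case using assms(2) by (auto intro: continuous_intros)
next
  case (Suc k)
  have *: "((\<lambda>x. inverse (f x)) has_derivative (\<lambda>v. - (inverse (f x) * fd f x v * inverse (f x)))) (at x)" if "x \<in> S" for x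
    using Deriv.has_derivative_inverse[OF assms(2)[OF that] Ck_on_has_derivative[OF Suc.prems that]] .
  have "Ck_on k S (\<lambda>x. inverse (f x))" using Suc Ck_on_Suc_D by blast
  then have "Ck_on k S (\<lambda>x. - (inverse (f x) * fd f x v * inverse (f x)))" for v
    using Suc.prems by (intro Ck_on_minus Ck_on_mult assms(1)) auto
  then have "Ck_on k S (\<lambda>x. fd (\<lambda>x. inverse (f x)) x v)" for v
    by (rule Ck_on_cong[OF assms(1), rotated]) (use fd_eq[OF *] in auto)
  then show ?case using * by (auto simp: differentiable_def)
qed

lemma smooth_on_imp_differentiable: "smooth_on S f \<Longrightarrow> x \<in> S \<Longrightarrow> f differentiable (at x)"
  unfolding smooth_on_def by (metis Ck_on.simps(2))

lemma smooth_on_has_derivative: "smooth_on S f \<Longrightarrow> x \<in> S \<Longrightarrow> (f has_derivative fd f x) (at x)"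
  using smooth_on_imp_differentiable frechet_derivative_works by blast

lemma smooth_on_fd: "smooth_on S f \<Longrightarrow> smooth_on S (\<lambda>x. fd f x v)"
  unfolding smooth_on_def by (metis Ck_on.simps(2))

lemma smooth_on_continuous: "smooth_on S f \<Longrightarrow> continuous_on S f"
  unfolding smooth_on_def by (metis Ck_on.simps(1))

lemma smooth_on_cong: "open S \<Longrightarrow> (\<And>x. x \<in> S \<Longrightarrow> f x = g x) \<Longrightarrow> smooth_on S f \<Longrightarrow> smooth_on S g"
  unfolding smooth_on_def using Ck_on_cong by blast

lemma smooth_on_subset: "smooth_on S f \<Longrightarrow> T \<subseteq> S \<Longrightarrow> smooth_on T f"
  unfolding smooth_on_def using Ck_on_subset by blast

lemma smooth_on_local: "(\<And>x. x \<in> S \<Longrightarrow> \<exists>T. open T \<and> x \<in> T \<and> smooth_on T f) \<Longrightarrow> smooth_on S f"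
  unfolding smooth_on_def by (intro allI Ck_on_local) blast

lemma smooth_on_const [simp]: "smooth_on S (\<lambda>x. c)"
  by (simp add: smooth_on_def)

lemma smooth_on_linear: "open S \<Longrightarrow> bounded_linear L \<Longrightarrow> smooth_on S f \<Longrightarrow> smooth_on S (\<lambda>x. L (f x))"
  by (simp add: smooth_on_def Ck_on_linear)

lemma smooth_on_bounded_linear: "open S \<Longrightarrow> bounded_linear L \<Longrightarrow> smooth_on S L"
  by (simp add: smooth_on_def Ck_on_bounded_linear)

lemma smooth_on_add: "open S \<Longrightarrow> smooth_on S f \<Longrightarrow> smooth_on S g \<Longrightarrow> smooth_on S (\<lambda>x. f x + g x)"
  by (simp add: smooth_on_def Ck_on_add)

lemma smooth_on_minus: "open S \<Longrightarrow> smooth_on S f \<Longrightarrow> smooth_on S (\<lambda>x. - f x)"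
  by (simp add: smooth_on_def Ck_on_minus)

lemma smooth_on_diff: "open S \<Longrightarrow> smooth_on S f \<Longrightarrow> smooth_on S g \<Longrightarrow> smooth_on S (\<lambda>x. f x - g x)"
  using smooth_on_add[of S f "\<lambda>x. - g x"] smooth_on_minus[of S g] by simp

lemma smooth_on_mult:
  fixes f g :: "'a::real_normed_vector \<Rightarrow> 'b::real_normed_algebra"
  shows "open S \<Longrightarrow> smooth_on S f \<Longrightarrow> smooth_on S g \<Longrightarrow> smooth_on S (\<lambda>x. f x * g x)"
  by (simp add: smooth_on_def Ck_on_mult)

lemma smooth_on_sum:
  "open S \<Longrightarrow> (\<And>a. a \<in> A \<Longrightarrow> smooth_on S (f a)) \<Longrightarrow> smooth_on S (\<lambda>x. \<Sum>a\<in>A. f a x)"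
  by (simp add: smooth_on_def Ck_on_sum)

lemma smooth_on_prod:
  fixes f :: "'i \<Rightarrow> 'a::real_normed_vector \<Rightarrow> 'b::{real_normed_algebra, comm_ring_1}"
  shows "open S \<Longrightarrow> (\<And>a. a \<in> A \<Longrightarrow> smooth_on S (f a)) \<Longrightarrow> smooth_on S (\<lambda>x. \<Prod>a\<in>A. f a x)"
  by (induction A rule: infinite_finite_induct) (auto intro: smooth_on_mult)

lemma smooth_on_inverse:
  fixes f :: "'a::real_normed_vector \<Rightarrow> 'b::real_normed_field"
  shows "open S \<Longrightarrow> (\<And>x. x \<in> S \<Longrightarrow> f x \<noteq> 0) \<Longrightarrow> smooth_on S f \<Longrightarrow> smooth_on S (\<lambda>x. inverse (f x))"
  by (simp add: smooth_on_def Ck_on_inverse)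

lemma smooth_on_compose:
  fixes f :: "'a::real_normed_vector \<Rightarrow> 'b::euclidean_space" and g :: "'b \<Rightarrow> 'c::real_normed_vector"
  shows "open S \<Longrightarrow> open T \<Longrightarrow> f ` S \<subseteq> T \<Longrightarrow> smooth_on S f \<Longrightarrow> smooth_on T g \<Longrightarrow> smooth_on S (\<lambda>x. g (f x))"
  by (simp add: smooth_on_def Ck_on_compose)

section \<open>Symmetry of second derivatives\<close>

lemma real_derivative_line:
  fixes f :: "'a::real_normed_vector \<Rightarrow> real"
  assumes "(f has_derivative f') (at (a + t *\<^sub>R w))"
  shows "((\<lambda>t. f (a + t *\<^sub>R w)) has_real_derivative f' w) (at t)"
proof -
  have "((\<lambda>t. a + t *\<^sub>R w) has_derivative (\<lambda>r. r *\<^sub>R w)) (at t)" by (auto intro!: derivative_eq_intros)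
  from has_derivative_compose[OF this assms]
  have "((\<lambda>t. f (a + t *\<^sub>R w)) has_derivative (\<lambda>r. r * f' w)) (at t)"
    by (simp add: linear_scale[OF has_derivative_linear[OF assms]])
  then show ?thesis by (rule has_derivative_imp_has_field_derivative) (simp add: mult.commute)
qed

text \<open>The mean value theorem twice: in direction \<open>v\<close> for the difference taken in
  direction \<open>w\<close>, then in direction \<open>w\<close> for the derivative along
  \<open>v\<close>. The point of the statement is that the second difference is symmetric in
  \<open>v\<close> and \<open>w\<close>.\<close>

lemma second_difference_mean_value:
  fixes f :: "'a::real_normed_vector \<Rightarrow> real"
  assumes S: "open S" and f: "Ck_on 2 S f" and "h > 0"
    and sub: "\<And>s t. 0 \<le> s \<Longrightarrow> s \<le> h \<Longrightarrow> 0 \<le> t \<Longrightarrow> t \<le> h \<Longrightarrow> x + s *\<^sub>R v + t *\<^sub>R w \<in> S"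
  shows "\<exists>s t. 0 \<le> s \<and> s \<le> h \<and> 0 \<le> t \<and> t \<le> h \<and>
    f (x + h *\<^sub>R v + h *\<^sub>R w) - f (x + h *\<^sub>R v) - f (x + h *\<^sub>R w) + f x =
    h * h * fd (\<lambda>y. fd f y v) (x + s *\<^sub>R v + t *\<^sub>R w) w"
proof -
  have d: "(f has_derivative fd f y) (at y)" "((\<lambda>y. fd f y v) has_derivative fd (\<lambda>y. fd f y v) y) (at y)" if "y \<in> S" for y
    using f that Ck_on_has_derivative[of 1 S f y] Ck_on_has_derivative[of 0 S "\<lambda>y. fd f y v" y]
    by (auto simp: numeral_2_eq_2 simp del: Ck_on.simps(1))
  define g where "g s = f (x + s *\<^sub>R v + h *\<^sub>R w) - f (x + s *\<^sub>R v)" for s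
  have "(g has_real_derivative fd f (x + s *\<^sub>R v + h *\<^sub>R w) v - fd f (x + s *\<^sub>R v) v) (at s)" if "0 \<le> s" "s \<le> h" for s
  proof -
    have in1: "(x + h *\<^sub>R w) + s *\<^sub>R v \<in> S" and in2: "x + s *\<^sub>R v \<in> S"
      using sub[of s h] sub[of s 0] that \<open>h > 0\<close> by (auto simp: algebra_simps)
    show ?thesis
      using DERIV_diff[OF real_derivative_line[OF d(1)[OF in1]] real_derivative_line[OF d(1)[OF in2]]]
      unfolding g_def by (simp add: add_ac)
  qed
  from MVT2[OF \<open>h > 0\<close> this] obtain s where s: "0 < s" "s < h"
    "g h - g 0 = h * (fd f (x + s *\<^sub>R v + h *\<^sub>R w) v - fd f (x + s *\<^sub>R v) v)" by auto
  have "((\<lambda>t. fd f (x + s *\<^sub>R v + t *\<^sub>R w) v) has_real_derivative fd (\<lambda>y. fd f y v) (x + s *\<^sub>R v + t *\<^sub>R w) w) (at t)" if "0 \<le> t" "t \<le> h" for t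
  proof -
    have in1: "x + s *\<^sub>R v + t *\<^sub>R w \<in> S" using sub[of s t] that s by auto
    show ?thesis by (rule real_derivative_line[OF d(2)[OF in1]])
  qed
  from MVT2[OF \<open>h > 0\<close> this] obtain t where t: "0 < t" "t < h"
    "fd f (x + s *\<^sub>R v + h *\<^sub>R w) v - fd f (x + s *\<^sub>R v + 0 *\<^sub>R w) v = h * fd (\<lambda>y. fd f y v) (x + s *\<^sub>R v + t *\<^sub>R w) w" by auto
  have "f (x + h *\<^sub>R v + h *\<^sub>R w) - f (x + h *\<^sub>R v) - f (x + h *\<^sub>R w) + f x = g h - g 0" by (simp add: g_def)
  also have "\<dots> = h * h * fd (\<lambda>y. fd f y v) (x + s *\<^sub>R v + t *\<^sub>R w) w" using s(3) t(3) by simp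
  finally show ?thesis using s t by (intro exI[of _ s] exI[of _ t]) auto
qed

text \<open>If the mixed derivatives differed at \<open>x\<close>, continuity would keep them apart
  near \<open>x\<close>; but the common second difference equates a value of one with a value of the
  other at nearby points.\<close>

lemma fd_fd_commute_real:
  fixes f :: "'a::real_normed_vector \<Rightarrow> real"
  assumes S: "open S" and f: "Ck_on 2 S f" and x: "x \<in> S"
  shows "fd (\<lambda>y. fd f y v) x w = fd (\<lambda>y. fd f y w) x v"
proof (rule ccontr)
  let ?F = "\<lambda>y. fd (\<lambda>y. fd f y v) y w" and ?G = "\<lambda>y. fd (\<lambda>y. fd f y w) y v"
  assume "?F x \<noteq> ?G x"
  define e where "e = dist (?F x) (?G x) / 2"
  have e: "e > 0" using \<open>?F x \<noteq> ?G x\<close> by (simp add: e_def)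
  have cont: "continuous_on S ?F" "continuous_on S ?G" using f by (auto simp: numeral_2_eq_2)
  then have "isCont ?F x" "isCont ?G x" using S x by (auto simp: continuous_on_eq_continuous_at)
  then obtain d1 d2 where d: "d1 > 0" "d2 > 0" "\<And>y. dist y x < d1 \<Longrightarrow> dist (?F y) (?F x) < e"
    "\<And>y. dist y x < d2 \<Longrightarrow> dist (?G y) (?G x) < e" using e unfolding continuous_at tendsto_iff eventually_at
    by (metis (no_types, lifting) UNIV_I dist_self)
  obtain d3 where d3: "d3 > 0" "ball x d3 \<subseteq> S" using S x openE by blast
  define r where "r = min d1 (min d2 d3)"
  \<comment> \<open>The parallelogram of side \<open>h\<close> then stays within distance
    \<open>r / 2\<close> of \<open>x\<close>; the summand 1 keeps the denominator positive when both
    directions are 0.\<close>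
  define h where "h = r / (2 * (1 + norm v + norm w))"
  have r: "r > 0" using d d3 by (simp add: r_def)
  have pos: "1 + norm v + norm w > 0" by (smt (verit) norm_ge_zero)
  have h: "h > 0" using r pos by (simp add: h_def)
  have near: "dist (x + s *\<^sub>R v + t *\<^sub>R w) x < r" if "0 \<le> s" "s \<le> h" "0 \<le> t" "t \<le> h" for s t
  proof -
    have "dist (x + s *\<^sub>R v + t *\<^sub>R w) x \<le> s * norm v + t * norm w"
      using norm_triangle_ineq[of "s *\<^sub>R v" "t *\<^sub>R w"] that by (simp add: dist_norm add.assoc)
    also have "\<dots> \<le> h * norm v + h * norm w" using that by (intro add_mono mult_right_mono) auto
    also have "\<dots> \<le> h * (1 + norm v + norm w)" using h by (simp add: algebra_simps)
    also have "\<dots> = r / 2" using pos by (simp add: h_def field_simps)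
    finally show ?thesis using r by linarith
  qed
  have near': "dist (x + s *\<^sub>R w + t *\<^sub>R v) x < r" if "0 \<le> s" "s \<le> h" "0 \<le> t" "t \<le> h" for s t
    using near[of t s] that by (simp add: add_ac)
  have sub: "y \<in> S" if "dist y x < r" for y using that d3 by (auto simp: r_def dist_commute subset_eq)
  obtain s t where st: "0 \<le> s" "s \<le> h" "0 \<le> t" "t \<le> h"
    "f (x + h *\<^sub>R v + h *\<^sub>R w) - f (x + h *\<^sub>R v) - f (x + h *\<^sub>R w) + f x = h * h * ?F (x + s *\<^sub>R v + t *\<^sub>R w)"
    using second_difference_mean_value[OF S f h, of x v w] sub near by blast
  obtain s' t' where st': "0 \<le> s'" "s' \<le> h" "0 \<le> t'" "t' \<le> h"
    "f (x + h *\<^sub>R w + h *\<^sub>R v) - f (x + h *\<^sub>R w) - f (x + h *\<^sub>R v) + f x = h * h * ?G (x + s' *\<^sub>R w + t' *\<^sub>R v)"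
    using second_difference_mean_value[OF S f h, of x w v] sub near' by blast
  have "h * h * ?F (x + s *\<^sub>R v + t *\<^sub>R w) = h * h * ?G (x + s' *\<^sub>R w + t' *\<^sub>R v)"
  proof -
    have "x + h *\<^sub>R w + h *\<^sub>R v = x + h *\<^sub>R v + h *\<^sub>R w" by (simp add: add_ac)
    then show ?thesis using st(5) st'(5) by (simp only:)
  qed
  then have eq: "?F (x + s *\<^sub>R v + t *\<^sub>R w) = ?G (x + s' *\<^sub>R w + t' *\<^sub>R v)" using h by simp
  have "dist (?F (x + s *\<^sub>R v + t *\<^sub>R w)) (?F x) < e" using near[OF st(1-4)] by (intro d) (simp add: r_def)
  moreover have "dist (?G (x + s' *\<^sub>R w + t' *\<^sub>R v)) (?G x) < e" using near'[OF st'(1-4)] by (intro d) (simp add: r_def)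
  ultimately have "dist (?F x) (?G x) < 2 * e" using eq by (simp add: dist_real_def)
  then show False by (simp add: e_def)
qed

lemma fd_fd_commute:
  fixes f :: "'a::real_normed_vector \<Rightarrow> complex"
  assumes S: "open S" and f: "smooth_on S f" and x: "x \<in> S"
  shows "fd (\<lambda>y. fd f y v) x w = fd (\<lambda>y. fd f y w) x v"
proof -
  have *: "L (fd (\<lambda>y. fd f y v) x w) = L (fd (\<lambda>y. fd f y w) x v)" if L: "bounded_linear L" for L :: "complex \<Rightarrow> real"
  proof -
    have 1: "fd (\<lambda>y. L (g y)) y = (\<lambda>v. L (fd g y v))" if "smooth_on S g" "y \<in> S" for g y
      using that by (intro fd_eq bounded_linear.has_derivative[OF L] smooth_on_has_derivative)
    have 2: "L (fd (\<lambda>y. fd f y v) x w) = fd (\<lambda>y. fd (\<lambda>y. L (f y)) y v) x w" for v w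
    proof -
      have "((\<lambda>y. L (fd f y v)) has_derivative (\<lambda>w. L (fd (\<lambda>y. fd f y v) x w))) (at x)"
        by (intro bounded_linear.has_derivative[OF L] smooth_on_has_derivative[OF smooth_on_fd[OF f] x])
      then have "((\<lambda>y. fd (\<lambda>y. L (f y)) y v) has_derivative (\<lambda>w. L (fd (\<lambda>y. fd f y v) x w))) (at x)"
        by (rule has_derivative_transform_within_open[OF _ S x]) (simp add: 1[OF f])
      from fd_eq[OF this] show ?thesis by simp
    qed
    have "Ck_on 2 S (\<lambda>y. L (f y))" using smooth_on_linear[OF S L f] by (simp add: smooth_on_def)
    from fd_fd_commute_real[OF S this x] show ?thesis by (simp add: 2)
  qed
  show ?thesis using *[OF bounded_linear_Re] *[OF bounded_linear_Im] by (simp add: complex_eq_iff)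
qed

section \<open>Calculus in a chart\<close>

text \<open>The part of the atlas axioms that concerns a single chart, so that it also covers
  restrictions of charts, which need not belong to the atlas.\<close>

definition chart :: "('a::topological_space, 'n::finite) chart \<Rightarrow> bool" where
  "chart c \<longleftrightarrow> open (cdom c) \<and> open (cimg c) \<and> (\<exists>g. homeomorphism (cdom c) (cimg c) (cmap c) g)"

lemma complex_atlas_chart: "complex_atlas A \<Longrightarrow> c \<in> A \<Longrightarrow> chart c"
  by (simp add: complex_atlas_def chart_def)

definition pd :: "('a, 'n::finite) chart \<Rightarrow> complex^'n \<Rightarrow> ('a \<Rightarrow> complex) \<Rightarrow> 'a \<Rightarrow> complex" where
  "pd c \<xi> f x = fd (f \<circ> cinv c) (cmap c x) \<xi>"

definition sm :: "('a, 'n::finite) chart \<Rightarrow> ('a \<Rightarrow> complex) \<Rightarrow> bool" where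
  "sm c f \<longleftrightarrow> smooth_on (cimg c) (f \<circ> cinv c)"

lemma fd_cong_open:
  assumes "open S" "x \<in> S" "\<And>y. y \<in> S \<Longrightarrow> f y = g y"
  shows "fd f x = fd g x"
proof -
  have "(f has_derivative d) (at x) \<longleftrightarrow> (g has_derivative d) (at x)" for d
  proof
    assume "(f has_derivative d) (at x)"
    then show "(g has_derivative d) (at x)"
      by (rule has_derivative_transform_within_open[OF _ assms(1,2)]) (rule assms(3))
  next
    assume "(g has_derivative d) (at x)"
    then show "(f has_derivative d) (at x)"
      by (rule has_derivative_transform_within_open[OF _ assms(1,2)]) (rule assms(3)[symmetric])
  qed
  then show ?thesis by (simp add: frechet_derivative_def)
qed

lemma wirtinger_decomposition:
  "v * ((p - \<i> * q) / 2) + cnj v * ((p + \<i> * q) / 2) = Re v *\<^sub>R p + Im v *\<^sub>R q"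
  by (simp add: complex_eq_iff field_simps)

text \<open>Directional and Wirtinger derivatives are treated uniformly, as derivations at a point. \<open>DE\<close> and \<open>Dop\<close>
  below apply a derivation to the coefficients of a field of forms and of a field of operators.\<close>

definition dv :: "('a, 'n::finite) chart \<Rightarrow> 'a \<Rightarrow> (('a \<Rightarrow> complex) \<Rightarrow> complex) \<Rightarrow> bool" where
  "dv c x D \<longleftrightarrow> (\<forall>f g. sm c f \<longrightarrow> sm c g \<longrightarrow> D (\<lambda>y. f y + g y) = D f + D g \<and>
     D (\<lambda>y. f y * g y) = D f * g x + f x * D g) \<and> (\<forall>a. D (\<lambda>y. a) = 0) \<and>
     (\<forall>f g. (\<forall>y\<in>cdom c. f y = g y) \<longrightarrow> D f = D g)"

context
  fixes c :: "('a::topological_space, 'n::finite) chart"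
  assumes c: "chart c"
begin

lemma open_cdom: "open (cdom c)" and open_cimg: "open (cimg c)"
  using c by (auto simp: chart_def)

lemma chart_homeomorphism: "homeomorphism (cdom c) (cimg c) (cmap c) (cinv c)"
proof -
  obtain g where g: "homeomorphism (cdom c) (cimg c) (cmap c) g" using c chart_def by blast
  have "inj_on (cmap c) (cdom c)" by (rule inj_on_inverseI[where g = g]) (use g homeomorphism_apply1 in blast)
  then have "cinv c z = g z" if "z \<in> cimg c" for z
    using g that unfolding cinv_def homeomorphism_def by (metis inv_into_f_f imageI)
  then show ?thesis using homeomorphism_cong[OF g] by (metis homeomorphism_cong g)
qed

lemma cinv_cmap [simp]: "x \<in> cdom c \<Longrightarrow> cinv c (cmap c x) = x"
  using chart_homeomorphism homeomorphism_apply1 by blast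

lemma cmap_cinv [simp]: "z \<in> cimg c \<Longrightarrow> cmap c (cinv c z) = z"
  using chart_homeomorphism homeomorphism_apply2 by blast

lemma cinv_in [simp]: "z \<in> cimg c \<Longrightarrow> cinv c z \<in> cdom c"
  using chart_homeomorphism homeomorphism_image2 by blast

lemma cmap_in [simp]: "x \<in> cdom c \<Longrightarrow> cmap c x \<in> cimg c"
  by (simp add: cimg_def)

lemma sm_cong: "(\<And>x. x \<in> cdom c \<Longrightarrow> f x = g x) \<Longrightarrow> sm c f \<Longrightarrow> sm c g"
  unfolding sm_def by (rule smooth_on_cong[OF open_cimg]) auto

lemma sm_const [simp]: "sm c (\<lambda>x. a)"
  by (simp add: sm_def o_def)

lemma sm_add: "sm c f \<Longrightarrow> sm c g \<Longrightarrow> sm c (\<lambda>x. f x + g x)"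
  by (simp add: sm_def o_def smooth_on_add open_cimg)

lemma sm_diff: "sm c f \<Longrightarrow> sm c g \<Longrightarrow> sm c (\<lambda>x. f x - g x)"
  by (simp add: sm_def o_def smooth_on_diff open_cimg)

lemma sm_minus: "sm c f \<Longrightarrow> sm c (\<lambda>x. - f x)"
  by (simp add: sm_def o_def smooth_on_minus open_cimg)

lemma sm_mult: "sm c f \<Longrightarrow> sm c g \<Longrightarrow> sm c (\<lambda>x. f x * g x)"
  by (simp add: sm_def o_def smooth_on_mult open_cimg)

lemma sm_power: "sm c f \<Longrightarrow> sm c (\<lambda>x. f x ^ k)"
  by (induction k) (auto intro: sm_mult)

lemma sm_sum: "(\<And>a. a \<in> S \<Longrightarrow> sm c (f a)) \<Longrightarrow> sm c (\<lambda>x. \<Sum>a\<in>S. f a x)"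
  by (simp add: sm_def o_def smooth_on_sum open_cimg)

lemma sm_prod: "(\<And>a. a \<in> S \<Longrightarrow> sm c (f a)) \<Longrightarrow> sm c (\<lambda>x. \<Prod>a\<in>S. f a x)"
  by (simp add: sm_def o_def smooth_on_prod open_cimg)

lemma sm_cnj: "sm c f \<Longrightarrow> sm c (\<lambda>x. cnj (f x))"
  using smooth_on_linear[OF open_cimg bounded_linear_cnj, of "f \<circ> cinv c"] by (simp add: sm_def o_def)

lemma sm_inverse: "sm c f \<Longrightarrow> (\<And>x. x \<in> cdom c \<Longrightarrow> f x \<noteq> 0) \<Longrightarrow> sm c (\<lambda>x. inverse (f x))"
  using smooth_on_inverse[OF open_cimg, of "f \<circ> cinv c"] by (simp add: sm_def o_def)

lemma sm_of_real: "smooth_on (cimg c) (f \<circ> cinv c) \<Longrightarrow> sm c (\<lambda>x. of_real (f x))"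
  using smooth_on_linear[OF open_cimg bounded_linear_of_real, of "f \<circ> cinv c"] by (simp add: sm_def o_def)

lemma sm_continuous: "sm c f \<Longrightarrow> continuous_on (cdom c) f"
proof -
  assume "sm c f"
  then have 1: "continuous_on (cimg c) (f \<circ> cinv c)" unfolding sm_def by (rule smooth_on_continuous)
  have 2: "continuous_on (cdom c) (cmap c)" using chart_homeomorphism by (simp add: homeomorphism_def)
  have "cmap c ` cdom c \<subseteq> cimg c" by (simp add: cimg_def)
  from continuous_on_compose2[OF 1 2 this] have "continuous_on (cdom c) (\<lambda>x. (f \<circ> cinv c) (cmap c x))" .
  moreover have "(f \<circ> cinv c) (cmap c x) = f x" if "x \<in> cdom c" for x using that by simp
  ultimately show ?thesis using continuous_on_cong[OF refl, of "cdom c" "\<lambda>x. (f \<circ> cinv c) (cmap c x)" f] by simp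
qed

lemma sm_pd: "sm c f \<Longrightarrow> sm c (pd c \<xi> f)"
proof -
  assume "sm c f"
  then have "smooth_on (cimg c) (\<lambda>z. fd (f \<circ> cinv c) z \<xi>)" by (simp add: sm_def smooth_on_fd)
  then show ?thesis unfolding sm_def
    by (rule smooth_on_cong[OF open_cimg, rotated]) (simp add: pd_def)
qed

context
  fixes x :: 'a
  assumes x: "x \<in> cdom c"
begin

lemma sm_has_derivative: "sm c f \<Longrightarrow> ((f \<circ> cinv c) has_derivative (\<lambda>\<xi>. pd c \<xi> f x)) (at (cmap c x))"
  unfolding sm_def pd_def using smooth_on_has_derivative x by (metis cmap_in)

lemma pd_eqI: "((f \<circ> cinv c) has_derivative f') (at (cmap c x)) \<Longrightarrow> pd c \<xi> f x = f' \<xi>"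
proof -
  assume "((f \<circ> cinv c) has_derivative f') (at (cmap c x))"
  from fd_eq[OF this] show ?thesis by (simp only: pd_def)
qed

lemma pd_cong: "(\<And>y. y \<in> cdom c \<Longrightarrow> f y = g y) \<Longrightarrow> pd c \<xi> f x = pd c \<xi> g x"
proof -
  assume *: "\<And>y. y \<in> cdom c \<Longrightarrow> f y = g y"
  have "fd (f \<circ> cinv c) (cmap c x) = fd (g \<circ> cinv c) (cmap c x)"
    by (rule fd_cong_open[OF open_cimg cmap_in[OF x]]) (simp add: *)
  then show ?thesis by (simp add: pd_def)
qed

lemma dv_pd: "dv c x (\<lambda>f. pd c \<xi> f x)"
proof -
  have add: "pd c \<xi> (\<lambda>y. f y + g y) x = pd c \<xi> f x + pd c \<xi> g x" if f: "sm c f" and g: "sm c g" for f g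
  proof -
    have "((\<lambda>y. f y + g y) \<circ> cinv c has_derivative (\<lambda>\<xi>. pd c \<xi> f x + pd c \<xi> g x)) (at (cmap c x))"
      using has_derivative_add[OF sm_has_derivative[OF f] sm_has_derivative[OF g]] by (simp add: o_def)
    then show ?thesis by (rule pd_eqI)
  qed
  have mult: "pd c \<xi> (\<lambda>y. f y * g y) x = pd c \<xi> f x * g x + f x * pd c \<xi> g x" if f: "sm c f" and g: "sm c g" for f g
  proof -
    have "((\<lambda>y. f y * g y) \<circ> cinv c has_derivative (\<lambda>\<xi>. f x * pd c \<xi> g x + pd c \<xi> f x * g x)) (at (cmap c x))"
      using has_derivative_mult[OF sm_has_derivative[OF f] sm_has_derivative[OF g]] x by (simp add: o_def)
    then have "pd c \<xi> (\<lambda>y. f y * g y) x = f x * pd c \<xi> g x + pd c \<xi> f x * g x" by (rule pd_eqI)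
    then show ?thesis by simp
  qed
  have const: "pd c \<xi> (\<lambda>y. a) x = 0" for a
  proof -
    have "((\<lambda>y. a) \<circ> cinv c has_derivative (\<lambda>_. 0)) (at (cmap c x))" by (simp add: o_def)
    then show ?thesis by (rule pd_eqI)
  qed
  have cong: "pd c \<xi> f x = pd c \<xi> g x" if "\<forall>y\<in>cdom c. f y = g y" for f g
    by (rule pd_cong) (use that in blast)
  show ?thesis unfolding dv_def using add mult const cong by blast
qed

lemma pd_linear:
  assumes f: "sm c f"
  shows "pd c (\<xi> + \<zeta>) f x = pd c \<xi> f x + pd c \<zeta> f x" "pd c (r *\<^sub>R \<xi>) f x = r *\<^sub>R pd c \<xi> f x"
    "pd c (\<Sum>a\<in>S. h a) f x = (\<Sum>a\<in>S. pd c (h a) f x)"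
proof -
  note l = has_derivative_linear[OF sm_has_derivative[OF f]]
  show "pd c (\<xi> + \<zeta>) f x = pd c \<xi> f x + pd c \<zeta> f x" by (rule linear_add[OF l])
  show "pd c (r *\<^sub>R \<xi>) f x = r *\<^sub>R pd c \<xi> f x" by (rule linear_scale[OF l])
  show "pd c (\<Sum>a\<in>S. h a) f x = (\<Sum>a\<in>S. pd c (h a) f x)" by (rule linear_sum[OF l])
qed

lemma pd_cnj: "sm c f \<Longrightarrow> pd c \<xi> (\<lambda>y. cnj (f y)) x = cnj (pd c \<xi> f x)"
proof -
  assume f: "sm c f"
  have "((\<lambda>y. cnj (f y)) \<circ> cinv c has_derivative (\<lambda>\<xi>. cnj (pd c \<xi> f x))) (at (cmap c x))"
    using bounded_linear.has_derivative[OF bounded_linear_cnj sm_has_derivative[OF f]] by (simp add: o_def)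
  then show ?thesis by (rule pd_eqI)
qed

end

lemma wirt_eq: "wirt c j f x = (pd c (axis j 1) f x - \<i> * pd c (axis j \<i>) f x) / 2"
  and wirtbar_eq: "wirtbar c j f x = (pd c (axis j 1) f x + \<i> * pd c (axis j \<i>) f x) / 2"
  by (simp_all add: wirt_def wirtbar_def pd_def Let_def)

lemma dv_wirt: "x \<in> cdom c \<Longrightarrow> dv c x (\<lambda>f. wirt c j f x)"
  and dv_wirtbar: "x \<in> cdom c \<Longrightarrow> dv c x (\<lambda>f. wirtbar c j f x)"
proof -
  assume x: "x \<in> cdom c"
  have *: "dv c x (\<lambda>f. (pd c (axis j 1) f x + a * pd c (axis j \<i>) f x) / 2)" for a
  proof -
    note 1 = dv_pd[OF x, of "axis j 1", unfolded dv_def] and 2 = dv_pd[OF x, of "axis j \<i>", unfolded dv_def]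
    show ?thesis unfolding dv_def
    proof (intro conjI allI impI)
      fix f g assume fg: "sm c f" "sm c g"
      show "(pd c (axis j 1) (\<lambda>y. f y + g y) x + a * pd c (axis j \<i>) (\<lambda>y. f y + g y) x) / 2 =
        (pd c (axis j 1) f x + a * pd c (axis j \<i>) f x) / 2 + (pd c (axis j 1) g x + a * pd c (axis j \<i>) g x) / 2"
        using 1 2 fg by (simp add: field_simps)
      show "(pd c (axis j 1) (\<lambda>y. f y * g y) x + a * pd c (axis j \<i>) (\<lambda>y. f y * g y) x) / 2 =
        (pd c (axis j 1) f x + a * pd c (axis j \<i>) f x) / 2 * g x + f x * ((pd c (axis j 1) g x + a * pd c (axis j \<i>) g x) / 2)"
        using 1 2 fg by (simp add: field_simps)
    next
      fix b show "(pd c (axis j 1) (\<lambda>y. b) x + a * pd c (axis j \<i>) (\<lambda>y. b) x) / 2 = 0"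
        using 1 2 by simp
    next
      fix f g :: "'a \<Rightarrow> complex" assume "\<forall>y\<in>cdom c. f y = g y"
      then have "pd c \<xi> f x = pd c \<xi> g x" for \<xi> by (intro pd_cong[OF x]) auto
      then show "(pd c (axis j 1) f x + a * pd c (axis j \<i>) f x) / 2 = (pd c (axis j 1) g x + a * pd c (axis j \<i>) g x) / 2"
        by simp
    qed
  qed
  show "dv c x (\<lambda>f. wirt c j f x)" "dv c x (\<lambda>f. wirtbar c j f x)"
    using *[of "- \<i>"] *[of "\<i>"] by (simp_all add: wirt_eq wirtbar_eq)
qed

lemma sm_wirt: "sm c f \<Longrightarrow> sm c (wirt c j f)" and sm_wirtbar: "sm c f \<Longrightarrow> sm c (wirtbar c j f)"
proof -
  assume f: "sm c f"
  have "sm c (\<lambda>x. (pd c (axis j 1) f x + - \<i> * pd c (axis j \<i>) f x) * (1 / 2))"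
    "sm c (\<lambda>x. (pd c (axis j 1) f x + \<i> * pd c (axis j \<i>) f x) * (1 / 2))"
    by (intro sm_mult sm_add sm_const sm_pd f)+
  then show "sm c (wirt c j f)" "sm c (wirtbar c j f)"
    by (simp_all add: wirt_eq[abs_def] wirtbar_eq[abs_def])
qed

lemma wirt_cnj: "x \<in> cdom c \<Longrightarrow> sm c f \<Longrightarrow> wirt c j (\<lambda>y. cnj (f y)) x = cnj (wirtbar c j f x)"
  by (simp add: wirt_eq wirtbar_eq pd_cnj)

lemma pd_decomp:
  assumes x: "x \<in> cdom c" and f: "sm c f"
  shows "pd c v f x = (\<Sum>j\<in>UNIV. v $ j * wirt c j f x + cnj (v $ j) * wirtbar c j f x)"
proof -
  have "v = (\<Sum>j\<in>UNIV. Re (v $ j) *\<^sub>R axis j 1 + Im (v $ j) *\<^sub>R axis j \<i>)"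
  proof (rule vector_eqI)
    fix i
    have "(Re (v $ j) *\<^sub>R axis j 1 + Im (v $ j) *\<^sub>R axis j \<i>) $ i = (if j = i then v $ i else 0)" for j
      by (auto simp: axis_def complex_eq_iff)
    then have "(\<Sum>j\<in>UNIV. Re (v $ j) *\<^sub>R axis j 1 + Im (v $ j) *\<^sub>R axis j \<i>) $ i =
      (\<Sum>j\<in>UNIV. if j = i then v $ i else 0)"
      unfolding sum_component by (intro sum.cong refl)
    then show "v $ i = (\<Sum>j\<in>UNIV. Re (v $ j) *\<^sub>R axis j 1 + Im (v $ j) *\<^sub>R axis j \<i>) $ i" by simp
  qed
  then have "pd c v f x = pd c (\<Sum>j\<in>UNIV. Re (v $ j) *\<^sub>R axis j 1 + Im (v $ j) *\<^sub>R axis j \<i>) f x"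
    by (rule arg_cong[where f = "\<lambda>v. pd c v f x"])
  also have "\<dots> = (\<Sum>j\<in>UNIV. Re (v $ j) *\<^sub>R pd c (axis j 1) f x + Im (v $ j) *\<^sub>R pd c (axis j \<i>) f x)"
    by (simp only: pd_linear[OF x f])
  also have "\<dots> = (\<Sum>j\<in>UNIV. v $ j * wirt c j f x + cnj (v $ j) * wirtbar c j f x)"
    by (simp only: wirt_eq wirtbar_eq wirtinger_decomposition)
  finally show ?thesis .
qed

end

subsection \<open>Derivatives of forms and of fields of operators\<close>

definition smE :: "('a, 'n::finite) chart \<Rightarrow> ('a \<Rightarrow> 'n ext) \<Rightarrow> bool" where
  "smE c U \<longleftrightarrow> (\<forall>I J. sm c (\<lambda>y. U y I J))"

definition DE :: "(('a \<Rightarrow> complex) \<Rightarrow> complex) \<Rightarrow> ('a \<Rightarrow> 'n ext) \<Rightarrow> 'n ext" where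
  "DE D U = (\<lambda>I J. D (\<lambda>y. U y I J))"

definition smop :: "('a, 'n::finite) chart \<Rightarrow> ('a \<Rightarrow> 'n lop) \<Rightarrow> bool" where
  "smop c p \<longleftrightarrow> (\<forall>K L I J. sm c (\<lambda>y. ap (p y) (bas K L) I J))"

text \<open>The operator with prescribed matrix entries in the basis \<open>bas\<close>; it allows a
  field of operators to be differentiated entry by entry.\<close>

lift_definition mk_lop :: "('n::finite set \<Rightarrow> 'n set \<Rightarrow> 'n set \<Rightarrow> 'n set \<Rightarrow> complex) \<Rightarrow> 'n lop" is
  "\<lambda>m \<alpha> I J. \<Sum>K\<in>UNIV. \<Sum>L\<in>UNIV. \<alpha> K L * m K L I J"
  by (auto simp: fun_eq_iff algebra_simps sum.distrib sum_distrib_left)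

definition Dop :: "(('a \<Rightarrow> complex) \<Rightarrow> complex) \<Rightarrow> ('a \<Rightarrow> 'n::finite lop) \<Rightarrow> 'n lop" where
  "Dop D p = mk_lop (\<lambda>K L I J. D (\<lambda>y. ap (p y) (bas K L) I J))"

lemma ap_coeff:
  fixes \<alpha> :: "'n::finite ext"
  shows "ap p \<alpha> I J = (\<Sum>K\<in>UNIV. \<Sum>L\<in>UNIV. \<alpha> K L * ap p (bas K L) I J)"
  by (subst ap_bas_expand) (simp add: sum_fun_apply)

lemma lop_eqI_bas:
  fixes p q :: "'n::finite lop"
  shows "(\<And>K L I J. ap p (bas K L) I J = ap q (bas K L) I J) \<Longrightarrow> p = q"
proof (rule lop_eqI, intro ext)
  fix \<alpha> I J assume "\<And>K L I J. ap p (bas K L) I J = ap q (bas K L) I J"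
  then show "ap p \<alpha> I J = ap q \<alpha> I J"
    by (simp only: ap_coeff[of p \<alpha>] ap_coeff[of q \<alpha>])
qed

lemma ap_mk_lop_bas: "ap (mk_lop m) (bas K L) I J = m K L I J"
proof -
  have "ap (mk_lop m) (bas K L) I J = (\<Sum>K'\<in>UNIV. \<Sum>L'\<in>UNIV. bas K L K' L' * m K' L' I J)"
    by (simp add: mk_lop.rep_eq)
  also have "\<dots> = ip (bas K L) (\<lambda>K L. cnj (m K L I J))"
    by (simp add: ip_def)
  finally show ?thesis by (simp add: ip_bas_left)
qed

lemma ap_Dop_bas: "ap (Dop D p) (bas K L) I J = D (\<lambda>y. ap (p y) (bas K L) I J)"
  by (simp add: Dop_def ap_mk_lop_bas)

context
  fixes c :: "('a::topological_space, 'n::{finite, linorder}) chart"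
  assumes c: "chart c"
begin

lemma smE_simps:
  "smE c U \<Longrightarrow> smE c V \<Longrightarrow> smE c (\<lambda>y. U y + V y)" "smE c U \<Longrightarrow> smE c V \<Longrightarrow> smE c (\<lambda>y. U y - V y)"
  "smE c U \<Longrightarrow> smE c (\<lambda>y. - U y)"
  "sm c f \<Longrightarrow> smE c U \<Longrightarrow> smE c (\<lambda>y. scl (f y) (U y))" "smE c (\<lambda>y. \<alpha>)"
  by (auto simp: smE_def sm_add sm_diff sm_minus sm_mult c)

lemma smE_cong: "(\<And>y. y \<in> cdom c \<Longrightarrow> U y = V y) \<Longrightarrow> smE c U \<Longrightarrow> smE c V"
  unfolding smE_def using sm_cong[OF c] by metis

lemma smE_sum: "(\<And>a. a \<in> S \<Longrightarrow> smE c (U a)) \<Longrightarrow> smE c (\<lambda>y. \<Sum>a\<in>S. U a y)"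
  by (simp add: smE_def sum_fun_apply sm_sum c)

lemma smE_cj: "smE c U \<Longrightarrow> smE c (\<lambda>y. cj (U y))"
  by (simp add: smE_def cj_def sm_mult sm_cnj c)

lemma smE_ap: "smop c p \<Longrightarrow> smE c U \<Longrightarrow> smE c (\<lambda>y. ap (p y) (U y))"
proof -
  assume p: "smop c p" and U: "smE c U"
  have "sm c (\<lambda>y. ap (p y) (U y) I J)" for I J
  proof -
    have "(\<lambda>y. ap (p y) (U y) I J) = (\<lambda>y. \<Sum>K\<in>UNIV. \<Sum>L\<in>UNIV. U y K L * ap (p y) (bas K L) I J)"
      by (rule ext) (rule ap_coeff)
    moreover have "sm c (\<lambda>y. \<Sum>K\<in>UNIV. \<Sum>L\<in>UNIV. U y K L * ap (p y) (bas K L) I J)"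
      using p U unfolding smop_def smE_def by (intro sm_sum[OF c] sm_mult[OF c]) auto
    ultimately show ?thesis by simp
  qed
  then show ?thesis by (simp add: smE_def)
qed

lemma smE_wirt: "smE c U \<Longrightarrow> smE c (\<lambda>y. DE (\<lambda>f. wirt c j f y) U)"
  unfolding smE_def DE_def by (auto intro: sm_wirt c)

lemma smop_const: "smop c (\<lambda>y. p)"
  by (simp add: smop_def c)

lemma smop_simps:
  "smop c p \<Longrightarrow> smop c q \<Longrightarrow> smop c (\<lambda>y. p y + q y)" "smop c p \<Longrightarrow> smop c q \<Longrightarrow> smop c (\<lambda>y. p y - q y)"
  "smop c p \<Longrightarrow> smop c (\<lambda>y. - p y)" "sm c f \<Longrightarrow> smop c (\<lambda>y. sc (f y))"
  by (auto simp: smop_def sm_add sm_diff sm_minus sm_mult c)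

lemma smop_mult: "smop c p \<Longrightarrow> smop c q \<Longrightarrow> smop c (\<lambda>y. p y * q y)"
proof -
  assume p: "smop c p" and q: "smop c q"
  then have "smE c (\<lambda>y. ap (q y) (bas K L))" for K L by (simp add: smE_def smop_def)
  from smE_ap[OF p this] show ?thesis by (simp add: smE_def smop_def)
qed

lemma smop_sum: "(\<And>a. a \<in> S \<Longrightarrow> smop c (p a)) \<Longrightarrow> smop c (\<lambda>y. \<Sum>a\<in>S. p a y)"
  by (simp add: smop_def ap_sum_left sum_fun_apply sm_sum c)

lemma smop_dag: "smop c p \<Longrightarrow> smop c (\<lambda>y. dag (p y))"
proof -
  have "ap (dag p) (bas K L) I J = cnj (ap p (bas I J) K L)" for p :: "'n lop" and K L I J
    by (metis ip_ap ip_bas_left ip_bas_right complex_cnj_cnj)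
  then show "smop c p \<Longrightarrow> smop c (\<lambda>y. dag (p y))" by (simp add: smop_def sm_cnj c)
qed

lemma sm_minor: "(\<And>i j. sm c (\<lambda>y. B y $ i $ j)) \<Longrightarrow> sm c (\<lambda>y. minor (B y) I K)"
  by (cases "card I = card K") (auto simp: minor_def intro!: sm_sum sm_mult sm_prod sm_const c)

lemma smop_pl: "(\<And>i j. sm c (\<lambda>y. B y $ i $ j)) \<Longrightarrow> smop c (\<lambda>y. pl (B y))"
  by (simp add: smop_def pull_bas sm_mult sm_cnj sm_minor c)

lemma smop_wd: "smE c U \<Longrightarrow> smop c (\<lambda>y. wd (U y))"
  unfolding smop_def ap_wd wedge_def smE_def by (auto intro!: sm_sum sm_mult sm_const c)

context
  fixes x :: 'a and D
  assumes D: "dv c x D"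
begin

lemma dv_simps:
  "sm c f \<Longrightarrow> sm c g \<Longrightarrow> D (\<lambda>y. f y + g y) = D f + D g"
  "sm c f \<Longrightarrow> sm c g \<Longrightarrow> D (\<lambda>y. f y * g y) = D f * g x + f x * D g" "D (\<lambda>y. a) = 0"
  using D by (simp_all add: dv_def)

lemma dv_cong: "(\<And>y. y \<in> cdom c \<Longrightarrow> f y = g y) \<Longrightarrow> D f = D g"
  using D unfolding dv_def by blast

lemma dv_minus: "sm c f \<Longrightarrow> D (\<lambda>y. - f y) = - D f"
proof -
  assume f: "sm c f"
  have "D (\<lambda>y. (-1) * f y) = D (\<lambda>y. -1) * f x + (-1) * D f"
    by (rule dv_simps(2)[OF sm_const[OF c] f])
  then show ?thesis by (simp add: dv_simps(3))
qed

lemma dv_diff: "sm c f \<Longrightarrow> sm c g \<Longrightarrow> D (\<lambda>y. f y - g y) = D f - D g"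
proof -
  assume f: "sm c f" and g: "sm c g"
  have "D (\<lambda>y. f y + - g y) = D f + D (\<lambda>y. - g y)"
    by (rule dv_simps(1)[OF f sm_minus[OF c g]])
  then show ?thesis by (simp add: dv_minus[OF g])
qed

lemma dv_sum: "(\<And>a. a \<in> S \<Longrightarrow> sm c (f a)) \<Longrightarrow> D (\<lambda>y. \<Sum>a\<in>S. f a y) = (\<Sum>a\<in>S. D (f a))"
proof (induction S rule: infinite_finite_induct)
  case (insert a S)
  have "D (\<lambda>y. f a y + (\<Sum>a\<in>S. f a y)) = D (f a) + D (\<lambda>y. \<Sum>a\<in>S. f a y)"
    by (rule dv_simps(1)) (use insert in \<open>auto intro: sm_sum[OF c]\<close>)
  then show ?case using insert by simp
qed (simp_all add: dv_simps(3))

lemma DE_cong: "(\<And>y. y \<in> cdom c \<Longrightarrow> U y = V y) \<Longrightarrow> DE D U = DE D V"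
proof (intro ext)
  fix I J assume "\<And>y. y \<in> cdom c \<Longrightarrow> U y = V y"
  then show "DE D U I J = DE D V I J" unfolding DE_def by (intro dv_cong) simp
qed

lemma DE_simps:
  "smE c U \<Longrightarrow> smE c V \<Longrightarrow> DE D (\<lambda>y. U y + V y) = DE D U + DE D V"
  "smE c U \<Longrightarrow> smE c V \<Longrightarrow> DE D (\<lambda>y. U y - V y) = DE D U - DE D V"
  "smE c U \<Longrightarrow> DE D (\<lambda>y. - U y) = - DE D U"
  "sm c f \<Longrightarrow> smE c U \<Longrightarrow> DE D (\<lambda>y. scl (f y) (U y)) = scl (D f) (U x) + scl (f x) (DE D U)"
  "DE D (\<lambda>y. \<alpha>) = 0"
  by (auto simp: DE_def fun_eq_iff smE_def dv_simps dv_diff dv_minus)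

lemma DE_ap: "smop c p \<Longrightarrow> smE c U \<Longrightarrow> DE D (\<lambda>y. ap (p y) (U y)) = ap (Dop D p) (U x) + ap (p x) (DE D U)"
proof (intro ext)
  fix I J assume p: "smop c p" and U: "smE c U"
  have "DE D (\<lambda>y. ap (p y) (U y)) I J = D (\<lambda>y. \<Sum>K\<in>UNIV. \<Sum>L\<in>UNIV. U y K L * ap (p y) (bas K L) I J)"
  proof -
    have "(\<lambda>y. ap (p y) (U y) I J) = (\<lambda>y. \<Sum>K\<in>UNIV. \<Sum>L\<in>UNIV. U y K L * ap (p y) (bas K L) I J)"
      by (rule ext) (rule ap_coeff)
    then show ?thesis by (simp only: DE_def)
  qed
  also have "\<dots> = (\<Sum>K\<in>UNIV. \<Sum>L\<in>UNIV. D (\<lambda>y. U y K L) * ap (p x) (bas K L) I J + U x K L * D (\<lambda>y. ap (p y) (bas K L) I J))"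
    using p U unfolding smop_def smE_def
    by (simp add: dv_sum sm_sum sm_mult c dv_simps)
  also have "\<dots> = ap (Dop D p) (U x) I J + ap (p x) (DE D U) I J"
    unfolding ap_coeff[of "Dop D p" "U x"] ap_coeff[of "p x" "DE D U"] by (simp add: ap_Dop_bas DE_def sum.distrib)
  finally show "DE D (\<lambda>y. ap (p y) (U y)) I J = (ap (Dop D p) (U x) + ap (p x) (DE D U)) I J" by simp
qed

lemma DE_ap_const: "smE c U \<Longrightarrow> DE D (\<lambda>y. ap p (U y)) = ap p (DE D U)"
proof -
  have "Dop D (\<lambda>y. p) = 0" by (rule lop_eqI_bas) (simp add: ap_Dop_bas dv_simps)
  then show "smE c U \<Longrightarrow> DE D (\<lambda>y. ap p (U y)) = ap p (DE D U)" using DE_ap[OF smop_const] by simp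
qed

lemma Dop_cong: "(\<And>y. y \<in> cdom c \<Longrightarrow> p y = q y) \<Longrightarrow> Dop D p = Dop D q"
  by (rule lop_eqI_bas, unfold ap_Dop_bas, rule dv_cong) simp

lemma Dop_simps:
  "smop c p \<Longrightarrow> smop c q \<Longrightarrow> Dop D (\<lambda>y. p y + q y) = Dop D p + Dop D q"
  "smop c p \<Longrightarrow> smop c q \<Longrightarrow> Dop D (\<lambda>y. p y - q y) = Dop D p - Dop D q"
  "smop c p \<Longrightarrow> smop c q \<Longrightarrow> Dop D (\<lambda>y. p y * q y) = Dop D p * q x + p x * Dop D q"
  "Dop D (\<lambda>y. q0) = 0"
  "sm c f \<Longrightarrow> Dop D (\<lambda>y. sc (f y)) = sc (D f)"
proof -
  show "smop c p \<Longrightarrow> smop c q \<Longrightarrow> Dop D (\<lambda>y. p y + q y) = Dop D p + Dop D q"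
   "smop c p \<Longrightarrow> smop c q \<Longrightarrow> Dop D (\<lambda>y. p y - q y) = Dop D p - Dop D q"
   "Dop D (\<lambda>y. q0) = 0"
    by (rule lop_eqI_bas, simp add: ap_Dop_bas dv_simps dv_diff smop_def)+
  show "sm c f \<Longrightarrow> Dop D (\<lambda>y. sc (f y)) = sc (D f)"
    by (rule lop_eqI_bas) (simp add: ap_Dop_bas dv_simps c)
  assume p: "smop c p" and q: "smop c q"
  show "Dop D (\<lambda>y. p y * q y) = Dop D p * q x + p x * Dop D q"
  proof (rule lop_eqI_bas)
    fix K L I J
    have "smE c (\<lambda>y. ap (q y) (bas K L))" by (intro smE_ap q smE_simps)
    note DE_ap[OF p this]
    moreover have "DE D (\<lambda>y. ap (q y) (bas K L)) = ap (Dop D q) (bas K L)" for q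
      by (intro ext) (simp add: DE_def ap_Dop_bas)
    ultimately have "ap (Dop D (\<lambda>y. p y * q y)) (bas K L) = ap (Dop D p * q x + p x * Dop D q) (bas K L)"
      by (metis (no_types, lifting) ap_simps(3,6) DE_cong)
    then show "ap (Dop D (\<lambda>y. p y * q y)) (bas K L) I J = ap (Dop D p * q x + p x * Dop D q) (bas K L) I J" by simp
  qed
qed

lemma Dop_sum: "(\<And>a. a \<in> S \<Longrightarrow> smop c (p a)) \<Longrightarrow> Dop D (\<lambda>y. \<Sum>a\<in>S. p a y) = (\<Sum>a\<in>S. Dop D (p a))"
  by (rule lop_eqI_bas) (simp add: ap_Dop_bas ap_sum_left sum_fun_apply dv_sum smop_def)

end

end

lemma lop_double_eq_0:
  fixes p :: "'n lop"
  assumes "p + p = 0"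
  shows "p = 0"
proof -
  have "sc (1 / 2) * (p + p) = sc (1 / 2 + 1 / 2) * p" by (simp only: sc_add distrib_left distrib_right)
  then show ?thesis using assms by simp
qed

subsection \<open>Restricted charts and changes of coordinates\<close>

text \<open>Used for overlaps: a function that is smooth on the intersection of two chart domains
  need not be smooth on either of them, while \<open>sm\<close> always refers to a whole
  domain.\<close>

definition rchart :: "('a, 'n::finite) chart \<Rightarrow> 'a set \<Rightarrow> ('a, 'n) chart" where
  "rchart c T = (cdom c \<inter> T, cmap c)"

lemma cdom_rchart [simp]: "cdom (rchart c T) = cdom c \<inter> T" and cmap_rchart [simp]: "cmap (rchart c T) = cmap c"
  by (simp_all add: rchart_def)

context
  fixes c :: "('a::topological_space, 'n::{finite, linorder}) chart" and T :: "'a set"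
  assumes c: "chart c" and T: "open T"
begin

lemma cimg_rchart: "cimg (rchart c T) = cmap c ` (cdom c \<inter> T)"
  by (simp add: rchart_def cimg_def)

lemma open_cimg_rchart: "open (cimg (rchart c T))"
proof -
  have "openin (top_of_set (cdom c)) (cdom c \<inter> T)" using T by (simp add: openin_open_Int)
  then have "openin (top_of_set (cimg c)) (cmap c ` (cdom c \<inter> T))"
    using homeomorphism_imp_open_map[OF chart_homeomorphism[OF c]] by blast
  then show ?thesis using open_cimg[OF c] by (simp add: cimg_rchart openin_open_eq)
qed

lemma cinv_rchart: "z \<in> cimg (rchart c T) \<Longrightarrow> cinv (rchart c T) z = cinv c z"
proof -
  assume "z \<in> cimg (rchart c T)"
  then obtain x where x: "x \<in> cdom c \<inter> T" "z = cmap c x" by (auto simp: cimg_rchart)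
  have "inj_on (cmap c) (cdom c)" by (rule inj_on_inverseI[where g = "cinv c"]) (simp add: c)
  then have "inj_on (cmap c) (cdom c \<inter> T)" by (rule inj_on_subset) auto
  then have "cinv (rchart c T) z = x" unfolding cinv_def using x by (simp add: inv_into_f_eq)
  then show ?thesis using x c by simp
qed

lemma chart_rchart: "chart (rchart c T)"
proof -
  have "homeomorphism (cdom c \<inter> T) (cimg (rchart c T)) (cmap c) (cinv c)"
    by (rule homeomorphism_of_subsets[OF chart_homeomorphism[OF c]]) (auto simp: cimg_rchart cimg_def)
  then show ?thesis unfolding chart_def using open_cimg_rchart open_cdom[OF c] T by auto
qed

lemma sm_rchart_iff: "sm (rchart c T) f \<longleftrightarrow> smooth_on (cmap c ` (cdom c \<inter> T)) (f \<circ> cinv c)"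
  unfolding sm_def cimg_rchart[symmetric]
proof
  assume "smooth_on (cimg (rchart c T)) (f \<circ> cinv (rchart c T))"
  then show "smooth_on (cimg (rchart c T)) (f \<circ> cinv c)"
    by (rule smooth_on_cong[OF open_cimg_rchart, rotated]) (simp add: cinv_rchart)
next
  assume "smooth_on (cimg (rchart c T)) (f \<circ> cinv c)"
  then show "smooth_on (cimg (rchart c T)) (f \<circ> cinv (rchart c T))"
    by (rule smooth_on_cong[OF open_cimg_rchart, rotated]) (simp add: cinv_rchart)
qed

lemma pd_rchart: "x \<in> cdom c \<Longrightarrow> x \<in> T \<Longrightarrow> pd (rchart c T) \<xi> f x = pd c \<xi> f x"
proof -
  assume x: "x \<in> cdom c" "x \<in> T"
  then have "cmap c x \<in> cimg (rchart c T)" by (simp add: cimg_rchart)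
  then have "fd (f \<circ> cinv (rchart c T)) (cmap c x) = fd (f \<circ> cinv c) (cmap c x)"
    by (rule fd_cong_open[OF open_cimg_rchart]) (simp add: cinv_rchart)
  then show ?thesis by (simp add: pd_def)
qed

lemma wirt_rchart: "x \<in> cdom c \<Longrightarrow> x \<in> T \<Longrightarrow> wirt (rchart c T) j f x = wirt c j f x"
  and wirtbar_rchart: "x \<in> cdom c \<Longrightarrow> x \<in> T \<Longrightarrow> wirtbar (rchart c T) j f x = wirtbar c j f x"
  by (simp_all add: wirt_eq[OF c] wirtbar_eq[OF c] wirt_eq[OF chart_rchart] wirtbar_eq[OF chart_rchart] pd_rchart)

end

lemma pd_commute:
  fixes c :: "('a::topological_space, 'n::{finite, linorder}) chart"
  assumes c: "chart c" and x: "x \<in> cdom c" and f: "sm c f"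
  shows "pd c \<xi> (pd c \<zeta> f) x = pd c \<zeta> (pd c \<xi> f) x"
proof -
  have *: "pd c \<xi> (pd c \<zeta> f) x = fd (\<lambda>z. fd (f \<circ> cinv c) z \<zeta>) (cmap c x) \<xi>" for \<xi> \<zeta>
    using fd_cong_open[OF open_cimg[OF c] cmap_in[OF c x], of "pd c \<zeta> f \<circ> cinv c" "\<lambda>z. fd (f \<circ> cinv c) z \<zeta>"]
    by (simp add: pd_def c)
  show ?thesis unfolding * using f x c
    by (intro fd_fd_commute[OF open_cimg[OF c]]) (auto simp: sm_def)
qed

text \<open>Both Wirtinger derivatives are combinations with constant coefficients of derivatives in
  fixed directions, which commute by \<open>pd_commute\<close>.\<close>

lemma wirt_wirt_commute:
  fixes c :: "('a::topological_space, 'n::{finite, linorder}) chart"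
  assumes c: "chart c" and x: "x \<in> cdom c" and f: "sm c f"
  shows "wirt c i (wirt c j f) x = wirt c j (wirt c i f) x"
    and "wirtbar c i (wirt c j f) x = wirt c j (wirtbar c i f) x"
proof -
  have lin: "pd c \<xi> (\<lambda>y. (g y + a * h y) / 2) x = (pd c \<xi> g x + a * pd c \<xi> h x) / 2" if "sm c g" "sm c h" for \<xi> g h a
  proof -
    note D = dv_pd[OF c x, of \<xi>]
    have "pd c \<xi> (\<lambda>y. (g y + a * h y) * (1 / 2)) x = pd c \<xi> (\<lambda>y. g y + a * h y) x * (1 / 2)"
      using dv_simps(2)[OF c D, of "\<lambda>y. g y + a * h y" "\<lambda>y. 1 / 2"] dv_simps(3)[OF c D] that
      by (simp add: sm_add sm_mult c)
    also have "pd c \<xi> (\<lambda>y. g y + a * h y) x = pd c \<xi> g x + a * pd c \<xi> h x"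
      using dv_simps(1)[OF c D, of g "\<lambda>y. a * h y"] dv_simps(2)[OF c D, of "\<lambda>y. a" h] dv_simps(3)[OF c D] that
      by (simp add: sm_mult c)
    finally show ?thesis by simp
  qed
  have w: "wirt c j f = (\<lambda>y. (pd c (axis j 1) f y + - \<i> * pd c (axis j \<i>) f y) / 2)"
    "wirtbar c j f = (\<lambda>y. (pd c (axis j 1) f y + \<i> * pd c (axis j \<i>) f y) / 2)" for j f
    by (auto simp: fun_eq_iff wirt_eq[OF c] wirtbar_eq[OF c])
  show "wirt c i (wirt c j f) x = wirt c j (wirt c i f) x"
    "wirtbar c i (wirt c j f) x = wirt c j (wirtbar c i f) x"
    using pd_commute[OF c x f, of "axis i 1" "axis j 1"] pd_commute[OF c x f, of "axis i 1" "axis j \<i>"]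
      pd_commute[OF c x f, of "axis i \<i>" "axis j 1"] pd_commute[OF c x f, of "axis i \<i>" "axis j \<i>"]
    by (simp_all only: w lin sm_pd[OF c] f) (simp_all add: field_simps)
qed

section \<open>Transition maps and their Jacobians\<close>

locale atlas =
  fixes A :: "('a::{t2_space, second_countable_topology}, 'n::{finite, linorder}) chart set"
  assumes A: "complex_atlas A"
begin

lemma chartA: "c \<in> A \<Longrightarrow> chart c"
  using A complex_atlas_chart by blast

lemma atlas_cover: "\<exists>c\<in>A. x \<in> cdom c"
  using A unfolding complex_atlas_def by blast

lemma chart_at: "chart_at A x \<in> A" "x \<in> cdom (chart_at A x)"
proof -
  have "\<exists>c. c \<in> A \<and> x \<in> cdom c" using atlas_cover by blast
  from someI_ex[OF this] show "chart_at A x \<in> A" "x \<in> cdom (chart_at A x)" unfolding chart_at_def by auto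
qed

context
  fixes c c' :: "('a, 'n) chart"
  assumes c: "c \<in> A" and c': "c' \<in> A"
begin

abbreviation (input) "c0 \<equiv> rchart c (cdom c')"

lemma charts: "chart c" "chart c'" "chart c0"
  using chartA[OF c] chartA[OF c'] chart_rchart[OF chartA[OF c] open_cdom[OF chartA[OF c']]] by simp_all

lemma trans_smooth: "smooth_on (cmap c ` (cdom c \<inter> cdom c')) (cmap c' \<circ> cinv c)"
  and trans_linear: "z \<in> cmap c ` (cdom c \<inter> cdom c') \<Longrightarrow>
     fd (cmap c' \<circ> cinv c) z (a *s v) = a *s fd (cmap c' \<circ> cinv c) z v"
  using A c c' unfolding complex_atlas_def holomorphic_map_on_def by blast+

lemma open_overlap: "open (cmap c ` (cdom c \<inter> cdom c'))"
  using open_cimg_rchart[OF charts(1) open_cdom[OF charts(2)]] cimg_rchart[OF charts(1) open_cdom[OF charts(2)]] by simp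

text \<open>Complex linearity of the differential reduces it to the vectors \<open>axis k 1\<close>,
  the only ones that enter \<open>jacobian\<close>.\<close>

lemma trans_jacobian:
  assumes x: "x \<in> cdom c" "x \<in> cdom c'"
  shows "fd (cmap c' \<circ> cinv c) (cmap c x) v = jacobian c c' x *v v"
proof -
  let ?f = "fd (cmap c' \<circ> cinv c) (cmap c x)"
  have z: "cmap c x \<in> cmap c ` (cdom c \<inter> cdom c')" using x by blast
  have lin: "linear ?f" using smooth_on_has_derivative[OF trans_smooth z] has_derivative_linear by blast
  have v: "v = (\<Sum>k\<in>UNIV. v $ k *s axis k 1)"
  proof (rule vector_eqI)
    fix i
    have "(v $ k *s axis k 1) $ i = (if k = i then v $ i else 0)" for k
      by (auto simp: axis_def)
    then have "(\<Sum>k\<in>UNIV. v $ k *s axis k 1) $ i = (\<Sum>k\<in>UNIV. if k = i then v $ i else 0)"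
      unfolding sum_component by (intro sum.cong refl)
    then show "v $ i = (\<Sum>k\<in>UNIV. v $ k *s axis k 1) $ i" by simp
  qed
  have "?f v = ?f (\<Sum>k\<in>UNIV. v $ k *s axis k 1)" using v by (rule arg_cong)
  also have "\<dots> = (\<Sum>k\<in>UNIV. v $ k *s ?f (axis k 1))"
    by (simp only: linear_sum[OF lin] trans_linear[OF z])
  also have "\<dots> = jacobian c c' x *v v"
  proof (rule vector_eqI)
    fix i show "(\<Sum>k\<in>UNIV. v $ k *s ?f (axis k 1)) $ i = (jacobian c c' x *v v) $ i"
      by (simp add: sum_component matrix_vector_mult_def jacobian_def mult.commute)
  qed
  finally show ?thesis .
qed

lemma fd_trans: "x \<in> cdom c \<Longrightarrow> x \<in> cdom c' \<Longrightarrow> fd (cmap c' \<circ> cinv c) (cmap c x) = (\<lambda>v. jacobian c c' x *v v)"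
  by (rule ext) (rule trans_jacobian)

lemma sm_overlap: "sm c' f \<Longrightarrow> sm c0 f"
proof -
  assume f: "sm c' f"
  have "smooth_on (cmap c ` (cdom c \<inter> cdom c')) (\<lambda>z. (f \<circ> cinv c') ((cmap c' \<circ> cinv c) z))"
  proof (rule smooth_on_compose[OF open_overlap open_cimg[OF charts(2)] _ trans_smooth])
    show "(cmap c' \<circ> cinv c) ` cmap c ` (cdom c \<inter> cdom c') \<subseteq> cimg c'" using charts by auto
    show "smooth_on (cimg c') (f \<circ> cinv c')" using f by (simp only: sm_def)
  qed
  then have "smooth_on (cmap c ` (cdom c \<inter> cdom c')) (f \<circ> cinv c)"
    by (rule smooth_on_cong[OF open_overlap, rotated]) (use charts in auto)
  then show ?thesis unfolding sm_rchart_iff[OF charts(1) open_cdom[OF charts(2)]] .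
qed

lemma pd_chain:
  assumes x: "x \<in> cdom c" "x \<in> cdom c'" and f: "sm c' f"
  shows "pd c v f x = pd c' (jacobian c c' x *v v) f x"
proof -
  have z: "cmap c x \<in> cmap c ` (cdom c \<inter> cdom c')" using x by blast
  have 1: "(cmap c' \<circ> cinv c has_derivative (\<lambda>v. jacobian c c' x *v v)) (at (cmap c x))"
    using smooth_on_has_derivative[OF trans_smooth z] fd_trans[OF x] by simp
  have "(cmap c' \<circ> cinv c) (cmap c x) = cmap c' x" using x charts by simp
  then have 2: "(f \<circ> cinv c' has_derivative (\<lambda>\<xi>. pd c' \<xi> f x)) (at ((cmap c' \<circ> cinv c) (cmap c x)))"
    using sm_has_derivative[OF charts(2) x(2) f] by simp
  have "((\<lambda>z. (f \<circ> cinv c') ((cmap c' \<circ> cinv c) z)) has_derivative (\<lambda>v. pd c' (jacobian c c' x *v v) f x)) (at (cmap c x))"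
    by (rule has_derivative_compose[OF 1 2])
  then have "(f \<circ> cinv c has_derivative (\<lambda>v. pd c' (jacobian c c' x *v v) f x)) (at (cmap c x))"
    by (rule has_derivative_transform_within_open[OF _ open_overlap z]) (use charts in auto)
  then show ?thesis by (rule pd_eqI[OF charts(1) x(1)])
qed

lemma jacobian_axis: "(jacobian c c' x *v axis k a) $ j = a * jacobian c c' x $ j $ k"
proof -
  have "(jacobian c c' x *v axis k a) $ j = (\<Sum>l\<in>UNIV. if l = k then a * jacobian c c' x $ j $ k else 0)"
    unfolding matrix_vector_mult_def vec_lambda_beta by (intro sum.cong refl) (auto simp: axis_def)
  then show ?thesis by simp
qed

text \<open>The differential of the transition map is complex linear, so the two parts of the
  decomposition in \<open>pd_decomp\<close> do not mix.\<close>

lemma wirt_chain: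
  assumes x: "x \<in> cdom c" "x \<in> cdom c'" and f: "sm c' f"
  shows "wirt c k f x = (\<Sum>j\<in>UNIV. jacobian c c' x $ j $ k * wirt c' j f x)"
    and "wirtbar c k f x = (\<Sum>j\<in>UNIV. cnj (jacobian c c' x $ j $ k) * wirtbar c' j f x)"
  unfolding wirt_eq[OF charts(1)] wirtbar_eq[OF charts(1)] pd_chain[OF x f] pd_decomp[OF charts(2) x(2) f] jacobian_axis
  by (simp_all add: sum_subtractf[symmetric] sum.distrib[symmetric] sum_distrib_left sum_divide_distrib algebra_simps)

lemma sm_coord: "sm c0 (\<lambda>y. cmap c' y $ j)"
proof -
  have "smooth_on (cmap c ` (cdom c \<inter> cdom c')) (\<lambda>z. (cmap c' \<circ> cinv c) z $ j)"
    by (rule smooth_on_linear[OF open_overlap bounded_linear_vec_nth trans_smooth])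
  then show ?thesis unfolding sm_rchart_iff[OF charts(1) open_cdom[OF charts(2)]] by (simp add: o_def)
qed

lemma pd_coord:
  assumes x: "x \<in> cdom c" "x \<in> cdom c'"
  shows "pd c0 v (\<lambda>y. cmap c' y $ j) x = (jacobian c c' x *v v) $ j"
proof -
  have z: "cmap c x \<in> cmap c ` (cdom c \<inter> cdom c')" using x by blast
  have "(cmap c' \<circ> cinv c has_derivative (\<lambda>v. jacobian c c' x *v v)) (at (cmap c x))"
    using smooth_on_has_derivative[OF trans_smooth z] fd_trans[OF x] by simp
  from bounded_linear.has_derivative[OF bounded_linear_vec_nth this, of j]
  have "((\<lambda>y. cmap c' y $ j) \<circ> cinv c has_derivative (\<lambda>v. (jacobian c c' x *v v) $ j)) (at (cmap c x))"
    by (simp add: o_def)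
  from pd_eqI[OF charts(1) x(1) this] show ?thesis
    by (simp add: pd_rchart[OF charts(1) open_cdom[OF charts(2)] x])
qed

lemma wirt_coord:
  assumes x: "x \<in> cdom c" "x \<in> cdom c'"
  shows "wirt c0 k (\<lambda>y. cmap c' y $ j) x = jacobian c c' x $ j $ k"
    and "wirtbar c0 k (\<lambda>y. cmap c' y $ j) x = 0"
  unfolding wirt_eq[OF charts(3)] wirtbar_eq[OF charts(3)] pd_coord[OF x] jacobian_axis
  by (simp_all add: mult.assoc[symmetric])

lemma sm_jacobian: "sm c0 (\<lambda>y. jacobian c c' y $ j $ k)"
  by (rule sm_cong[OF charts(3) _ sm_wirt[OF charts(3) sm_coord[where j = j], where j = k]]) (auto simp: wirt_coord)

text \<open>The entries are Wirtinger derivatives of the coordinates of \<open>c'\<close>. Second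
  derivatives commute, and \<open>wirtbar\<close> annihilates a holomorphic coordinate.\<close>

lemma wirt_jacobian:
  assumes x: "x \<in> cdom c" "x \<in> cdom c'"
  shows "wirt c0 i (\<lambda>y. jacobian c c' y $ j $ k) x = wirt c0 k (\<lambda>y. jacobian c c' y $ j $ i) x"
    and "wirtbar c0 i (\<lambda>y. jacobian c c' y $ j $ k) x = 0"
proof -
  have x0: "x \<in> cdom c0" using x by (simp add: rchart_def)
  have *: "wirt c0 i (\<lambda>y. jacobian c c' y $ j $ k) x = wirt c0 i (wirt c0 k (\<lambda>y. cmap c' y $ j)) x" for i k
    by (rule dv_cong[OF charts(3) dv_wirt[OF charts(3) x0]]) (auto simp: wirt_coord)
  have "wirt c0 i (wirt c0 k (\<lambda>y. cmap c' y $ j)) x = wirt c0 k (wirt c0 i (\<lambda>y. cmap c' y $ j)) x"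
    by (rule wirt_wirt_commute(1)[OF charts(3) x0 sm_coord])
  then show "wirt c0 i (\<lambda>y. jacobian c c' y $ j $ k) x = wirt c0 k (\<lambda>y. jacobian c c' y $ j $ i) x"
    by (simp only: *)
  have "wirtbar c0 i (\<lambda>y. jacobian c c' y $ j $ k) x = wirtbar c0 i (wirt c0 k (\<lambda>y. cmap c' y $ j)) x"
    by (rule dv_cong[OF charts(3) dv_wirtbar[OF charts(3) x0]]) (auto simp: wirt_coord)
  also have "\<dots> = wirt c0 k (wirtbar c0 i (\<lambda>y. cmap c' y $ j)) x"
    by (rule wirt_wirt_commute(2)[OF charts(3) x0 sm_coord])
  also have "\<dots> = wirt c0 k (\<lambda>y. 0) x"
    by (rule dv_cong[OF charts(3) dv_wirt[OF charts(3) x0]]) (auto simp: wirt_coord)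
  also have "\<dots> = 0" by (rule dv_simps(3)[OF charts(3) dv_wirt[OF charts(3) x0]])
  finally show "wirtbar c0 i (\<lambda>y. jacobian c c' y $ j $ k) x = 0" .
qed

lemma smop_pl_jacobian: "smop c0 (\<lambda>y. pl (jacobian c c' y))"
  by (rule smop_pl[OF charts(3) sm_jacobian])

text \<open>The closedness of the forms \<open>dz'\<^sub>j\<close> in the coordinates of \<open>c\<close>, expressed on the whole exterior algebra.\<close>

lemma sum_E_D_pl_jacobian:
  assumes x: "x \<in> cdom c" "x \<in> cdom c'"
  shows "(\<Sum>k\<in>UNIV. E k * Dop (\<lambda>f. wirt c0 k f x) (\<lambda>y. pl (jacobian c c' y))) = 0"
proof -
  have x0: "x \<in> cdom c0" using x by (simp add: rchart_def)
  note D = dv_wirt[OF charts(3) x0]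
  let ?J = "jacobian c c'" and ?D = "\<lambda>k f. wirt c0 k f x"
  let ?P = "\<lambda>k. Dop (?D k) (\<lambda>y. pl (?J y))"
  define R where "R = (\<Sum>k\<in>UNIV. E k * ?P k)"
  have rE: "smop c0 (\<lambda>y. rowE (?J y) j)" "smop c0 (\<lambda>y. rowEb (?J y) j)" for j
    unfolding rowE_def rowEb_def
    by (intro smop_sum[OF charts(3)] smop_mult[OF charts(3)] smop_const[OF charts(3)] smop_simps(4)[OF charts(3)]
      sm_jacobian sm_cnj[OF charts(3)])+
  have PE: "?P k * E j = Dop (?D k) (\<lambda>y. rowE (?J y) j) * pl (?J x) + rowE (?J x) j * ?P k" for k j
  proof -
    have "?P k * E j = Dop (?D k) (\<lambda>y. pl (?J y) * E j)"
      using Dop_simps(3)[OF charts(3) D smop_pl_jacobian smop_const[OF charts(3)], of k "E j"]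
      by (simp add: Dop_simps(4)[OF charts(3) D])
    also have "\<dots> = Dop (?D k) (\<lambda>y. rowE (?J y) j * pl (?J y))" by (simp only: pl_E)
    finally show ?thesis by (simp only: Dop_simps(3)[OF charts(3) D rE(1) smop_pl_jacobian])
  qed
  have PEb: "?P k * Eb j = Dop (?D k) (\<lambda>y. rowEb (?J y) j) * pl (?J x) + rowEb (?J x) j * ?P k" for k j
  proof -
    have "?P k * Eb j = Dop (?D k) (\<lambda>y. pl (?J y) * Eb j)"
      using Dop_simps(3)[OF charts(3) D smop_pl_jacobian smop_const[OF charts(3)], of k "Eb j"]
      by (simp add: Dop_simps(4)[OF charts(3) D])
    also have "\<dots> = Dop (?D k) (\<lambda>y. rowEb (?J y) j * pl (?J y))" by (simp only: pl_Eb)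
    finally show ?thesis by (simp only: Dop_simps(3)[OF charts(3) D rE(2) smop_pl_jacobian])
  qed
  have DrE: "Dop (?D k) (\<lambda>y. rowE (?J y) j) = (\<Sum>l\<in>UNIV. sc (?D k (\<lambda>y. ?J y $ j $ l)) * E l)" for k j
    unfolding rowE_def
    by (simp add: Dop_sum[OF charts(3) D] smop_mult smop_simps smop_const sm_jacobian charts(3)
        Dop_simps[OF charts(3) D])
  have DrEb: "Dop (?D k) (\<lambda>y. rowEb (?J y) j) = 0" for k j
    unfolding rowEb_def
    by (simp add: Dop_sum[OF charts(3) D] smop_mult smop_simps smop_const sm_jacobian sm_cnj charts(3)
        Dop_simps[OF charts(3) D] wirt_cnj[OF charts(3) x0 sm_jacobian] wirt_jacobian(2)[OF x])
  have "R = 0"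
  proof (rule lop_eq_0I)
    have "ap (?P k) oneE = 0" for k
    proof -
      have "DE (?D k) (\<lambda>y. ap (pl (?J y)) oneE) = ap (?P k) oneE + ap (pl (?J x)) (DE (?D k) (\<lambda>y. oneE))"
        by (rule DE_ap[OF charts(3) D smop_pl_jacobian smE_simps(5)[OF charts(3)]])
      then show ?thesis by (simp add: DE_simps(5)[OF charts(3) D] pull_linear)
    qed
    then show "ap R oneE = 0" by (simp add: R_def ap_sum_left)
  next
    fix j \<alpha> assume R0: "ap R \<alpha> = 0"
    \<comment> \<open>The second derivatives of a coordinate are symmetric in \<open>k\<close> and
      \<open>l\<close>, the products \<open>E k * E l\<close> antisymmetric.\<close>
    have sym: "(\<Sum>k\<in>UNIV. \<Sum>l\<in>UNIV. sc (?D k (\<lambda>y. ?J y $ j $ l)) * (E k * E l)) = 0" (is "?S = 0")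
    proof -
      have "?S = (\<Sum>k\<in>UNIV. \<Sum>l\<in>UNIV. - (sc (?D l (\<lambda>y. ?J y $ j $ k)) * (E l * E k)))"
      proof (rule sum.cong[OF refl], rule sum.cong[OF refl])
        fix k l
        show "sc (?D k (\<lambda>y. ?J y $ j $ l)) * (E k * E l) = - (sc (?D l (\<lambda>y. ?J y $ j $ k)) * (E l * E k))"
          by (simp add: wirt_jacobian(1)[OF x, of k j l] E_E[of k l])
      qed
      also have "\<dots> = - ?S" unfolding sum_negf by (subst sum.swap) (rule refl)
      finally have "?S + ?S = 0" by (simp add: eq_neg_iff_add_eq_0)
      then show ?thesis by (rule lop_double_eq_0)
    qed
    have "R * E j = ?S * pl (?J x) + (\<Sum>k\<in>UNIV. E k * rowE (?J x) j * ?P k)"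
      by (simp add: R_def sum_distrib_right mult.assoc PE DrE distrib_left sum.distrib sum_distrib_left sc_norm)
    also have "\<dots> = - (rowE (?J x) j * R)"
    proof -
      have "E k * rowE (?J x) j = - (rowE (?J x) j * E k)" for k
        using E_E[of k] by (simp add: rowE_def sum_distrib_left sum_distrib_right sc_norm mult.assoc sum_negf)
      then show ?thesis by (simp add: sym R_def sum_distrib_left sum_negf mult.assoc)
    qed
    finally have "ap (R * E j) \<alpha> = ap (- (rowE (?J x) j * R)) \<alpha>" by simp
    then show "ap R (ap (E j) \<alpha>) = 0" by (simp only: ap_simps R0 ap_0 minus_zero)
  next
    fix j \<alpha> assume R0: "ap R \<alpha> = 0"
    have "R * Eb j = (\<Sum>k\<in>UNIV. E k * rowEb (?J x) j * ?P k)"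
      by (simp add: R_def sum_distrib_right mult.assoc PEb DrEb)
    also have "\<dots> = - (rowEb (?J x) j * R)"
    proof -
      have "E k * rowEb (?J x) j = - (rowEb (?J x) j * E k)" for k
        using Eb_E[of _ k] by (simp add: rowEb_def sum_distrib_left sum_distrib_right sc_norm mult.assoc sum_negf)
      then show ?thesis by (simp add: R_def sum_distrib_left sum_negf mult.assoc)
    qed
    finally have "ap (R * Eb j) \<alpha> = ap (- (rowEb (?J x) j * R)) \<alpha>" by simp
    then show "ap R (ap (Eb j) \<alpha>) = 0" by (simp only: ap_simps R0 ap_0 minus_zero)
  qed
  then show ?thesis by (simp add: R_def)
qed

text \<open>The chain rule for a coordinate of \<open>c\<close>, computed by way of
  \<open>c'\<close>. Such a coordinate is smooth in terms of \<open>c'\<close> only on the overlap,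
  so \<open>pd_chain\<close> does not apply and the restricted chart takes its place.\<close>

lemma jacobian_inverse:
  assumes x: "x \<in> cdom c" "x \<in> cdom c'"
  shows "jacobian c' c x ** jacobian c c' x = mI"
proof (rule matrix_eqI)
  fix i j
  have smc: "sm c (\<lambda>y. cmap c y $ i)"
    unfolding sm_def by (rule smooth_on_cong[OF open_cimg[OF charts(1)] _ smooth_on_bounded_linear[OF open_cimg[OF charts(1)] bounded_linear_vec_nth]])
      (simp add: charts)
  have 1: "pd c v (\<lambda>y. cmap c y $ i) x = v $ i" for v
  proof (rule pd_eqI[OF charts(1) x(1)])
    have "((\<lambda>z. z $ i) has_derivative (\<lambda>v. v $ i)) (at (cmap c x))"
      by (rule bounded_linear_imp_has_derivative[OF bounded_linear_vec_nth])
    then show "((\<lambda>y. cmap c y $ i) \<circ> cinv c has_derivative (\<lambda>v. v $ i)) (at (cmap c x))"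
      by (rule has_derivative_transform_within_open[OF _ open_cimg[OF charts(1)] cmap_in[OF charts(1) x(1)]])
        (simp add: charts)
  qed
  have sm': "sm (rchart c' (cdom c)) (\<lambda>y. cmap c y $ i)"
    by (rule atlas.sm_coord[OF atlas_axioms c' c])
  have "(jacobian c' c x *v (jacobian c c' x *v axis j 1)) $ i = axis j 1 $ i"
  proof -
    have "pd c (axis j 1) (\<lambda>y. cmap c y $ i) x = pd (rchart c' (cdom c)) (jacobian c c' x *v axis j 1) (\<lambda>y. cmap c y $ i) x"
    proof -
      have z: "cmap c x \<in> cmap c ` (cdom c \<inter> cdom c')" using x by blast
      have d1: "(cmap c' \<circ> cinv c has_derivative (\<lambda>v. jacobian c c' x *v v)) (at (cmap c x))"
        using smooth_on_has_derivative[OF trans_smooth z] fd_trans[OF x] by simp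
      let ?r = "rchart c' (cdom c)"
      have r: "chart ?r" by (rule chart_rchart[OF charts(2) open_cdom[OF charts(1)]])
      have "(cmap c' \<circ> cinv c) (cmap c x) = cmap ?r x" using x charts by (simp add: rchart_def)
      then have d2: "((\<lambda>y. cmap c y $ i) \<circ> cinv ?r has_derivative (\<lambda>\<xi>. pd ?r \<xi> (\<lambda>y. cmap c y $ i) x)) (at ((cmap c' \<circ> cinv c) (cmap c x)))"
        using sm_has_derivative[OF r _ sm', of x] x by (simp add: rchart_def)
      have "((\<lambda>z. ((\<lambda>y. cmap c y $ i) \<circ> cinv ?r) ((cmap c' \<circ> cinv c) z)) has_derivative (\<lambda>v. pd ?r (jacobian c c' x *v v) (\<lambda>y. cmap c y $ i) x)) (at (cmap c x))"
        by (rule has_derivative_compose[OF d1 d2])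
      then have "((\<lambda>y. cmap c y $ i) \<circ> cinv c has_derivative (\<lambda>v. pd ?r (jacobian c c' x *v v) (\<lambda>y. cmap c y $ i) x)) (at (cmap c x))"
      proof (rule has_derivative_transform_within_open[OF _ open_overlap z])
        fix z assume "z \<in> cmap c ` (cdom c \<inter> cdom c')"
        then obtain y where y: "y \<in> cdom c" "y \<in> cdom c'" "z = cmap c y" by blast
        have "cinv ?r (cmap ?r y) = y" using y by (intro cinv_cmap[OF r]) (simp add: rchart_def)
        then show "((\<lambda>y. cmap c y $ i) \<circ> cinv ?r) ((cmap c' \<circ> cinv c) z) = ((\<lambda>y. cmap c y $ i) \<circ> cinv c) z"
          using y charts by (simp add: rchart_def)
      qed
      then show ?thesis by (rule pd_eqI[OF charts(1) x(1)])
    qed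
    then show ?thesis using atlas.pd_coord[OF atlas_axioms c' c x(2) x(1)] 1 by simp
  qed
  then show "(jacobian c' c x ** jacobian c c' x) $ i $ j = mI $ i $ j"
    by (simp add: matrix_vector_mul_assoc) (simp add: matrix_vector_mult_def axis_def Finite_Cartesian_Product.mat_def if_distrib cong: if_cong)
qed

end

end

section \<open>Smooth forms and tensorial operators\<close>

context atlas
begin

lemma sf_zero: "smooth_form A u \<Longrightarrow> \<not> (c \<in> A \<and> x \<in> cdom c) \<Longrightarrow> u c x = 0"
  and sf_smE: "smooth_form A u \<Longrightarrow> c \<in> A \<Longrightarrow> smE c (u c)"
  and sf_pull: "smooth_form A u \<Longrightarrow> c \<in> A \<Longrightarrow> c' \<in> A \<Longrightarrow> x \<in> cdom c \<Longrightarrow> x \<in> cdom c' \<Longrightarrow>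
     u c x = pull (jacobian c c' x) (u c' x)"
  unfolding smooth_form_def smE_def sm_def o_def by blast+

lemma smooth_formI:
  assumes "\<And>c x. \<not> (c \<in> A \<and> x \<in> cdom c) \<Longrightarrow> u c x = 0" "\<And>c. c \<in> A \<Longrightarrow> smE c (u c)"
    "\<And>c c' x. c \<in> A \<Longrightarrow> c' \<in> A \<Longrightarrow> x \<in> cdom c \<Longrightarrow> x \<in> cdom c' \<Longrightarrow> u c x = pull (jacobian c c' x) (u c' x)"
  shows "smooth_form A u"
  using assms unfolding smooth_form_def smE_def sm_def o_def by blast

lemma smooth_form_eqI:
  assumes "smooth_form A u" "smooth_form A v" "\<And>c x. c \<in> A \<Longrightarrow> x \<in> cdom c \<Longrightarrow> u c x = v c x"
  shows "u = v"
proof (rule ext, rule ext)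
  fix c x show "u c x = v c x"
    using assms sf_zero[of u c x] sf_zero[of v c x] by (cases "c \<in> A \<and> x \<in> cdom c") auto
qed

lemma smooth_form_add: "smooth_form A u \<Longrightarrow> smooth_form A v \<Longrightarrow> smooth_form A (u + v)"
proof (rule smooth_formI)
  assume u: "smooth_form A u" and v: "smooth_form A v"
  show "(u + v) c x = 0" if "\<not> (c \<in> A \<and> x \<in> cdom c)" for c x
    using sf_zero[OF u that] sf_zero[OF v that] by simp
  show "smE c ((u + v) c)" if "c \<in> A" for c
    using smE_simps(1)[OF chartA[OF that] sf_smE[OF u that] sf_smE[OF v that]] by (simp add: smE_def)
  show "(u + v) c x = pull (jacobian c c' x) ((u + v) c' x)" if "c \<in> A" "c' \<in> A" "x \<in> cdom c" "x \<in> cdom c'" for c c' x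
    using sf_pull[OF u that] sf_pull[OF v that] by (simp add: pull_linear)
qed

lemma fscale_apply: "fscale f u c x = scl (f x) (u c x)"
  by (simp add: fscale_def scl_def)

lemma smooth_form_fscale:
  assumes "smooth_form A u" "\<And>c. c \<in> A \<Longrightarrow> sm c f"
  shows "smooth_form A (fscale f u)"
proof (rule smooth_formI)
  show "c \<in> A \<Longrightarrow> smE c (fscale f u c)" for c
    using smE_simps(4)[OF chartA assms(2) sf_smE[OF assms(1)]] by (simp add: fscale_apply[abs_def])
  show "fscale f u c x = pull (jacobian c c' x) (fscale f u c' x)" if "c \<in> A" "c' \<in> A" "x \<in> cdom c" "x \<in> cdom c'" for c c' x
    using sf_pull[OF assms(1) that] by (simp add: fscale_apply pull_linear)
  show "fscale f u c x = 0" if "\<not> (c \<in> A \<and> x \<in> cdom c)" for c x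
    using sf_zero[OF assms(1) that] by (simp only: fscale_apply scl_simps)
qed

lemma smooth_form_fscale_const: "smooth_form A u \<Longrightarrow> smooth_form A (fscale (\<lambda>_. a) u)"
  by (rule smooth_form_fscale) (simp_all add: sm_const[OF chartA])

lemma smooth_form_minus: "smooth_form A u \<Longrightarrow> smooth_form A (- u)"
proof -
  assume "smooth_form A u"
  moreover have "fscale (\<lambda>_. -1) u = - u" by (simp add: fun_eq_iff fscale_def)
  ultimately show ?thesis using smooth_form_fscale_const[of u "-1"] by simp
qed

lemma smooth_form_diff: "smooth_form A u \<Longrightarrow> smooth_form A v \<Longrightarrow> smooth_form A (u - v)"
  using smooth_form_add[of u "- v"] smooth_form_minus[of v] by simp

lemma conj_form_apply: "conj_form u c x = cj (u c x)"
  by (simp add: conj_form_def cj_def)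

lemma conj_form_conj_form [simp]: "conj_form (conj_form u) = u"
  by (rule ext, rule ext) (simp only: conj_form_apply cj_simps)

lemma smooth_form_conj: "smooth_form A u \<Longrightarrow> smooth_form A (conj_form u)"
proof (rule smooth_formI)
  assume u: "smooth_form A u"
  show "c \<in> A \<Longrightarrow> smE c (conj_form u c)" for c
    using smE_cj[OF chartA sf_smE[OF u]] by (simp add: conj_form_apply[abs_def])
  show "conj_form u c x = pull (jacobian c c' x) (conj_form u c' x)" if "c \<in> A" "c' \<in> A" "x \<in> cdom c" "x \<in> cdom c'" for c c' x
    using sf_pull[OF u that] by (simp only: conj_form_apply cj_pull)
  show "conj_form u c x = 0" if "\<not> (c \<in> A \<and> x \<in> cdom c)" for c x
    using sf_zero[OF u that] by (simp only: conj_form_apply cj_simps)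
qed

lemma del_apply: "x \<in> cdom c \<Longrightarrow> del u c x = (\<Sum>k\<in>UNIV. ap (E k) (DE (\<lambda>f. wirt c k f x) (u c)))"
  by (simp add: del_def DE_def wd_dz[symmetric])

lemma delbar_apply: "x \<in> cdom c \<Longrightarrow> delbar u c x = (\<Sum>k\<in>UNIV. ap (Eb k) (DE (\<lambda>f. wirtbar c k f x) (u c)))"
  by (simp add: delbar_def DE_def wd_dzbar[symmetric])

lemma DE_wirt_0: "DE (\<lambda>f. wirt c k f x) (\<lambda>_. 0) = 0" "DE (\<lambda>f. wirtbar c k f x) (\<lambda>_. 0) = 0"
  by (simp_all add: DE_def wirt_def wirtbar_def o_def frechet_derivative_const fun_eq_iff)

lemma del_outside:
  assumes "smooth_form A u" "\<not> (c \<in> A \<and> x \<in> cdom c)"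
  shows "del u c x = 0" "delbar u c x = 0"
proof -
  have "del u c x = 0 \<and> delbar u c x = 0"
  proof (cases "x \<in> cdom c")
    case True
    then have "u c = (\<lambda>_. 0)" using assms sf_zero[OF assms(1), of c] by auto
    then show ?thesis using True by (simp only: del_apply delbar_apply DE_wirt_0 ap_0 sum.neutral_const simp_thms)
  qed (simp add: del_def delbar_def)
  then show "del u c x = 0" "delbar u c x = 0" by auto
qed

text \<open>Differentiating the transformation rule of \<open>u\<close> gives two terms. The
  derivative of the pull-back is removed by \<open>sum_E_D_pl_jacobian\<close>; in the other term
  \<open>wirt_chain\<close> produces the rows of the Jacobian, and \<open>pl_E\<close> moves the
  pull-back to the front.\<close>

lemma del_natural:
  assumes u: "smooth_form A u" and c: "c \<in> A" "c' \<in> A" and x: "x \<in> cdom c" "x \<in> cdom c'"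
  shows "del u c x = pull (jacobian c c' x) (del u c' x)"
proof -
  let ?c0 = "rchart c (cdom c')" and ?J = "jacobian c c'"
  note ch = charts[OF c]
  have x0: "x \<in> cdom ?c0" using x by simp
  have sm0: "smE ?c0 (u c')" using sf_smE[OF u c(2)] sm_overlap[OF c] by (simp add: smE_def)
  have "DE (\<lambda>f. wirt c k f x) (u c) = ap (Dop (\<lambda>f. wirt ?c0 k f x) (\<lambda>y. pl (?J y))) (u c' x)
     + ap (pl (?J x)) (\<Sum>j\<in>UNIV. scl (?J x $ j $ k) (DE (\<lambda>f. wirt c' j f x) (u c')))" for k
  proof -
    have "DE (\<lambda>f. wirt c k f x) (u c) = DE (\<lambda>f. wirt ?c0 k f x) (u c)"
      by (simp add: wirt_rchart[OF ch(1) open_cdom[OF ch(2)] x])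
    also have "\<dots> = DE (\<lambda>f. wirt ?c0 k f x) (\<lambda>y. ap (pl (?J y)) (u c' y))"
      by (rule DE_cong[OF ch(3) dv_wirt[OF ch(3) x0]]) (auto intro: sf_pull[OF u c])
    also have "\<dots> = ap (Dop (\<lambda>f. wirt ?c0 k f x) (\<lambda>y. pl (?J y))) (u c' x) + ap (pl (?J x)) (DE (\<lambda>f. wirt ?c0 k f x) (u c'))"
      by (rule DE_ap[OF ch(3) dv_wirt[OF ch(3) x0] smop_pl_jacobian[OF c] sm0])
    also have "DE (\<lambda>f. wirt ?c0 k f x) (u c') = (\<Sum>j\<in>UNIV. scl (?J x $ j $ k) (DE (\<lambda>f. wirt c' j f x) (u c')))"
      using sf_smE[OF u c(2)]
      by (intro ext) (simp add: DE_def wirt_rchart[OF ch(1) open_cdom[OF ch(2)] x] sum_fun_apply wirt_chain(1)[OF c x] smE_def)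
    finally show ?thesis .
  qed
  then have "del u c x = ap (\<Sum>k\<in>UNIV. E k * Dop (\<lambda>f. wirt ?c0 k f x) (\<lambda>y. pl (?J y))) (u c' x)
    + (\<Sum>k\<in>UNIV. \<Sum>j\<in>UNIV. ap (sc (?J x $ j $ k) * E k * pl (?J x)) (DE (\<lambda>f. wirt c' j f x) (u c')))"
    by (simp add: del_apply[OF x(1)] ap_add ap_sum ap_scl ap_sum_left sum.distrib pull_sum pull_linear)
  also have "\<dots> = (\<Sum>j\<in>UNIV. \<Sum>k\<in>UNIV. ap (sc (?J x $ j $ k) * E k * pl (?J x)) (DE (\<lambda>f. wirt c' j f x) (u c')))"
    unfolding sum_E_D_pl_jacobian[OF c x] by (subst sum.swap) simp
  also have "\<dots> = (\<Sum>j\<in>UNIV. ap (rowE (?J x) j * pl (?J x)) (DE (\<lambda>f. wirt c' j f x) (u c')))"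
    by (simp only: rowE_def sum_distrib_right ap_sum_left)
  also have "\<dots> = ap (pl (?J x)) (del u c' x)"
    by (simp only: pl_E[symmetric] del_apply[OF x(2)] ap_sum ap_simps(6))
  finally show ?thesis by simp
qed

lemma smooth_form_del: "smooth_form A u \<Longrightarrow> smooth_form A (del u)"
proof (rule smooth_formI)
  assume u: "smooth_form A u"
  fix c assume c: "c \<in> A"
  have "smE c (\<lambda>x. \<Sum>k\<in>UNIV. ap (E k) (DE (\<lambda>f. wirt c k f x) (u c)))"
    by (intro smE_sum smE_ap smop_const smE_wirt chartA c sf_smE u)
  then show "smE c (del u c)" by (rule smE_cong[OF chartA[OF c], rotated]) (simp add: del_apply)
next
  assume u: "smooth_form A u"
  show "del u c x = 0" if "\<not> (c \<in> A \<and> x \<in> cdom c)" for c x by (rule del_outside[OF u that])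
  show "del u c x = pull (jacobian c c' x) (del u c' x)" if "c \<in> A" "c' \<in> A" "x \<in> cdom c" "x \<in> cdom c'" for c c' x
    by (rule del_natural[OF u that])
qed

lemma cj_DE:
  fixes c :: "('a, 'n) chart"
  assumes c: "chart c" and D: "dv c x D" and U: "smE c U"
  shows "cj (DE D (\<lambda>y. cj (U y))) = DE (\<lambda>f. cnj (D (\<lambda>y. cnj (f y)))) U"
proof (intro ext)
  fix I J
  have "D (\<lambda>y. (-1) ^ (card J * card I) * cnj (U y I J)) = (-1) ^ (card J * card I) * D (\<lambda>y. cnj (U y I J))"
    using dv_simps(2)[OF c D sm_const[OF c] sm_cnj[OF c], of "\<lambda>y. U y I J"] U dv_simps(3)[OF c D] by (simp add: smE_def)
  then show "cj (DE D (\<lambda>y. cj (U y))) I J = DE (\<lambda>f. cnj (D (\<lambda>y. cnj (f y)))) U I J"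
    by (simp add: cj_def DE_def mult.commute[of "card J"])
qed

text \<open>Conjugation exchanges \<open>wirt\<close> with \<open>wirtbar\<close> and
  \<open>E\<close> with \<open>Eb\<close>. Through this lemma \<open>delbar\<close> inherits
  smoothness and the compatibility with changes of charts from \<open>del\<close>.\<close>

lemma conj_del:
  assumes u: "smooth_form A u"
  shows "delbar u = conj_form (del (conj_form u))"
proof (rule ext, rule ext)
  fix c x
  show "delbar u c x = conj_form (del (conj_form u)) c x"
  proof (cases "c \<in> A \<and> x \<in> cdom c")
    case True
    then have c: "chart c" and x: "x \<in> cdom c" and U: "smE c (u c)" using chartA sf_smE[OF u] by auto
    have "cj (DE (\<lambda>f. wirt c k f x) (\<lambda>y. cj (u c y))) = DE (\<lambda>f. wirtbar c k f x) (u c)" for k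
    proof -
      have "DE (\<lambda>f. cnj (wirt c k (\<lambda>y. cnj (f y)) x)) (u c) = DE (\<lambda>f. wirtbar c k f x) (u c)"
        using U by (simp add: DE_def fun_eq_iff wirt_cnj[OF c x] smE_def)
      then show ?thesis using cj_DE[OF c dv_wirt[OF c x] U] by simp
    qed
    then show ?thesis
      by (simp add: conj_form_apply del_apply[OF x] delbar_apply[OF x] cj_sum cj_E conj_form_apply[abs_def])
  next
    case False
    show ?thesis using del_outside(2)[OF u False] del_outside(1)[OF smooth_form_conj[OF u] False]
      by (simp only: conj_form_apply cj_simps)
  qed
qed

lemma smooth_form_delbar: "smooth_form A u \<Longrightarrow> smooth_form A (delbar u)"
  by (simp add: conj_del smooth_form_conj smooth_form_del)

lemma smooth_form_ext_d: "smooth_form A u \<Longrightarrow> smooth_form A (ext_d u)"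
  by (simp add: ext_d_def smooth_form_add smooth_form_del smooth_form_delbar)

subsection \<open>Tensorial operators\<close>

text \<open>A smooth field of endomorphisms that commutes with changes of coordinates, so that
  \<open>opf\<close> maps smooth forms to smooth forms.\<close>

definition tensor :: "(('a, 'n) chart \<Rightarrow> 'a \<Rightarrow> 'n lop) \<Rightarrow> bool" where
  "tensor p \<longleftrightarrow> (\<forall>c\<in>A. smop c (p c)) \<and>
     (\<forall>c\<in>A. \<forall>c'\<in>A. \<forall>x\<in>cdom c \<inter> cdom c'. p c x * pl (jacobian c c' x) = pl (jacobian c c' x) * p c' x)"

definition opf :: "(('a, 'n) chart \<Rightarrow> 'a \<Rightarrow> 'n lop) \<Rightarrow> ('a, 'n) form \<Rightarrow> ('a, 'n) form" where
  "opf p u = (\<lambda>c x. if c \<in> A \<and> x \<in> cdom c then ap (p c x) (u c x) else 0)"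

lemma opf_apply [simp]: "c \<in> A \<Longrightarrow> x \<in> cdom c \<Longrightarrow> opf p u c x = ap (p c x) (u c x)"
  by (simp add: opf_def)

lemma smooth_form_opf:
  assumes p: "tensor p" and u: "smooth_form A u"
  shows "smooth_form A (opf p u)"
proof (rule smooth_formI)
  fix c assume c: "c \<in> A"
  have "smE c (\<lambda>x. ap (p c x) (u c x))"
    using p c by (intro smE_ap chartA sf_smE[OF u]) (auto simp: tensor_def)
  then show "smE c (opf p u c)" by (rule smE_cong[OF chartA[OF c], rotated]) (simp add: c)
next
  fix c c' x assume c: "c \<in> A" "c' \<in> A" and x: "x \<in> cdom c" "x \<in> cdom c'"
  have "ap (p c x * pl (jacobian c c' x)) (u c' x) = ap (pl (jacobian c c' x) * p c' x) (u c' x)"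
    using p c x unfolding tensor_def by auto
  then show "opf p u c x = pull (jacobian c c' x) (opf p u c' x)"
    using c x sf_pull[OF u c x] by simp
next
  show "opf p u c x = 0" if "\<not> (c \<in> A \<and> x \<in> cdom c)" for c x
    unfolding opf_def by (rule if_not_P[OF that])
qed

lemma tensor_simps:
  "tensor p \<Longrightarrow> tensor q \<Longrightarrow> tensor (\<lambda>c x. p c x + q c x)"
  "tensor p \<Longrightarrow> tensor q \<Longrightarrow> tensor (\<lambda>c x. p c x - q c x)"
  "tensor p \<Longrightarrow> tensor (\<lambda>c x. - p c x)"
  unfolding tensor_def by (simp_all add: smop_simps[OF chartA] algebra_simps)

lemma tensor_mult: "tensor p \<Longrightarrow> tensor q \<Longrightarrow> tensor (\<lambda>c x. p c x * q c x)"
  unfolding tensor_def by (simp add: smop_mult[OF chartA] mult.assoc) (simp add: mult.assoc[symmetric])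

lemma tensor_wd: "smooth_form A u \<Longrightarrow> tensor (\<lambda>c x. wd (u c x))"
  unfolding tensor_def
proof (intro conjI ballI)
  assume u: "smooth_form A u"
  show "c \<in> A \<Longrightarrow> smop c (\<lambda>x. wd (u c x))" for c using smop_wd[OF chartA sf_smE[OF u]] by simp
  fix c c' x assume c: "c \<in> A" "c' \<in> A" and x: "x \<in> cdom c \<inter> cdom c'"
  show "wd (u c x) * pl (jacobian c c' x) = pl (jacobian c c' x) * wd (u c' x)"
    by (rule lop_eqI) (use x sf_pull[OF u c] in \<open>simp add: pull_wedge\<close>)
qed

lemma opf_wd: "smooth_form A u \<Longrightarrow> smooth_form A \<alpha> \<Longrightarrow> \<alpha> \<and>\<and> u = opf (\<lambda>c x. wd (\<alpha> c x)) u"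
proof (rule ext, rule ext)
  assume u: "smooth_form A u"
  fix c x
  have 1: "(\<alpha> \<and>\<and> u) c x = wedge (\<alpha> c x) (u c x)" by (simp add: fwedge_def)
  show "(\<alpha> \<and>\<and> u) c x = opf (\<lambda>c x. wd (\<alpha> c x)) u c x"
  proof (cases "c \<in> A \<and> x \<in> cdom c")
    case False
    have "wedge (\<alpha> c x) (u c x) = 0"
      using ap_0[of "wd (\<alpha> c x)"] by (simp only: sf_zero[OF u False] ap_wd)
    then show ?thesis unfolding 1 opf_def if_not_P[OF False] .
  qed (simp add: 1)
qed

lemma smooth_form_wedge: "smooth_form A u \<Longrightarrow> smooth_form A \<alpha> \<Longrightarrow> smooth_form A (\<alpha> \<and>\<and> u)"
  by (simp add: opf_wd smooth_form_opf tensor_wd)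

end

section \<open>Metrics, determinants and adjoints under changes of coordinates\<close>

lemma ap_E_Eb_oneE: "ap (E a) (ap (Eb b) oneE) = bas {a} {b}"
  by (simp add: bas_empty[symmetric] Eb_bas' E_bas' sg_def scl_simps)

lemma adjm_1: "adjm mI = mI"
  by (simp add: adjm_def Finite_Cartesian_Product.mat_def vec_eq_iff)

text \<open>The congruence rule for a sesquilinear form, phrased for the transpose because
  \<open>gram\<close> inverts the transpose.\<close>

lemma herm_mat_pull:
  fixes w :: "'n::{finite, linorder} ext"
  assumes "\<And>I J. w I J \<noteq> 0 \<Longrightarrow> card I = 1 \<and> card J = 1"
  shows "mT (herm_mat (pull B w)) = adjm B ** (mT (herm_mat w) ** B)"
proof -
  have rr: "pull B (ap (E j) (ap (Eb k) oneE)) = ap (rowE B j) (ap (rowEb B k) oneE)" for j k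
    using arg_cong[OF pl_E[of B j], of "\<lambda>p. ap p (ap (Eb k) oneE)"] arg_cong[OF pl_Eb[of B k], of "\<lambda>p. ap p oneE"] by simp
  have coeff: "ap (rowE B j) (ap (rowEb B k) oneE) {a} {b} = B $ j $ a * cnj (B $ k $ b)" for j k a b
  proof -
    have "ap (rowE B j) (ap (rowEb B k) oneE) = (\<Sum>a\<in>UNIV. \<Sum>b\<in>UNIV. scl (B $ j $ a * cnj (B $ k $ b)) (bas {a} {b}))"
      by (simp add: rowE_def rowEb_def ap_sum_left ap_sum ap_scl ap_E_Eb_oneE scl_sum scl_simps)
        (subst sum.swap, simp add: mult.commute)
    then have "ap (rowE B j) (ap (rowEb B k) oneE) {a} {b} =
       (\<Sum>a\<in>UNIV. \<Sum>b\<in>UNIV. scl (B $ j $ a * cnj (B $ k $ b)) (bas {a} {b})) {a} {b}" by (simp only:)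
    also have "\<dots> =
      (\<Sum>a'\<in>UNIV. \<Sum>b'\<in>UNIV. if b' = b then (if a' = a then B $ j $ a * cnj (B $ k $ b) else 0) else 0)"
      unfolding sum_fun_apply by (rule sum.cong[OF refl], rule sum.cong[OF refl]) (auto simp: bas_def)
    finally show ?thesis by simp
  qed
  have "pull B w = (\<Sum>j\<in>UNIV. \<Sum>k\<in>UNIV. scl (w {j} {k}) (ap (rowE B j) (ap (rowEb B k) oneE)))"
    using arg_cong[OF type11_expand[OF assms], where f = "pull B"] by (simp only: pull_sum pull_linear rr)
  then have "pull B w {a} {b} = (\<Sum>j\<in>UNIV. \<Sum>k\<in>UNIV. w {j} {k} * (B $ j $ a * cnj (B $ k $ b)))" for a b
    by (simp only: sum_fun_apply scl_apply coeff)
  then have entry: "herm_mat (pull B w) $ a $ b = (\<Sum>j\<in>UNIV. \<Sum>k\<in>UNIV. herm_mat w $ j $ k * (B $ j $ a * cnj (B $ k $ b)))" for a b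
    by (simp add: herm_mat_def sum_distrib_left mult_ac)
  show ?thesis
  proof (rule matrix_eqI)
    fix b a
    have "(adjm B ** (mT (herm_mat w) ** B)) $ b $ a = (\<Sum>k\<in>UNIV. \<Sum>j\<in>UNIV. herm_mat w $ j $ k * (B $ j $ a * cnj (B $ k $ b)))"
      by (simp add: matrix_matrix_mult_def adjm_def Finite_Cartesian_Product.transpose_def sum_distrib_left mult_ac)
    also have "\<dots> = mT (herm_mat (pull B w)) $ b $ a"
      unfolding Finite_Cartesian_Product.transpose_def by (subst sum.swap) (simp add: entry)
    finally show "mT (herm_mat (pull B w)) $ b $ a = (adjm B ** (mT (herm_mat w) ** B)) $ b $ a" by simp
  qed
qed

lemma det_herm_mat_pull:
  fixes w :: "'n::{finite, linorder} ext"
  assumes "metric w"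
  shows "det (herm_mat (pull B w)) = of_real ((cmod (det B))\<^sup>2) * det (herm_mat w)"
proof -
  have "det (mT (herm_mat (pull B w))) = det (adjm B ** (mT (herm_mat w) ** B))"
    by (subst herm_mat_pull) (use assms in \<open>auto simp: metric_def\<close>)
  then show ?thesis unfolding complex_norm_square
    by (simp add: det_mul det_adjm Determinants.det_transpose mult_ac)
qed

text \<open>The Gram matrix transforms by the inverse congruence, with \<open>K\<close>, so
  sandwiching the new Gram operator between the pull-back and its reference adjoint gives back the
  old one. This makes \<open>inner_at\<close> independent of the chart.\<close>

lemma ext_inner_pull:
  fixes w :: "'n::{finite, linorder} ext"
  assumes w: "metric w" and K: "K ** B = mI"
  shows "ext_inner (pull B w) (pull B \<alpha>) (pull B \<beta>) = ext_inner w \<alpha> \<beta>"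
proof -
  have K': "B ** K = mI" using K by (simp only: matrix_left_right_inverse)
  have H: "mT (herm_mat (pull B w)) = adjm B ** (mT (herm_mat w) ** B)"
    by (rule herm_mat_pull) (use w in \<open>auto simp: metric_def\<close>)
  have "mT (herm_mat (pull B w)) ** (K ** gram w ** adjm K) = adjm B ** (mT (herm_mat w) ** (B ** K) ** gram w ** adjm K)"
    by (simp add: H matrix_mul_assoc)
  also have "\<dots> = adjm (K ** B)" by (simp add: K' gram_inv[OF w] adjm_mult)
  also have "\<dots> = mI" by (simp only: K adjm_1)
  finally have G: "gram (pull B w) = K ** gram w ** adjm K" unfolding gram_def[of "pull B w"] by (rule matrix_inv_eq)
  have "adjm K ** adjm B = mI"
    by (simp only: adjm_mult[symmetric] K' adjm_1)
  then have "B ** (K ** gram w ** adjm K) ** adjm B = gram w"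
    by (simp add: matrix_mul_assoc K') (simp add: matrix_mul_assoc[symmetric])
  then have "pl (adjm B) * (Mop (pull B w) * pl B) = Mop w"
    by (simp add: Mop_def pl_mult G)
  then show ?thesis
    by (simp only: ext_inner_eq ap_pl[symmetric] dag_pl[symmetric] ip_ap dag_dag flip: ap_simps(6))
       (metis ap_simps(6) ip_ap dag_dag)
qed

text \<open>An adjoint is characterised by the inner product, which the pull-back preserves; as
  \<open>B\<close> is invertible, every test vector is itself a pull-back.\<close>

lemma adj_pull:
  fixes w :: "'n::{finite, linorder} ext"
  assumes w: "metric w" "metric (pull B w)" and K: "K ** B = mI" and p: "p * pl B = pl B * p'"
  shows "adj (pull B w) p * pl B = pl B * adj w p'"
proof (rule lop_eqI)
  fix \<beta>
  have "ap (adj (pull B w) p) (pull B \<beta>) = pull B (ap (adj w p') \<beta>)"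
  proof (rule ext_inner_nondeg[OF w(2)])
    fix \<alpha>
    have K': "B ** K = mI" using K by (simp only: matrix_left_right_inverse)
    have \<alpha>: "\<alpha> = pull B (pull K \<alpha>)"
      using arg_cong[OF pl_1, of "\<lambda>p. ap p \<alpha>"] by (simp add: pull_pull K)
    have "ap p (pull B (pull K \<alpha>)) = pull B (ap p' (pull K \<alpha>))"
      using arg_cong[OF p, of "\<lambda>p. ap p (pull K \<alpha>)"] by simp
    then have "ext_inner (pull B w) (pull B (pull K \<alpha>)) (ap (adj (pull B w) p) (pull B \<beta>)) =
       ext_inner (pull B w) (pull B (pull K \<alpha>)) (pull B (ap (adj w p') \<beta>))"
      by (simp only: ext_inner_adj[OF w(2), symmetric] ext_inner_pull[OF w(1) K] ext_inner_adj[OF w(1)])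
    then show "ext_inner (pull B w) \<alpha> (ap (adj (pull B w) p) (pull B \<beta>)) = ext_inner (pull B w) \<alpha> (pull B (ap (adj w p') \<beta>))"
      by (simp only: \<alpha>[symmetric])
  qed
  then show "ap (adj (pull B w) p * pl B) \<beta> = ap (pl B * adj w p') \<beta>" by simp
qed

lemma sm_det:
  fixes c :: "('a::topological_space, 'n::{finite, linorder}) chart" and B :: "'a \<Rightarrow> complex^'m::finite^'m::finite"
  shows "chart c \<Longrightarrow> (\<And>i j. sm c (\<lambda>y. B y $ i $ j)) \<Longrightarrow> sm c (\<lambda>y. det (B y))"
  unfolding Determinants.det_def by (intro sm_sum sm_mult sm_prod sm_const)

locale hermitian = atlas A for A :: "('a::{t2_space, second_countable_topology}, 'n::{finite, linorder}) chart set" +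
  fixes \<omega> :: "('a, 'n) form"
  assumes \<omega>: "hermitian_metric A \<omega>"
begin

lemma smooth_\<omega>: "smooth_form A \<omega>"
  using \<omega> by (simp add: hermitian_metric_def)

lemma metric_\<omega>: "c \<in> A \<Longrightarrow> x \<in> cdom c \<Longrightarrow> metric (\<omega> c x)"
  using \<omega> unfolding hermitian_metric_def metric_def of_type_def hform_def Let_def by blast

lemma pull_\<omega>: "c \<in> A \<Longrightarrow> c' \<in> A \<Longrightarrow> x \<in> cdom c \<Longrightarrow> x \<in> cdom c' \<Longrightarrow> \<omega> c x = pull (jacobian c c' x) (\<omega> c' x)"
  by (rule sf_pull[OF smooth_\<omega>])

lemma sm_herm: "c \<in> A \<Longrightarrow> sm c (\<lambda>y. herm_mat (\<omega> c y) $ j $ k)"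
  using sf_smE[OF smooth_\<omega>, of c] by (simp add: herm_mat_def smE_def sm_mult sm_minus chartA)

text \<open>Cramer's rule presents the entries of the inverse matrix as quotients of determinants
  with a denominator that never vanishes.\<close>

lemma sm_gram:
  assumes c: "c \<in> A"
  shows "sm c (\<lambda>y. gram (\<omega> c y) $ k $ l)"
proof -
  let ?A = "\<lambda>y. mT (herm_mat (\<omega> c y))"
  let ?B = "\<lambda>y. (\<chi> i j. if j = k then axis l 1 $ i else ?A y $ i $ j) :: 'n cmat"
  have A: "sm c (\<lambda>y. ?A y $ i $ j)" for i j
    using sm_herm[OF c] by (simp add: Finite_Cartesian_Product.transpose_def)
  have B: "sm c (\<lambda>y. ?B y $ i $ j)" for i j
    using A by (cases "j = k") (simp_all add: sm_const[OF chartA[OF c]])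
  have det0: "det (?A y) \<noteq> 0" if "y \<in> cdom c" for y
    using det_herm[OF metric_\<omega>[OF c that]] by (auto simp: Determinants.det_transpose)
  have "sm c (\<lambda>y. det (?B y) * inverse (det (?A y)))"
    by (intro sm_mult sm_inverse sm_det A B chartA c det0)
  then show ?thesis
  proof (rule sm_cong[OF chartA[OF c], rotated])
    fix y assume y: "y \<in> cdom c"
    let ?x = "\<chi> i. gram (\<omega> c y) $ i $ l"
    have "?A y *v ?x = axis l 1"
    proof (rule vector_eqI)
      fix i
      have "(?A y *v ?x) $ i = (?A y ** gram (\<omega> c y)) $ i $ l"
        by (simp add: matrix_vector_mult_def matrix_matrix_mult_def)
      then show "(?A y *v ?x) $ i = axis l 1 $ i"
        by (simp add: gram_inv[OF metric_\<omega>[OF c y]] Finite_Cartesian_Product.mat_def axis_def)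
    qed
    then have "?x = (\<chi> k. det (\<chi> i j. if j = k then axis l 1 $ i else ?A y $ i $ j) / det (?A y))"
      using cramer[OF det0[OF y]] by blast
    then have "?x $ k = (\<chi> k. det (\<chi> i j. if j = k then axis l 1 $ i else ?A y $ i $ j) / det (?A y)) $ k"
      by (rule arg_cong)
    then show "det (?B y) * inverse (det (?A y)) = gram (\<omega> c y) $ k $ l"
      by (simp add: divide_inverse)
  qed
qed

lemma tensor_adj:
  assumes p: "tensor p"
  shows "tensor (\<lambda>c x. adj (\<omega> c x) (p c x))"
  unfolding tensor_def
proof (intro conjI ballI)
  fix c assume c: "c \<in> A"
  have "sm c (\<lambda>y. mT (herm_mat (\<omega> c y)) $ i $ j)" for i j
    using sm_herm[OF c] by (simp add: Finite_Cartesian_Product.transpose_def)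
  then show "smop c (\<lambda>x. adj (\<omega> c x) (p c x))"
    unfolding adj_def Mop_def using p c
    by (intro smop_mult smop_pl smop_dag chartA sm_gram) (auto simp: tensor_def)
next
  fix c c' x assume c: "c \<in> A" "c' \<in> A" and x: "x \<in> cdom c \<inter> cdom c'"
  then have x: "x \<in> cdom c" "x \<in> cdom c'" by auto
  have "adj (pull (jacobian c c' x) (\<omega> c' x)) (p c x) * pl (jacobian c c' x) = pl (jacobian c c' x) * adj (\<omega> c' x) (p c' x)"
  proof (rule adj_pull[where K = "jacobian c' c x"])
    show "metric (pull (jacobian c c' x) (\<omega> c' x))" using metric_\<omega>[OF c(1) x(1)] pull_\<omega>[OF c x] by simp
    show "p c x * pl (jacobian c c' x) = pl (jacobian c c' x) * p c' x" using p c x by (auto simp: tensor_def)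
  qed (use metric_\<omega> c x jacobian_inverse in auto)
  then show "adj (\<omega> c x) (p c x) * pl (jacobian c c' x) = pl (jacobian c c' x) * adj (\<omega> c' x) (p c' x)"
    using pull_\<omega>[OF c x] by simp
qed

lemma inner_at_eq:
  assumes u: "smooth_form A u" "smooth_form A v" and c: "c \<in> A" and x: "x \<in> cdom c"
  shows "inner_at A \<omega> x u v = ext_inner (\<omega> c x) (u c x) (v c x)"
proof -
  let ?c = "chart_at A x" and ?J = "jacobian c (chart_at A x) x"
  note c' = chart_at[of x]
  have "ext_inner (\<omega> c x) (u c x) (v c x) = ext_inner (pull ?J (\<omega> ?c x)) (pull ?J (u ?c x)) (pull ?J (v ?c x))"
    using pull_\<omega>[OF c c'(1) x c'(2)] sf_pull[OF u(1) c c'(1) x c'(2)] sf_pull[OF u(2) c c'(1) x c'(2)] by simp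
  also have "\<dots> = ext_inner (\<omega> ?c x) (u ?c x) (v ?c x)"
    by (rule ext_inner_pull[OF metric_\<omega>[OF c'] jacobian_inverse[OF c c'(1) x c'(2)]])
  finally show ?thesis by (simp add: inner_at_def Let_def)
qed

text \<open>Makes the definite description explicit. For uniqueness a second candidate is tested
  against its difference from the first, whose norm then vanishes at every point.\<close>

lemma pointwise_adjoint_eq:
  assumes P: "\<And>u. smooth_form A u \<Longrightarrow> P u = opf p u" and p: "tensor p" and v: "smooth_form A v"
  shows "pointwise_adjoint A \<omega> P v = opf (\<lambda>c x. adj (\<omega> c x) (p c x)) v"
  unfolding pointwise_adjoint_def
proof (rule the_equality)
  let ?w = "opf (\<lambda>c x. adj (\<omega> c x) (p c x)) v"
  have w: "smooth_form A ?w" by (rule smooth_form_opf[OF tensor_adj[OF p] v])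
  have eq: "inner_at A \<omega> x (P u) v = inner_at A \<omega> x u ?w" if u: "smooth_form A u" for u x
  proof -
    obtain c where c: "c \<in> A" "x \<in> cdom c" using atlas_cover by blast
    have Pu: "smooth_form A (P u)" using P[OF u] smooth_form_opf[OF p u] by simp
    show ?thesis
      unfolding inner_at_eq[OF Pu v c] inner_at_eq[OF u w c]
      using c by (simp add: P[OF u] ext_inner_adj[OF metric_\<omega>[OF c]])
  qed
  then show "smooth_form A ?w \<and> (\<forall>u. smooth_form A u \<longrightarrow> (\<forall>x. inner_at A \<omega> x (P u) v = inner_at A \<omega> x u ?w))"
    using w by blast
  fix w' assume w': "smooth_form A w' \<and> (\<forall>u. smooth_form A u \<longrightarrow> (\<forall>x. inner_at A \<omega> x (P u) v = inner_at A \<omega> x u w'))"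
  show "w' = ?w"
  proof (rule smooth_form_eqI)
    fix c x assume c: "c \<in> A" "x \<in> cdom c"
    let ?d = "w' - ?w"
    have d: "smooth_form A ?d" using w' w smooth_form_diff by blast
    have sw': "smooth_form A w'" and "inner_at A \<omega> x (P ?d) v = inner_at A \<omega> x ?d w'" using w' d by blast+
    then have "inner_at A \<omega> x ?d w' = inner_at A \<omega> x ?d ?w" by (simp only: eq[OF d])
    then have "ext_inner (\<omega> c x) (?d c x) (w' c x) = ext_inner (\<omega> c x) (?d c x) (?w c x)"
      by (simp only: inner_at_eq[OF d sw' c] inner_at_eq[OF d w c])
    then have "ext_inner (\<omega> c x) (?d c x) (?d c x) = 0" by (simp add: ext_inner_simps)
    then have "?d c x = 0" using ext_inner_pos(1)[OF metric_\<omega>[OF c], of "?d c x"] by fastforce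
    then show "w' c x = ?w c x" by simp
  qed (use w w' in auto)
qed

end

section \<open>The variation of the metric and the commutation relations\<close>

context hermitian
begin

context
  fixes c :: "('a, 'n) chart"
  assumes cA: "c \<in> A"
begin

private abbreviation (input) "w \<equiv> \<omega> c"
private abbreviation (input) "dH y \<equiv> det (herm_mat (\<omega> c y))"

private lemma c: "chart c" by (rule chartA[OF cA])

private lemma mw: "y \<in> cdom c \<Longrightarrow> metric (w y)" by (rule metric_\<omega>[OF cA])

lemma smE_\<omega>: "smE c w" by (rule sf_smE[OF smooth_\<omega> cA])

lemma sm_dH: "sm c (\<lambda>y. dH y)"
  by (rule sm_det[OF c sm_herm[OF cA]])

lemma smop_Mop: "smop c (\<lambda>y. Mop (w y))"
  unfolding Mop_def by (rule smop_pl[OF c sm_gram[OF cA]])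

lemma smop_Lam: "smop c (\<lambda>y. Lam (w y))"
  using tensor_adj[OF tensor_wd[OF smooth_\<omega>]] cA unfolding tensor_def Lam_def by blast

lemma smop_Es: "smop c (\<lambda>y. Es (w y) j)" and smop_Ebs: "smop c (\<lambda>y. Ebs (w y) j)"
  unfolding Es_def Ebs_def
  by (intro smop_sum[OF c] smop_mult[OF c] smop_simps(4)[OF c] smop_const[OF c] sm_gram[OF cA])+

lemma sm_ip: "smE c U \<Longrightarrow> smE c V \<Longrightarrow> sm c (\<lambda>y. ip (U y) (V y))"
  unfolding ip_def smE_def by (intro sm_sum[OF c] sm_mult[OF c] sm_cnj[OF c]) auto

lemma sm_ext_inner: "smE c U \<Longrightarrow> smE c V \<Longrightarrow> sm c (\<lambda>y. ext_inner (w y) (U y) (V y))"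
  unfolding ext_inner_eq by (intro sm_ip smE_ap[OF c] smop_Mop)

context
  fixes x :: 'a
  assumes x: "x \<in> cdom c"
begin

definition Kop :: "(('a \<Rightarrow> complex) \<Rightarrow> complex) \<Rightarrow> 'n lop" where
  "Kop D = Dop D (\<lambda>y. Lam (w y)) * wd (w x) - wd (w x) * Dop D (\<lambda>y. Lam (w y))"

definition dmat :: "(('a \<Rightarrow> complex) \<Rightarrow> complex) \<Rightarrow> 'n cmat" where
  "dmat D = (\<chi> a b. D (\<lambda>y. herm_mat (w y) $ a $ b))"

lemma herm_mat_DE:
  assumes D: "dv c x D"
  shows "wd (DE D w) = LH (dmat D)"
proof -
  have "wd (DE D w) = LH (herm_mat (DE D w))"
  proof (rule wd_type11)
    fix I J assume *: "DE D w I J \<noteq> 0"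
    show "card I = 1 \<and> card J = 1"
    proof (rule ccontr)
      assume "\<not> (card I = 1 \<and> card J = 1)"
      then have "D (\<lambda>y. w y I J) = D (\<lambda>y. 0)"
        by (intro dv_cong[OF c D]) (use mw in \<open>unfold metric_def, blast\<close>)
      then show False using * dv_simps(3)[OF c D] by (simp add: DE_def)
    qed
  qed
  moreover have "herm_mat (DE D w) = dmat D"
  proof (rule matrix_eqI)
    fix a b
    have "D (\<lambda>y. - \<i> * w y {a} {b}) = D (\<lambda>y. - \<i>) * w x {a} {b} + - \<i> * D (\<lambda>y. w y {a} {b})"
      by (rule dv_simps(2)[OF c D sm_const[OF c]]) (use smE_\<omega> in \<open>simp add: smE_def\<close>)
    then show "herm_mat (DE D w) $ a $ b = dmat D $ a $ b"
      using dv_simps(3)[OF c D, of "- \<i>"] by (simp add: herm_mat_def dmat_def DE_def)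
  qed
  ultimately show ?thesis by simp
qed

context
  fixes \<xi> :: "'n cvec"
begin

private abbreviation (input) "D f \<equiv> pd c \<xi> f x"

private lemma D: "dv c x (\<lambda>f. D f)"
  by (rule dv_pd[OF c x])

private abbreviation (input) "dHm \<equiv> dmat (\<lambda>f. D f)"

definition dGm :: "'n cmat" where "dGm = (\<chi> a b. D (\<lambda>y. gram (w y) $ a $ b))"

lemma dHm_herm: "cnj (dHm $ a $ b) = dHm $ b $ a"
proof -
  have "cnj (D (\<lambda>y. herm_mat (w y) $ a $ b)) = D (\<lambda>y. cnj (herm_mat (w y) $ a $ b))"
    by (rule pd_cnj[OF c x sm_herm[OF cA], symmetric])
  also have "\<dots> = D (\<lambda>y. herm_mat (w y) $ b $ a)"
    by (rule dv_cong[OF c D]) (rule herm_cnj[OF mw])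
  finally show ?thesis by (simp add: dmat_def)
qed

text \<open>Differentiates the relation that the Gram matrix inverts the transposed metric, and
  contracts the result with the Gram matrix once more.\<close>

lemma dGm_eq: "dGm $ i $ k = - (\<Sum>a\<in>UNIV. \<Sum>b\<in>UNIV. gram (w x) $ i $ b * dHm $ a $ b * gram (w x) $ a $ k)"
proof -
  have 0: "(\<Sum>b\<in>UNIV. dHm $ a $ b * gram (w x) $ i $ b + herm_mat (w x) $ a $ b * dGm $ i $ b) = 0" for a
  proof -
    have "D (\<lambda>y. \<Sum>b\<in>UNIV. herm_mat (w y) $ a $ b * gram (w y) $ i $ b) = D (\<lambda>y. if a = i then 1 else 0)"
      by (rule dv_cong[OF c D]) (rule gram_herm_sum1[OF mw])
    also have "\<dots> = 0" by (rule dv_simps(3)[OF c D])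
    also have "D (\<lambda>y. \<Sum>b\<in>UNIV. herm_mat (w y) $ a $ b * gram (w y) $ i $ b) =
      (\<Sum>b\<in>UNIV. D (\<lambda>y. herm_mat (w y) $ a $ b * gram (w y) $ i $ b))"
      by (rule dv_sum[OF c D]) (intro sm_mult[OF c] sm_herm[OF cA] sm_gram[OF cA])
    also have "\<dots> = (\<Sum>b\<in>UNIV. dHm $ a $ b * gram (w x) $ i $ b + herm_mat (w x) $ a $ b * dGm $ i $ b)"
      by (rule sum.cong[OF refl]) (simp add: dv_simps(2)[OF c D sm_herm[OF cA] sm_gram[OF cA]] dmat_def dGm_def)
    finally show ?thesis by simp
  qed
  have "0 = (\<Sum>a\<in>UNIV. gram (w x) $ a $ k * (\<Sum>b\<in>UNIV. dHm $ a $ b * gram (w x) $ i $ b + herm_mat (w x) $ a $ b * dGm $ i $ b))"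
    by (simp only: 0) simp
  also have "\<dots> = (\<Sum>a\<in>UNIV. \<Sum>b\<in>UNIV. gram (w x) $ i $ b * dHm $ a $ b * gram (w x) $ a $ k)
     + (\<Sum>a\<in>UNIV. \<Sum>b\<in>UNIV. (herm_mat (w x) $ a $ b * gram (w x) $ a $ k) * dGm $ i $ b)"
    by (simp add: sum_distrib_left sum.distrib algebra_simps)
  also have "(\<Sum>a\<in>UNIV. \<Sum>b\<in>UNIV. (herm_mat (w x) $ a $ b * gram (w x) $ a $ k) * dGm $ i $ b) =
     (\<Sum>b\<in>UNIV. (\<Sum>a\<in>UNIV. herm_mat (w x) $ a $ b * gram (w x) $ a $ k) * dGm $ i $ b)"
    by (subst sum.swap) (simp add: sum_distrib_right)
  also have "\<dots> = (\<Sum>b\<in>UNIV. if b = k then dGm $ i $ b else 0)"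
    unfolding gram_herm_sum2[OF mw[OF x]] by (intro sum.cong refl) auto
  finally show ?thesis by (simp add: eq_neg_iff_add_eq_0 add.commute)
qed

private abbreviation (input) "dMop \<equiv> Dop (\<lambda>f. D f) (\<lambda>y. Mop (w y))"

lemma dMop_oneE: "ap dMop oneE = 0"
proof -
  have "DE (\<lambda>f. D f) (\<lambda>y. ap (Mop (w y)) oneE) = ap dMop oneE + ap (Mop (w x)) (DE (\<lambda>f. D f) (\<lambda>y. oneE))"
    by (rule DE_ap[OF c D smop_Mop smE_simps(5)[OF c]])
  then show ?thesis by (simp add: DE_simps(5)[OF c D] Mop_def pull_linear)
qed

lemma dMop_E: "dMop * E j = rowE dGm j * Mop (w x) + rowE (gram (w x)) j * dMop"
proof -
  have sr: "smop c (\<lambda>y. rowE (gram (w y)) j)"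
    unfolding rowE_def by (intro smop_sum[OF c] smop_mult[OF c] smop_const[OF c] smop_simps(4)[OF c] sm_gram[OF cA])
  have "dMop * E j = Dop (\<lambda>f. D f) (\<lambda>y. Mop (w y) * E j)"
    using Dop_simps(3)[OF c D smop_Mop smop_const[OF c], of "E j"] by (simp add: Dop_simps(4)[OF c D])
  also have "\<dots> = Dop (\<lambda>f. D f) (\<lambda>y. rowE (gram (w y)) j * Mop (w y))" by (simp only: Mop_def pl_E)
  also have "\<dots> = Dop (\<lambda>f. D f) (\<lambda>y. rowE (gram (w y)) j) * Mop (w x) + rowE (gram (w x)) j * dMop"
    by (rule Dop_simps(3)[OF c D sr smop_Mop])
  also have "Dop (\<lambda>f. D f) (\<lambda>y. rowE (gram (w y)) j) = rowE dGm j"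
    unfolding rowE_def
    by (simp add: Dop_sum[OF c D] smop_mult smop_simps smop_const sm_gram cA c Dop_simps[OF c D] dGm_def)
  finally show ?thesis .
qed

lemma dMop_Eb: "dMop * Eb j = rowEb dGm j * Mop (w x) + rowEb (gram (w x)) j * dMop"
proof -
  have sr: "smop c (\<lambda>y. rowEb (gram (w y)) j)"
    unfolding rowEb_def by (intro smop_sum[OF c] smop_mult[OF c] smop_const[OF c] smop_simps(4)[OF c] sm_cnj[OF c] sm_gram[OF cA])
  have "dMop * Eb j = Dop (\<lambda>f. D f) (\<lambda>y. Mop (w y) * Eb j)"
    using Dop_simps(3)[OF c D smop_Mop smop_const[OF c], of "Eb j"] by (simp add: Dop_simps(4)[OF c D])
  also have "\<dots> = Dop (\<lambda>f. D f) (\<lambda>y. rowEb (gram (w y)) j * Mop (w y))" by (simp only: Mop_def pl_Eb)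
  also have "\<dots> = Dop (\<lambda>f. D f) (\<lambda>y. rowEb (gram (w y)) j) * Mop (w x) + rowEb (gram (w x)) j * dMop"
    by (rule Dop_simps(3)[OF c D sr smop_Mop])
  also have "Dop (\<lambda>f. D f) (\<lambda>y. rowEb (gram (w y)) j) = rowEb dGm j"
    unfolding rowEb_def
    by (simp add: Dop_sum[OF c D] smop_mult smop_simps smop_const sm_gram sm_cnj cA c Dop_simps[OF c D] dGm_def
       pd_cnj[OF c x sm_gram[OF cA]])
  finally show ?thesis .
qed

private abbreviation (input) "tH \<equiv> \<Sum>a\<in>UNIV. \<Sum>b\<in>UNIV. dHm $ a $ b * gram (w x) $ a $ b"

private lemmas var = mw[OF x] dMop_oneE dMop_E dMop_Eb dGm_eq dHm_herm

text \<open>Jacobi's formula without differentiating a determinant expansion: \<open>dM_top\<close>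
  provides it for the Gram matrix, and the product of the two determinants is constant.\<close>

lemma D_det: "D (\<lambda>y. dH y) = tH * dH x"
proof -
  let ?dG = "\<lambda>y. det (gram (w y))"
  have sdG: "sm c ?dG" by (rule sm_det[OF c sm_gram[OF cA]])
  have "ap dMop (bas UNIV {}) = scl (D ?dG) (bas UNIV {})"
  proof (intro ext)
    fix K L :: "'n set"
    have "ap (Mop (w y)) (bas UNIV {}) K L = ?dG y * bas UNIV {} K L" for y
      using minor_card[of "UNIV::'n set" K "gram (w y)"] minor_card[of "{}::'n set" L "gram (w y)"]
      unfolding Mop_def ap_pl pull_bas
      by (cases "K = UNIV"; cases "L = {}") (auto simp: minor_UNIV bas_def dest: card_eq_UNIV_imp_eq_UNIV[OF finite, OF sym])
    then have "ap dMop (bas UNIV {}) K L = D (\<lambda>y. ?dG y * bas UNIV {} K L)" by (simp add: ap_Dop_bas)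
    also have "\<dots> = D ?dG * bas UNIV {} K L + ?dG x * D (\<lambda>y. bas UNIV {} K L)"
      by (rule dv_simps(2)[OF c D sdG sm_const[OF c]])
    finally show "ap dMop (bas UNIV {}) K L = scl (D ?dG) (bas UNIV {}) K L"
      by (simp add: dv_simps(3)[OF c D])
  qed
  then have dG: "D ?dG = - tH * ?dG x" by (rule dM_top[OF var])
  have "D (\<lambda>y. dH y * ?dG y) = D (\<lambda>y. 1)" by (rule dv_cong[OF c D]) (rule det_gram[OF mw])
  then have "D (\<lambda>y. dH y) * ?dG x + dH x * D ?dG = 0"
    by (simp add: dv_simps[OF c D] sm_dH sdG)
  then have "(D (\<lambda>y. dH y) - tH * dH x) * ?dG x = 0" by (simp add: dG algebra_simps)
  then show ?thesis using det_gram[OF mw[OF x]] by auto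
qed

lemma Dop_Lam: "Dop (\<lambda>f. D f) (\<lambda>y. Lam (w y)) = - adj (w x) (LH dHm)"
proof -
  have "Dop (\<lambda>f. D f) (\<lambda>y. Lam (w y)) = Dop (\<lambda>f. D f) (\<lambda>y. LamG (gram (w y)))"
    by (rule Dop_cong[OF c D]) (rule Lam_eq[OF mw])
  also have "\<dots> = LamG dGm"
  proof -
    have sc: "sm c (\<lambda>y. - \<i> * gram (w y) $ k $ l)" for k l by (intro sm_mult sm_const sm_gram c cA)
    have "D (\<lambda>y. - \<i> * gram (w y) $ k $ l) = D (\<lambda>y. - \<i>) * gram (w x) $ k $ l + - \<i> * D (\<lambda>y. gram (w y) $ k $ l)" for k l
      by (rule dv_simps(2)[OF c D sm_const[OF c] sm_gram[OF cA]])
    then have d: "D (\<lambda>y. - \<i> * gram (w y) $ k $ l) = - \<i> * dGm $ k $ l" for k l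
      by (simp add: dv_simps(3)[OF c D] dGm_def del: mult_minus_left)
    show ?thesis unfolding LamG_def
      using sc d by (simp add: Dop_sum[OF c D] smop_sum smop_mult smop_simps(4) smop_const c Dop_simps[OF c D] del: sc_simps(3))
  qed
  also have "\<dots> = - adj (w x) (LH dHm)" by (rule LamG_variation[OF mw[OF x] dGm_eq dHm_herm])
  finally show ?thesis .
qed

lemma D_ip: "smE c U \<Longrightarrow> smE c V \<Longrightarrow> D (\<lambda>y. ip (U y) (V y)) = ip (DE (\<lambda>f. D f) U) (V x) + ip (U x) (DE (\<lambda>f. D f) V)"
proof -
  assume U: "smE c U" and V: "smE c V"
  then have s: "sm c (\<lambda>y. U y I J)" "sm c (\<lambda>y. V y I J)" "sm c (\<lambda>y. cnj (V y I J))" for I J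
    by (auto simp: smE_def sm_cnj[OF c])
  have "D (\<lambda>y. ip (U y) (V y)) = (\<Sum>I\<in>UNIV. \<Sum>J\<in>UNIV. D (\<lambda>y. U y I J * cnj (V y I J)))"
    unfolding ip_def by (simp add: dv_sum[OF c D] sm_sum sm_mult s c)
  also have "\<dots> = ip (DE (\<lambda>f. D f) U) (V x) + ip (U x) (DE (\<lambda>f. D f) V)"
    by (simp add: ip_def DE_def dv_simps(2)[OF c D s(1,3)] pd_cnj[OF c x s(2)] sum.distrib)
  finally show ?thesis .
qed

text \<open>The derivatives of the density and of the Gram operator combine by \<open>dM_eq\<close>
  into the commutator of \<open>Lam\<close> with the derivative of the metric. It is moved to the
  second argument, where its adjoint is \<open>- Kop\<close>.\<close>

lemma metric_derivative_real:
  assumes V: "smE c V" and U: "smE c U"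
  shows "D (\<lambda>y. dH y * ext_inner (w y) (V y) (U y)) = dH x * (ext_inner (w x) (DE (\<lambda>f. D f) V) (U x)
     + ext_inner (w x) (V x) (DE (\<lambda>f. D f) U) - ext_inner (w x) (V x) (ap (Kop (\<lambda>f. D f)) (U x)))"
proof -
  note m = mw[OF x]
  let ?K = "Lam (w x) * LH dHm - LH dHm * Lam (w x)"
  have "D (\<lambda>y. dH y * ext_inner (w y) (V y) (U y)) = D (\<lambda>y. dH y) * ext_inner (w x) (V x) (U x) + dH x * D (\<lambda>y. ip (ap (Mop (w y)) (V y)) (U y))"
    unfolding ext_inner_eq[symmetric] by (rule dv_simps(2)[OF c D sm_dH sm_ext_inner[OF V U]])
  also have "D (\<lambda>y. ip (ap (Mop (w y)) (V y)) (U y)) = ip (ap dMop (V x)) (U x) + ext_inner (w x) (DE (\<lambda>f. D f) V) (U x) + ext_inner (w x) (V x) (DE (\<lambda>f. D f) U)"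
    by (simp add: D_ip smE_ap[OF c smop_Mop V] U DE_ap[OF c D smop_Mop V] ip_simps ext_inner_eq)
  also have "D (\<lambda>y. dH y) * ext_inner (w x) (V x) (U x) + dH x * (ip (ap dMop (V x)) (U x) + ext_inner (w x) (DE (\<lambda>f. D f) V) (U x) + ext_inner (w x) (V x) (DE (\<lambda>f. D f) U))
     = dH x * (ip (ap (dMop + sc tH * Mop (w x)) (V x)) (U x) + ext_inner (w x) (DE (\<lambda>f. D f) V) (U x) + ext_inner (w x) (V x) (DE (\<lambda>f. D f) U))"
    by (simp add: D_det ext_inner_eq ip_simps algebra_simps)
  also have "ip (ap (dMop + sc tH * Mop (w x)) (V x)) (U x) = ext_inner (w x) (ap ?K (V x)) (U x)"
    unfolding dM_eq[OF var] ap_simps(6) ext_inner_eq ..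
  also have "\<dots> = ext_inner (w x) (V x) (ap (adj (w x) ?K) (U x))"
    by (rule ext_inner_adj[OF m])
  also have "adj (w x) ?K = - Kop (\<lambda>f. D f)"
    unfolding Kop_def Dop_Lam by (simp add: adj_simps[OF m] adj_Lam[OF m] wd_metric[OF m])
  finally show ?thesis unfolding ap_simps(5) ext_inner_simps by (simp add: algebra_simps)
qed

end

private abbreviation (input) "W j \<equiv> (\<lambda>f. wirt c j f x)"
private abbreviation (input) "Wb j \<equiv> (\<lambda>f. wirtbar c j f x)"

private lemmas dvW = dv_wirt[OF c x] and dvWb = dv_wirtbar[OF c x]

lemma DE_W: "DE (W j) U = scl (1/2) (DE (\<lambda>f. pd c (axis j 1) f x) U - scl \<i> (DE (\<lambda>f. pd c (axis j \<i>) f x) U))"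
  and DE_Wb: "DE (Wb j) U = scl (1/2) (DE (\<lambda>f. pd c (axis j 1) f x) U + scl \<i> (DE (\<lambda>f. pd c (axis j \<i>) f x) U))"
  by (simp_all add: DE_def fun_eq_iff wirt_eq[OF c] wirtbar_eq[OF c])

lemma Dop_W: "Dop (W j) p = sc (1/2) * (Dop (\<lambda>f. pd c (axis j 1) f x) p - sc \<i> * Dop (\<lambda>f. pd c (axis j \<i>) f x) p)"
  and Dop_Wb: "Dop (Wb j) p = sc (1/2) * (Dop (\<lambda>f. pd c (axis j 1) f x) p + sc \<i> * Dop (\<lambda>f. pd c (axis j \<i>) f x) p)"
  by (rule lop_eqI_bas, simp add: ap_Dop_bas wirt_eq[OF c] wirtbar_eq[OF c])+

lemma dmat_W: "LH (dmat (W j)) = sc (1/2) * (LH (dmat (\<lambda>f. pd c (axis j 1) f x)) - sc \<i> * LH (dmat (\<lambda>f. pd c (axis j \<i>) f x)))"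
  and dmat_Wb: "LH (dmat (Wb j)) = sc (1/2) * (LH (dmat (\<lambda>f. pd c (axis j 1) f x)) + sc \<i> * LH (dmat (\<lambda>f. pd c (axis j \<i>) f x)))"
  by (simp_all add: herm_mat_DE[symmetric] dvW dvWb dv_pd[OF c x] DE_W DE_Wb wd_scl wd_diff wd_add)

text \<open>\<open>Dop_Lam\<close> holds for real directions. The adjoint conjugates scalars, so its
  extension to complex combinations exchanges the two Wirtinger derivatives.\<close>

lemma Dop_Lam_W: "adj (w x) (LH (dmat (Wb j))) = - Dop (W j) (\<lambda>y. Lam (w y))"
  and Dop_Lam_Wb: "adj (w x) (LH (dmat (W j))) = - Dop (Wb j) (\<lambda>y. Lam (w y))"
proof -
  have "adj (w x) (sc a * p) = sc (cnj a) * adj (w x) p" for a p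
    by (simp only: adj_simps[OF mw[OF x]] sc_comm)
  note s = this adj_simps(1,2)[OF mw[OF x]]
  show "adj (w x) (LH (dmat (Wb j))) = - Dop (W j) (\<lambda>y. Lam (w y))"
    unfolding dmat_Wb Dop_W Dop_Lam s by (simp add: algebra_simps)
  show "adj (w x) (LH (dmat (W j))) = - Dop (Wb j) (\<lambda>y. Lam (w y))"
    unfolding dmat_W Dop_Wb Dop_Lam s by (simp add: algebra_simps)
qed

text \<open>The inner product is antilinear in its second argument, so a Wirtinger derivative acts
  there, and in \<open>Kop\<close>, as the conjugate one.\<close>

lemma metric_derivative:
  assumes V: "smE c V" and U: "smE c U"
  shows "W j (\<lambda>y. dH y * ext_inner (w y) (V y) (U y)) = dH x * (ext_inner (w x) (DE (W j) V) (U x)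
     + ext_inner (w x) (V x) (DE (Wb j) U - ap (Kop (Wb j)) (U x)))" (is ?A)
  and "Wb j (\<lambda>y. dH y * ext_inner (w y) (V y) (U y)) = dH x * (ext_inner (w x) (DE (Wb j) V) (U x)
     + ext_inner (w x) (V x) (DE (W j) U - ap (Kop (W j)) (U x)))" (is ?B)
proof -
  have KW: "Kop (W j) = sc (1/2) * (Kop (\<lambda>f. pd c (axis j 1) f x) - sc \<i> * Kop (\<lambda>f. pd c (axis j \<i>) f x))"
   "Kop (Wb j) = sc (1/2) * (Kop (\<lambda>f. pd c (axis j 1) f x) + sc \<i> * Kop (\<lambda>f. pd c (axis j \<i>) f x))"
    unfolding Kop_def Dop_W Dop_Wb by (simp_all add: algebra_simps sc_norm)
  note R = metric_derivative_real[OF V U]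
  show ?A unfolding DE_W DE_Wb KW unfolding wirt_eq[OF c] R
    by (simp add: ext_inner_simps field_simps)
  show ?B unfolding DE_W DE_Wb KW unfolding wirtbar_eq[OF c] R
    by (simp add: ext_inner_simps field_simps)
qed

text \<open>Both commutation relations follow from the same computation, with \<open>s = i\<close>,
  \<open>X\<^sub>j = dz\<^sub>j \<and> \<cdot>\<close>, \<open>Y\<^sub>j = dzbar\<^sub>j \<and> \<cdot>\<close> and with \<open>s = - i\<close> and the roles of \<open>X\<close>, \<open>Y\<close> exchanged.\<close>

lemma commutation_aux:
  fixes s :: complex
  assumes s: "s * s = - 1"
    and XL: "\<And>j. Xs x j * wd (w x) - wd (w x) * Xs x j = sc s * Y j"
    and YL: "\<And>j y. y \<in> cdom c \<Longrightarrow> Lam (w y) * Y j - Y j * Lam (w y) = sc s * Xs y j"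
    and D: "\<And>j. dv c x (D j)" and U: "smE c U"
    and T: "T = (\<Sum>j\<in>UNIV. - Dop (D j) (\<lambda>y. Lam (w y)) * Xs x j)"
  shows "(\<Sum>j\<in>UNIV. DE (D j) (\<lambda>y. ap (Xs y j) (U y)) - ap (Kop (D j)) (ap (Xs x j) (U x))) =
    ap (T * wd (w x) - wd (w x) * T) (U x) - scl s (ap (Lam (w x)) (\<Sum>j\<in>UNIV. ap (Y j) (DE (D j) U))
        - (\<Sum>j\<in>UNIV. ap (Y j) (DE (D j) (\<lambda>y. ap (Lam (w y)) (U y)))))"
proof -
  let ?La = "\<lambda>j. Dop (D j) (\<lambda>y. Lam (w y))"
  have LU: "smE c (\<lambda>y. ap (Lam (w y)) (U y))" by (rule smE_ap[OF c smop_Lam U])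
  have YU: "smE c (\<lambda>y. ap (Y j) (U y))" for j by (rule smE_ap[OF c smop_const[OF c] U])
  \<comment> \<open>Since \<open>s * s = - 1\<close>, the relation \<open>YL\<close> can be solved
    for \<open>Xs\<close>; then only \<open>Lam\<close> and constant operators have to be
    differentiated.\<close>
  have 1: "DE (D j) (\<lambda>y. ap (Xs y j) (U y)) = scl (- s) (ap (?La j) (ap (Y j) (U x)) + ap (Lam (w x)) (ap (Y j) (DE (D j) U))
      - ap (Y j) (DE (D j) (\<lambda>y. ap (Lam (w y)) (U y))))" for j
  proof -
    have "ap (Xs y j) (U y) = scl (- s) (ap (Lam (w y)) (ap (Y j) (U y)) - ap (Y j) (ap (Lam (w y)) (U y)))" if "y \<in> cdom c" for y
    proof -
      have "sc (- s) * (Lam (w y) * Y j - Y j * Lam (w y)) = Xs y j"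
        unfolding YL[OF that] sc_mult_left using s by (simp add: )
      from arg_cong[OF this, of "\<lambda>p. ap p (U y)"] show ?thesis by (simp add: scl_simps)
    qed
    then have "DE (D j) (\<lambda>y. ap (Xs y j) (U y)) = DE (D j) (\<lambda>y. scl (- s) (ap (Lam (w y)) (ap (Y j) (U y)) - ap (Y j) (ap (Lam (w y)) (U y))))"
      by (rule DE_cong[OF c D])
    also have "\<dots> = scl (- s) (DE (D j) (\<lambda>y. ap (Lam (w y)) (ap (Y j) (U y)) - ap (Y j) (ap (Lam (w y)) (U y))))"
      using DE_simps(4)[OF c D sm_const[OF c] smE_simps(2)[OF c smE_ap[OF c smop_Lam YU] smE_ap[OF c smop_const[OF c] LU]], of j "- s" j "Y j"]
      by (simp only: dv_simps(3)[OF c D] scl_simps(7) add_0_left)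
    also have "DE (D j) (\<lambda>y. ap (Lam (w y)) (ap (Y j) (U y)) - ap (Y j) (ap (Lam (w y)) (U y))) =
      DE (D j) (\<lambda>y. ap (Lam (w y)) (ap (Y j) (U y))) - DE (D j) (\<lambda>y. ap (Y j) (ap (Lam (w y)) (U y)))"
      by (rule DE_simps(2)[OF c D smE_ap[OF c smop_Lam YU] smE_ap[OF c smop_const[OF c] LU]])
    also have "DE (D j) (\<lambda>y. ap (Lam (w y)) (ap (Y j) (U y))) = ap (?La j) (ap (Y j) (U x)) + ap (Lam (w x)) (ap (Y j) (DE (D j) U))"
      by (simp only: DE_ap[OF c D smop_Lam YU] DE_ap_const[OF c D U])
    also have "DE (D j) (\<lambda>y. ap (Y j) (ap (Lam (w y)) (U y))) = ap (Y j) (DE (D j) (\<lambda>y. ap (Lam (w y)) (U y)))"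
      by (rule DE_ap_const[OF c D LU])
    finally show ?thesis .
  qed
  \<comment> \<open>The commutator in \<open>XL\<close> appears once the torsion terms are added to
    the \<open>Kop\<close> terms; what remains cancels the terms of 1 in which \<open>Lam\<close> is
    differentiated.\<close>
  have 2: "T * wd (w x) - wd (w x) * T + (\<Sum>j\<in>UNIV. Kop (D j) * Xs x j) = - (\<Sum>j\<in>UNIV. ?La j * (sc s * Y j))"
    unfolding XL[symmetric] T Kop_def
    by (simp add: sum_distrib_left sum_distrib_right sum_negf sum_subtractf algebra_simps)
  have "(\<Sum>j\<in>UNIV. DE (D j) (\<lambda>y. ap (Xs y j) (U y)) - ap (Kop (D j)) (ap (Xs x j) (U x))) =
     ap (T * wd (w x) - wd (w x) * T) (U x) - (ap (T * wd (w x) - wd (w x) * T + (\<Sum>j\<in>UNIV. Kop (D j) * Xs x j)) (U x))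
     + (\<Sum>j\<in>UNIV. DE (D j) (\<lambda>y. ap (Xs y j) (U y)))"
    by (simp add: sum_subtractf ap_sum_left)
  also have "\<dots> = ap (T * wd (w x) - wd (w x) * T) (U x) - scl s (ap (Lam (w x)) (\<Sum>j\<in>UNIV. ap (Y j) (DE (D j) U))
        - (\<Sum>j\<in>UNIV. ap (Y j) (DE (D j) (\<lambda>y. ap (Lam (w y)) (U y)))))"
    unfolding 2 1
    by (simp add: ap_sum_left ap_sum scl_sum scl_simps sum.distrib sum_subtractf sum_negf ap_scl)
  finally show ?thesis .
qed

text \<open>The left-hand sides of the next two lemmas are divergences, whose integrals vanish for compactly supported \<open>V\<close>.\<close>

lemma adjoint_del:
  assumes V: "smE c V" and U: "smE c U"
  shows "(\<Sum>j\<in>UNIV. W j (\<lambda>y. dH y * ext_inner (w y) (V y) (ap (Es (w y) j) (U y)))) =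
    dH x * (ext_inner (w x) (\<Sum>j\<in>UNIV. ap (E j) (DE (W j) V)) (U x)
      - ext_inner (w x) (V x) (scl \<i> (ap (Lam (w x)) (\<Sum>j\<in>UNIV. ap (Eb j) (DE (Wb j) U))
        - (\<Sum>j\<in>UNIV. ap (Eb j) (DE (Wb j) (\<lambda>y. ap (Lam (w y)) (U y)))))
      - ap (adj (w x) (wd (\<Sum>j\<in>UNIV. ap (E j) (DE (W j) w))) * wd (w x) - wd (w x) * adj (w x) (wd (\<Sum>j\<in>UNIV. ap (E j) (DE (W j) w)))) (U x)))"
proof -
  note m = mw[OF x]
  let ?T = "adj (w x) (wd (\<Sum>j\<in>UNIV. ap (E j) (DE (W j) w)))"
  \<comment> \<open>The adjoint reverses the factors of the multiplication by \<open>dz j\<close>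
    and the derivative of the metric, and turns the latter into minus the conjugate derivative of
    \<open>Lam\<close>.\<close>
  have T: "?T = (\<Sum>j\<in>UNIV. - Dop (Wb j) (\<lambda>y. Lam (w y)) * Es (w x) j)"
    by (simp add: wd_sum wd_E adj_sum[OF m] adj_simps[OF m] adj_E[OF m] herm_mat_DE[OF dvW] Dop_Lam_Wb)
  have EU: "smE c (\<lambda>y. ap (Es (w y) j) (U y))" for j by (rule smE_ap[OF c smop_Es U])
  have "(\<Sum>j\<in>UNIV. W j (\<lambda>y. dH y * ext_inner (w y) (V y) (ap (Es (w y) j) (U y)))) =
    dH x * (ext_inner (w x) (\<Sum>j\<in>UNIV. ap (E j) (DE (W j) V)) (U x)
      + ext_inner (w x) (V x) (\<Sum>j\<in>UNIV. DE (Wb j) (\<lambda>y. ap (Es (w y) j) (U y)) - ap (Kop (Wb j)) (ap (Es (w x) j) (U x))))"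
    unfolding metric_derivative(1)[OF V EU]
    by (simp add: ext_inner_sum sum_distrib_left sum.distrib distrib_left ext_inner_adj[OF m] adj_E[OF m])
  also have "(\<Sum>j\<in>UNIV. DE (Wb j) (\<lambda>y. ap (Es (w y) j) (U y)) - ap (Kop (Wb j)) (ap (Es (w x) j) (U x))) =
    ap (?T * wd (w x) - wd (w x) * ?T) (U x) - scl \<i> (ap (Lam (w x)) (\<Sum>j\<in>UNIV. ap (Eb j) (DE (Wb j) U))
        - (\<Sum>j\<in>UNIV. ap (Eb j) (DE (Wb j) (\<lambda>y. ap (Lam (w y)) (U y)))))"
    by (rule commutation_aux[where Xs = "\<lambda>y. Es (w y)" and Y = Eb])
      (use Es_L[OF m] Lam_Eb[OF mw] dvWb U T in auto)
  finally show ?thesis by (simp only: ext_inner_simps diff_diff_eq2 add_diff_eq)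
qed

lemma adjoint_delbar:
  assumes V: "smE c V" and U: "smE c U"
  shows "(\<Sum>j\<in>UNIV. Wb j (\<lambda>y. dH y * ext_inner (w y) (V y) (ap (Ebs (w y) j) (U y)))) =
    dH x * (ext_inner (w x) (\<Sum>j\<in>UNIV. ap (Eb j) (DE (Wb j) V)) (U x)
      - ext_inner (w x) (V x) (scl (- \<i>) (ap (Lam (w x)) (\<Sum>j\<in>UNIV. ap (E j) (DE (W j) U))
        - (\<Sum>j\<in>UNIV. ap (E j) (DE (W j) (\<lambda>y. ap (Lam (w y)) (U y)))))
      - ap (adj (w x) (wd (\<Sum>j\<in>UNIV. ap (Eb j) (DE (Wb j) w))) * wd (w x) - wd (w x) * adj (w x) (wd (\<Sum>j\<in>UNIV. ap (Eb j) (DE (Wb j) w)))) (U x)))"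
proof -
  note m = mw[OF x]
  let ?T = "adj (w x) (wd (\<Sum>j\<in>UNIV. ap (Eb j) (DE (Wb j) w)))"
  have T: "?T = (\<Sum>j\<in>UNIV. - Dop (W j) (\<lambda>y. Lam (w y)) * Ebs (w x) j)"
    by (simp add: wd_sum wd_Eb adj_sum[OF m] adj_simps[OF m] adj_Eb[OF m] herm_mat_DE[OF dvWb] Dop_Lam_W)
  have EU: "smE c (\<lambda>y. ap (Ebs (w y) j) (U y))" for j by (rule smE_ap[OF c smop_Ebs U])
  have "(\<Sum>j\<in>UNIV. Wb j (\<lambda>y. dH y * ext_inner (w y) (V y) (ap (Ebs (w y) j) (U y)))) =
    dH x * (ext_inner (w x) (\<Sum>j\<in>UNIV. ap (Eb j) (DE (Wb j) V)) (U x)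
      + ext_inner (w x) (V x) (\<Sum>j\<in>UNIV. DE (W j) (\<lambda>y. ap (Ebs (w y) j) (U y)) - ap (Kop (W j)) (ap (Ebs (w x) j) (U x))))"
    unfolding metric_derivative(2)[OF V EU]
    by (simp add: ext_inner_sum sum_distrib_left sum.distrib distrib_left ext_inner_adj[OF m] adj_Eb[OF m])
  also have "(\<Sum>j\<in>UNIV. DE (W j) (\<lambda>y. ap (Ebs (w y) j) (U y)) - ap (Kop (W j)) (ap (Ebs (w x) j) (U x))) =
    ap (?T * wd (w x) - wd (w x) * ?T) (U x) - scl (- \<i>) (ap (Lam (w x)) (\<Sum>j\<in>UNIV. ap (E j) (DE (W j) U))
        - (\<Sum>j\<in>UNIV. ap (E j) (DE (W j) (\<lambda>y. ap (Lam (w y)) (U y)))))"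
    by (rule commutation_aux[where Xs = "\<lambda>y. Ebs (w y)" and Y = E])
      (use Ebs_L[OF m] Lam_E[OF mw] dvW U T in auto)
  finally show ?thesis by (simp only: ext_inner_simps diff_diff_eq2 add_diff_eq)
qed

end

end

end

section \<open>Holomorphic change of variables\<close>

text \<open>The matrix is conjugated by the unipotent block matrix with off-diagonal block i, which
  makes it block triangular with diagonal blocks \<open>X\<close> plus and minus i times
  \<open>Y\<close>.\<close>

lemma det_complex_block:
  fixes X Y :: "complex mat"
  assumes X: "X \<in> carrier_mat n n" and Y: "Y \<in> carrier_mat n n"
  shows "Determinant.det (four_block_mat X (- Y) Y X) =
    Determinant.det (X + \<i> \<cdot>\<^sub>m Y) * Determinant.det (X - \<i> \<cdot>\<^sub>m Y)"
proof -
  let ?I = "1\<^sub>m n :: complex mat" and ?Z = "0\<^sub>m n n :: complex mat"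
  let ?P = "four_block_mat ?I (\<i> \<cdot>\<^sub>m ?I) ?Z ?I" and ?Q = "four_block_mat ?I (- (\<i> \<cdot>\<^sub>m ?I)) ?Z ?I"
  let ?M = "four_block_mat X (- Y) Y X"
  have M: "?M \<in> carrier_mat (n + n) (n + n)" and P: "?P \<in> carrier_mat (n + n) (n + n)"
    and Q: "?Q \<in> carrier_mat (n + n) (n + n)"
    using X Y by auto
  have C: "?I \<in> carrier_mat n n" "?Z \<in> carrier_mat n n" "\<i> \<cdot>\<^sub>m ?I \<in> carrier_mat n n" "- (\<i> \<cdot>\<^sub>m ?I) \<in> carrier_mat n n"
    "- Y \<in> carrier_mat n n" "X + \<i> \<cdot>\<^sub>m Y \<in> carrier_mat n n" "- Y + \<i> \<cdot>\<^sub>m X \<in> carrier_mat n n"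
    using X Y by auto
  have s: "(\<i> \<cdot>\<^sub>m ?I) * W = \<i> \<cdot>\<^sub>m W" "W * (\<i> \<cdot>\<^sub>m ?I) = \<i> \<cdot>\<^sub>m W" if "W \<in> carrier_mat n n" for W
    using that mult_smult_assoc_mat[OF C(1) that, of \<i>] mult_smult_distrib[OF that C(1), of \<i>] by auto
  have 2: "- (\<i> \<cdot>\<^sub>m (X + \<i> \<cdot>\<^sub>m Y)) + (- Y + \<i> \<cdot>\<^sub>m X) = ?Z" "- (\<i> \<cdot>\<^sub>m Y) + X = X - \<i> \<cdot>\<^sub>m Y"
    and 3: "- ?Z + X = X"
    using X Y by (intro eq_matI; auto simp: algebra_simps)+
  have 1: "?P * ?M = four_block_mat (X + \<i> \<cdot>\<^sub>m Y) (- Y + \<i> \<cdot>\<^sub>m X) Y X"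
    unfolding mult_four_block_mat[OF C(1) C(3) C(2) C(1) X C(5) Y X] using X Y by (simp add: s 3)
  have "?P * ?M * ?Q = four_block_mat (X + \<i> \<cdot>\<^sub>m Y) ?Z Y (X - \<i> \<cdot>\<^sub>m Y)"
    unfolding 1 mult_four_block_mat[OF C(6) C(7) Y X C(1) C(4) C(2) C(1)] using X Y C by (simp add: s 2)
  moreover have "Determinant.det (four_block_mat (X + \<i> \<cdot>\<^sub>m Y) ?Z Y (X - \<i> \<cdot>\<^sub>m Y)) =
      Determinant.det (X + \<i> \<cdot>\<^sub>m Y) * Determinant.det (X - \<i> \<cdot>\<^sub>m Y)"
    using X Y by (intro det_four_block_mat_upper_right_zero) auto
  moreover have "Determinant.det ?P = 1" "Determinant.det ?Q = 1"
    by (subst det_four_block_mat_lower_left_zero[where n = n and m = n]; simp)+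
  moreover have "Determinant.det (?P * ?M * ?Q) = Determinant.det ?P * Determinant.det ?M * Determinant.det ?Q"
    using Determinant.det_mult[OF _ Q, of "?P * ?M"] Determinant.det_mult[OF P M] P M by simp
  ultimately show ?thesis by simp
qed

text \<open>The library's change of variables theorem is about \<open>real^'m\<close> with a well-ordered index type;
  \<open>'n bit0\<close> has twice as many elements as \<open>'n\<close>.\<close>

definition idx :: "nat \<Rightarrow> 'm::{finite, linorder}" where
  "idx k = sorted_list_of_set UNIV ! k"

lemma bij_idx: "bij_betw (idx :: nat \<Rightarrow> 'm) {..<CARD('m::{finite, linorder})} UNIV"
  unfolding idx_def[abs_def] by (rule bij_betw_nth) auto

definition pos :: "'m::{finite, linorder} \<Rightarrow> nat" where
  "pos = the_inv_into {..<CARD('m)} idx"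

lemma pos_idx [simp]: "k < CARD('m::{finite, linorder}) \<Longrightarrow> pos (idx k :: 'm) = k"
  unfolding pos_def by (rule the_inv_into_f_f) (use bij_idx in \<open>auto simp: bij_betw_def\<close>)

lemma idx_pos [simp]: "idx (pos i) = i" and pos_less [simp]: "pos (i :: 'm::{finite, linorder}) < CARD('m)"
proof -
  show "idx (pos i) = i" unfolding pos_def using bij_idx[where 'm = 'm] by (simp add: bij_betw_def f_the_inv_into_f)
  show "pos i < CARD('m)" unfolding pos_def
    using the_inv_into_into[of idx "{..<CARD('m)}" i "{..<CARD('m)}"] bij_idx[where 'm = 'm] by (simp add: bij_betw_def)
qed

lemma idx_eq_iff: "j < CARD('m) \<Longrightarrow> k < CARD('m) \<Longrightarrow> (idx j :: 'm::{finite, linorder}) = idx k \<longleftrightarrow> j = k"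
  by (metis pos_idx)

text \<open>All real parts come first, then all imaginary parts, so that a complex linear map takes
  the block shape of \<open>det_complex_block\<close>.\<close>

definition of_complex_vec :: "complex^'n::{finite, linorder} \<Rightarrow> real^'n bit0" where
  "of_complex_vec z = (\<chi> i. if pos i < CARD('n) then Re (z $ idx (pos i)) else Im (z $ idx (pos i - CARD('n))))"

definition to_complex_vec :: "real^'n bit0 \<Rightarrow> complex^'n::{finite, linorder}" where
  "to_complex_vec r = (\<chi> j. Complex (r $ idx (pos j)) (r $ idx (pos j + CARD('n))))"

lemma of_to_complex_vec [simp]: "of_complex_vec (to_complex_vec r) = (r :: real^'n::{finite, linorder} bit0)"
proof (rule vector_eqI)
  fix i :: "'n bit0"
  have "pos i < 2 * CARD('n)" using pos_less[of i] by simp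
  then show "of_complex_vec (to_complex_vec r) $ i = r $ i"
    by (auto simp: of_complex_vec_def to_complex_vec_def)
qed

lemma pos_idx_double:
  fixes j :: "'n::{finite, linorder}"
  shows "pos (idx (pos j) :: 'n bit0) = pos j" "pos (idx (pos j + CARD('n)) :: 'n bit0) = pos j + CARD('n)"
  by (rule pos_idx, unfold card_bit0, use pos_less[of j] in linarith)+

lemma to_of_complex_vec [simp]: "to_complex_vec (of_complex_vec z) = (z :: complex^'n::{finite, linorder})"
  by (simp add: vec_eq_iff of_complex_vec_def to_complex_vec_def complex_eq_iff pos_idx_double)

lemma linear_of_complex_vec: "linear of_complex_vec"
  by (rule linearI) (auto simp: of_complex_vec_def vec_eq_iff)

lemma linear_to_complex_vec: "linear to_complex_vec"
  by (rule linearI) (auto simp: to_complex_vec_def vec_eq_iff complex_eq_iff)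

lemma to_complex_vec_axis:
  assumes "k < 2 * CARD('n)"
  shows "(to_complex_vec (axis (idx k) 1) :: complex^'n::{finite, linorder}) =
    (if k < CARD('n) then axis (idx k) 1 else axis (idx (k - CARD('n))) \<i>)"
proof (rule vector_eqI)
  fix j :: 'n
  have p: "pos j < CARD('n)" by simp
  have 1: "(idx a :: 'n bit0) = idx k \<longleftrightarrow> a = k" if "a < 2 * CARD('n)" for a
    using that assms idx_eq_iff[of a k, where 'm = "'n bit0"] by simp
  have 2: "(idx a :: 'n) = j \<longleftrightarrow> a = pos j" if "a < CARD('n)" for a using that by (metis idx_pos pos_idx)
  have 3: "(idx (pos j) :: 'n bit0) = idx k \<longleftrightarrow> pos j = k"
    by (rule 1) (use p in linarith)
  have 4: "(idx (pos j + CARD('n)) :: 'n bit0) = idx k \<longleftrightarrow> pos j + CARD('n) = k"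
    by (rule 1) (use p in linarith)
  show "to_complex_vec (axis (idx k) 1) $ j = (if k < CARD('n) then axis (idx k) 1 else axis (idx (k - CARD('n))) \<i>) $ j"
  proof (cases "k < CARD('n)")
    case True
    then have "pos j + CARD('n) \<noteq> k" by linarith
    then show ?thesis using True 2[OF True] by (auto simp: to_complex_vec_def axis_def complex_eq_iff 3 4 simp del: idx_pos)
  next
    case False
    then have *: "pos j \<noteq> k" "k - CARD('n) < CARD('n)" "pos j + CARD('n) = k \<longleftrightarrow> k - CARD('n) = pos j" using p assms by linarith+
    then show ?thesis using False 2[OF *(2)] by (auto simp: to_complex_vec_def axis_def complex_eq_iff 3 4 simp del: idx_pos)
  qed
qed

text \<open>With \<open>X\<close>, \<open>Y\<close> the real and imaginary parts of
  \<open>J\<close>, the two factors in \<open>det_complex_block\<close> are \<open>det J\<close> and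
  its conjugate.\<close>

lemma det_of_complex_linear:
  fixes J :: "complex^'n::{finite, linorder}^'n::{finite, linorder}"
  shows "det (matrix (\<lambda>r. of_complex_vec (J *v to_complex_vec r))) = (cmod (det J))\<^sup>2"
proof -
  let ?n = "CARD('n)"
  let ?R = "matrix (\<lambda>r. of_complex_vec (J *v to_complex_vec r)) :: real^'n bit0^'n bit0"
  define X where "X = Matrix.mat ?n ?n (\<lambda>(a, b). complex_of_real (Re (J $ idx a $ idx b)))"
  define Y where "Y = Matrix.mat ?n ?n (\<lambda>(a, b). complex_of_real (Im (J $ idx a $ idx b)))"
  have XY: "X \<in> carrier_mat ?n ?n" "Y \<in> carrier_mat ?n ?n" by (auto simp: X_def Y_def)
  have ax: "(J *v axis j s) $ i = J $ i $ j * s" for i j s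
    by (simp add: matrix_vector_mult_def axis_def if_distrib[of "(*) _"] cong: if_cong)
  have R: "?R $ idx a $ idx b = (if a < ?n then (if b < ?n then Re (J $ idx a $ idx b) else - Im (J $ idx a $ idx (b - ?n)))
     else (if b < ?n then Im (J $ idx (a - ?n) $ idx b) else Re (J $ idx (a - ?n) $ idx (b - ?n))))"
    if "a < 2 * ?n" "b < 2 * ?n" for a b
    using that to_complex_vec_axis[OF that(2)] by (simp add: matrix_def of_complex_vec_def ax)
  have "complex_of_real (det ?R) = det (\<chi> i j. complex_of_real (?R $ i $ j))"
    unfolding Determinants.det_def by (simp add: of_real_sum of_real_prod)
  also have "\<dots> = Determinant.det (Matrix.mat (?n + ?n) (?n + ?n) (\<lambda>(a, b). complex_of_real (?R $ idx a $ idx b)))"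
    using det_eq_mat_det[OF bij_idx[where 'm = "'n bit0"], of "\<chi> i j. complex_of_real (?R $ i $ j)"] by (simp add: mult_2)
  also have "Matrix.mat (?n + ?n) (?n + ?n) (\<lambda>(a, b). complex_of_real (?R $ idx a $ idx b)) = four_block_mat X (- Y) Y X"
    by (rule eq_matI) (auto simp: X_def Y_def R)
  also have "Determinant.det (four_block_mat X (- Y) Y X) = Determinant.det (X + \<i> \<cdot>\<^sub>m Y) * Determinant.det (X - \<i> \<cdot>\<^sub>m Y)"
    by (rule det_complex_block[OF XY])
  also have "X + \<i> \<cdot>\<^sub>m Y = Matrix.mat ?n ?n (\<lambda>(a, b). J $ idx a $ idx b)"
    by (rule eq_matI) (auto simp: X_def Y_def complex_eq_iff)
  also have "X - \<i> \<cdot>\<^sub>m Y = Matrix.mat ?n ?n (\<lambda>(a, b). (\<chi> i j. cnj (J $ i $ j)) $ idx a $ idx b)"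
    by (rule eq_matI) (auto simp: X_def Y_def complex_eq_iff)
  also have "Determinant.det (Matrix.mat ?n ?n (\<lambda>(a, b). J $ idx a $ idx b)) * Determinant.det (Matrix.mat ?n ?n (\<lambda>(a, b). (\<chi> i j. cnj (J $ i $ j)) $ idx a $ idx b))
     = det J * det (\<chi> i j. cnj (J $ i $ j))"
    by (simp only: det_eq_mat_det[OF bij_idx[where 'm = 'n]])
  also have "det (\<chi> i j. cnj (J $ i $ j)) = cnj (det J)"
    unfolding Determinants.det_def by simp
  finally show ?thesis using complex_norm_square[of "det J"] by (metis of_real_eq_iff)
qed

text \<open>The map only renames coordinates, so preimages of boxes are boxes of the same volume,
  and the volumes of boxes determine \<open>lborel\<close>.\<close>

lemma lborel_distr_basis:
  fixes f :: "'a::euclidean_space \<Rightarrow> 'b::euclidean_space"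
  assumes f: "linear f" and b: "bij_betw f Basis Basis"
  shows "distr lborel borel f = lborel"
proof (rule lborel_eqI[symmetric])
  have inner: "f x \<bullet> f b = x \<bullet> b" if "b \<in> Basis" for x b
  proof -
    have "f x = (\<Sum>a\<in>Basis. (x \<bullet> a) *\<^sub>R f a)"
      using linear_sum[OF f, of "\<lambda>a. (x \<bullet> a) *\<^sub>R a" Basis] by (simp add: euclidean_representation linear_scale[OF f])
    then have "f x \<bullet> f b = (\<Sum>a\<in>Basis. (x \<bullet> a) * (f a \<bullet> f b))" by (simp add: inner_sum_left)
    also have "\<dots> = (\<Sum>a\<in>Basis. if a = b then x \<bullet> a else 0)"
    proof (intro sum.cong refl)
      fix a :: 'a assume a: "a \<in> Basis"
      have "f a \<in> Basis" "f b \<in> Basis" "f a = f b \<longleftrightarrow> a = b"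
        using a that b by (auto simp: bij_betw_def inj_on_def)
      then show "(x \<bullet> a) * (f a \<bullet> f b) = (if a = b then x \<bullet> a else 0)" by (simp add: inner_Basis)
    qed
    finally show ?thesis using that by simp
  qed
  fix l u :: 'b
  assume lu: "\<And>b. b \<in> Basis \<Longrightarrow> l \<bullet> b \<le> u \<bullet> b"
  define g where "g y = (\<Sum>a\<in>Basis. (y \<bullet> f a) *\<^sub>R a)" for y
  have g: "g y \<bullet> a = y \<bullet> f a" if "a \<in> Basis" for y a using that by (simp add: g_def)
  have "f -` box l u = box (g l) (g u)"
  proof -
    have "x \<in> f -` box l u \<longleftrightarrow> x \<in> box (g l) (g u)" for x
    proof -
      have "x \<in> f -` box l u \<longleftrightarrow> (\<forall>a\<in>f ` Basis. l \<bullet> a < f x \<bullet> a \<and> f x \<bullet> a < u \<bullet> a)"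
        using b by (simp add: mem_box bij_betw_def)
      then show ?thesis by (simp add: mem_box g inner)
    qed
    then show ?thesis by blast
  qed
  then have "emeasure (distr lborel borel f) (box l u) = emeasure lborel (box (g l) (g u))"
    using f by (simp add: emeasure_distr borel_measurable_continuous_onI linear_continuous_on linear_conv_bounded_linear)
  also have "\<dots> = (\<Prod>a\<in>Basis. (g u - g l) \<bullet> a)"
    using b by (intro emeasure_lborel_box) (auto simp: g bij_betw_def intro!: lu)
  also have "\<dots> = (\<Prod>a\<in>Basis. (u - l) \<bullet> f a)" by (intro arg_cong[where f = ennreal] prod.cong refl) (simp add: g inner_diff_left)
  also have "\<dots> = (\<Prod>a\<in>Basis. (u - l) \<bullet> a)" by (intro arg_cong[where f = ennreal] prod.reindex_bij_betw b)
  finally show "emeasure (distr lborel borel f) (box l u) = ennreal (\<Prod>a\<in>Basis. (u - l) \<bullet> a)" .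
qed simp

section \<open>The volume measure\<close>

text \<open>For nonnegative functions absolute integrability is integrability, and extension by 0
  turns the integral over \<open>T\<close> into one over the whole space.\<close>

lemma absolutely_integrable_iff_nn_integral:
  fixes h :: "'m::euclidean_space \<Rightarrow> real"
  assumes m: "(\<lambda>x. h x * indicator T x) \<in> borel_measurable borel"
    and h: "\<And>x. x \<in> T \<Longrightarrow> 0 \<le> h x"
  shows "h absolutely_integrable_on T \<and> integral T h = b \<longleftrightarrow>
    0 \<le> b \<and> (\<integral>\<^sup>+ x. ennreal (h x) * indicator T x \<partial>lborel) = ennreal b"
proof -
  let ?f = "\<lambda>x. h x * indicator T x"
  have f: "0 \<le> ?f x" for x using h by (auto simp: indicator_def)
  have "h absolutely_integrable_on T \<and> integral T h = b \<longleftrightarrow> (h has_integral b) T"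
    using absolutely_integrable_on_iff_nonneg[of T h] h by (auto simp: has_integral_iff)
  also have "\<dots> \<longleftrightarrow> (?f has_integral b) UNIV"
    unfolding has_integral_restrict_UNIV[of T h, symmetric] by (intro arg_cong[where f = "\<lambda>f. (f has_integral b) UNIV"] ext) (auto simp: indicator_def)
  also have "\<dots> \<longleftrightarrow> (?f \<in> borel_measurable lebesgue \<and> (\<integral>\<^sup>+ x. ennreal (?f x) \<partial>lebesgue) = ennreal b \<and> 0 \<le> b)"
    by (rule has_integral_iff_nn_integral_lebesgue) (rule f)
  also have "(\<integral>\<^sup>+ x. ennreal (?f x) \<partial>lebesgue) = (\<integral>\<^sup>+ x. ennreal (h x) * indicator T x \<partial>lborel)"
    unfolding nn_integral_completion by (intro nn_integral_cong) (auto simp: indicator_def)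
  finally show ?thesis using measurable_completion[of ?f lborel borel] m by auto
qed

text \<open>The theorem for absolutely integrable functions says that one integral exists with value
  \<open>b\<close> if and only if the other does. So both sides have the same finite values, and if
  one of them is infinite the other cannot be finite.\<close>

lemma nn_integral_change_of_variables_real:
  fixes f :: "real^'m::{finite, wellorder} \<Rightarrow> real" and g :: "real^'m::{finite, wellorder} \<Rightarrow> real^'m::{finite, wellorder}"
  assumes S: "S \<in> sets borel"
    and der: "\<And>x. x \<in> S \<Longrightarrow> (g has_derivative g' x) (at x within S)" and inj: "inj_on g S"
    and f: "(\<lambda>x. f x * indicator (g ` S) x) \<in> borel_measurable borel"
    and fg: "(\<lambda>x. \<bar>det (matrix (g' x))\<bar> * f (g x) * indicator S x) \<in> borel_measurable borel"
    and nonneg: "\<And>x. x \<in> g ` S \<Longrightarrow> 0 \<le> f x"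
  shows "(\<integral>\<^sup>+ x. ennreal (f x) * indicator (g ` S) x \<partial>lborel) =
    (\<integral>\<^sup>+ x. ennreal (\<bar>det (matrix (g' x))\<bar> * f (g x)) * indicator S x \<partial>lborel)" (is "?L = ?R")
proof -
  let ?D = "\<lambda>x. \<bar>det (matrix (g' x))\<bar> * f (g x)"
  have "?D absolutely_integrable_on S \<and> integral S ?D = b \<longleftrightarrow> f absolutely_integrable_on (g ` S) \<and> integral (g ` S) f = b" for b
    using has_absolute_integral_change_of_variables[OF _ der inj, of "\<lambda>x. Finite_Cartesian_Product.vec (f x) :: real^1" "Finite_Cartesian_Product.vec b"] S
    by (simp add: absolutely_integrable_on_1_iff integral_on_1_eq o_def)
  then have *: "0 \<le> b \<and> ?R = ennreal b \<longleftrightarrow> 0 \<le> b \<and> ?L = ennreal b" for b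
    using absolutely_integrable_iff_nn_integral[OF f nonneg, of b] absolutely_integrable_iff_nn_integral[of ?D S b, OF fg] nonneg
    by simp
  have "a = b" if "\<And>r. 0 \<le> r \<and> b = ennreal r \<longleftrightarrow> 0 \<le> r \<and> a = ennreal r" for a b :: ennreal
    by (cases a; cases b) (use that in metis)+
  from this[OF *] show ?thesis .
qed

lemma bij_betw_to_complex_vec_Basis:
  "bij_betw (to_complex_vec :: real^'n::{finite, linorder} bit0 \<Rightarrow> complex^'n::{finite, linorder}) Basis Basis"
proof -
  have inj: "inj_on (to_complex_vec :: (real, 'n bit0) Finite_Cartesian_Product.vec \<Rightarrow> 'n cvec) Basis"
    by (rule inj_on_inverseI[of _ of_complex_vec]) simp
  have sub: "to_complex_vec ` (Basis :: ((real, 'n bit0) Finite_Cartesian_Product.vec) set) \<subseteq> (Basis :: ('n cvec) set)"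
  proof
    fix y :: "'n cvec" assume "y \<in> to_complex_vec ` (Basis :: ((real, 'n bit0) Finite_Cartesian_Product.vec) set)"
    then obtain i where y: "y = to_complex_vec (axis i 1)" by (auto simp: Basis_vec_def)
    have "pos i < 2 * CARD('n)" using pos_less[of i] by simp
    from to_complex_vec_axis[OF this] y show "y \<in> Basis" by (auto simp: Basis_vec_def Basis_complex_def split: if_splits)
  qed
  have "card (to_complex_vec ` (Basis :: ((real, 'n bit0) Finite_Cartesian_Product.vec) set)) = card (Basis :: ('n cvec) set)"
    by (subst card_image[OF inj]) (simp flip: DIM_complex)
  then show ?thesis using inj sub by (simp add: bij_betw_def card_subset_eq)
qed

lemma borel_measurable_to_complex_vec: "to_complex_vec \<in> borel_measurable borel"
  using linear_to_complex_vec by (intro borel_measurable_continuous_onI linear_continuous_on) (simp add: linear_conv_bounded_linear)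

lemma mem_image_of_complex_vec: "r \<in> of_complex_vec ` X \<longleftrightarrow> to_complex_vec r \<in> X"
  by (auto intro: image_eqI[of _ _ "to_complex_vec r"])

lemma nn_integral_complex_vec:
  fixes h :: "complex^'n::{finite, linorder} \<Rightarrow> ennreal"
  assumes h: "h \<in> borel_measurable borel"
  shows "(\<integral>\<^sup>+ z. h z \<partial>lborel) = (\<integral>\<^sup>+ x. h (to_complex_vec x) \<partial>lborel)"
proof -
  have "(\<integral>\<^sup>+ z. h z \<partial>distr lborel borel to_complex_vec) = (\<integral>\<^sup>+ x. h (to_complex_vec x) \<partial>lborel)"
    using h borel_measurable_to_complex_vec by (intro nn_integral_distr) simp_all
  then show ?thesis
    by (simp add: lborel_distr_basis[OF linear_to_complex_vec bij_betw_to_complex_vec_Basis])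
qed

text \<open>The real theorem transported along \<open>of_complex_vec\<close>; by
  \<open>det_of_complex_linear\<close> the real Jacobian determinant is the squared modulus of the
  complex one.\<close>

lemma nn_integral_holomorphic_change:
  fixes f :: "complex^'n::{finite, linorder} \<Rightarrow> real" and \<phi> :: "complex^'n::{finite, linorder} \<Rightarrow> complex^'n::{finite, linorder}"
  assumes S: "S \<in> sets borel"
    and der: "\<And>z. z \<in> S \<Longrightarrow> (\<phi> has_derivative (\<lambda>v. J z *v v)) (at z)" and inj: "inj_on \<phi> S"
    and f: "(\<lambda>z. f z * indicator (\<phi> ` S) z) \<in> borel_measurable borel"
    and f\<phi>: "(\<lambda>z. (cmod (det (J z)))\<^sup>2 * f (\<phi> z) * indicator S z) \<in> borel_measurable borel"
    and nonneg: "\<And>z. z \<in> \<phi> ` S \<Longrightarrow> 0 \<le> f z"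
  shows "(\<integral>\<^sup>+ z. ennreal (f z) * indicator (\<phi> ` S) z \<partial>lborel) =
    (\<integral>\<^sup>+ z. ennreal ((cmod (det (J z)))\<^sup>2 * f (\<phi> z)) * indicator S z \<partial>lborel)"
proof -
  let ?T = "of_complex_vec ` S"
  let ?g = "\<lambda>r. of_complex_vec (\<phi> (to_complex_vec r))"
  let ?g' = "\<lambda>r v. of_complex_vec (J (to_complex_vec r) *v to_complex_vec v)"
  have gT: "?g ` ?T = of_complex_vec ` (\<phi> ` S)" by (auto simp: image_iff)
  note T = mem_image_of_complex_vec[of _ S]
  have iT: "indicator ?T r = (indicator S (to_complex_vec r) :: 'b::zero_neq_one)" for r by (simp add: indicator_def T)
  have igT: "indicator (?g ` ?T) r = (indicator (\<phi> ` S) (to_complex_vec r) :: 'b::zero_neq_one)" for r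
    unfolding gT by (simp add: indicator_def mem_image_of_complex_vec)
  have "?T = to_complex_vec -` S \<inter> space borel" using T by auto
  then have Tb: "?T \<in> sets borel" using measurable_sets[OF borel_measurable_to_complex_vec S] by simp
  have bl: "bounded_linear (of_complex_vec :: 'n cvec \<Rightarrow> _)"
    "bounded_linear (to_complex_vec :: _ \<Rightarrow> 'n cvec)"
    using linear_of_complex_vec linear_to_complex_vec by (auto simp: linear_conv_bounded_linear)
  have "(\<integral>\<^sup>+ z. ennreal (f z) * indicator (\<phi> ` S) z \<partial>lborel) =
      (\<integral>\<^sup>+ z. ennreal (f z * indicator (\<phi> ` S) z) \<partial>lborel)"
    by (intro nn_integral_cong) (auto simp: indicator_def)
  also have "\<dots> = (\<integral>\<^sup>+ r. ennreal (f (to_complex_vec r) * indicator (\<phi> ` S) (to_complex_vec r)) \<partial>lborel)"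
    using f by (intro nn_integral_complex_vec) simp
  also have "\<dots> = (\<integral>\<^sup>+ r. ennreal (f (to_complex_vec r)) * indicator (?g ` ?T) r \<partial>lborel)"
    by (intro nn_integral_cong) (simp only: igT, simp add: indicator_def)
  also have "\<dots> = (\<integral>\<^sup>+ r. ennreal (\<bar>det (matrix (?g' r))\<bar> * f (to_complex_vec (?g r))) * indicator ?T r \<partial>lborel)"
  proof (rule nn_integral_change_of_variables_real[OF Tb])
    show "(?g has_derivative ?g' r) (at r within ?T)" if "r \<in> ?T" for r
    proof -
      have "(?g has_derivative ?g' r) (at r)"
        using bounded_linear.has_derivative[OF bl(1) has_derivative_compose[OF bounded_linear_imp_has_derivative[OF bl(2)] der]] that T by blast
      then show ?thesis by (rule has_derivative_at_withinI)
    qed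
    show "inj_on ?g ?T"
      using inj by (auto simp: inj_on_def dest!: arg_cong[where f = to_complex_vec])
    show "(\<lambda>r. f (to_complex_vec r) * indicator (?g ` ?T) r) \<in> borel_measurable borel"
      unfolding igT using measurable_compose[OF borel_measurable_to_complex_vec f] .
    show "(\<lambda>r. \<bar>det (matrix (?g' r))\<bar> * f (to_complex_vec (?g r)) * indicator ?T r) \<in> borel_measurable borel"
      unfolding iT det_of_complex_linear using measurable_compose[OF borel_measurable_to_complex_vec f\<phi>] by simp
    show "0 \<le> f (to_complex_vec r)" if "r \<in> ?g ` ?T" for r using that nonneg by auto
  qed
  also have "\<dots> = (\<integral>\<^sup>+ r. ennreal ((cmod (det (J (to_complex_vec r))))\<^sup>2 * f (\<phi> (to_complex_vec r)) * indicator S (to_complex_vec r)) \<partial>lborel)"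
    unfolding det_of_complex_linear iT by (intro nn_integral_cong) (auto simp: indicator_def)
  also have "\<dots> = (\<integral>\<^sup>+ z. ennreal ((cmod (det (J z)))\<^sup>2 * f (\<phi> z) * indicator S z) \<partial>lborel)"
    using f\<phi> by (intro nn_integral_complex_vec[symmetric]) simp
  also have "\<dots> = (\<integral>\<^sup>+ z. ennreal ((cmod (det (J z)))\<^sup>2 * f (\<phi> z)) * indicator S z \<partial>lborel)"
    by (intro nn_integral_cong) (auto simp: indicator_def)
  finally show ?thesis .
qed

context hermitian
begin

definition dens :: "('a, 'n) chart \<Rightarrow> 'n cvec \<Rightarrow> real" where
  "dens c z = 2 ^ CARD('n) * Re (det (herm_mat (\<omega> c (cinv c z))))"

text \<open>The inverse chart with one constant value outside the image, which makes it Borel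
  measurable on all of the coordinate space.\<close>

definition inv_chart :: "('a, 'n) chart \<Rightarrow> 'n cvec \<Rightarrow> 'a" where
  "inv_chart c z = (if z \<in> cimg c then cinv c z else undefined)"

text \<open>The volume of the part of the manifold that \<open>c\<close> covers, extended by 0 to a
  measure on the whole manifold.\<close>

definition chart_measure :: "('a, 'n) chart \<Rightarrow> 'a measure" where
  "chart_measure c = distr (density lborel (\<lambda>z. ennreal (indicator (cimg c) z * dens c z))) borel (inv_chart c)"

lemma dens_pos: "c \<in> A \<Longrightarrow> z \<in> cimg c \<Longrightarrow> 0 < dens c z"
  using det_herm(2)[OF metric_\<omega>] chartA cinv_in by (simp add: dens_def)

lemma complex_of_dens:
  assumes c: "c \<in> A" and x: "x \<in> cdom c"
  shows "complex_of_real (dens c (cmap c x)) = 2 ^ CARD('n) * det (herm_mat (\<omega> c x))"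
  using det_herm(1)[OF metric_\<omega>[OF c x]] chartA[OF c] x by (simp add: dens_def complex_eq_iff)

lemma continuous_on_dens:
  assumes c: "c \<in> A"
  shows "continuous_on (cimg c) (dens c)"
proof -
  have "sm c (\<lambda>y. det (herm_mat (\<omega> c y)))"
    by (rule sm_det[OF chartA[OF c] sm_herm[OF c]])
  then have "continuous_on (cimg c) (\<lambda>z. det (herm_mat (\<omega> c (cinv c z))))"
    using smooth_on_continuous by (fastforce simp: sm_def o_def)
  then show ?thesis unfolding dens_def[abs_def] by (intro continuous_intros)
qed

lemma measurable_dens:
  assumes c: "c \<in> A"
  shows "(\<lambda>z. indicator (cimg c) z * dens c z) \<in> borel_measurable borel"
  using borel_measurable_continuous_on_indicator[OF _ continuous_on_dens[OF c]] open_cimg[OF chartA[OF c]] by simp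

lemma measurable_inv_chart:
  assumes c: "c \<in> A"
  shows "inv_chart c \<in> borel_measurable borel"
  unfolding inv_chart_def[abs_def] using chart_homeomorphism[OF chartA[OF c]] open_cimg[OF chartA[OF c]]
  by (intro borel_measurable_continuous_on_if) (auto simp: homeomorphism_def)

lemma image_cmap:
  assumes c: "c \<in> A" and B: "B \<subseteq> cdom c"
  shows "cmap c ` B = {z \<in> cimg c. inv_chart c z \<in> B}"
proof safe
  fix x assume "x \<in> B"
  then show "cmap c x \<in> cimg c" "inv_chart c (cmap c x) \<in> B" using B chartA[OF c] by (auto simp: inv_chart_def)
next
  fix z assume "z \<in> cimg c" "inv_chart c z \<in> B"
  then show "z \<in> cmap c ` B" using chartA[OF c] by (intro image_eqI[of _ _ "cinv c z"]) (auto simp: inv_chart_def)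
qed

lemma borel_image_cmap:
  assumes c: "c \<in> A" and B: "B \<subseteq> cdom c" "B \<in> sets borel"
  shows "cmap c ` B \<in> sets borel"
proof -
  have "cmap c ` B = cimg c \<inter> (inv_chart c -` B \<inter> space borel)" using image_cmap[OF c B(1)] by auto
  then show ?thesis using measurable_sets[OF measurable_inv_chart[OF c] B(2)] open_cimg[OF chartA[OF c]] by simp
qed

lemma emeasure_chart_measure:
  assumes c: "c \<in> A" and B: "B \<in> sets borel"
  shows "emeasure (chart_measure c) B = (\<integral>\<^sup>+ z. ennreal (dens c z) * indicator (cmap c ` (B \<inter> cdom c)) z \<partial>lborel)"
proof -
  have "emeasure (chart_measure c) B = (\<integral>\<^sup>+ z. ennreal (indicator (cimg c) z * dens c z) * indicator (inv_chart c -` B) z \<partial>lborel)"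
    unfolding chart_measure_def using B measurable_inv_chart[OF c] measurable_dens[OF c] measurable_sets[OF measurable_inv_chart[OF c] B]
    by (subst emeasure_distr) (auto simp: emeasure_density)
  also have "\<dots> = (\<integral>\<^sup>+ z. ennreal (dens c z) * indicator (cmap c ` (B \<inter> cdom c)) z \<partial>lborel)"
    unfolding image_cmap[OF c Int_lower2] using chartA[OF c]
    by (intro nn_integral_cong) (auto simp: indicator_def inv_chart_def)
  finally show ?thesis .
qed

lemma is_volume_measure_iff:
  "is_volume_measure A \<omega> M \<longleftrightarrow> sets M = sets borel \<and>
     (\<forall>c\<in>A. \<forall>B\<in>sets borel. B \<subseteq> cdom c \<longrightarrow> emeasure M B = emeasure (chart_measure c) B)"
  unfolding is_volume_measure_def
  by (intro conj_cong refl ball_cong imp_cong) (simp add: emeasure_chart_measure Int_absorb2 dens_def)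

text \<open>By \<open>det_herm_mat_pull\<close> the densities of two charts differ by the squared
  modulus of the Jacobian determinant, which is the factor in the holomorphic change of
  variables.\<close>

lemma chart_measure_overlap:
  assumes c: "c \<in> A" and c': "c' \<in> A" and B: "B \<subseteq> cdom c" "B \<subseteq> cdom c'" "B \<in> sets borel"
  shows "emeasure (chart_measure c) B = emeasure (chart_measure c') B"
proof -
  let ?\<phi> = "cmap c' \<circ> cinv c" and ?S = "cmap c ` B"
  note ch = chartA[OF c] chartA[OF c']
  have im: "?\<phi> ` ?S = cmap c' ` B" unfolding image_image by (rule image_cong) (use B ch in auto)
  have d: "(cmod (det (jacobian c c' (cinv c z))))\<^sup>2 * dens c' (?\<phi> z) = dens c z" if "z \<in> ?S" for z
  proof -
    from that obtain x where x: "x \<in> B" "z = cmap c x" by blast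
    then have x': "x \<in> cdom c" "x \<in> cdom c'" using B by auto
    have "det (herm_mat (\<omega> c x)) = of_real ((cmod (det (jacobian c c' x)))\<^sup>2) * det (herm_mat (\<omega> c' x))"
      unfolding pull_\<omega>[OF c c' x'] by (rule det_herm_mat_pull[OF metric_\<omega>[OF c' x'(2)]])
    then show ?thesis using x x' ch by (simp add: dens_def)
  qed
  have m: "(\<lambda>z. dens c0 z * indicator (cmap c0 ` B) z) \<in> borel_measurable borel" if "c0 \<in> A" "B \<subseteq> cdom c0" for c0
  proof -
    have "(\<lambda>z. (indicator (cimg c0) z * dens c0 z) * indicator (cmap c0 ` B) z) \<in> borel_measurable borel"
      by (rule borel_measurable_times[OF measurable_dens[OF that(1)] borel_measurable_indicator[OF borel_image_cmap[OF that B(3)]]])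
    moreover have "(indicator (cimg c0) z * dens c0 z) * indicator (cmap c0 ` B) z = dens c0 z * indicator (cmap c0 ` B) z" for z
      using that(2) by (auto simp: indicator_def cimg_def)
    ultimately show ?thesis by simp
  qed
  have e: "emeasure (chart_measure c0) B = (\<integral>\<^sup>+ z. ennreal (dens c0 z) * indicator (cmap c0 ` B) z \<partial>lborel)"
    if "c0 \<in> A" "B \<subseteq> cdom c0" for c0
    using emeasure_chart_measure[OF that(1) B(3)] that(2) by (simp add: Int_absorb2)
  have "emeasure (chart_measure c') B = (\<integral>\<^sup>+ z. ennreal (dens c' z) * indicator (?\<phi> ` ?S) z \<partial>lborel)"
    unfolding im by (rule e[OF c' B(2)])
  also have "\<dots> = (\<integral>\<^sup>+ z. ennreal ((cmod (det (jacobian c c' (cinv c z))))\<^sup>2 * dens c' (?\<phi> z)) * indicator ?S z \<partial>lborel)"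
  proof (rule nn_integral_holomorphic_change)
    show "?S \<in> sets borel" by (rule borel_image_cmap[OF c B(1,3)])
    show "(?\<phi> has_derivative (\<lambda>v. jacobian c c' (cinv c z) *v v)) (at z)" if "z \<in> ?S" for z
    proof -
      from that B obtain x where x: "x \<in> cdom c" "x \<in> cdom c'" "z = cmap c x" by blast
      then have "z \<in> cmap c ` (cdom c \<inter> cdom c')" by blast
      from smooth_on_has_derivative[OF trans_smooth[OF c c'] this] fd_trans[OF c c' x(1,2)] show ?thesis
        using x ch by simp
    qed
    show "inj_on ?\<phi> ?S"
    proof (rule inj_on_inverseI)
      fix z assume "z \<in> ?S"
      then obtain x where "x \<in> cdom c" "x \<in> cdom c'" "z = cmap c x" using B by blast
      then show "(cmap c \<circ> cinv c') (?\<phi> z) = z" using ch by simp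
    qed
    show "(\<lambda>z. dens c' z * indicator (?\<phi> ` ?S) z) \<in> borel_measurable borel"
      unfolding im by (rule m[OF c' B(2)])
    have "(\<lambda>z. (cmod (det (jacobian c c' (cinv c z))))\<^sup>2 * dens c' (?\<phi> z) * indicator ?S z) = (\<lambda>z. dens c z * indicator ?S z)"
      using d by (auto simp: indicator_def fun_eq_iff)
    then show "(\<lambda>z. (cmod (det (jacobian c c' (cinv c z))))\<^sup>2 * dens c' (?\<phi> z) * indicator ?S z) \<in> borel_measurable borel"
      using m[OF c B(1)] by simp
    show "0 \<le> dens c' z" if "z \<in> ?\<phi> ` ?S" for z
      using that B(2) dens_pos[OF c', of z] unfolding im cimg_def by force
  qed
  also have "\<dots> = (\<integral>\<^sup>+ z. ennreal (dens c z) * indicator ?S z \<partial>lborel)"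
    by (intro nn_integral_cong) (use d in \<open>auto simp: indicator_def\<close>)
  also have "\<dots> = emeasure (chart_measure c) B" by (rule e[OF c B(1), symmetric])
  finally show ?thesis by simp
qed

text \<open>Second countability enters here, through the Lindelof property, so that the volume can
  be written as a countable sum.\<close>

lemma countable_subatlas: "\<exists>ch :: nat \<Rightarrow> ('a, 'n) chart. range ch \<subseteq> A \<and> (\<Union>k. cdom (ch k)) = UNIV"
proof -
  have "\<And>S. S \<in> cdom ` A \<Longrightarrow> open S" using open_cdom[OF chartA] by auto
  then obtain F where F: "F \<subseteq> cdom ` A" "countable F" "\<Union>F = \<Union>(cdom ` A)" by (rule Lindelof)
  have U: "\<Union>F = UNIV" using F(3) atlas_cover by auto
  then have "F \<noteq> {}" by auto
  have "\<forall>S\<in>F. \<exists>c\<in>A. cdom c = S" using F(1) by blast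
  then obtain g where g: "\<And>S. S \<in> F \<Longrightarrow> g S \<in> A \<and> cdom (g S) = S" by metis
  have r: "range (from_nat_into F) = F" using \<open>F \<noteq> {}\<close> F(2) by (rule range_from_nat_into)
  have m: "from_nat_into F k \<in> F" for k by (rule from_nat_into) fact
  have "range (\<lambda>k. g (from_nat_into F k)) \<subseteq> A" using g[OF m] by blast
  moreover have "(\<Union>k. cdom (g (from_nat_into F k))) = UNIV" using g[OF m] r U by simp
  ultimately have "range (\<lambda>k. g (from_nat_into F k)) \<subseteq> A \<and> (\<Union>k. cdom (g (from_nat_into F k))) = UNIV" by blast
  then show ?thesis by blast
qed

text \<open>Countably many chart domains are made disjoint, and each piece is measured in its own
  chart; \<open>chart_measure_overlap\<close> makes the sum correct in every other chart. Any volume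
  measure agrees with it on each piece, which gives uniqueness.\<close>

lemma ex1_volume_measure: "\<exists>!M. is_volume_measure A \<omega> M"
proof -
  obtain ch :: "nat \<Rightarrow> ('a, 'n) chart" where ch: "range ch \<subseteq> A" "(\<Union>k. cdom (ch k)) = UNIV"
    using countable_subatlas by blast
  then have chA: "ch k \<in> A" for k by auto
  define U where "U = disjointed (\<lambda>k. cdom (ch k))"
  have "range U \<subseteq> sets borel"
    unfolding U_def by (rule sets.range_disjointed_sets) (use open_cdom[OF chartA[OF chA]] in auto)
  then have U: "U k \<in> sets borel" for k by blast
  have Uc: "U k \<subseteq> cdom (ch k)" for k unfolding U_def by (rule disjointed_subset)
  have UU: "(\<Union>k. U k) = UNIV" unfolding U_def UN_disjointed_eq by (rule ch(2))
  have dU: "disjoint_family U" unfolding U_def by (rule disjoint_family_disjointed)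
  have dB: "disjoint_family (\<lambda>k. B \<inter> U k)" for B using dU by (auto simp: disjoint_family_on_def)
  have split: "emeasure M B = (\<Sum>k. emeasure M (B \<inter> U k))" if M: "sets M = sets borel" and B: "B \<in> sets borel" for M B
  proof -
    have "(\<Sum>k. emeasure M (B \<inter> U k)) = emeasure M (\<Union>k. B \<inter> U k)"
      using M B U dB by (intro suminf_emeasure) auto
    then show ?thesis using UU by (simp flip: Int_UN_distrib)
  qed
  define \<mu> where "\<mu> B = (\<Sum>k. emeasure (chart_measure (ch k)) (B \<inter> U k))" for B
  define M where "M = measure_of UNIV (sets borel) \<mu>"
  have sM: "sets M = sets borel" unfolding M_def using sets.sigma_sets_eq[of borel] by (simp add: sets_measure_of_conv)
  have sC: "sets (chart_measure c) = sets borel" for c by (simp add: chart_measure_def)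
  have eM: "emeasure M B = \<mu> B" if "B \<in> sets borel" for B
  proof (rule emeasure_measure_of[OF M_def])
    show "positive (sets M) \<mu>" by (simp add: positive_def \<mu>_def)
    show "countably_additive (sets M) \<mu>"
    proof (rule countably_additiveI)
      fix F :: "nat \<Rightarrow> 'a set" assume F: "range F \<subseteq> sets M" "disjoint_family F"
      \<comment> \<open>Tonelli's theorem for counting measures.\<close>
      have "(\<Sum>i. \<Sum>k. f i k) = (\<Sum>k. \<Sum>i. f i k)" for f :: "nat \<Rightarrow> nat \<Rightarrow> ennreal"
        using nn_integral_fst_count_space[of "\<lambda>(i, k). f i k"] nn_integral_snd_count_space[of "\<lambda>(i, k). f i k"]
        by (simp add: nn_integral_count_space_nat)
      then have "(\<Sum>i. \<mu> (F i)) = (\<Sum>k. \<Sum>i. emeasure (chart_measure (ch k)) (F i \<inter> U k))"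
        unfolding \<mu>_def .
      also have "\<dots> = \<mu> (\<Union>i. F i)"
        unfolding \<mu>_def
      proof (intro suminf_cong)
        fix k
        have "(\<Sum>i. emeasure (chart_measure (ch k)) (F i \<inter> U k)) = emeasure (chart_measure (ch k)) (\<Union>i. F i \<inter> U k)"
          using F U sM sC by (intro suminf_emeasure) (auto simp: disjoint_family_on_def)
        then show "(\<Sum>i. emeasure (chart_measure (ch k)) (F i \<inter> U k)) = emeasure (chart_measure (ch k)) ((\<Union>i. F i) \<inter> U k)" by simp
      qed
      finally show "(\<Sum>i. \<mu> (F i)) = \<mu> (\<Union>i. F i)" .
    qed
  qed (use that sM in auto)
  show ?thesis
  proof (rule ex1I[of _ M])
    show "is_volume_measure A \<omega> M"
      unfolding is_volume_measure_iff
    proof (intro conjI ballI impI sM)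
      fix c B assume c: "c \<in> A" and B: "B \<in> sets borel" "B \<subseteq> cdom c"
      have "emeasure M B = (\<Sum>k. emeasure (chart_measure c) (B \<inter> U k))"
        unfolding eM[OF B(1)] \<mu>_def
        by (intro suminf_cong chart_measure_overlap[OF chA c]) (use B Uc U in auto)
      then show "emeasure M B = emeasure (chart_measure c) B" using split[OF sC B(1)] by simp
    qed
    fix M' assume M': "is_volume_measure A \<omega> M'"
    show "M' = M"
    proof (rule measure_eqI)
      show s: "sets M' = sets M" using M' sM by (simp add: is_volume_measure_iff)
      fix B assume "B \<in> sets M'"
      then have B: "B \<in> sets borel" using s sM by simp
      have "emeasure M' B = \<mu> B"
        unfolding \<mu>_def split[OF s[unfolded sM] B]
      proof (intro suminf_cong)
        fix k
        have "B \<inter> U k \<in> sets borel" "B \<inter> U k \<subseteq> cdom (ch k)" using B U[of k] Uc[of k] by auto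
        then show "emeasure M' (B \<inter> U k) = emeasure (chart_measure (ch k)) (B \<inter> U k)"
          using M' chA[of k] by (simp add: is_volume_measure_iff)
      qed
      then show "emeasure M' B = emeasure M B" by (simp add: eM[OF B])
    qed
  qed
qed

abbreviation vol :: "'a measure" where "vol \<equiv> volume_measure A \<omega>"

lemma is_volume_measure_vol: "is_volume_measure A \<omega> vol"
  unfolding volume_measure_def by (rule theI'[OF ex1_volume_measure])

lemma sets_vol [simp, measurable_cong]: "sets vol = sets borel"
  using is_volume_measure_vol by (simp add: is_volume_measure_iff)

lemma density_vol:
  assumes c: "c \<in> A"
  shows "density vol (indicator (cdom c)) = chart_measure c"
proof (rule measure_eqI)
  show s: "sets (density vol (indicator (cdom c))) = sets (chart_measure c)" by (simp add: chart_measure_def)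
  fix B assume "B \<in> sets (density vol (indicator (cdom c)))"
  then have B: "B \<in> sets borel" by simp
  have o: "cdom c \<in> sets borel" using open_cdom[OF chartA[OF c]] by simp
  have "emeasure (density vol (indicator (cdom c))) B = emeasure vol (B \<inter> cdom c)"
    using B o by (subst emeasure_density) (auto simp flip: indicator_inter_arith simp: Int_commute)
  also have "\<dots> = emeasure (chart_measure c) (B \<inter> cdom c)"
    using is_volume_measure_vol c B o by (auto simp: is_volume_measure_iff)
  also have "\<dots> = emeasure (chart_measure c) B"
    using B o by (simp add: emeasure_chart_measure[OF c])
  finally show "emeasure (density vol (indicator (cdom c))) B = emeasure (chart_measure c) B" .
qed

text \<open>Both sides are 0 if the function is not integrable, so the integrability statement is needed separately.\<close>

lemma integral_vol_chart:
  fixes f :: "'a \<Rightarrow> complex"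
  assumes c: "c \<in> A" and f: "f \<in> borel_measurable borel" and supp: "\<And>x. x \<notin> cdom c \<Longrightarrow> f x = 0"
  shows "integral\<^sup>L vol f = (LINT z|lborel. indicator (cimg c) z *\<^sub>R (dens c z *\<^sub>R f (cinv c z)))"
    and "integrable vol f \<longleftrightarrow> integrable lborel (\<lambda>z. indicator (cimg c) z *\<^sub>R (dens c z *\<^sub>R f (cinv c z)))"
proof -
  have o: "cdom c \<in> sets borel" using open_cdom[OF chartA[OF c]] by simp
  have f1: "indicator (cdom c) x *\<^sub>R f x = f x" for x using supp by (auto simp: indicator_def)
  have f2: "(indicator (cimg c) z * dens c z) *\<^sub>R f (inv_chart c z) = indicator (cimg c) z *\<^sub>R (dens c z *\<^sub>R f (cinv c z))" for z
    by (auto simp: indicator_def inv_chart_def)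
  have fi: "(\<lambda>z. f (inv_chart c z)) \<in> borel_measurable lborel"
    using measurable_compose[OF measurable_inv_chart[OF c] f] by simp
  have nn: "AE z in lborel. 0 \<le> indicator (cimg c) z * dens c z"
    using dens_pos[OF c] by (intro AE_I2) (auto simp: indicator_def intro: less_imp_le)
  have md: "(\<lambda>z. indicator (cimg c) z * dens c z) \<in> borel_measurable lborel" using measurable_dens[OF c] by simp
  have "density vol (\<lambda>x. ennreal (indicator (cdom c) x)) = chart_measure c"
    using density_vol[OF c] by (simp add: ennreal_indicator)
  note d = this
  have i1: "(indicator (cdom c) :: 'a \<Rightarrow> real) \<in> borel_measurable vol" using o by simp
  have f': "f \<in> borel_measurable vol" using f by simp
  have "integral\<^sup>L vol f = integral\<^sup>L (chart_measure c) f"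
    using integral_density[OF f' i1] unfolding d f1 by simp
  also have "\<dots> = (LINT z|lborel. indicator (cimg c) z *\<^sub>R (dens c z *\<^sub>R f (cinv c z)))"
    unfolding chart_measure_def
    using f fi md nn measurable_inv_chart[OF c] by (simp add: integral_distr integral_density f2)
  finally show "integral\<^sup>L vol f = (LINT z|lborel. indicator (cimg c) z *\<^sub>R (dens c z *\<^sub>R f (cinv c z)))" .
  have "integrable vol f \<longleftrightarrow> integrable (chart_measure c) f"
    using integrable_density[OF f' i1] unfolding d f1 by simp
  also have "\<dots> \<longleftrightarrow> integrable lborel (\<lambda>z. indicator (cimg c) z *\<^sub>R (dens c z *\<^sub>R f (cinv c z)))"
    unfolding chart_measure_def
    using f fi md nn measurable_inv_chart[OF c] by (simp add: integrable_distr_eq integrable_density f2)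
  finally show "integrable vol f \<longleftrightarrow> integrable lborel (\<lambda>z. indicator (cimg c) z *\<^sub>R (dens c z *\<^sub>R f (cinv c z)))" .
qed

end

section \<open>The divergence theorem in a chart\<close>

text \<open>Difference quotients have integral 0 by translation invariance. They converge to the
  derivative and are bounded by a constant on one compact set, so dominated convergence
  applies.\<close>

lemma integral_fd_compact_support:
  fixes h :: "'e::euclidean_space \<Rightarrow> complex"
  assumes h: "smooth_on UNIV h" and K: "compact K" and supp: "\<And>x. x \<notin> K \<Longrightarrow> h x = 0"
  shows "(LINT x|lborel. fd h x \<xi>) = 0"
proof -
  have der: "(h has_derivative fd h x) (at x)" for x using smooth_on_has_derivative[OF h] by simp
  have ch: "continuous_on UNIV h" by (rule smooth_on_continuous[OF h])
  have cfd: "continuous_on UNIV (\<lambda>x. fd h x \<xi>)" by (rule smooth_on_continuous[OF smooth_on_fd[OF h]])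
  have fd0: "fd h x \<xi> = 0" if "x \<notin> K" for x
  proof -
    have "fd h x = fd (\<lambda>y. 0) x"
      by (rule fd_cong_open[of "- K"]) (use that K supp in \<open>auto simp: compact_imp_closed open_Compl\<close>)
    then show ?thesis by simp
  qed
  obtain B where B: "0 \<le> B" "\<And>x. norm (fd h x \<xi>) \<le> B"
  proof -
    have "compact ((\<lambda>x. fd h x \<xi>) ` K)"
      using K cfd by (intro compact_continuous_image) (auto intro: continuous_on_subset)
    then obtain B where "0 < B" "\<And>x. x \<in> K \<Longrightarrow> norm (fd h x \<xi>) \<le> B"
      using bounded_pos[of "(\<lambda>x. fd h x \<xi>) ` K"] compact_imp_bounded by auto
    then show ?thesis using that[of B] fd0 by (metis less_imp_le norm_zero)
  qed
  define g where "g n x = real (Suc n) *\<^sub>R (h (x + (1 / real (Suc n)) *\<^sub>R \<xi>) - h x)" for n x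
  \<comment> \<open>Contains the supports of all \<open>g n\<close>, since the increments
    \<open>1 / real (Suc n)\<close> lie in the unit interval.\<close>
  define K2 where "K2 = (\<lambda>(k, s). k - s *\<^sub>R \<xi>) ` (K \<times> {0..1::real})"
  have K2: "compact K2" unfolding K2_def using K
    by (intro compact_continuous_image compact_Times) (auto simp: split_def intro!: continuous_intros)
  have int_h: "integrable lborel h"
  proof -
    have "(\<lambda>x. indicator K x *\<^sub>R h x) = h" using supp by (auto simp: indicator_def fun_eq_iff)
    then show ?thesis using borel_integrable_compact[OF K continuous_on_subset[OF ch subset_UNIV]] by simp
  qed
  have tr: "integrable lborel (\<lambda>x. h (x + a))" "(LINT x|lborel. h (x + a)) = (LINT x|lborel. h x)" for a
  proof -
    have m: "(+) a \<in> measurable lborel borel" "h \<in> borel_measurable borel"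
      using ch by (auto intro: borel_measurable_continuous_onI)
    show "integrable lborel (\<lambda>x. h (x + a))"
      using integrable_distr_eq[OF m] int_h by (simp add: lborel_distr_plus add.commute)
    show "(LINT x|lborel. h (x + a)) = (LINT x|lborel. h x)"
      using integral_distr[OF m] by (simp add: lborel_distr_plus add.commute)
  qed
  have ig: "(LINT x|lborel. g n x) = 0" for n
    unfolding g_def using tr int_h by simp
  have line: "((\<lambda>t. h (x + t *\<^sub>R \<xi>)) has_derivative (\<lambda>s. s *\<^sub>R fd h (x + t *\<^sub>R \<xi>) \<xi>)) (at t)" for x t
  proof -
    have "((\<lambda>t. x + t *\<^sub>R \<xi>) has_derivative (\<lambda>s. s *\<^sub>R \<xi>)) (at t)" by (auto intro!: derivative_eq_intros)
    from has_derivative_compose[OF this der] show ?thesis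
      using linear_scale[OF has_derivative_linear[OF der]] by simp
  qed
  have lim: "(\<lambda>n. g n x) \<longlonglongrightarrow> fd h x \<xi>" for x
  proof -
    have "((\<lambda>t. norm (h (x + t *\<^sub>R \<xi>) - h x - t *\<^sub>R fd h x \<xi>) / norm t) \<longlongrightarrow> 0) (at 0)"
      using line[of x 0] unfolding has_derivative_at by simp
    then have "((\<lambda>t. norm ((h (x + t *\<^sub>R \<xi>) - h x) /\<^sub>R t - fd h x \<xi>)) \<longlongrightarrow> 0) (at 0)"
    proof (rule Lim_transform_eventually)
      have "norm (a - t *\<^sub>R d) / norm t = norm (a /\<^sub>R t - d)" if "t \<noteq> 0" for a d :: complex and t :: real
      proof -
        have "a /\<^sub>R t - d = (a - t *\<^sub>R d) /\<^sub>R t" using that by (simp add: scaleR_diff_right)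
        then show ?thesis by (simp add: divide_inverse mult.commute)
      qed
      then show "\<forall>\<^sub>F t in at 0. norm (h (x + t *\<^sub>R \<xi>) - h x - t *\<^sub>R fd h x \<xi>) / norm t = norm ((h (x + t *\<^sub>R \<xi>) - h x) /\<^sub>R t - fd h x \<xi>)"
        by (auto simp: eventually_at intro!: exI[of _ 1])
    qed
    then have "((\<lambda>t. (h (x + t *\<^sub>R \<xi>) - h x) /\<^sub>R t) \<longlongrightarrow> fd h x \<xi>) (at 0)"
      by (rule LIM_zero_cancel[OF tendsto_norm_zero_cancel])
    moreover have "filterlim (\<lambda>n. 1 / real (Suc n)) (at 0) sequentially"
      unfolding filterlim_at using LIMSEQ_inverse_real_of_nat by (auto simp: inverse_eq_divide)
    ultimately have "(\<lambda>n. (h (x + (1 / real (Suc n)) *\<^sub>R \<xi>) - h x) /\<^sub>R (1 / real (Suc n))) \<longlonglongrightarrow> fd h x \<xi>"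
      by (rule filterlim_compose)
    then show ?thesis by (simp add: g_def)
  qed
  have bd: "norm (g n x) \<le> B * indicator K2 x" for n x
  proof (cases "x \<in> K2")
    case True
    have "norm (h (x + (1 / real (Suc n)) *\<^sub>R \<xi>) - h (x + 0 *\<^sub>R \<xi>)) \<le> B * norm (1 / real (Suc n) - 0)"
    proof (rule differentiable_bound[of UNIV "\<lambda>t. h (x + t *\<^sub>R \<xi>)"])
      show "onorm (\<lambda>s. s *\<^sub>R fd h (x + t *\<^sub>R \<xi>) \<xi>) \<le> B" for t
        by (rule onorm_bound) (use B in \<open>auto simp: mult.commute[of B] intro!: mult_left_mono\<close>)
    qed (auto intro: line)
    then show ?thesis using True by (simp add: g_def divide_simps mult.commute)
  next
    case False
    have "x + s *\<^sub>R \<xi> \<notin> K" if "0 \<le> s" "s \<le> 1" for s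
    proof
      assume "x + s *\<^sub>R \<xi> \<in> K"
      then have "x \<in> K2" unfolding K2_def using that by (intro image_eqI[of _ _ "(x + s *\<^sub>R \<xi>, s)"]) auto
      then show False using False by simp
    qed
    from this[of 0] this[of "1 / real (Suc n)"] show ?thesis using supp False by (simp add: g_def)
  qed
  have "(\<lambda>n. LINT x|lborel. g n x) \<longlonglongrightarrow> (LINT x|lborel. fd h x \<xi>)"
  proof (rule integral_dominated_convergence[where w = "\<lambda>x. B * indicator K2 x"])
    show "(\<lambda>x. fd h x \<xi>) \<in> borel_measurable lborel" using cfd by (simp add: borel_measurable_continuous_onI)
    have "continuous_on UNIV (g n)" for n
      unfolding g_def[abs_def] by (intro continuous_intros continuous_on_compose2[OF ch]) auto
    then show "g n \<in> borel_measurable lborel" for n by (simp add: borel_measurable_continuous_onI)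
    show "integrable lborel (\<lambda>x. B * indicator K2 x)"
      using borel_integrable_compact[OF K2, of "\<lambda>_. 1::real"] by (simp add: mult.commute)
    show "AE x in lborel. (\<lambda>n. g n x) \<longlonglongrightarrow> fd h x \<xi>" using lim by simp
    show "AE x in lborel. norm (g n x) \<le> B * indicator K2 x" for n using bd by simp
  qed
  then show ?thesis using ig LIMSEQ_unique by (simp add: LIMSEQ_const_iff)
qed

text \<open>Phrased with some compact \<open>K\<close> rather than with the closure of the support,
  so that one \<open>K\<close> can serve for several functions at once.\<close>

definition csupp :: "('a::topological_space, 'n::finite) chart \<Rightarrow> ('a \<Rightarrow> 'b::zero) \<Rightarrow> bool" where
  "csupp c f \<longleftrightarrow> (\<exists>K. compact K \<and> K \<subseteq> cdom c \<and> (\<forall>x. x \<notin> K \<longrightarrow> f x = 0))"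

lemma csupp_outside: "csupp c f \<Longrightarrow> x \<notin> cdom c \<Longrightarrow> f x = 0"
  unfolding csupp_def by blast

context
  fixes c :: "('a::t2_space, 'n::finite) chart"
  assumes c: "chart c"
begin

lemma csupp_image:
  assumes "csupp c f"
  obtains K where "compact K" "K \<subseteq> cimg c" "\<And>z. z \<in> cimg c \<Longrightarrow> z \<notin> K \<Longrightarrow> f (cinv c z) = 0"
proof -
  obtain K where K: "compact K" "K \<subseteq> cdom c" "\<And>x. x \<notin> K \<Longrightarrow> f x = 0" using assms unfolding csupp_def by blast
  have "continuous_on K (cmap c)"
    using chart_homeomorphism[OF c] K(2) by (auto simp: homeomorphism_def intro: continuous_on_subset)
  then have "compact (cmap c ` K)" using K(1) by (rule compact_continuous_image)
  moreover have "cmap c ` K \<subseteq> cimg c" using K(2) by (auto simp: cimg_def)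
  moreover have "f (cinv c z) = 0" if "z \<in> cimg c" "z \<notin> cmap c ` K" for z
  proof -
    have "cinv c z \<notin> K" using that c by (metis cmap_cinv imageI)
    then show ?thesis by (rule K(3))
  qed
  ultimately show ?thesis using that by blast
qed

lemma csupp_continuous:
  fixes f :: "'a \<Rightarrow> 'b::{topological_space, zero}"
  assumes "csupp c f" "continuous_on (cdom c) f"
  shows "continuous_on UNIV f"
proof -
  obtain K where K: "compact K" "K \<subseteq> cdom c" "\<And>x. x \<notin> K \<Longrightarrow> f x = 0" using assms(1) unfolding csupp_def by blast
  have "continuous_on (- K) f"
    using continuous_on_cong[of "- K" "- K" f "\<lambda>_. 0"] K(3) by simp
  moreover have "open (- K)" using compact_imp_closed[OF K(1)] by (rule open_Compl)
  ultimately have "continuous_on (cdom c \<union> - K) f"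
    using assms(2) open_cdom[OF c] by (intro continuous_on_open_Un) auto
  moreover have "cdom c \<union> - K = UNIV" using K(2) by auto
  ultimately show ?thesis by simp
qed

text \<open>As the support is compact inside the chart, extension by 0 gives a smooth function on
  the whole coordinate space, to which \<open>integral_fd_compact_support\<close> applies.\<close>

lemma integral_pd_csupp:
  assumes f: "sm c f" "csupp c f"
  shows "(LINT z|lborel. indicator (cimg c) z *\<^sub>R pd c \<xi> f (cinv c z)) = 0"
    and "integrable lborel (\<lambda>z. indicator (cimg c) z *\<^sub>R pd c \<xi> f (cinv c z))"
proof -
  obtain K where K: "compact K" "K \<subseteq> cimg c" "\<And>z. z \<in> cimg c \<Longrightarrow> z \<notin> K \<Longrightarrow> f (cinv c z) = 0"
    using csupp_image[OF f(2)] by blast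
  define h where "h z = (if z \<in> cimg c then f (cinv c z) else 0)" for z
  have h0: "h z = 0" if "z \<notin> K" for z using K that by (auto simp: h_def)
  have oK: "open (- K)" using compact_imp_closed[OF K(1)] by (rule open_Compl)
  have h: "smooth_on UNIV h"
  proof (rule smooth_on_local)
    fix z
    show "\<exists>T. open T \<and> z \<in> T \<and> smooth_on T h"
    proof (cases "z \<in> cimg c")
      case True
      have "smooth_on (cimg c) h"
        using f(1) unfolding sm_def by (rule smooth_on_cong[OF open_cimg[OF c], rotated]) (simp add: h_def)
      then show ?thesis using True open_cimg[OF c] by blast
    next
      case False
      have "smooth_on (- K) h"
        by (rule smooth_on_cong[OF oK _ smooth_on_const[of _ 0]]) (use h0 in auto)
      then show ?thesis using False K(2) oK by blast
    qed
  qed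
  have eq: "indicator (cimg c) z *\<^sub>R pd c \<xi> f (cinv c z) = fd h z \<xi>" for z
  proof (cases "z \<in> cimg c")
    case True
    have "fd h z = fd (f \<circ> cinv c) z"
      by (rule fd_cong_open[OF open_cimg[OF c] True]) (simp add: h_def)
    then show ?thesis using True c by (simp add: pd_def)
  next
    case False
    have "fd h z = fd (\<lambda>y. 0) z"
      by (rule fd_cong_open[OF oK]) (use h0 False K(2) in auto)
    then show ?thesis using False by simp
  qed
  show "(LINT z|lborel. indicator (cimg c) z *\<^sub>R pd c \<xi> f (cinv c z)) = 0"
    unfolding eq by (rule integral_fd_compact_support[OF h K(1) h0])
  have "continuous_on K (\<lambda>z. fd h z \<xi>)"
    by (rule continuous_on_subset[OF smooth_on_continuous[OF smooth_on_fd[OF h]]]) simp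
  from borel_integrable_compact[OF K(1) this]
  show "integrable lborel (\<lambda>z. indicator (cimg c) z *\<^sub>R pd c \<xi> f (cinv c z))"
    unfolding eq
  proof (elim back_subst[where P = "integrable lborel"])
    have "fd h z \<xi> = 0" if "z \<notin> K" for z
    proof -
      have "fd h z = fd (\<lambda>y. 0) z" by (rule fd_cong_open[OF oK]) (use h0 that in auto)
      then show ?thesis by simp
    qed
    then show "(\<lambda>z. indicator K z *\<^sub>R fd h z \<xi>) = (\<lambda>z. fd h z \<xi>)" by (auto simp: indicator_def fun_eq_iff)
  qed
qed

lemma integral_wirt_csupp:
  assumes f: "sm c f" "csupp c f"
  shows "has_bochner_integral lborel (\<lambda>z. indicator (cimg c) z *\<^sub>R wirt c j f (cinv c z)) 0"
    and "has_bochner_integral lborel (\<lambda>z. indicator (cimg c) z *\<^sub>R wirtbar c j f (cinv c z)) 0"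
proof -
  have h: "has_bochner_integral lborel (\<lambda>z. indicator (cimg c) z *\<^sub>R pd c \<xi> f (cinv c z)) 0" for \<xi>
    using integral_pd_csupp[OF f] by (simp add: has_bochner_integral_iff)
  have "has_bochner_integral lborel (\<lambda>z. (1/2) * (indicator (cimg c) z *\<^sub>R pd c (axis j 1) f (cinv c z) - \<i> * (indicator (cimg c) z *\<^sub>R pd c (axis j \<i>) f (cinv c z)))) ((1/2) * (0 - \<i> * 0))"
    by (intro has_bochner_integral_mult_right has_bochner_integral_diff h)
  then show "has_bochner_integral lborel (\<lambda>z. indicator (cimg c) z *\<^sub>R wirt c j f (cinv c z)) 0"
    by (simp add: wirt_eq[OF c] scaleR_conv_of_real diff_divide_distrib add_divide_distrib algebra_simps)
  have "has_bochner_integral lborel (\<lambda>z. (1/2) * (indicator (cimg c) z *\<^sub>R pd c (axis j 1) f (cinv c z) + \<i> * (indicator (cimg c) z *\<^sub>R pd c (axis j \<i>) f (cinv c z)))) ((1/2) * (0 + \<i> * 0))"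
    by (intro has_bochner_integral_mult_right has_bochner_integral_add h)
  then show "has_bochner_integral lborel (\<lambda>z. indicator (cimg c) z *\<^sub>R wirtbar c j f (cinv c z)) 0"
    by (simp add: wirtbar_eq[OF c] scaleR_conv_of_real diff_divide_distrib add_divide_distrib algebra_simps)
qed

end

context hermitian
begin

lemma integrable_csupp:
  assumes c: "c \<in> A" and f: "csupp c f" "continuous_on (cdom c) f"
  shows "integrable vol (f :: 'a \<Rightarrow> complex)"
proof -
  note ch = chartA[OF c]
  obtain K where K: "compact K" "K \<subseteq> cimg c" "\<And>z. z \<in> cimg c \<Longrightarrow> z \<notin> K \<Longrightarrow> f (cinv c z) = 0"
    using csupp_image[OF ch f(1)] by blast
  have m: "f \<in> borel_measurable borel"
    using csupp_continuous[OF ch f] by (rule borel_measurable_continuous_onI)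
  have "continuous_on K (\<lambda>z. dens c z *\<^sub>R f (cinv c z))"
  proof (intro continuous_intros)
    show "continuous_on K (dens c)" using continuous_on_dens[OF c] K(2) by (rule continuous_on_subset)
    have "continuous_on (cimg c) (cinv c)" using chart_homeomorphism[OF ch] by (simp add: homeomorphism_def)
    from continuous_on_compose2[OF f(2) continuous_on_subset[OF this K(2)]]
    have "cinv c ` K \<subseteq> cdom c" using K(2) cinv_in[OF ch] by blast
    then show "continuous_on K (\<lambda>z. f (cinv c z))" by fact
  qed
  from borel_integrable_compact[OF K(1) this]
  have "integrable lborel (\<lambda>z. indicator (cimg c) z *\<^sub>R (dens c z *\<^sub>R f (cinv c z)))"
    by (elim back_subst[where P = "integrable lborel"]) (use K in \<open>auto simp: indicator_def fun_eq_iff\<close>)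
  then show ?thesis using integral_vol_chart(2)[OF c m csupp_outside[OF f(1)]] by blast
qed

text \<open>The volume density is a constant times the determinant of the metric, so the integrand
  in coordinates is a constant times a sum of coordinate derivatives, each with integral 0.\<close>

lemma integral_divergence:
  assumes c: "c \<in> A" and f: "csupp c f" "continuous_on (cdom c) f"
    and F: "\<And>j. sm c (F j)" "\<And>j. csupp c (F j)" and G: "\<And>j. sm c (G j)" "\<And>j. csupp c (G j)"
    and eq: "\<And>x. x \<in> cdom c \<Longrightarrow> det (herm_mat (\<omega> c x)) * f x =
      (\<Sum>j\<in>UNIV. wirt c j (F j) x) + (\<Sum>j\<in>UNIV. wirtbar c j (G j) x)"
  shows "integral\<^sup>L vol f = 0"
proof -
  note ch = chartA[OF c]
  have m: "f \<in> borel_measurable borel"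
    using csupp_continuous[OF ch f] by (rule borel_measurable_continuous_onI)
  have "has_bochner_integral lborel (\<lambda>z. 2 ^ CARD('n) * ((\<Sum>j\<in>UNIV. indicator (cimg c) z *\<^sub>R wirt c j (F j) (cinv c z)) +
      (\<Sum>j\<in>UNIV. indicator (cimg c) z *\<^sub>R wirtbar c j (G j) (cinv c z)))) (2 ^ CARD('n) * ((\<Sum>j\<in>(UNIV::'n set). 0) + (\<Sum>j\<in>(UNIV::'n set). 0)))"
    by (intro has_bochner_integral_mult_right has_bochner_integral_add has_bochner_integral_sum integral_wirt_csupp[OF ch] F G)
  moreover have "2 ^ CARD('n) * ((\<Sum>j\<in>UNIV. indicator (cimg c) z *\<^sub>R wirt c j (F j) (cinv c z)) +
      (\<Sum>j\<in>UNIV. indicator (cimg c) z *\<^sub>R wirtbar c j (G j) (cinv c z))) = indicator (cimg c) z *\<^sub>R (dens c z *\<^sub>R f (cinv c z))" for z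
  proof (cases "z \<in> cimg c")
    case True
    then show ?thesis using eq[of "cinv c z"] complex_of_dens[OF c, of "cinv c z"] ch
      by (simp add: scaleR_conv_of_real mult.assoc)
  qed simp
  ultimately have "has_bochner_integral lborel (\<lambda>z. indicator (cimg c) z *\<^sub>R (dens c z *\<^sub>R f (cinv c z)))
      (2 ^ CARD('n) * ((\<Sum>j\<in>(UNIV::'n set). 0) + (\<Sum>j\<in>(UNIV::'n set). 0)))"
    by (simp only:)
  then have "(LINT z|lborel. indicator (cimg c) z *\<^sub>R (dens c z *\<^sub>R f (cinv c z))) = 0"
    using has_bochner_integral_integral_eq by fastforce
  then show ?thesis using integral_vol_chart(1)[OF c m csupp_outside[OF f(1)]] by simp
qed

end

section \<open>Bump functions\<close>

text \<open>The powers of \<open>inverse t\<close> make this family closed under differentiation up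
  to linear combinations, so smoothness is one induction over all \<open>k\<close> at once.\<close>

definition flat :: "nat \<Rightarrow> real \<Rightarrow> real" where
  "flat k t = (if 0 < t then inverse t ^ k * exp (- inverse t) else 0)"

lemma power_le_fact_exp: "0 \<le> x \<Longrightarrow> x ^ k \<le> fact k * exp (x :: real)"
proof -
  assume x: "0 \<le> x"
  have s: "summable (\<lambda>n. x ^ n /\<^sub>R fact n)" by (rule summable_exp_generic)
  have "x ^ k /\<^sub>R fact k = (\<Sum>n\<in>{k}. x ^ n /\<^sub>R fact n)" by simp
  also have "\<dots> \<le> (\<Sum>n. x ^ n /\<^sub>R fact n)"
    by (rule sum_le_suminf[OF s]) (use x in auto)
  also have "\<dots> = exp x" by (simp add: exp_def)
  finally show ?thesis by (simp add: field_simps)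
qed

lemma flat_nonneg: "0 \<le> flat k t"
  by (simp add: flat_def)

text \<open>This is \<open>power_le_fact_exp\<close> with exponent \<open>k + 2\<close> at
  \<open>inverse t\<close>. The square on the right makes the difference quotient at 0 tend to
  0.\<close>

lemma flat_bound: "flat k t \<le> fact (k + 2) * t\<^sup>2"
proof (cases "0 < t")
  case True
  have "inverse t ^ k * exp (- inverse t) = inverse t ^ (k + 2) * exp (- inverse t) * t\<^sup>2"
    using True by (simp add: power2_eq_square field_simps)
  also have "\<dots> \<le> (fact (k + 2) * exp (inverse t)) * exp (- inverse t) * t\<^sup>2"
    using True by (intro mult_right_mono power_le_fact_exp) auto
  also have "\<dots> = fact (k + 2) * t\<^sup>2" by (simp add: mult.assoc flip: exp_add)
  finally show ?thesis using True by (simp add: flat_def)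
qed (simp add: flat_def)

lemma flat_derivative: "(flat k has_real_derivative flat (k + 2) t - real k * flat (k + 1) t) (at t)"
proof (cases t "0 :: real" rule: linorder_cases)
  case less
  have "((\<lambda>t. 0) has_real_derivative 0) (at t)" by simp
  then have "(flat k has_real_derivative 0) (at t)"
    by (rule has_field_derivative_transform_within_open[of _ _ _ "{..<0}"]) (use less in \<open>auto simp: flat_def\<close>)
  then show ?thesis using less by (simp add: flat_def)
next
  case greater
  have "((\<lambda>t. inverse t ^ k * exp (- inverse t)) has_real_derivative
      real k * (- (inverse t)\<^sup>2) * inverse t ^ (k - 1) * exp (- inverse t) + inverse t ^ k * (exp (- inverse t) * (inverse t)\<^sup>2)) (at t)"
    using greater by (auto intro!: derivative_eq_intros simp: power2_eq_square)
  also have "real k * (- (inverse t)\<^sup>2) * inverse t ^ (k - 1) * exp (- inverse t) + inverse t ^ k * (exp (- inverse t) * (inverse t)\<^sup>2)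
     = flat (k + 2) t - real k * flat (k + 1) t"
    using greater by (cases k) (simp_all add: flat_def power2_eq_square algebra_simps)
  finally have "((\<lambda>t. inverse t ^ k * exp (- inverse t)) has_real_derivative flat (k + 2) t - real k * flat (k + 1) t) (at t)" .
  then show ?thesis
    by (rule has_field_derivative_transform_within_open[of _ _ _ "{0<..}"]) (use greater in \<open>auto simp: flat_def\<close>)
next
  case equal
  have "((\<lambda>h. flat k h / h) \<longlongrightarrow> 0) (at 0)"
  proof (rule Lim_null_comparison)
    have "norm (flat k h / h) \<le> fact (k + 2) * \<bar>h\<bar>" if "h \<noteq> 0" for h
    proof -
      have "flat k h \<le> fact (k + 2) * \<bar>h\<bar> * \<bar>h\<bar>"
        using flat_bound[of k h] by (simp only: power2_eq_square mult.assoc abs_mult_self_eq)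
      then show ?thesis using that flat_nonneg[of k h] by (simp only: real_norm_def abs_divide pos_divide_le_eq abs_of_nonneg zero_less_abs_iff simp_thms)
    qed
    then show "\<forall>\<^sub>F h in at 0. norm (flat k h / h) \<le> fact (k + 2) * \<bar>h\<bar>"
      by (auto simp: eventually_at intro!: exI[of _ 1])
    show "((\<lambda>h. fact (k + 2) * \<bar>h\<bar>) \<longlongrightarrow> (0::real)) (at 0)"
      by (auto intro!: tendsto_eq_intros)
  qed
  then show ?thesis using equal by (simp add: DERIV_def flat_def[of _ 0])
qed

lemma smooth_flat: "smooth_on UNIV (flat k)"
proof -
  have d: "(flat k has_derivative (\<lambda>v. v * (flat (k + 2) t - real k * flat (k + 1) t))) (at t)" for k t
    using flat_derivative[of k t] by (simp add: has_field_derivative_def mult.commute[of _ "flat _ _ - _"] mult_commute_abs)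
  have "Ck_on m UNIV (flat k)" for m
  proof (induction m arbitrary: k)
    case 0
    show ?case using has_derivative_continuous[OF d] by (simp add: continuous_at_imp_continuous_on)
  next
    case (Suc m)
    have "Ck_on m UNIV (\<lambda>t. v * (flat (k + 2) t + (- real k) * flat (k + 1) t))" for v
      by (intro Ck_on_mult Ck_on_add Ck_on_const Suc open_UNIV)
    then show ?case using d[of k] fd_eq[OF d[of k]] by (auto simp: differentiable_def)
  qed
  then show ?thesis by (simp add: smooth_on_def)
qed

text \<open>The quotient of \<open>flat 0 (2 - t)\<close> by its sum with
  \<open>flat 0 (t - 1)\<close>; the denominator is positive because \<open>2 - t\<close> and
  \<open>t - 1\<close> are never both nonpositive.\<close>

lemma ex_cutoff:
  "\<exists>\<beta> :: real \<Rightarrow> real. smooth_on UNIV \<beta> \<and> (\<forall>t. 0 \<le> \<beta> t) \<and> (\<forall>t\<le>1. \<beta> t = 1) \<and> (\<forall>t\<ge>2. \<beta> t = 0)"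
proof -
  let ?d = "\<lambda>t. flat 0 (2 - t) + flat 0 (t - 1)"
  have d: "?d t > 0" for t
    by (cases "t < 2") (auto simp: flat_def intro: add_pos_nonneg)
  have sm: "smooth_on UNIV (\<lambda>t. flat 0 (a * t + b))" for a b
    by (rule smooth_on_compose[OF open_UNIV open_UNIV subset_UNIV
      smooth_on_add[OF open_UNIV smooth_on_bounded_linear[OF open_UNIV bounded_linear_mult_right] smooth_on_const] smooth_flat])
  have "smooth_on UNIV (\<lambda>t. flat 0 (2 - t) * inverse (?d t))"
    using sm[of "-1" 2] sm[of 1 "-1"] d by (intro smooth_on_mult smooth_on_inverse smooth_on_add) (auto simp: less_imp_neq[symmetric] dest: less_imp_neq)
  moreover have "0 \<le> flat 0 (2 - t) * inverse (?d t)" for t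
    using d[of t] flat_nonneg by (simp add: less_imp_le)
  moreover have "flat 0 (2 - t) * inverse (?d t) = 1" if "t \<le> 1" for t
    using that d[of t] by (simp add: flat_def)
  moreover have "flat 0 (2 - t) * inverse (?d t) = 0" if "t \<ge> 2" for t
    using that by (simp add: flat_def)
  ultimately show ?thesis by blast
qed

lemma smooth_on_norm_square:
  fixes p :: "'e::euclidean_space"
  shows "smooth_on UNIV (\<lambda>z. (norm (z - p))\<^sup>2)"
proof -
  have "(norm (z - p))\<^sup>2 = (\<Sum>b\<in>Basis. (z \<bullet> b + - (p \<bullet> b)) * (z \<bullet> b + - (p \<bullet> b)))" for z
    unfolding power2_norm_eq_inner euclidean_inner[of "z - p" "z - p"] by (simp add: inner_diff_left)
  moreover have "smooth_on UNIV (\<lambda>z. \<Sum>b\<in>Basis. (z \<bullet> b + - (p \<bullet> b)) * (z \<bullet> b + - (p \<bullet> b)))"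
    by (intro smooth_on_sum smooth_on_mult smooth_on_add smooth_on_bounded_linear bounded_linear_inner_left smooth_on_const open_UNIV)
  ultimately show ?thesis by simp
qed

context atlas
begin

text \<open>Inside the domain of \<open>c\<close> smoothness is carried over by the transition map;
  every other point has a neighbourhood where \<open>f\<close> vanishes, as compact sets are closed
  in a Hausdorff space.\<close>

lemma sm_local_zero:
  assumes c: "c \<in> A" "c' \<in> A" and f: "sm c f" and K: "compact K" "K \<subseteq> cdom c" "\<And>x. x \<notin> K \<Longrightarrow> f x = 0"
  shows "sm c' f"
  unfolding sm_def
proof (rule smooth_on_local)
  note ch = chartA[OF c(1)] chartA[OF c(2)]
  have oK: "open (- K)" using compact_imp_closed[OF K(1)] by (rule open_Compl)
  fix z assume z: "z \<in> cimg c'"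
  show "\<exists>T. open T \<and> z \<in> T \<and> smooth_on T (f \<circ> cinv c')"
  proof (cases "cinv c' z \<in> cdom c")
    case True
    have "smooth_on (cmap c' ` (cdom c' \<inter> cdom c)) (f \<circ> cinv c')"
      using sm_overlap[OF c(2,1) f] unfolding sm_rchart_iff[OF ch(2) open_cdom[OF ch(1)]] .
    moreover have "z \<in> cmap c' ` (cdom c' \<inter> cdom c)" using z True ch by (intro image_eqI[of _ _ "cinv c' z"]) auto
    ultimately show ?thesis using open_overlap[OF c(2,1)] by blast
  next
    case False
    have "smooth_on (cmap c' ` (cdom c' \<inter> - K)) (f \<circ> cinv c')"
    proof (rule smooth_on_cong[OF _ _ smooth_on_const[of _ 0]])
      show "open (cmap c' ` (cdom c' \<inter> - K))" using open_cimg_rchart[OF ch(2) oK] by (simp add: cimg_rchart[OF ch(2) oK])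
      show "0 = (f \<circ> cinv c') y" if "y \<in> cmap c' ` (cdom c' \<inter> - K)" for y using that K(3) ch(2) by auto
    qed
    moreover have "z \<in> cmap c' ` (cdom c' \<inter> - K)" using z False K(2) ch by (intro image_eqI[of _ _ "cinv c' z"]) auto
    moreover have "open (cmap c' ` (cdom c' \<inter> - K))" using open_cimg_rchart[OF ch(2) oK] by (simp add: cimg_rchart[OF ch(2) oK])
    ultimately show ?thesis by blast
  qed
qed

definition bump :: "('a, 'n) chart \<Rightarrow> ('a \<Rightarrow> real) \<Rightarrow> 'a set \<Rightarrow> 'a set \<Rightarrow> bool" where
  "bump c \<rho> V K \<longleftrightarrow> c \<in> A \<and> open V \<and> compact K \<and> K \<subseteq> cdom c \<and> (\<forall>x. 0 \<le> \<rho> x) \<and>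
     (\<forall>x\<in>V. \<rho> x = 1) \<and> (\<forall>x. x \<notin> K \<longrightarrow> \<rho> x = 0) \<and> (\<forall>c'\<in>A. sm c' (\<lambda>x. of_real (\<rho> x)))"

lemma ex_bump: "\<exists>c \<rho> V K. bump c \<rho> V K \<and> x0 \<in> V"
proof -
  obtain c where c: "c \<in> A" "x0 \<in> cdom c" using atlas_cover by blast
  note ch = chartA[OF c(1)]
  obtain \<beta> :: "real \<Rightarrow> real" where \<beta>: "smooth_on UNIV \<beta>" "\<And>t. 0 \<le> \<beta> t" "\<And>t. t \<le> 1 \<Longrightarrow> \<beta> t = 1" "\<And>t. t \<ge> 2 \<Longrightarrow> \<beta> t = 0"
    using ex_cutoff by blast
  let ?p = "cmap c x0"
  obtain e where e: "e > 0" "cball ?p e \<subseteq> cimg c"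
    using open_contains_cball open_cimg[OF ch] cmap_in[OF ch c(2)] by blast
  \<comment> \<open>With this scaling the argument of \<open>\<beta>\<close> is at most 1 up to
    distance \<open>e / 2\<close> and at least 2 from distance \<open>e\<close> on.\<close>
  define g where "g z = \<beta> (4 / e\<^sup>2 * (norm (z - ?p))\<^sup>2)" for z
  define \<rho> where "\<rho> x = (if x \<in> cdom c then g (cmap c x) else 0)" for x
  let ?K = "cinv c ` cball ?p e" and ?V = "cdom c \<inter> cmap c -` ball ?p (e / 2)"
  have hom: "continuous_on (cdom c) (cmap c)" "continuous_on (cimg c) (cinv c)"
    using chart_homeomorphism[OF ch] by (auto simp: homeomorphism_def)
  have K: "compact ?K" "?K \<subseteq> cdom c"
    using continuous_on_subset[OF hom(2) e(2)] e(2) cinv_in[OF ch] by (auto intro: compact_continuous_image)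
  have g0: "g z = 0" if "z \<notin> cball ?p e" for z
  proof -
    have "e\<^sup>2 \<le> (norm (z - ?p))\<^sup>2" using that e by (intro power_mono) (auto simp: dist_norm norm_minus_commute)
    then have "2 * e\<^sup>2 \<le> 4 * (norm (z - ?p))\<^sup>2" using zero_le_power2[of "norm (z - ?p)"] by linarith
    then have "2 \<le> 4 / e\<^sup>2 * (norm (z - ?p))\<^sup>2" using e by (simp add: pos_le_divide_eq)
    then show ?thesis unfolding g_def by (rule \<beta>(4))
  qed
  have \<rho>0: "\<rho> x = 0" if "x \<notin> ?K" for x
  proof (cases "x \<in> cdom c")
    case True
    then have "cmap c x \<notin> cball ?p e" using that ch by (metis cinv_cmap imageI)
    then show ?thesis using True g0 by (simp add: \<rho>_def)
  qed (simp add: \<rho>_def)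
  have \<rho>1: "\<rho> x = 1" if "x \<in> ?V" for x
  proof -
    have "norm (cmap c x - ?p) \<le> e / 2" using that by (auto simp: dist_norm norm_minus_commute)
    then have "(norm (cmap c x - ?p))\<^sup>2 \<le> (e / 2)\<^sup>2" by (intro power_mono) auto
    then have "4 / e\<^sup>2 * (norm (cmap c x - ?p))\<^sup>2 \<le> 1" using e by (simp add: field_simps)
    then show ?thesis using that \<beta>(3) by (simp add: \<rho>_def g_def)
  qed
  have "smooth_on UNIV g" unfolding g_def[abs_def]
    by (rule smooth_on_compose[OF open_UNIV open_UNIV _ smooth_on_mult[OF open_UNIV smooth_on_const smooth_on_norm_square] \<beta>(1)]) simp
  then have "smooth_on (cimg c) g" by (rule smooth_on_subset) simp
  then have "smooth_on (cimg c) (\<rho> \<circ> cinv c)"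
    by (rule smooth_on_cong[OF open_cimg[OF ch], rotated]) (simp add: \<rho>_def ch)
  then have sm: "sm c (\<lambda>x. of_real (\<rho> x))" by (rule sm_of_real[OF ch])
  have sm': "sm c' (\<lambda>x. of_real (\<rho> x))" if "c' \<in> A" for c'
    by (rule sm_local_zero[OF c(1) that sm K]) (simp add: \<rho>0)
  have V: "open ?V" by (rule continuous_open_preimage[OF hom(1) open_cdom[OF ch] open_ball])
  have x0: "x0 \<in> ?V" using c e by simp
  have pos: "0 \<le> \<rho> x" for x using \<beta>(2) by (simp add: \<rho>_def g_def)
  have "bump c \<rho> ?V ?K"
    unfolding bump_def by (intro conjI allI ballI impI c(1) V K pos \<rho>1 \<rho>0 sm')
  then show ?thesis using x0 by (intro exI conjI)
qed

text \<open>Derivatives at a point of \<open>T\<close> can be computed in the chart restricted to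
  \<open>T\<close>, where all coefficients are constantly 0.\<close>

lemma ext_d_local_zero:
  assumes T: "open T" and v: "\<And>y c. y \<in> T \<Longrightarrow> v c y = 0" and c: "c \<in> A" and x: "x \<in> T"
  shows "ext_d v c x = 0"
proof (cases "x \<in> cdom c")
  case True
  note ch = chartA[OF c]
  have x': "x \<in> cdom (rchart c T)" using True x by simp
  have "DE (\<lambda>f. wirt c k f x) (v c) = DE (\<lambda>f. wirt (rchart c T) k f x) (v c)"
     "DE (\<lambda>f. wirtbar c k f x) (v c) = DE (\<lambda>f. wirtbar (rchart c T) k f x) (v c)" for k
    by (simp_all add: DE_def wirt_rchart[OF ch T True x] wirtbar_rchart[OF ch T True x])
  moreover have "DE (\<lambda>f. wirt (rchart c T) k f x) (v c) = DE (\<lambda>f. wirt (rchart c T) k f x) (\<lambda>_. 0)"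
     "DE (\<lambda>f. wirtbar (rchart c T) k f x) (v c) = DE (\<lambda>f. wirtbar (rchart c T) k f x) (\<lambda>_. 0)" for k
    using dv_wirt[OF chart_rchart[OF ch T] x'] dv_wirtbar[OF chart_rchart[OF ch T] x'] v
    by (metis (no_types, lifting) DE_cong[OF chart_rchart[OF ch T]] IntD2 cdom_rchart)+
  ultimately show ?thesis using True by (simp add: ext_d_def del_apply delbar_apply DE_wirt_0)
qed (simp add: ext_d_def del_def delbar_def)

end

section \<open>Formal adjoints\<close>

lemma form_apply:
  fixes u v :: "('a, 'n) form"
  shows "(u + v) c x = u c x + v c x" "(u - v) c x = u c x - v c x" "(- u) c x = - u c x" "(0 :: ('a, 'n) form) c x = 0"
  by simp_all

context atlas
begin

lemma DE_add_wirt: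
  assumes u: "smooth_form A u" and v: "smooth_form A v" and c: "c \<in> A" "x \<in> cdom c"
  shows "DE (\<lambda>f. wirt c k f x) (u c + v c) = DE (\<lambda>f. wirt c k f x) (u c) + DE (\<lambda>f. wirt c k f x) (v c)"
    and "DE (\<lambda>f. wirtbar c k f x) (u c + v c) = DE (\<lambda>f. wirtbar c k f x) (u c) + DE (\<lambda>f. wirtbar c k f x) (v c)"
  using DE_simps(1)[OF chartA[OF c(1)] dv_wirt[OF chartA[OF c(1)] c(2)] sf_smE[OF u c(1)] sf_smE[OF v c(1)]]
    DE_simps(1)[OF chartA[OF c(1)] dv_wirtbar[OF chartA[OF c(1)] c(2)] sf_smE[OF u c(1)] sf_smE[OF v c(1)]]
  by (simp_all add: plus_fun_def)

lemma del_add: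
  assumes u: "smooth_form A u" and v: "smooth_form A v"
  shows "del (u + v) = del u + del v" "delbar (u + v) = delbar u + delbar v"
proof -
  note uv = smooth_form_add[OF u v]
  show "del (u + v) = del u + del v"
    by (rule smooth_form_eqI) (simp_all add: uv u v smooth_form_del smooth_form_add del_apply DE_add_wirt[OF u v] ap_add sum.distrib)
  show "delbar (u + v) = delbar u + delbar v"
    by (rule smooth_form_eqI) (simp_all add: uv u v smooth_form_delbar smooth_form_add delbar_apply DE_add_wirt[OF u v] ap_add sum.distrib)
qed

lemma ext_d_add: "smooth_form A u \<Longrightarrow> smooth_form A v \<Longrightarrow> ext_d (u + v) = ext_d u + ext_d v"
  by (simp add: ext_d_def del_add)

end

context hermitian
begin

definition Lam_form :: "('a, 'n) oper" where
  "Lam_form = opf (\<lambda>c x. Lam (\<omega> c x))"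

text \<open>The formal adjoint of \<open>d\<close>.\<close>

definition codiff :: "('a, 'n) oper" where
  "codiff u = fscale (\<lambda>_. - \<i>) (Lam_form (del u - delbar u) - (del (Lam_form u) - delbar (Lam_form u)))
     - opf (\<lambda>c x. adj (\<omega> c x) (wd (ext_d \<omega> c x)) * wd (\<omega> c x) - wd (\<omega> c x) * adj (\<omega> c x) (wd (ext_d \<omega> c x))) u"

lemma tensor_Lam: "tensor (\<lambda>c x. Lam (\<omega> c x))"
  unfolding Lam_def by (rule tensor_adj[OF tensor_wd[OF smooth_\<omega>]])

lemma smooth_form_Lam: "smooth_form A u \<Longrightarrow> smooth_form A (Lam_form u)"
  unfolding Lam_form_def by (rule smooth_form_opf[OF tensor_Lam])

lemma smooth_form_codiff: "smooth_form A u \<Longrightarrow> smooth_form A (codiff u)"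
  unfolding codiff_def
  by (intro smooth_form_diff smooth_form_fscale_const smooth_form_Lam smooth_form_del smooth_form_delbar
      smooth_form_opf tensor_simps tensor_mult tensor_adj tensor_wd smooth_\<omega> smooth_form_ext_d)

text \<open>Regroups \<open>codiff\<close> into the two halves that \<open>adjoint_del\<close> and
  \<open>adjoint_delbar\<close> produce.\<close>

lemma codiff_apply:
  assumes u: "smooth_form A u" and c: "c \<in> A" and x: "x \<in> cdom c"
  shows "codiff u c x =
    (scl \<i> (ap (Lam (\<omega> c x)) (\<Sum>j\<in>UNIV. ap (Eb j) (DE (\<lambda>f. wirtbar c j f x) (u c)))
        - (\<Sum>j\<in>UNIV. ap (Eb j) (DE (\<lambda>f. wirtbar c j f x) (\<lambda>y. ap (Lam (\<omega> c y)) (u c y)))))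
      - ap (adj (\<omega> c x) (wd (\<Sum>j\<in>UNIV. ap (E j) (DE (\<lambda>f. wirt c j f x) (\<omega> c)))) * wd (\<omega> c x)
           - wd (\<omega> c x) * adj (\<omega> c x) (wd (\<Sum>j\<in>UNIV. ap (E j) (DE (\<lambda>f. wirt c j f x) (\<omega> c))))) (u c x)) +
    (scl (- \<i>) (ap (Lam (\<omega> c x)) (\<Sum>j\<in>UNIV. ap (E j) (DE (\<lambda>f. wirt c j f x) (u c)))
        - (\<Sum>j\<in>UNIV. ap (E j) (DE (\<lambda>f. wirt c j f x) (\<lambda>y. ap (Lam (\<omega> c y)) (u c y)))))
      - ap (adj (\<omega> c x) (wd (\<Sum>j\<in>UNIV. ap (Eb j) (DE (\<lambda>f. wirtbar c j f x) (\<omega> c)))) * wd (\<omega> c x)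
           - wd (\<omega> c x) * adj (\<omega> c x) (wd (\<Sum>j\<in>UNIV. ap (Eb j) (DE (\<lambda>f. wirtbar c j f x) (\<omega> c))))) (u c x))"
proof -
  note ch = chartA[OF c]
  have L: "DE (\<lambda>f. wirt c j f x) (Lam_form u c) = DE (\<lambda>f. wirt c j f x) (\<lambda>y. ap (Lam (\<omega> c y)) (u c y))"
    "DE (\<lambda>f. wirtbar c j f x) (Lam_form u c) = DE (\<lambda>f. wirtbar c j f x) (\<lambda>y. ap (Lam (\<omega> c y)) (u c y))" for j
    by (rule DE_cong[OF ch dv_wirt[OF ch x]] DE_cong[OF ch dv_wirtbar[OF ch x]], simp add: Lam_form_def c)+
  note m = metric_\<omega>[OF c x]
  have Lf: "Lam_form p c x = ap (Lam (\<omega> c x)) (p c x)" for p by (simp add: Lam_form_def c x)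
  show ?thesis
    unfolding del_apply[OF x, symmetric] delbar_apply[OF x, symmetric] L[symmetric]
    unfolding codiff_def ext_d_def form_apply fscale_apply opf_apply[OF c x] Lf
    by (simp only: wd_add adj_simps[OF m] distrib_left distrib_right ap_simps ap_add ap_diff ap_minus scl_simps
        diff_conv_add_uminus minus_add_distrib minus_minus add_ac)
qed

text \<open>The sum of \<open>adjoint_del\<close> and \<open>adjoint_delbar\<close>: the pointwise
  failure of adjointness is a divergence.\<close>

lemma adjoint_ext_d:
  assumes v: "smooth_form A v" and u: "smooth_form A u" and c: "c \<in> A" and x: "x \<in> cdom c"
  shows "det (herm_mat (\<omega> c x)) * (inner_at A \<omega> x (ext_d v) u - inner_at A \<omega> x v (codiff u)) =
    (\<Sum>j\<in>UNIV. wirt c j (\<lambda>y. det (herm_mat (\<omega> c y)) * ext_inner (\<omega> c y) (v c y) (ap (Es (\<omega> c y) j) (u c y))) x) +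
    (\<Sum>j\<in>UNIV. wirtbar c j (\<lambda>y. det (herm_mat (\<omega> c y)) * ext_inner (\<omega> c y) (v c y) (ap (Ebs (\<omega> c y) j) (u c y))) x)"
proof -
  have d: "ext_d v c x = (\<Sum>j\<in>UNIV. ap (E j) (DE (\<lambda>f. wirt c j f x) (v c))) + (\<Sum>j\<in>UNIV. ap (Eb j) (DE (\<lambda>f. wirtbar c j f x) (v c)))"
    unfolding ext_d_def form_apply del_apply[OF x] delbar_apply[OF x] ..
  show ?thesis
    unfolding adjoint_del[OF c x sf_smE[OF v c] sf_smE[OF u c]] adjoint_delbar[OF c x sf_smE[OF v c] sf_smE[OF u c]]
      inner_at_eq[OF smooth_form_ext_d[OF v] u c x] inner_at_eq[OF v smooth_form_codiff[OF u] c x] codiff_apply[OF u c x] d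
    unfolding ext_inner_simps(1,2) by (simp only: algebra_simps)
qed

lemma inner_at_0:
  assumes "u (chart_at A x) x = 0 \<or> v (chart_at A x) x = 0"
  shows "inner_at A \<omega> x u v = 0"
  using assms unfolding inner_at_def Let_def by (metis ext_inner_simps(9,10))

lemma inner_at_add: "inner_at A \<omega> x (u + v) w = inner_at A \<omega> x u w + inner_at A \<omega> x v w"
  by (simp add: inner_at_def Let_def ext_inner_simps)

lemma inner_at_diff: "inner_at A \<omega> x w (u - v) = inner_at A \<omega> x w u - inner_at A \<omega> x w v"
  by (simp add: inner_at_def Let_def ext_inner_simps)

lemma continuous_inner_at:
  assumes u: "smooth_form A u" and v: "smooth_form A v" and c: "c \<in> A"
  shows "continuous_on (cdom c) (\<lambda>x. inner_at A \<omega> x u v)"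
proof -
  have "continuous_on (cdom c) (\<lambda>x. ext_inner (\<omega> c x) (u c x) (v c x))"
    by (rule sm_continuous[OF chartA[OF c] sm_ext_inner[OF c sf_smE[OF u c] sf_smE[OF v c]]])
  then show ?thesis by (rule continuous_on_eq) (simp add: inner_at_eq[OF u v c])
qed

context
  fixes u :: "('a, 'n) form"
  assumes u: "smooth_form A u"
begin

text \<open>Integrability is part of the property so that it is preserved by sums.\<close>

private definition good :: "('a, 'n) form \<Rightarrow> bool" where
  "good v \<longleftrightarrow> integrable vol (\<lambda>x. inner_at A \<omega> x (ext_d v) u) \<and> integrable vol (\<lambda>x. inner_at A \<omega> x v (codiff u)) \<and>
     L2_inner A \<omega> (ext_d v) u = L2_inner A \<omega> v (codiff u)"

text \<open>The form and its differential vanish off \<open>K\<close>, hence so do both pairings and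
  the vector fields in \<open>adjoint_ext_d\<close>, and the divergence theorem of the chart
  applies.\<close>

private lemma good_chart:
  assumes v: "smooth_form A v" and c: "c \<in> A" and K: "compact K" "K \<subseteq> cdom c" "\<And>x c'. x \<notin> K \<Longrightarrow> v c' x = 0"
  shows "good v"
proof -
  note ch = chartA[OF c]
  have oK: "open (- K)" using compact_imp_closed[OF K(1)] by (rule open_Compl)
  have d0: "ext_d v c' x = 0" if "x \<notin> K" "c' \<in> A" for c' x
    by (rule ext_d_local_zero[OF oK]) (use K(3) that in auto)
  let ?f = "\<lambda>x. inner_at A \<omega> x (ext_d v) u" and ?g = "\<lambda>x. inner_at A \<omega> x v (codiff u)"
  have f0: "?f x = 0" "?g x = 0" if "x \<notin> K" for x
    by (rule inner_at_0, use d0[OF that chart_at(1)] K(3)[OF that] in simp)+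
  have s: "csupp c ?f" "csupp c ?g"
    unfolding csupp_def by (rule exI[of _ K], simp add: K f0)+
  have co: "continuous_on (cdom c) ?f" "continuous_on (cdom c) ?g"
    by (intro continuous_inner_at smooth_form_ext_d smooth_form_codiff u v c)+
  have i: "integrable vol ?f" "integrable vol ?g" by (intro integrable_csupp[OF c] s co)+
  have "integral\<^sup>L vol (\<lambda>x. ?f x - ?g x) = 0"
  proof (rule integral_divergence[OF c])
    show "csupp c (\<lambda>x. ?f x - ?g x)"
      unfolding csupp_def by (rule exI[of _ K], simp add: K f0)
    show "continuous_on (cdom c) (\<lambda>x. ?f x - ?g x)" by (intro continuous_on_diff co)
    have su: "csupp c (\<lambda>y. det (herm_mat (\<omega> c y)) * ext_inner (\<omega> c y) (v c y) (U y))" for U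
      unfolding csupp_def
    proof (intro exI[of _ K] conjI allI impI K(1,2))
      fix x assume "x \<notin> K"
      from K(3)[OF this, of c] show "det (herm_mat (\<omega> c x)) * ext_inner (\<omega> c x) (v c x) (U x) = 0"
        by (simp only: ext_inner_simps mult_zero_right)
    qed
    show "csupp c (\<lambda>y. det (herm_mat (\<omega> c y)) * ext_inner (\<omega> c y) (v c y) (ap (Es (\<omega> c y) j) (u c y)))"
      "csupp c (\<lambda>y. det (herm_mat (\<omega> c y)) * ext_inner (\<omega> c y) (v c y) (ap (Ebs (\<omega> c y) j) (u c y)))" for j
      by (rule su)+
    show "sm c (\<lambda>y. det (herm_mat (\<omega> c y)) * ext_inner (\<omega> c y) (v c y) (ap (Es (\<omega> c y) j) (u c y)))"
      "sm c (\<lambda>y. det (herm_mat (\<omega> c y)) * ext_inner (\<omega> c y) (v c y) (ap (Ebs (\<omega> c y) j) (u c y)))" for j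
      by (intro sm_mult[OF ch] sm_dH[OF c] sm_ext_inner[OF c] smE_ap[OF ch] smop_Es[OF c] smop_Ebs[OF c] sf_smE u v c)+
  qed (rule adjoint_ext_d[OF v u c])
  then have "integral\<^sup>L vol ?f = integral\<^sup>L vol ?g" using i by simp
  then show ?thesis using i by (simp add: good_def L2_inner_def)
qed

private lemma good_add:
  assumes "smooth_form A v" "smooth_form A w" "good v" "good w"
  shows "good (v + w)"
  using assms by (simp add: good_def L2_inner_def ext_d_add inner_at_add)

text \<open>A cut-off function \<open>\<rho>\<close> that is 1 on \<open>V\<close> splits \<open>v\<close> into \<open>\<rho> v\<close>, supported in one chart, and \<open>(1 - \<rho>) v\<close>,
  which vanishes on \<open>V\<close>; so no partition of unity is needed.\<close>

private lemma good_covered: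
  assumes "finite F" "\<And>p. p \<in> F \<Longrightarrow> case p of (c, \<rho>, V, K) \<Rightarrow> bump c \<rho> V K"
    and "smooth_form A v" "{x. \<exists>c. v c x \<noteq> 0} \<subseteq> (\<Union>(c, \<rho>, V, K)\<in>F. V)"
  shows "good v"
  using assms
proof (induction F arbitrary: v rule: finite_induct)
  case empty
  have "{x. \<exists>c. v c x \<noteq> 0} = {}" using empty.prems(3) unfolding image_empty Union_empty subset_empty .
  then have v0: "v c x = 0" for c x by blast
  obtain c where c: "c \<in> A" using atlas_cover by blast
  show "good v" by (rule good_chart[OF empty.prems(2) c compact_empty empty_subsetI v0])
next
  case (insert p F)
  obtain c \<rho> V K where p: "p = (c, \<rho>, V, K)" by (cases p) auto
  have b: "bump c \<rho> V K" using insert.prems(1)[of p] p by simp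
  have s: "sm c' (\<lambda>x. of_real (\<rho> x))" "sm c' (\<lambda>x. 1 - of_real (\<rho> x))" if "c' \<in> A" for c'
    using b that sm_diff[OF chartA[OF that] sm_const[OF chartA[OF that]]] by (auto simp: bump_def)
  let ?v1 = "fscale (\<lambda>x. of_real (\<rho> x)) v" and ?v2 = "fscale (\<lambda>x. 1 - of_real (\<rho> x)) v"
  have v1: "smooth_form A ?v1" and v2: "smooth_form A ?v2"
    by (intro smooth_form_fscale[OF insert.prems(2)] s; assumption)+
  have "good ?v1"
    by (rule good_chart[OF v1, of c K]) (use b in \<open>auto simp: bump_def fscale_def fun_eq_iff\<close>)
  moreover have "good ?v2"
  proof (rule insert.IH[OF _ v2])
    show "case p of (c, \<rho>, V, K) \<Rightarrow> bump c \<rho> V K" if "p \<in> F" for p using insert.prems(1) that by blast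
    show "{x. \<exists>c. ?v2 c x \<noteq> 0} \<subseteq> (\<Union>(c, \<rho>, V, K)\<in>F. V)"
    proof clarify
      fix x c' assume x: "?v2 c' x \<noteq> 0"
      then have "x \<notin> V" "v c' x \<noteq> 0" using b by (auto simp: bump_def fscale_def fun_eq_iff)
      then show "x \<in> (\<Union>(c, \<rho>, V, K)\<in>F. V)" using insert.prems(3) p by blast
    qed
  qed
  ultimately have "good (?v1 + ?v2)" by (rule good_add[OF v1 v2])
  moreover have "?v1 + ?v2 = v" by (simp add: fscale_def fun_eq_iff algebra_simps)
  ultimately show "good v" by simp
qed

text \<open>Every point lies in an open set where some bump function is 1; compactness of the
  support leaves finitely many of them for \<open>good_covered\<close>.\<close>

lemma L2_inner_ext_d:
  assumes v: "smooth_form A v" "compactly_supported v"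
  shows "L2_inner A \<omega> (ext_d v) u = L2_inner A \<omega> v (codiff u)"
proof -
  let ?S = "closure {x. \<exists>c. v c x \<noteq> 0}" and ?B = "{(c, \<rho>, V, K). bump c \<rho> V K}"
  have "compact ?S" using v(2) by (simp add: compactly_supported_def)
  moreover have "open (case p of (c, \<rho>, V, K) \<Rightarrow> V)" if "p \<in> ?B" for p using that by (auto simp: bump_def)
  moreover have "?S \<subseteq> (\<Union>p\<in>?B. case p of (c, \<rho>, V, K) \<Rightarrow> V)" using ex_bump by fastforce
  ultimately obtain F where F: "F \<subseteq> ?B" "finite F" "?S \<subseteq> (\<Union>p\<in>F. case p of (c, \<rho>, V, K) \<Rightarrow> V)"
    by (rule compactE_image)
  have "good v"
    by (rule good_covered[OF F(2) _ v(1)]) (use F(1,3) closure_subset[of "{x. \<exists>c. v c x \<noteq> 0}"] in auto)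
  then show ?thesis by (simp add: good_def)
qed

end

text \<open>The test form is the difference times a bump function, which makes the integrand
  nonnegative, hence 0 almost everywhere. If the forms differed, it would be positive on a nonempty
  open set, which is not negligible.\<close>

lemma L2_inner_eqI:
  assumes w: "smooth_form A w1" "smooth_form A w2"
    and eq: "\<And>v. smooth_form A v \<Longrightarrow> compactly_supported v \<Longrightarrow> L2_inner A \<omega> v w1 = L2_inner A \<omega> v w2"
  shows "w1 = w2"
proof (rule ccontr)
  let ?d = "w1 - w2"
  assume "w1 \<noteq> w2"
  then obtain c1 x0 where "w1 c1 x0 \<noteq> w2 c1 x0" by (meson ext)
  then have d1: "?d c1 x0 \<noteq> 0" unfolding form_apply by (simp only: right_minus_eq not_False_eq_True)
  note d = smooth_form_diff[OF w]
  obtain c \<rho> V K where b: "bump c \<rho> V K" "x0 \<in> V" using ex_bump by blast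
  then have c: "c \<in> A" and K: "compact K" "K \<subseteq> cdom c" "\<And>x. x \<notin> K \<Longrightarrow> \<rho> x = 0"
    and \<rho>: "\<And>x. 0 \<le> \<rho> x" "\<rho> x0 = 1" "\<And>c'. c' \<in> A \<Longrightarrow> sm c' (\<lambda>x. of_real (\<rho> x))" by (auto simp: bump_def)
  note ch = chartA[OF c]
  let ?v = "fscale (\<lambda>x. of_real (\<rho> x)) ?d"
  have v: "smooth_form A ?v" by (rule smooth_form_fscale[OF d \<rho>(3)])
  have x0: "x0 \<in> K" using K(3) \<rho>(2) by force
  have v0: "?v c' x = 0" if "x \<notin> K" for x c' using K(3)[OF that] by (simp add: fscale_def fun_eq_iff)
  have "closure {x. \<exists>c. ?v c x \<noteq> 0} \<subseteq> K"
    by (rule closure_minimal) (use v0 compact_imp_closed[OF K(1)] in auto)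
  then have cs: "compactly_supported ?v"
    unfolding compactly_supported_def using compact_Int_closed[OF K(1) closed_closure, of "{x. \<exists>c. ?v c x \<noteq> 0}"]
    by (simp only: Int_absorb1)
  have su: "csupp c (\<lambda>x. inner_at A \<omega> x ?v w)" for w
    unfolding csupp_def
  proof (intro exI[of _ K] conjI allI impI K(1,2))
    show "inner_at A \<omega> x ?v w = 0" if "x \<notin> K" for x
      by (rule inner_at_0) (use v0[OF that] in blast)
  qed
  have co: "smooth_form A w \<Longrightarrow> continuous_on (cdom c) (\<lambda>x. inner_at A \<omega> x ?v w)" for w
    by (rule continuous_inner_at[OF v _ c])
  let ?f = "\<lambda>x. inner_at A \<omega> x ?v ?d"
  have "integral\<^sup>L vol ?f = 0"
    using eq[OF v cs] integrable_csupp[OF c su co[OF w(1)]] integrable_csupp[OF c su co[OF w(2)]]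
    by (simp add: L2_inner_def inner_at_diff)
  moreover have mf: "?f \<in> borel_measurable borel"
    using csupp_continuous[OF ch su co[OF d]] by (rule borel_measurable_continuous_onI)
  let ?h = "\<lambda>z. indicator (cimg c) z *\<^sub>R (dens c z *\<^sub>R ?f (cinv c z))"
  note I = integral_vol_chart[OF c mf csupp_outside[OF su]]
  have ih: "integrable lborel ?h" "integral\<^sup>L lborel ?h = 0"
    using I integrable_csupp[OF c su co[OF d]] \<open>integral\<^sup>L vol ?f = 0\<close> by auto
  have f: "?f x = of_real (\<rho> x * Re (ext_inner (\<omega> c x) (?d c x) (?d c x)))" "0 \<le> Re (?f x)"
     "?d c x \<noteq> 0 \<Longrightarrow> \<rho> x \<noteq> 0 \<Longrightarrow> Re (?f x) > 0" if x: "x \<in> cdom c" for x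
    using ext_inner_pos[OF metric_\<omega>[OF c x], of "?d c x"] \<rho>(1)[of x]
    by (simp_all add: inner_at_eq[OF v d c x] fscale_apply ext_inner_simps complex_eq_iff del: minus_apply)
  have ae: "AE z in lborel. Re (?h z) = 0"
  proof (rule integral_nonneg_eq_0_iff_AE[THEN iffD1])
    show "integrable lborel (\<lambda>z. Re (?h z))" using ih(1) by (rule integrable_Re)
    show "AE z in lborel. 0 \<le> Re (?h z)"
      by (intro AE_I2) (simp add: indicator_def f(2) ch less_imp_le[OF dens_pos[OF c]])
    show "integral\<^sup>L lborel (\<lambda>z. Re (?h z)) = 0"
      using integral_Re[OF ih(1)] unfolding ih(2) by (simp only: zero_complex.sel)
  qed
  define Q where "Q = cimg c \<inter> (\<lambda>z. Re (?f (cinv c z))) -` {0<..}"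
  have Q: "open Q"
    unfolding Q_def
  proof (rule continuous_open_preimage[OF _ open_cimg[OF ch]])
    have "continuous_on (cimg c) (cinv c)" using chart_homeomorphism[OF ch] by (simp add: homeomorphism_def)
    then have "continuous_on (cimg c) (\<lambda>z. ?f (cinv c z))"
      by (rule continuous_on_compose2[OF co[OF d]]) (use ch in auto)
    then show "continuous_on (cimg c) (\<lambda>z. Re (?f (cinv c z)))" by (rule continuous_on_Re)
  qed simp
  have "Q \<noteq> {}"
  proof -
    have x0c: "x0 \<in> cdom c" using x0 K(2) by blast
    \<comment> \<open>The forms are known to differ in the chart \<open>c1\<close>; the change of
      coordinates carries this to the chart of the bump function.\<close>
    have "?d c x0 \<noteq> 0"
    proof
      assume "?d c x0 = 0"
      moreover have "c1 \<in> A \<and> x0 \<in> cdom c1" using sf_zero[OF d] d1 by blast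
      ultimately show False using sf_pull[OF d _ c, of c1 x0] x0c d1 by (simp add: pull_linear)
    qed
    then have "cmap c x0 \<in> Q" using f(3)[OF x0c] \<rho>(2) x0c ch by (simp add: Q_def)
    then show ?thesis by blast
  qed
  have QN: "Q \<subseteq> {z. Re (?h z) \<noteq> 0}"
  proof
    fix z assume "z \<in> Q"
    then show "z \<in> {z. Re (?h z) \<noteq> 0}" using dens_pos[OF c, of z] by (simp add: Q_def)
  qed
  obtain N where N: "{z \<in> space lborel. \<not> Re (?h z) = 0} \<subseteq> N" "N \<in> null_sets lborel"
    using ae by (rule AE_E3) auto
  have "{z. Re (?h z) \<noteq> 0} \<subseteq> N" using N(1) by (simp only: space_lborel space_borel UNIV_I simp_thms)
  with QN have "Q \<subseteq> N" by (rule subset_trans)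
  moreover have "Q \<in> sets lborel" using Q by simp
  ultimately have "Q \<in> null_sets lborel" using null_sets_subset[OF N(2)] by blast
  then have "negligible Q" unfolding negligible_iff_null_sets by (rule null_sets_completionI)
  then show False using open_not_negligible[OF Q \<open>Q \<noteq> {}\<close>] by blast
qed

lemma formal_adjoint_eqI:
  assumes w: "smooth_form A w"
    and eq: "\<And>v. smooth_form A v \<Longrightarrow> compactly_supported v \<Longrightarrow> L2_inner A \<omega> (P v) u = L2_inner A \<omega> v w"
  shows "formal_adjoint A \<omega> P u = w"
  unfolding formal_adjoint_def
proof (rule the_equality)
  show "smooth_form A w \<and> (\<forall>v. smooth_form A v \<and> compactly_supported v \<longrightarrow> L2_inner A \<omega> (P v) u = L2_inner A \<omega> v w)"
    using w eq by blast
next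
  fix w' assume "smooth_form A w' \<and> (\<forall>v. smooth_form A v \<and> compactly_supported v \<longrightarrow> L2_inner A \<omega> (P v) u = L2_inner A \<omega> v w')"
  then show "w' = w" using eq by (intro L2_inner_eqI w) auto
qed

end

section \<open>Rescaling by powers of a function\<close>

lift_definition Th :: "real \<Rightarrow> 'n::{finite, linorder} lop" is "\<lambda>r \<alpha> I J. of_real r ^ card I * \<alpha> I J"
  by (auto simp: fun_eq_iff algebra_simps)

lemma ap_Th: "ap (Th r) \<alpha> I J = of_real r ^ card I * \<alpha> I J"
  by (simp add: Th.rep_eq)

lemma Th_mult: "Th a * Th b = Th (a * b)" and Th_1: "Th 1 = 1"
  by (rule lop_eqI, simp add: fun_eq_iff ap_Th power_mult_distrib)+

lemma Th_Eb: "Th r * Eb j = Eb j * Th r"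
  by (rule lop_eqI) (simp add: fun_eq_iff ap_Th ap_Eb)

lemma Th_E: "Th r * E j = sc (of_real r) * (E j * Th r)"
proof (rule lop_eqI, intro ext)
  fix \<alpha> and I J :: "'a set"
  show "ap (Th r * E j) \<alpha> I J = ap (sc (of_real r) * (E j * Th r)) \<alpha> I J"
  proof (cases "j \<in> I")
    case True
    then obtain m where "card I = Suc m" by (metis card_Suc_Diff1 finite)
    then show ?thesis using True by (simp add: ap_Th ap_E)
  qed (simp add: ap_Th ap_E)
qed

lemma Th_wd: "Th r * wd \<alpha> = wd (ap (Th r) \<alpha>) * Th r"
proof (rule lop_eqI, intro ext)
  fix \<beta> and I J :: "'a set"
  show "ap (Th r * wd \<alpha>) \<beta> I J = ap (wd (ap (Th r) \<alpha>) * Th r) \<beta> I J"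
    unfolding ap_simps ap_wd ap_Th wedge_def sum_distrib_left
  proof (intro sum.cong refl)
    fix K L assume "K \<in> Pow I"
    then have "card I = card K + card (I - K)" using card_Int_Diff[of I K] by (simp add: Int_absorb1)
    then have "complex_of_real r ^ card I = of_real r ^ card K * of_real r ^ card (I - K)" by (simp add: power_add)
    then show "complex_of_real r ^ card I * ((- 1) ^ (card L * card (I - K)) * shuffle_sign K (I - K) * shuffle_sign L (J - L) * \<alpha> K L * \<beta> (I - K) (J - L)) =
      (- 1) ^ (card L * card (I - K)) * shuffle_sign K (I - K) * shuffle_sign L (J - L) * (of_real r ^ card K * \<alpha> K L) * (of_real r ^ card (I - K) * \<beta> (I - K) (J - L))"
      by (simp add: mult_ac)
  qed
qed

text \<open>A complex linear change of coordinates preserves the type: minors with unequal numbers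
  of rows and columns are 0.\<close>

lemma Th_pl: "Th r * pl B = pl B * Th r"
proof (rule lop_eqI, intro ext)
  fix \<alpha> and K L :: "'a set"
  have "of_real r ^ card K * minor B I K = of_real r ^ card I * minor B I K" for I
    by (cases "card I = card K") (simp_all add: minor_card)
  from arg_cong[OF this, of "\<lambda>t. t * (\<alpha> I J * cnj (minor B J L))" for I J]
  have "of_real r ^ card K * (\<alpha> I J * minor B I K * cnj (minor B J L)) = of_real r ^ card I * \<alpha> I J * minor B I K * cnj (minor B J L)" for I J
    by (simp only: mult_ac)
  then show "ap (Th r * pl B) \<alpha> K L = ap (pl B * Th r) \<alpha> K L"
    unfolding ap_simps ap_pl ap_Th pull_def sum_distrib_left by (intro sum.cong refl)
qed

text \<open>Forms of different types are orthogonal, and on each type \<open>Th r\<close> is a real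
  scalar.\<close>

lemma adj_Th:
  assumes w: "metric w"
  shows "adj w (Th r) = Th r"
proof (rule adjI[OF w])
  fix \<alpha> \<beta>
  have "of_real r ^ card I * minor (gram w) I K = of_real r ^ card K * minor (gram w) I K" for I K
    by (cases "card I = card K") (simp_all add: minor_card)
  from arg_cong[OF this, of "\<lambda>t. t * (\<alpha> I J * cnj (\<beta> K L) * cnj (minor (gram w) J L))" for I J K L]
  have "of_real r ^ card I * \<alpha> I J * cnj (\<beta> K L) * minor (gram w) I K * cnj (minor (gram w) J L) =
    \<alpha> I J * cnj (of_real r ^ card K * \<beta> K L) * minor (gram w) I K * cnj (minor (gram w) J L)" for I J K L
    by (simp only: complex_cnj_mult complex_cnj_power complex_cnj_complex_of_real mult_ac)
  then show "ext_inner w (ap (Th r) \<alpha>) \<beta> = ext_inner w \<alpha> (ap (Th r) \<beta>)"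
    unfolding ext_inner_def ap_Th by (intro sum.cong refl)
qed

lemma Th_metric: "metric w \<Longrightarrow> ap (Th r) w = scl (of_real r) w"
proof (intro ext)
  fix I J assume "metric w"
  then have "w I J \<noteq> 0 \<Longrightarrow> card I = 1" by (auto simp: metric_def)
  then show "ap (Th r) w I J = scl (of_real r) w I J" by (cases "w I J = 0") (simp_all add: ap_Th)
qed

section \<open>Counting operators for the bidegree and the algebra of the rescaling terms\<close>

lemma ap_Np: "ap Np \<alpha> I J = of_nat (card I) * \<alpha> I J"
proof -
  have "ap (E j) (ap (C j) \<alpha>) I J = (if j \<in> I then \<alpha> I J else 0)" for j
    by (auto simp: ap_E ap_C sg_remove insert_absorb)
  then have "ap Np \<alpha> I J = (\<Sum>j\<in>UNIV. if j \<in> I then \<alpha> I J else 0)"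
    by (simp add: Np_def ap_sum_left sum_fun_apply)
  then show ?thesis by (simp add: sum.If_cases)
qed

lemma ap_Nq: "ap Nq \<alpha> I J = of_nat (card J) * \<alpha> I J"
proof -
  have "ap (Eb j) (ap (Cb j) \<alpha>) I J = (if j \<in> J then \<alpha> I J else 0)" for j
    by (auto simp: ap_Eb ap_Cb sg_remove insert_absorb power_mult_distrib[symmetric] mult_ac)
  then have "ap Nq \<alpha> I J = (\<Sum>j\<in>UNIV. if j \<in> J then \<alpha> I J else 0)"
    by (simp add: Nq_def ap_sum_left sum_fun_apply)
  then show ?thesis by (simp add: sum.If_cases)
qed

lemma of_nat_card_insert_remove:
  fixes I :: "'n::finite set"
  shows "k \<in> I \<Longrightarrow> of_nat (card (I - {k})) = (of_nat (card I) - 1 :: complex)"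
    and "k \<notin> I \<Longrightarrow> of_nat (card (insert k I)) = (of_nat (card I) + 1 :: complex)"
proof -
  assume "k \<in> I"
  then obtain m where "card I = Suc m" by (metis card_Suc_Diff1 finite)
  then show "of_nat (card (I - {k})) = (of_nat (card I) - 1 :: complex)" using \<open>k \<in> I\<close> by simp
qed simp

lemma Np_E: "Np * E k = E k * Np + E k" and Nq_Eb: "Nq * Eb k = Eb k * Nq + Eb k"
  and Np_Eb: "Np * Eb k = Eb k * Np" and Nq_E: "Nq * E k = E k * Nq"
  and Np_C: "Np * C k = C k * Np - C k" and Nq_Cb: "Nq * Cb k = Cb k * Nq - Cb k"
  and Np_Cb: "Np * Cb k = Cb k * Np" and Nq_C: "Nq * C k = C k * Nq"
  by (rule lop_eqI, auto simp: fun_eq_iff ap_gen ap_Np ap_Nq of_nat_card_insert_remove algebra_simps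
      simp del: card_Diff_singleton card_insert_disjoint card_Diff_insert)+

context
  fixes w :: "'n::{finite, linorder} ext"
  assumes w: "metric w"
begin

text \<open>\<open>Lam w\<close> is a combination of products of one \<open>C\<close> and one
  \<open>Cb\<close>, and each contraction lowers the total degree by 1.\<close>

lemma N_Lam: "(Np + Nq) * Lam w = Lam w * (Np + Nq) - 2 * Lam w"
proof -
  have "(Np + Nq) * (Cb l * C k) = Cb l * C k * (Np + Nq) - 2 * (Cb l * C k)" for l k :: 'n
  proof -
    have "(Np + Nq) * (Cb l * C k) = Cb l * (Np * C k) + (Nq * Cb l) * C k"
      by (simp add: distrib_right Np_Cb flip: mult.assoc)
    also have "\<dots> = Cb l * C k * (Np + Nq) - 2 * (Cb l * C k)"
      by (simp add: Np_C Nq_Cb algebra_simps Nq_C mult_2)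
    finally show ?thesis .
  qed
  then show ?thesis
    unfolding Lam_eq[OF w] LamG_def
    by (simp add: sum_distrib_left sum_distrib_right sum_subtractf[symmetric] sc_left_commute mult.assoc right_diff_distrib)
qed

text \<open>With \<open>a j\<close> the derivatives of \<open>\<eta>\<close>, \<open>F\<close> and
  \<open>X\<close> are the multiplications by the 1-forms \<open>dbar_neg_eta\<close> and
  \<open>d_eta_eta\<close>. The adjoint of \<open>X\<close> is i times the commutator of
  \<open>Lam\<close> with \<open>F\<close>, and its commutator with omega is minus i times
  \<open>F\<close>. The Leibniz rule then leaves the commutator of \<open>Lam\<close> with omega,
  which contributes the dimension and the degree; the degree operator is finally moved next to the
  argument or next to \<open>Lam\<close>.\<close>

lemma adjoint_formula_algebra:
  fixes a b :: "'n \<Rightarrow> complex" and h :: real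
  assumes b: "\<And>j. b j = cnj (a j)"
  defines "e1 \<equiv> \<Sum>j\<in>UNIV. sc (a j) * E j" and "e2 \<equiv> \<Sum>j\<in>UNIV. sc (b j) * Eb j"
  defines "F \<equiv> e1 - sc (of_real h) * e2" and "X \<equiv> sc (of_real h) * e1 + e2"
  shows "Lam w * adj w X * wd w - wd w * (Lam w * adj w X) =
    sc \<i> * (F * Lam w + F * (Np + Nq) * Lam w - Lam w * F * (Np + Nq)) + sc (\<i> * of_nat CARD('n)) * (Lam w * F - F * Lam w)"
proof -
  let ?L = "Lam w" and ?W = "wd w" and ?N = "Np + Nq :: 'n lop"
  have A: "adj w X = (\<Sum>j\<in>UNIV. sc (of_real h * b j) * Es w j) + (\<Sum>j\<in>UNIV. sc (a j) * Ebs w j)"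
    by (simp add: X_def e1_def e2_def adj_simps[OF w] adj_sum[OF w] adj_E[OF w] adj_Eb[OF w] b sum_distrib_right sum_distrib_left
      sc_comm[symmetric] sc_mult_left mult.commute)
  have A1: "adj w X = sc \<i> * (?L * F - F * ?L)"
  proof -
    have 1: "?L * e1 - e1 * ?L = - (sc \<i> * (\<Sum>j\<in>UNIV. sc (a j) * Ebs w j))"
    proof -
      have "?L * e1 - e1 * ?L = (\<Sum>j\<in>UNIV. sc (a j) * (?L * E j - E j * ?L))"
        by (simp add: e1_def sum_distrib_left sum_distrib_right sum_subtractf[symmetric] sc_left_commute[of ?L] mult.assoc right_diff_distrib)
      then show ?thesis by (simp add: Lam_E[OF w] sum_distrib_left sum_negf sc_mult_left mult.commute)
    qed
    have 2: "?L * e2 - e2 * ?L = sc \<i> * (\<Sum>j\<in>UNIV. sc (b j) * Es w j)"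
    proof -
      have "?L * e2 - e2 * ?L = (\<Sum>j\<in>UNIV. sc (b j) * (?L * Eb j - Eb j * ?L))"
        by (simp add: e2_def sum_distrib_left sum_distrib_right sum_subtractf[symmetric] sc_left_commute[of ?L] mult.assoc right_diff_distrib)
      then show ?thesis by (simp add: Lam_Eb[OF w] sum_distrib_left sc_mult_left mult.commute)
    qed
    have 3: "sc \<i> * (- (sc \<i> * P) - sc (of_real h) * (sc \<i> * Q)) = P + sc (of_real h) * Q" for P Q :: "'n lop"
    proof -
      have "\<i> * (of_real h * \<i>) = - of_real h" by (simp add: complex_eq_iff)
      then show ?thesis by (simp add: right_diff_distrib sc_mult_left)
    qed
    have "?L * F - F * ?L = (?L * e1 - e1 * ?L) - sc (of_real h) * (?L * e2 - e2 * ?L)"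
      by (simp add: F_def algebra_simps sc_left_commute[of ?L])
    note e = this[unfolded 1 2]
    show ?thesis unfolding A e 3 by (simp add: sum_distrib_left sc_mult_left)
  qed
  have A2: "adj w X * ?W - ?W * adj w X = - (sc \<i> * F)"
  proof -
    have "adj w X * ?W - ?W * adj w X = (\<Sum>j\<in>UNIV. sc (of_real h * b j) * (Es w j * ?W - ?W * Es w j)) + (\<Sum>j\<in>UNIV. sc (a j) * (Ebs w j * ?W - ?W * Ebs w j))"
      unfolding A by (simp add: sum_distrib_left sum_distrib_right sum_subtractf distrib_left distrib_right sc_left_commute[of ?W] mult.assoc right_diff_distrib)
    then show ?thesis unfolding Es_L[OF w] Ebs_L[OF w]
      by (simp add: F_def e1_def e2_def sum_distrib_left sum_negf right_diff_distrib sc_mult_left mult_ac)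
  qed
  have NF: "?N * F = F * ?N + F"
  proof -
    have "?N * e1 = e1 * ?N + e1" "?N * e2 = e2 * ?N + e2"
      by (simp_all add: e1_def e2_def sum_distrib_left sum_distrib_right sum.distrib[symmetric] sc_left_commute distrib_left distrib_right
          mult.assoc Np_E Nq_E Np_Eb Nq_Eb add_ac)
    note N = this
    have "?N * F = ?N * e1 - sc (of_real h) * (?N * e2)" unfolding F_def right_diff_distrib sc_left_commute[of ?N] ..
    then show ?thesis unfolding N by (simp add: F_def distrib_left left_diff_distrib mult.assoc)
  qed
  have "?L * adj w X * ?W - ?W * (?L * adj w X) = ?L * (adj w X * ?W - ?W * adj w X) + (?L * ?W - ?W * ?L) * adj w X"
    by (simp add: algebra_simps)
  also have "?L * (adj w X * ?W - ?W * adj w X) = - (sc \<i> * (?L * F))"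
    unfolding A2 by (simp add: sc_left_commute[of ?L])
  also have "(?L * ?W - ?W * ?L) * adj w X = (sc (of_nat CARD('n)) - ?N) * (sc \<i> * (?L * F - F * ?L))"
    unfolding Lam_L[OF w] A1 by (simp add: diff_diff_eq sc_of_nat)
  also have "\<dots> = sc (\<i> * of_nat CARD('n)) * (?L * F - F * ?L) - sc \<i> * (?N * (?L * F) - ?N * (F * ?L))"
    unfolding left_diff_distrib sc_left_commute[of ?N] right_diff_distrib[of ?N] by (simp add: sc_mult_left mult.commute)
  also have "?N * (?L * F) = ?L * (F * ?N) - ?L * F"
  proof -
    have "?N * (?L * F) = (?N * ?L) * F" by (simp add: mult.assoc)
    also have "\<dots> = ?L * (?N * F) - 2 * (?L * F)" unfolding N_Lam by (simp add: left_diff_distrib mult.assoc)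
    also have "\<dots> = ?L * (F * ?N) - ?L * F" unfolding NF by (simp add: distrib_left mult_2)
    finally show ?thesis .
  qed
  also have "?N * (F * ?L) = F * (?N * ?L) + F * ?L"
    unfolding mult.assoc[symmetric] NF by (simp add: distrib_right mult.assoc)
  finally show ?thesis by (simp add: algebra_simps)
qed

end

text \<open>For \<open>k = 0\<close> the truncated exponent \<open>k - 1\<close> is harmless,
  because the factor \<open>of_nat k\<close> is 0.\<close>

lemma dv_power:
  fixes c :: "('a::topological_space, 'n::{finite, linorder}) chart"
  assumes c: "chart c" and D: "dv c x D" and f: "sm c f"
  shows "D (\<lambda>y. f y ^ k) = of_nat k * f x ^ (k - 1) * D f"
proof (induction k)
  case 0
  show ?case using dv_simps(3)[OF c D, of 1] by simp
next
  case (Suc k)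
  then show ?case using dv_simps(2)[OF c D f sm_power[OF c f], of k] by (cases k) (simp_all add: algebra_simps)
qed

text \<open>Differentiating the power of \<open>\<zeta>\<close> on (p, q)-forms brings down a factor
  p, which is the operator \<open>Np\<close>.\<close>

lemma DE_Th:
  fixes c :: "('a::topological_space, 'n::{finite, linorder}) chart" and U :: "'a \<Rightarrow> 'n ext"
  assumes c: "chart c" and D: "dv c x D" and \<zeta>: "sm c (\<lambda>y. of_real (\<zeta> y))" "\<zeta> x \<noteq> 0" and U: "smE c U"
  shows "DE D (\<lambda>y. ap (Th (\<zeta> y)) (U y)) =
    ap (Th (\<zeta> x)) (DE D U + scl (D (\<lambda>y. of_real (\<zeta> y)) / of_real (\<zeta> x)) (ap Np (U x)))"
proof (intro ext)
  fix I J :: "'n set"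
  let ?d = "D (\<lambda>y. of_real (\<zeta> y))" and ?k = "card I"
  have "D (\<lambda>y. of_real (\<zeta> y) ^ ?k * U y I J) = D (\<lambda>y. of_real (\<zeta> y) ^ ?k) * U x I J + of_real (\<zeta> x) ^ ?k * D (\<lambda>y. U y I J)"
    by (rule dv_simps(2)[OF c D sm_power[OF c \<zeta>(1)]]) (use U in \<open>simp add: smE_def\<close>)
  also have "D (\<lambda>y. of_real (\<zeta> y) ^ ?k) = of_real (\<zeta> x) ^ ?k * (?d / of_real (\<zeta> x) * of_nat ?k)"
    unfolding dv_power[OF c D \<zeta>(1)] using \<zeta>(2) by (cases ?k) (simp_all)
  finally show "DE D (\<lambda>y. ap (Th (\<zeta> y)) (U y)) I J = ap (Th (\<zeta> x)) (DE D U + scl (?d / of_real (\<zeta> x)) (ap Np (U x))) I J"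
    by (simp add: DE_def ap_Th ap_Np algebra_simps)
qed

lemma theta_apply: "theta \<zeta> u c y = ap (Th (\<zeta> y)) (u c y)"
  by (simp add: theta_def fun_eq_iff ap_Th)

lemma E_Th: "r \<noteq> 0 \<Longrightarrow> E j * Th r = sc (1 / of_real r) * (Th r * E j)"
  unfolding Th_E by (simp add: sc_mult_left)

section \<open>The rescaled differentials in a chart\<close>

context atlas
begin

text \<open>Smoothness of a real function expressed by its complex values, since \<open>sm\<close>
  and derivations are about complex functions.\<close>

definition sreal :: "('a \<Rightarrow> real) \<Rightarrow> bool" where
  "sreal f \<longleftrightarrow> (\<forall>c\<in>A. sm c (\<lambda>x. of_real (f x)))"

text \<open>Exterior multiplication by \<open>\<partial>f\<close> and by \<open>\<partial>bar f\<close>.\<close>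

definition gp :: "('a \<Rightarrow> real) \<Rightarrow> ('a, 'n) chart \<Rightarrow> 'a \<Rightarrow> 'n lop" where
  "gp f c x = (\<Sum>j\<in>UNIV. sc (wirt c j (\<lambda>y. of_real (f y)) x) * E j)"

definition gq :: "('a \<Rightarrow> real) \<Rightarrow> ('a, 'n) chart \<Rightarrow> 'a \<Rightarrow> 'n lop" where
  "gq f c x = (\<Sum>j\<in>UNIV. sc (wirtbar c j (\<lambda>y. of_real (f y)) x) * Eb j)"

lemma tensor_Th:
  assumes "sreal \<zeta>"
  shows "tensor (\<lambda>c x. Th (\<zeta> x))"
  unfolding tensor_def
proof (intro conjI ballI Th_pl)
  fix c assume c: "c \<in> A"
  note ch = chartA[OF c]
  show "smop c (\<lambda>x. Th (\<zeta> x))"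
    unfolding smop_def ap_Th using assms c
    by (intro allI sm_mult[OF ch] sm_power[OF ch] sm_const[OF ch]) (simp add: sreal_def)
qed

lemma theta_opf: "smooth_form A u \<Longrightarrow> theta \<zeta> u = opf (\<lambda>c x. Th (\<zeta> x)) u"
proof (rule ext, rule ext)
  fix c x assume u: "smooth_form A u"
  show "theta \<zeta> u c x = opf (\<lambda>c x. Th (\<zeta> x)) u c x"
  proof (cases "c \<in> A \<and> x \<in> cdom c")
    case False
    show ?thesis unfolding theta_apply sf_zero[OF u False] opf_def using False by (simp only: if_False ap_0)
  qed (simp add: theta_apply)
qed

lemma smooth_form_theta: "sreal \<zeta> \<Longrightarrow> smooth_form A u \<Longrightarrow> smooth_form A (theta \<zeta> u)"
  by (simp add: theta_opf smooth_form_opf tensor_Th)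

lemma sreal_inverse: "sreal \<zeta> \<Longrightarrow> (\<And>x. \<zeta> x \<noteq> 0) \<Longrightarrow> sreal (\<lambda>x. 1 / \<zeta> x)"
  unfolding sreal_def using sm_inverse[OF chartA, of _ "\<lambda>x. of_real (\<zeta> x)"] by (simp add: divide_inverse)

lemma sreal_minus: "sreal \<zeta> \<Longrightarrow> sreal (\<lambda>x. - \<zeta> x)"
  unfolding sreal_def using sm_minus[OF chartA] by auto

context
  fixes c :: "('a, 'n) chart" and x :: 'a
  assumes c: "c \<in> A" and x: "x \<in> cdom c"
begin

lemma gp_minus: "sreal f \<Longrightarrow> gp (\<lambda>x. - f x) c x = - gp f c x" "sreal f \<Longrightarrow> gq (\<lambda>x. - f x) c x = - gq f c x"
  using dv_minus[OF chartA[OF c] dv_wirt[OF chartA[OF c] x]] dv_minus[OF chartA[OF c] dv_wirtbar[OF chartA[OF c] x]] c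
  by (simp_all add: gp_def gq_def sreal_def sum_negf)

lemma gp_inverse:
  assumes f: "sreal f" "\<And>x. f x \<noteq> 0"
  shows "gp (\<lambda>x. 1 / f x) c x = sc (- 1 / (of_real (f x))\<^sup>2) * gp f c x"
    and "gq (\<lambda>x. 1 / f x) c x = sc (- 1 / (of_real (f x))\<^sup>2) * gq f c x"
proof -
  note ch = chartA[OF c]
  have s: "sm c (\<lambda>x. of_real (f x))" "sm c (\<lambda>x. of_real (1 / f x))"
    using f sreal_inverse[OF f] c by (auto simp: sreal_def)
  have "D (\<lambda>y. of_real (1 / f y)) = - 1 / (of_real (f x))\<^sup>2 * D (\<lambda>y. of_real (f y))" if D: "dv c x D" for D
  proof -
    have "D (\<lambda>y. of_real (f y) * of_real (1 / f y)) = D (\<lambda>y. 1)"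
      by (rule dv_cong[OF ch D]) (simp add: f)
    then have "D (\<lambda>y. of_real (f y)) * of_real (1 / f x) + of_real (f x) * D (\<lambda>y. of_real (1 / f y)) = 0"
      unfolding dv_simps(2)[OF ch D s] dv_simps(3)[OF ch D] .
    then have "of_real (f x) * D (\<lambda>y. of_real (1 / f y)) = - (D (\<lambda>y. of_real (f y)) * of_real (1 / f x))"
      by (simp add: add_eq_0_iff2)
    then show ?thesis using f(2)[of x] by (simp add: field_simps power2_eq_square)
  qed
  note d = this[OF dv_wirt[OF ch x]] this[OF dv_wirtbar[OF ch x]]
  show "gp (\<lambda>x. 1 / f x) c x = sc (- 1 / (of_real (f x))\<^sup>2) * gp f c x"
    and "gq (\<lambda>x. 1 / f x) c x = sc (- 1 / (of_real (f x))\<^sup>2) * gq f c x"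
    unfolding gp_def gq_def d sum_distrib_left sc_mult_left by (rule refl)+
qed

lemma del_fscale_real:
  assumes f: "sreal f" and u: "smooth_form A u"
  shows "del (fscale (\<lambda>y. of_real (f y)) u) c x = scl (of_real (f x)) (del u c x) + ap (gp f c x) (u c x)"
    and "delbar (fscale (\<lambda>y. of_real (f y)) u) c x = scl (of_real (f x)) (delbar u c x) + ap (gq f c x) (u c x)"
proof -
  note ch = chartA[OF c]
  have fs: "fscale (\<lambda>y. of_real (f y)) u c = (\<lambda>y. scl (of_real (f y)) (u c y))" by (rule ext) (simp only: fscale_apply)
  have s: "sm c (\<lambda>x. of_real (f x))" using f c by (simp add: sreal_def)
  note d = DE_simps(4)[OF ch dv_wirt[OF ch x] s sf_smE[OF u c]] DE_simps(4)[OF ch dv_wirtbar[OF ch x] s sf_smE[OF u c]]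
  show "del (fscale (\<lambda>y. of_real (f y)) u) c x = scl (of_real (f x)) (del u c x) + ap (gp f c x) (u c x)"
    unfolding del_apply[OF x] fs d gp_def
    by (simp only: ap_add ap_scl sum.distrib ap_sum_left ap_simps scl_sum add.commute)
  show "delbar (fscale (\<lambda>y. of_real (f y)) u) c x = scl (of_real (f x)) (delbar u c x) + ap (gq f c x) (u c x)"
    unfolding delbar_apply[OF x] fs d gq_def
    by (simp only: ap_add ap_scl sum.distrib ap_sum_left ap_simps scl_sum add.commute)
qed

text \<open>\<open>Th\<close> is pulled out to the left, where the outer rescaling in
  \<open>D_eta\<close> will cancel it. Passing \<open>E j\<close> costs a factor
  \<open>1 / f x\<close>, passing \<open>Eb j\<close> costs nothing.\<close>

lemma del_theta:
  assumes f: "sreal f" "f x \<noteq> 0" and u: "smooth_form A u"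
  shows "del (theta f u) c x = ap (Th (f x)) (scl (1 / of_real (f x)) (del u c x) + scl (1 / (of_real (f x))\<^sup>2) (ap (gp f c x) (ap Np (u c x))))"
    and "delbar (theta f u) c x = ap (Th (f x)) (delbar u c x + scl (1 / of_real (f x)) (ap (gq f c x) (ap Np (u c x))))"
proof -
  note ch = chartA[OF c]
  have fs: "theta f u c = (\<lambda>y. ap (Th (f y)) (u c y))" by (rule ext) (rule theta_apply)
  have s: "sm c (\<lambda>x. of_real (f x))" using f c by (simp add: sreal_def)
  note d = DE_Th[OF ch dv_wirt[OF ch x] s f(2) sf_smE[OF u c]] DE_Th[OF ch dv_wirtbar[OF ch x] s f(2) sf_smE[OF u c]]
  have e: "ap (E j) (ap (Th (f x)) \<alpha>) = ap (Th (f x)) (scl (1 / of_real (f x)) (ap (E j) \<alpha>))"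
     "ap (Eb j) (ap (Th (f x)) \<alpha>) = ap (Th (f x)) (ap (Eb j) \<alpha>)" for j \<alpha>
    using arg_cong[OF E_Th[OF f(2), of j], of "\<lambda>p. ap p \<alpha>"] arg_cong[OF Th_Eb[of "f x" j], of "\<lambda>p. ap p \<alpha>"]
    by (simp_all only: ap_simps ap_scl)
  show "del (theta f u) c x = ap (Th (f x)) (scl (1 / of_real (f x)) (del u c x) + scl (1 / (of_real (f x))\<^sup>2) (ap (gp f c x) (ap Np (u c x))))"
    unfolding del_apply[OF x] fs d e gp_def
    by (simp add: ap_add ap_scl sum.distrib ap_sum_left ap_sum scl_sum scl_simps(1,5) power2_eq_square)
  show "delbar (theta f u) c x = ap (Th (f x)) (delbar u c x + scl (1 / of_real (f x)) (ap (gq f c x) (ap Np (u c x))))"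
    unfolding delbar_apply[OF x] fs d e gq_def
    by (simp add: ap_add ap_scl sum.distrib ap_sum_left ap_sum scl_sum scl_simps(1,5))
qed

text \<open>The explicit formula on (p, q)-forms with \<open>Np\<close> in place of p. It is
  \<open>del_theta\<close> for the function \<open>1 / f\<close>, whose derivatives are given by
  \<open>gp_inverse\<close>.\<close>

lemma D_eta_apply:
  assumes f: "sreal f" "\<And>x. f x \<noteq> 0" and u: "smooth_form A u"
  shows "D_eta f u c x = scl (of_real (f x)) (del u c x) + delbar u c x - ap (gp f c x) (ap Np (u c x))
    - scl (1 / of_real (f x)) (ap (gq f c x) (ap Np (u c x)))"
proof -
  have fx: "1 / f x \<noteq> 0" using f(2) by simp
  have T: "ap (Th (f x)) (ap (Th (1 / f x)) \<alpha>) = \<alpha>" for \<alpha>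
    using arg_cong[OF Th_mult[of "f x" "1 / f x"], of "\<lambda>p. ap p \<alpha>"] f(2)[of x] by (simp add: Th_1)
  show ?thesis
    unfolding D_eta_def theta_apply ext_d_def form_apply del_theta[OF sreal_inverse[OF f] fx u] ap_add T gp_inverse[OF f]
    using f(2)[of x] by (simp add: scl_simps power2_eq_square)
qed

lemma cj_Np: "cj (ap Np \<alpha>) = ap Nq (cj \<alpha>)"
  by (simp add: Np_def Nq_def ap_sum_left cj_sum cj_E cj_C)

lemma cj_gp: "sreal f \<Longrightarrow> cj (ap (gp f c x) \<alpha>) = ap (gq f c x) (cj \<alpha>)"
  and cj_gq: "sreal f \<Longrightarrow> cj (ap (gq f c x) \<alpha>) = ap (gp f c x) (cj \<alpha>)"
proof -
  assume "sreal f"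
  then have s: "sm c (\<lambda>x. of_real (f x))" using c by (simp add: sreal_def)
  have w: "cnj (wirt c j (\<lambda>y. of_real (f y)) x) = wirtbar c j (\<lambda>y. of_real (f y)) x" for j
    using wirt_cnj[OF chartA[OF c] x s, of j] by simp
  then have w': "cnj (wirtbar c j (\<lambda>y. of_real (f y)) x) = wirt c j (\<lambda>y. of_real (f y)) x" for j
    by (metis complex_cnj_cnj)
  show "cj (ap (gp f c x) \<alpha>) = ap (gq f c x) (cj \<alpha>)" "cj (ap (gq f c x) \<alpha>) = ap (gp f c x) (cj \<alpha>)"
    by (simp_all add: gp_def gq_def ap_sum_left cj_sum cj_E cj_Eb cj_simps w w')
qed

text \<open>The conjugate of \<open>D_eta_apply\<close> for \<open>- f\<close>; conjugation
  exchanges \<open>gp\<close> with \<open>gq\<close> and \<open>Np\<close> with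
  \<open>Nq\<close>.\<close>

lemma Dbar_apply:
  assumes f: "sreal f" "\<And>x. f x \<noteq> 0" and u: "smooth_form A u"
  shows "Dbar_neg f u c x = del u c x - scl (of_real (f x)) (delbar u c x) + ap (gq f c x) (ap Nq (u c x))
    - scl (1 / of_real (f x)) (ap (gp f c x) (ap Nq (u c x)))"
proof -
  note cu = smooth_form_conj[OF u]
  have 1: "cj (del (conj_form u) c x) = delbar u c x"
    unfolding conj_del[OF u] conj_form_apply ..
  have 2: "cj (delbar (conj_form u) c x) = del u c x"
    using conj_del[OF cu] by (simp add: conj_form_apply cj_simps(5))
  have fm: "- f x \<noteq> 0" for x using f(2) by simp
  show ?thesis
    unfolding Dbar_neg_def conj_op_def conj_form_apply[of "D_eta _ _"] D_eta_apply[OF sreal_minus[OF f(1)] fm cu]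
      cj_simps 1 2 gp_minus[OF f(1)] ap_simps(5) cj_gp[OF f(1)] cj_gq[OF f(1)] cj_Np conj_form_apply[of u]
    by (simp add: scl_simps)
qed

end

lemma smooth_form_D_eta: "sreal f \<Longrightarrow> (\<And>x. f x \<noteq> 0) \<Longrightarrow> smooth_form A u \<Longrightarrow> smooth_form A (D_eta f u)"
  unfolding D_eta_def by (intro smooth_form_theta smooth_form_ext_d sreal_inverse)

lemma smooth_form_Dbar: "sreal f \<Longrightarrow> (\<And>x. f x \<noteq> 0) \<Longrightarrow> smooth_form A u \<Longrightarrow> smooth_form A (Dbar_neg f u)"
  unfolding Dbar_neg_def conj_op_def by (intro smooth_form_conj smooth_form_D_eta sreal_minus) auto

lemma theta_add: "theta f (u + v) = theta f u + theta f v"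
  by (simp add: theta_def fun_eq_iff algebra_simps)

lemma conj_form_add: "conj_form (u + v) = conj_form u + conj_form v"
  by (simp add: conj_form_def fun_eq_iff algebra_simps)

lemma D_eta_add:
  "sreal f \<Longrightarrow> (\<And>x. f x \<noteq> 0) \<Longrightarrow> smooth_form A u \<Longrightarrow> smooth_form A v \<Longrightarrow> D_eta f (u + v) = D_eta f u + D_eta f v"
  unfolding D_eta_def theta_add by (subst ext_d_add) (simp_all add: smooth_form_theta sreal_inverse theta_add)

lemma Dbar_add:
  "sreal f \<Longrightarrow> (\<And>x. f x \<noteq> 0) \<Longrightarrow> smooth_form A u \<Longrightarrow> smooth_form A v \<Longrightarrow> Dbar_neg f (u + v) = Dbar_neg f u + Dbar_neg f v"
  unfolding Dbar_neg_def conj_op_def conj_form_add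
  by (subst D_eta_add) (simp_all add: sreal_minus smooth_form_conj conj_form_add)

end

section \<open>The adjoint of the rescaled differential\<close>

lemma compactly_supported_mono:
  assumes "compactly_supported u" "\<And>c x. u c x = 0 \<Longrightarrow> v c x = 0"
  shows "compactly_supported v"
proof -
  have "closure {x. \<exists>c. v c x \<noteq> 0} \<subseteq> closure {x. \<exists>c. u c x \<noteq> 0}"
    using assms(2) by (intro closure_mono) blast
  then show ?thesis
    using assms(1) compact_Int_closed[of "closure {x. \<exists>c. u c x \<noteq> 0}" "closure {x. \<exists>c. v c x \<noteq> 0}"]
    unfolding compactly_supported_def by (simp only: Int_absorb1 closed_closure)
qed

lemma compactly_supported_theta:
  fixes u :: "('a::topological_space, 'n::{finite, linorder}) form"
  shows "compactly_supported u \<Longrightarrow> compactly_supported (theta f u)"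
proof (rule compactly_supported_mono)
  show "u c x = 0 \<Longrightarrow> theta f u c x = 0" for c x by (simp only: theta_apply ap_0)
qed

text \<open>The metric has type (1,1), so \<open>Th r\<close> passes the multiplication by it with
  one factor \<open>r\<close>; the adjoint of this relation is the claim.\<close>

lemma Lam_Th:
  assumes m: "metric w"
  shows "Lam w * Th r = Th r * (Lam w * sc (of_real r))"
proof -
  have "Th r * wd w = sc (of_real r) * (wd w * Th r)"
    unfolding Th_wd Th_metric[OF m] wd_scl by (simp add: mult.assoc)
  then have "adj w (Th r * wd w) = adj w (sc (of_real r) * (wd w * Th r))" by simp
  then show ?thesis by (simp add: adj_simps[OF m] adj_Th[OF m] mult.assoc Lam_def)
qed

context atlas
begin

lemma opf_cong: "(\<And>c x. c \<in> A \<Longrightarrow> x \<in> cdom c \<Longrightarrow> p c x = q c x) \<Longrightarrow> opf p u = opf q u"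
  by (auto simp: opf_def fun_eq_iff)

lemma wd_gp: "wd (ap (gp f c x) \<alpha>) = gp f c x * wd \<alpha>" and wd_gq: "wd (ap (gq f c x) \<alpha>) = gq f c x * wd \<alpha>"
  by (simp_all add: gp_def gq_def ap_sum_left wd_sum wd_scl wd_E wd_Eb sum_distrib_right mult.assoc)

context
  fixes f :: "'a \<Rightarrow> real"
  assumes f: "sreal f"
begin

private abbreviation (input) "ef \<equiv> form_of_fun A (\<lambda>x. of_real (f x))"

lemma form_of_fun_apply: "c \<in> A \<Longrightarrow> x \<in> cdom c \<Longrightarrow> ef c x = scl (of_real (f x)) oneE"
  by (auto simp: form_of_fun_def oneE_def fun_eq_iff)

lemma smooth_form_of_fun: "smooth_form A ef"
proof (rule smooth_formI)
  show "ef c x = 0" if "\<not> (c \<in> A \<and> x \<in> cdom c)" for c x using that by (auto simp: form_of_fun_def fun_eq_iff)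
  show "smE c (ef c)" if c: "c \<in> A" for c
  proof (rule smE_cong[OF chartA[OF c]])
    show "smE c (\<lambda>y. scl (of_real (f y)) oneE)"
      using f c by (intro smE_simps(4,5) chartA) (auto simp: sreal_def)
  qed (simp add: form_of_fun_apply c)
  show "ef c x = pull (jacobian c c' x) (ef c' x)" if "c \<in> A" "c' \<in> A" "x \<in> cdom c" "x \<in> cdom c'" for c c' x
    unfolding form_of_fun_apply[OF that(1,3)] form_of_fun_apply[OF that(2,4)] pull_linear pull_oneE ..
qed

lemma del_form_of_fun:
  assumes c: "c \<in> A" and x: "x \<in> cdom c"
  shows "del ef c x = ap (gp f c x) oneE" "delbar ef c x = ap (gq f c x) oneE"
proof -
  note ch = chartA[OF c]
  have s: "sm c (\<lambda>x. of_real (f x))" using f c by (simp add: sreal_def)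
  have d: "DE D (ef c) = scl (D (\<lambda>y. of_real (f y))) oneE" if D: "dv c x D" for D
  proof -
    have "DE D (ef c) = DE D (\<lambda>y. scl (of_real (f y)) oneE)"
      by (rule DE_cong[OF ch D]) (simp add: form_of_fun_apply c)
    then show ?thesis using DE_simps(4)[OF ch D s smE_simps(5)[OF ch]] by (simp add: DE_simps(5)[OF ch D] scl_simps)
  qed
  show "del ef c x = ap (gp f c x) oneE" "delbar ef c x = ap (gq f c x) oneE"
    unfolding del_apply[OF x] delbar_apply[OF x] d[OF dv_wirt[OF ch x]] d[OF dv_wirtbar[OF ch x]] gp_def gq_def
    by (simp_all only: ap_sum_left ap_simps ap_scl)
qed

lemma smooth_form_dbar_neg_eta: "smooth_form A (dbar_neg_eta A f)"
  and smooth_form_d_eta_eta: "smooth_form A (d_eta_eta A f)"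
  unfolding dbar_neg_eta_def d_eta_eta_def Let_def using f
  by (intro smooth_form_diff smooth_form_add smooth_form_fscale smooth_form_del smooth_form_delbar smooth_form_of_fun; simp add: sreal_def)+

lemma wd_dbar_neg_eta:
  assumes c: "c \<in> A" and x: "x \<in> cdom c"
  shows "wd (dbar_neg_eta A f c x) = gp f c x - sc (of_real (f x)) * gq f c x"
    and "wd (d_eta_eta A f c x) = sc (of_real (f x)) * gp f c x + gq f c x"
  unfolding dbar_neg_eta_def d_eta_eta_def Let_def form_apply fscale_apply del_form_of_fun[OF c x]
  by (simp_all add: wd_diff wd_add wd_scl wd_gp wd_gq wd_oneE)

end

end

context hermitian
begin

lemma lefschetz_adj_eq: "smooth_form A u \<Longrightarrow> lefschetz_adj A \<omega> u = Lam_form u"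
  unfolding lefschetz_adj_def Lam_form_def Lam_def
  by (rule pointwise_adjoint_eq[OF opf_wd[OF _ smooth_\<omega>] tensor_wd[OF smooth_\<omega>]])

lemma Lam_form_apply: "c \<in> A \<Longrightarrow> x \<in> cdom c \<Longrightarrow> Lam_form u c x = ap (Lam (\<omega> c x)) (u c x)"
  by (simp add: Lam_form_def)

text \<open>The adjoint reverses the commutator and turns \<open>Lam\<close> back into
  multiplication by the metric. The form \<open>\<alpha>\<close> is general so that both torsion
  operators are covered.\<close>

lemma torsion_adjoint:
  assumes \<alpha>: "smooth_form A \<alpha>" and u: "smooth_form A u"
  shows "pointwise_adjoint A \<omega> (gcomm (- 2) 3 (lefschetz_adj A \<omega>) (\<lambda>u. \<alpha> \<and>\<and> u)) u =
    opf (\<lambda>c x. adj (\<omega> c x) (wd (\<alpha> c x)) * wd (\<omega> c x) - wd (\<omega> c x) * adj (\<omega> c x) (wd (\<alpha> c x))) u"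
proof -
  let ?p = "\<lambda>c x. Lam (\<omega> c x) * wd (\<alpha> c x) - wd (\<alpha> c x) * Lam (\<omega> c x)"
  have p: "tensor ?p" by (intro tensor_simps tensor_mult tensor_Lam tensor_wd \<alpha>)
  have "gcomm (- 2) 3 (lefschetz_adj A \<omega>) (\<lambda>u. \<alpha> \<and>\<and> u) v = opf ?p v" if v: "smooth_form A v" for v
  proof (rule smooth_form_eqI)
    have e: "gcomm (- 2) 3 (lefschetz_adj A \<omega>) (\<lambda>u. \<alpha> \<and>\<and> u) v = Lam_form (\<alpha> \<and>\<and> v) - fscale (\<lambda>_. 1) (\<alpha> \<and>\<and> Lam_form v)"
      unfolding gcomm_def lefschetz_adj_eq[OF v] lefschetz_adj_eq[OF smooth_form_wedge[OF v \<alpha>]] by simp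
    show "smooth_form A (gcomm (- 2) 3 (lefschetz_adj A \<omega>) (\<lambda>u. \<alpha> \<and>\<and> u) v)"
      unfolding e by (intro smooth_form_diff smooth_form_fscale_const smooth_form_Lam smooth_form_wedge v \<alpha>)
    show "smooth_form A (opf ?p v)" by (rule smooth_form_opf[OF p v])
    fix c x assume c: "c \<in> A" "x \<in> cdom c"
    show "gcomm (- 2) 3 (lefschetz_adj A \<omega>) (\<lambda>u. \<alpha> \<and>\<and> u) v c x = opf ?p v c x"
      unfolding e unfolding form_apply fscale_apply Lam_form_apply[OF c] opf_apply[OF c] fwedge_def by (simp add: scl_simps)
  qed
  from pointwise_adjoint_eq[OF this p u]
  have "pointwise_adjoint A \<omega> (gcomm (- 2) 3 (lefschetz_adj A \<omega>) (\<lambda>u. \<alpha> \<and>\<and> u)) u = opf (\<lambda>c x. adj (\<omega> c x) (?p c x)) u" .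
  also have "\<dots> = opf (\<lambda>c x. adj (\<omega> c x) (wd (\<alpha> c x)) * wd (\<omega> c x) - wd (\<omega> c x) * adj (\<omega> c x) (wd (\<alpha> c x))) u"
    by (rule opf_cong) (simp add: adj_simps[OF metric_\<omega>] adj_Lam[OF metric_\<omega>] wd_metric[OF metric_\<omega>])
  finally show ?thesis .
qed

lemma inner_at_theta: "inner_at A \<omega> x (theta f u) v = inner_at A \<omega> x u (theta f v)"
  unfolding inner_at_def Let_def theta_apply ext_inner_adj[OF metric_\<omega>[OF chart_at]] adj_Th[OF metric_\<omega>[OF chart_at]] ..

lemma gcomm_wedge_Lam:
  assumes \<alpha>: "smooth_form A \<alpha>" and u: "smooth_form A u"
  shows "gcomm 1 (- 2) (\<lambda>v. \<alpha> \<and>\<and> v) (lefschetz_adj A \<omega>) u = opf (\<lambda>c x. wd (\<alpha> c x) * Lam (\<omega> c x) - Lam (\<omega> c x) * wd (\<alpha> c x)) u"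
proof (rule smooth_form_eqI)
  have e: "gcomm 1 (- 2) (\<lambda>v. \<alpha> \<and>\<and> v) (lefschetz_adj A \<omega>) u = \<alpha> \<and>\<and> Lam_form u - fscale (\<lambda>_. 1) (Lam_form (\<alpha> \<and>\<and> u))"
    unfolding gcomm_def lefschetz_adj_eq[OF u] lefschetz_adj_eq[OF smooth_form_wedge[OF u \<alpha>]] by simp
  show "smooth_form A (gcomm 1 (- 2) (\<lambda>v. \<alpha> \<and>\<and> v) (lefschetz_adj A \<omega>) u)"
    unfolding e by (intro smooth_form_diff smooth_form_fscale_const smooth_form_Lam smooth_form_wedge u \<alpha>)
  show "smooth_form A (opf (\<lambda>c x. wd (\<alpha> c x) * Lam (\<omega> c x) - Lam (\<omega> c x) * wd (\<alpha> c x)) u)"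
    by (intro smooth_form_opf tensor_simps tensor_mult tensor_Lam tensor_wd \<alpha> u)
  fix c x assume c: "c \<in> A" "x \<in> cdom c"
  show "gcomm 1 (- 2) (\<lambda>v. \<alpha> \<and>\<and> v) (lefschetz_adj A \<omega>) u c x = opf (\<lambda>c x. wd (\<alpha> c x) * Lam (\<omega> c x) - Lam (\<omega> c x) * wd (\<alpha> c x)) u c x"
    unfolding e unfolding form_apply fscale_apply Lam_form_apply[OF c] opf_apply[OF c] fwedge_def by (simp add: scl_simps)
qed

context
  fixes \<eta> :: "'a \<Rightarrow> real"
  assumes \<eta>: "sreal \<eta>" "\<And>x. \<eta> x \<noteq> 0"
begin

lemma L2_inner_D_eta:
  assumes u: "smooth_form A u" and v: "smooth_form A v" "compactly_supported v"
  shows "L2_inner A \<omega> (D_eta \<eta> v) u = L2_inner A \<omega> v (theta (\<lambda>x. 1 / \<eta> x) (codiff (theta \<eta> u)))"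
proof -
  have "L2_inner A \<omega> (D_eta \<eta> v) u = L2_inner A \<omega> (ext_d (theta (\<lambda>x. 1 / \<eta> x) v)) (theta \<eta> u)"
    unfolding L2_inner_def D_eta_def inner_at_theta ..
  also have "\<dots> = L2_inner A \<omega> (theta (\<lambda>x. 1 / \<eta> x) v) (codiff (theta \<eta> u))"
    by (rule L2_inner_ext_d[OF smooth_form_theta[OF \<eta>(1) u] smooth_form_theta[OF sreal_inverse[OF \<eta>] v(1)] compactly_supported_theta[OF v(2)]])
  also have "\<dots> = L2_inner A \<omega> v (theta (\<lambda>x. 1 / \<eta> x) (codiff (theta \<eta> u)))"
    unfolding L2_inner_def inner_at_theta ..
  finally show ?thesis .
qed

lemma formal_adjoint_D_eta:
  assumes u: "smooth_form A u"
  shows "formal_adjoint A \<omega> (D_eta \<eta>) u = theta (\<lambda>x. 1 / \<eta> x) (codiff (theta \<eta> u))"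
  by (rule formal_adjoint_eqI) (intro smooth_form_theta smooth_form_codiff sreal_inverse \<eta> u, rule L2_inner_D_eta[OF u])

text \<open>\<open>Lam\<close> lowers the holomorphic degree by 1, so one factor of
  \<open>\<eta>\<close> is left over.\<close>

lemma Lam_form_theta:
  "Lam_form (theta \<eta> u) = theta \<eta> (fscale (\<lambda>x. of_real (\<eta> x)) (Lam_form u))"
proof (rule ext, rule ext)
  fix c x
  show "Lam_form (theta \<eta> u) c x = theta \<eta> (fscale (\<lambda>x. of_real (\<eta> x)) (Lam_form u)) c x"
  proof (cases "c \<in> A \<and> x \<in> cdom c")
    case True
    then have "metric (\<omega> c x)" by (simp add: metric_\<omega>)
    note Lam_Th[OF this, of "\<eta> x"]
    from arg_cong[OF this, of "\<lambda>p. ap p (u c x)"] show ?thesis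
      using True by (simp add: theta_apply fscale_apply Lam_form_apply ap_scl)
  next
    case False
    then have 0: "Lam_form u c x = 0" for u by (auto simp: Lam_form_def opf_def)
    show ?thesis by (simp only: theta_apply fscale_apply 0 scl_simps ap_0)
  qed
qed

context
  fixes c :: "('a, 'n) chart" and x :: 'a
  assumes c: "c \<in> A" and x: "x \<in> cdom c"
begin

private abbreviation (input) "om \<equiv> \<omega> c x"
private abbreviation (input) "h \<equiv> complex_of_real (\<eta> x)"
private abbreviation (input) "p \<equiv> gp \<eta> c x"
private abbreviation (input) "q \<equiv> gq \<eta> c x"
private abbreviation (input) "T0 \<equiv> Th (\<eta> x) :: 'n lop"
private abbreviation (input) "T1 \<equiv> Th (1 / \<eta> x) :: 'n lop"
private abbreviation (input) "F \<equiv> p - sc h * q"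
private abbreviation (input) "X \<equiv> sc h * p + q"

private lemma m: "metric om" by (rule metric_\<omega>[OF c x])

private lemma T1T0: "T1 * T0 = 1" "T0 * T1 = 1"
  using \<eta>(2)[of x] by (simp_all add: Th_mult Th_1)

text \<open>The two components of the differential of omega have holomorphic degrees 2 and 1 and are
  scaled by the square of \<open>\<eta>\<close> and by \<open>\<eta>\<close>, which matches
  \<open>\<eta>\<close> times the derivative part of \<open>D_eta\<close>. The correction
  \<open>X\<close> compensates the terms of \<open>D_eta\<close> with \<open>Np\<close>, which is 1
  on omega.\<close>

lemma Th_ext_d_omega: "ap T0 (ext_d \<omega> c x) = scl h (D_eta \<eta> \<omega> c x) + ap X om"
proof -
  note ch = chartA[OF c]
  have DE: "ap T0 (DE D (\<omega> c)) = scl h (DE D (\<omega> c))" if D: "dv c x D" for D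
  proof -
    have "ap T0 (DE D (\<omega> c)) = DE D (\<lambda>y. ap T0 (\<omega> c y))" by (rule DE_ap_const[OF ch D sf_smE[OF smooth_\<omega> c], symmetric])
    also have "\<dots> = DE D (\<lambda>y. scl h (\<omega> c y))" by (rule DE_cong[OF ch D]) (rule Th_metric[OF metric_\<omega>[OF c]])
    also have "\<dots> = scl (D (\<lambda>y. h)) (\<omega> c x) + scl h (DE D (\<omega> c))" by (rule DE_simps(4)[OF ch D sm_const[OF ch] sf_smE[OF smooth_\<omega> c]])
    finally show ?thesis by (simp only: dv_simps(3)[OF ch D] scl_simps(7) add_0_left)
  qed
  have E: "ap T0 (ap (E j) \<alpha>) = scl h (ap (E j) (ap T0 \<alpha>))" "ap T0 (ap (Eb j) \<alpha>) = ap (Eb j) (ap T0 \<alpha>)" for j \<alpha>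
    using arg_cong[OF Th_E[of "\<eta> x" j], of "\<lambda>p. ap p \<alpha>"] arg_cong[OF Th_Eb[of "\<eta> x" j], of "\<lambda>p. ap p \<alpha>"] by (simp_all only: ap_simps)
  have "ap T0 (del \<omega> c x) = scl (h * h) (del \<omega> c x)" "ap T0 (delbar \<omega> c x) = scl h (delbar \<omega> c x)"
    unfolding del_apply[OF x] delbar_apply[OF x] ap_sum E DE[OF dv_wirt[OF ch x]] DE[OF dv_wirtbar[OF ch x]] ap_scl scl_simps(5) scl_sum
    by (rule refl)+
  moreover have "ap Np om = om"
  proof (intro ext)
    fix I J
    have "om I J \<noteq> 0 \<Longrightarrow> card I = 1" using m by (auto simp: metric_def)
    then show "ap Np om I J = om I J" by (cases "om I J = 0") (simp_all add: ap_Np)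
  qed
  ultimately show ?thesis
    unfolding D_eta_apply[OF c x \<eta> smooth_\<omega>] ext_d_def form_apply ap_add ap_simps using \<eta>(2)[of x]
    by (simp add: scl_simps)
qed

text \<open>Conjugation by \<open>Th\<close> passes through adjoints and products, so it acts on
  each factor of the commutator separately; \<open>Th_ext_d_omega\<close> then splits off the
  torsion of \<open>D_eta\<close>. The remainder is what \<open>adjoint_formula_algebra\<close>
  evaluates.\<close>

lemma rescaled_torsion:
  "T1 * (adj om (wd (ext_d \<omega> c x)) * wd om - wd om * adj om (wd (ext_d \<omega> c x))) * T0 =
    (adj om (wd (D_eta \<eta> \<omega> c x)) * wd om - wd om * adj om (wd (D_eta \<eta> \<omega> c x)))
    + sc (1 / h) * (Lam om * adj om X * wd om - wd om * (Lam om * adj om X))"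
proof -
  let ?T = "adj om (wd (ext_d \<omega> c x))" and ?S = "adj om (wd (D_eta \<eta> \<omega> c x))" and ?W = "wd om"
  have wX: "wd (ap X om) = X * ?W" by (simp add: ap_simps wd_add wd_scl wd_gp wd_gq distrib_right mult.assoc)
  have "T0 * wd (ext_d \<omega> c x) * T1 = sc h * wd (D_eta \<eta> \<omega> c x) + X * ?W"
    unfolding Th_wd Th_ext_d_omega wd_add wd_scl wX using T1T0(2) by (simp add: mult.assoc)
  from arg_cong[OF this, of "adj om"] have a: "T1 * ?T * T0 = sc h * ?S + Lam om * adj om X"
    by (simp only: adj_simps(1,4,5)[OF m] adj_Th[OF m] complex_cnj_complex_of_real sc_comm[of h] Lam_def mult.assoc)
  have b: "T1 * ?W * T0 = sc (1 / h) * ?W"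
    unfolding Th_wd Th_metric[OF m] wd_scl using T1T0(1) by (simp add: mult.assoc)
  have "T1 * (?T * ?W - ?W * ?T) * T0 = (T1 * ?T * T0) * (T1 * ?W * T0) - (T1 * ?W * T0) * (T1 * ?T * T0)"
  proof -
    have "(T1 * P * T0) * (T1 * Q * T0) = T1 * (P * Q) * T0" for P Q
    proof -
      have "(T1 * P * T0) * (T1 * Q * T0) = T1 * P * (T0 * T1) * Q * T0" by (simp only: mult.assoc)
      then show ?thesis unfolding T1T0(2) by (simp add: mult.assoc)
    qed
    then show ?thesis by (simp add: right_diff_distrib left_diff_distrib)
  qed
  also have "\<dots> = sc (1 / h) * ((sc h * ?S + Lam om * adj om X) * ?W - ?W * (sc h * ?S + Lam om * adj om X))"
    unfolding a b by (simp add: right_diff_distrib sc_left_commute[of "_ + _"] mult.assoc)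
  also have "(sc h * ?S + Lam om * adj om X) * ?W - ?W * (sc h * ?S + Lam om * adj om X) =
     sc h * (?S * ?W - ?W * ?S) + (Lam om * adj om X * ?W - ?W * (Lam om * adj om X))"
    by (simp add: distrib_left distrib_right sc_left_commute[of ?W] mult.assoc right_diff_distrib)
  also have "sc (1 / h) * (sc h * (?S * ?W - ?W * ?S) + (Lam om * adj om X * ?W - ?W * (Lam om * adj om X))) =
     (?S * ?W - ?W * ?S) + sc (1 / h) * (Lam om * adj om X * ?W - ?W * (Lam om * adj om X))"
    using \<eta>(2)[of x] by (simp only: distrib_left sc_mult_left) simp
  finally show ?thesis .
qed

private lemma expand:
  fixes G L S :: "'n lop"
  shows "ap (S + sc r * (sc \<i> * (G * L + G * (Np + Nq) * L - L * G * (Np + Nq)) + sc k * (L * G - G * L))) v =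
    ap S v + scl r (scl \<i> (ap G (ap L v) + (ap G (ap Np (ap L v)) + ap G (ap Nq (ap L v)))
       - (ap L (ap G (ap Np v)) + ap L (ap G (ap Nq v)))) + scl k (ap L (ap G v) - ap G (ap L v)))"
  by (simp only: ap_simps ap_add scl_simps(1))

text \<open>The cancellation of the degree terms: \<open>a1\<close>, \<open>b1\<close> carry
  \<open>Np\<close> and drop out together with the single \<open>b0\<close> from the derivative of
  \<open>\<eta>\<close>. The terms \<open>a2\<close>, \<open>b2\<close> carry \<open>Nq\<close>;
  they survive and complete the derivative terms to \<open>Dbar_neg\<close>.\<close>

private lemma vector_identity:
  "scl (- \<i>) (l + scl r a1 - P' - scl r b0 - scl r b1) - (s + scl r (scl \<i> (b0 + (b1 + b2) - (a1 + a2)) + scl (\<i> * n) (d0 - b0))) =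
    scl \<i> ((P' - scl r b2) - (l - scl r a2)) - s + scl n (scl r (scl \<i> b0 - scl \<i> d0))"
  by (simp add: fun_eq_iff algebra_simps)

lemma adjoint_D_eta_apply:
  assumes u: "smooth_form A u"
  shows "theta (\<lambda>x. 1 / \<eta> x) (codiff (theta \<eta> u)) c x =
    scl \<i> (Dbar_neg \<eta> (Lam_form u) c x - ap (Lam om) (Dbar_neg \<eta> u c x))
    - ap (adj om (wd (D_eta \<eta> \<omega> c x)) * wd om - wd om * adj om (wd (D_eta \<eta> \<omega> c x))) (u c x)
    + scl (of_nat CARD('n)) (scl (1 / h) (scl \<i> (ap F (ap (Lam om) (u c x))) - scl \<i> (ap (Lam om) (ap F (u c x)))))"
proof -
  note Lu = smooth_form_Lam[OF u] and tu = smooth_form_theta[OF \<eta>(1) u]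
  have h0: "h \<noteq> 0" using \<eta>(2) by simp
  let ?L = "Lam om" and ?v = "u c x" and ?N = "Np + Nq :: 'n lop"
  let ?P = "del u c x - scl h (delbar u c x)" and ?P' = "del (Lam_form u) c x - scl h (delbar (Lam_form u) c x)"
  let ?R = "adj om (wd (ext_d \<omega> c x)) * wd om - wd om * adj om (wd (ext_d \<omega> c x))"
  let ?S = "adj om (wd (D_eta \<eta> \<omega> c x)) * wd om - wd om * adj om (wd (D_eta \<eta> \<omega> c x))"
  have fL: "smooth_form A (fscale (\<lambda>x. of_real (\<eta> x)) (Lam_form u))"
    using \<eta>(1) by (intro smooth_form_fscale Lu) (simp add: sreal_def)
  have d1: "del (theta \<eta> u) c x - delbar (theta \<eta> u) c x = ap T0 (scl (1 / h) (?P + scl (1 / h) (ap F (ap Np ?v))))"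
    unfolding del_theta[OF c x \<eta>(1) \<eta>(2) u] using h0
    by (simp only: ap_diff[symmetric] ap_simps scl_simps) (simp add: scl_simps power2_eq_square algebra_simps)
  have d2: "del (Lam_form (theta \<eta> u)) c x - delbar (Lam_form (theta \<eta> u)) c x =
      ap T0 (?P' + scl (1 / h) (ap F (ap ?L ?v)) + scl (1 / h) (ap F (ap Np (ap ?L ?v))))"
    unfolding Lam_form_theta del_theta[OF c x \<eta>(1) \<eta>(2) fL] del_fscale_real[OF c x \<eta>(1) Lu] fscale_apply Lam_form_apply[OF c x] using h0
    by (simp only: ap_diff[symmetric] ap_simps scl_simps ap_scl) (simp add: scl_simps power2_eq_square algebra_simps)
  have TL: "ap T1 (ap ?L (ap T0 \<alpha>)) = scl h (ap ?L \<alpha>)" for \<alpha>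
  proof -
    have "T1 * (?L * T0) = T1 * T0 * (?L * sc h)" unfolding Lam_Th[OF m] by (simp only: mult.assoc)
    from arg_cong[OF this, of "\<lambda>p. ap p \<alpha>"] show ?thesis unfolding T1T0(1) by (simp add: ap_scl)
  qed
  have TT: "ap T1 (ap T0 \<alpha>) = \<alpha>" for \<alpha>
    using arg_cong[OF T1T0(1), of "\<lambda>p. ap p \<alpha>"] by simp
  have TR: "ap T1 (ap ?R (ap T0 ?v)) = ap ?S ?v + scl (1 / h) (scl \<i> (ap F (ap ?L ?v) + (ap F (ap Np (ap ?L ?v)) + ap F (ap Nq (ap ?L ?v)))
       - (ap ?L (ap F (ap Np ?v)) + ap ?L (ap F (ap Nq ?v)))) + scl (\<i> * of_nat CARD('n)) (ap ?L (ap F ?v) - ap F (ap ?L ?v)))"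
  proof -
    have b: "wirtbar c j (\<lambda>y. of_real (\<eta> y)) x = cnj (wirt c j (\<lambda>y. of_real (\<eta> y)) x)" for j
      using wirt_cnj[OF chartA[OF c] x, of "\<lambda>y. of_real (\<eta> y)" j] \<eta>(1) c by (simp add: sreal_def)
    have alg: "?L * adj om X * wd om - wd om * (?L * adj om X) =
      sc \<i> * (F * ?L + F * ?N * ?L - ?L * F * ?N) + sc (\<i> * of_nat CARD('n)) * (?L * F - F * ?L)"
      unfolding gp_def gq_def by (rule adjoint_formula_algebra[OF m b])
    have "ap T1 (ap ?R (ap T0 ?v)) = ap (T1 * ?R * T0) ?v" by (simp only: ap_simps)
    also have "\<dots> = ap (?S + sc (1 / h) * (sc \<i> * (F * ?L + F * ?N * ?L - ?L * F * ?N) + sc (\<i> * of_nat CARD('n)) * (?L * F - F * ?L))) ?v"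
      unfolding rescaled_torsion alg ..
    finally show ?thesis unfolding expand .
  qed
  have "theta (\<lambda>x. 1 / \<eta> x) (codiff (theta \<eta> u)) c x =
    scl (- \<i>) (ap ?L ?P + scl (1 / h) (ap ?L (ap F (ap Np ?v))) - ?P' - scl (1 / h) (ap F (ap ?L ?v)) - scl (1 / h) (ap F (ap Np (ap ?L ?v))))
    - ap T1 (ap ?R (ap T0 ?v))"
  proof -
    have "codiff (theta \<eta> u) c x = scl (- \<i>) (ap ?L (del (theta \<eta> u) c x - delbar (theta \<eta> u) c x)
        - (del (Lam_form (theta \<eta> u)) c x - delbar (Lam_form (theta \<eta> u)) c x)) - ap ?R (ap T0 ?v)"
      unfolding codiff_def form_apply fscale_apply Lam_form_apply[OF c x] opf_apply[OF c x] theta_apply ..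
    then have "theta (\<lambda>x. 1 / \<eta> x) (codiff (theta \<eta> u)) c x = scl (- \<i>) (scl h (ap ?L (scl (1 / h) (?P + scl (1 / h) (ap F (ap Np ?v)))))
       - (?P' + scl (1 / h) (ap F (ap ?L ?v)) + scl (1 / h) (ap F (ap Np (ap ?L ?v))))) - ap T1 (ap ?R (ap T0 ?v))"
      unfolding d1 d2 theta_apply[of _ "codiff _"] by (simp only: ap_diff ap_scl[of T1] TL TT)
    also have "scl h (ap ?L (scl (1 / h) (?P + scl (1 / h) (ap F (ap Np ?v))))) = ap ?L ?P + scl (1 / h) (ap ?L (ap F (ap Np ?v)))"
      using h0 by (simp only: ap_scl ap_add scl_simps(5)) (simp add: scl_simps)
    finally show ?thesis by (simp only: diff_diff_eq add.assoc)
  qed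
  also have "\<dots> = scl \<i> ((?P' - scl (1 / h) (ap F (ap Nq (ap ?L ?v)))) - (ap ?L ?P - scl (1 / h) (ap ?L (ap F (ap Nq ?v))))) - ap ?S ?v
    + scl (of_nat CARD('n)) (scl (1 / h) (scl \<i> (ap F (ap ?L ?v)) - scl \<i> (ap ?L (ap F ?v))))"
    unfolding TR by (rule vector_identity)
  also have "?P' - scl (1 / h) (ap F (ap Nq (ap ?L ?v))) = Dbar_neg \<eta> (Lam_form u) c x"
    unfolding Dbar_apply[OF c x \<eta> Lu] Lam_form_apply[OF c x] using h0 by (simp add: scl_simps)
  also have "ap ?L ?P - scl (1 / h) (ap ?L (ap F (ap Nq ?v))) = ap ?L (Dbar_neg \<eta> u c x)"
    unfolding Dbar_apply[OF c x \<eta> u] ap_scl[of "Lam om", symmetric] ap_diff[of "Lam om", symmetric] using h0 by (simp add: scl_simps algebra_simps)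
  finally show ?thesis .
qed

end

end

end

section \<open>Conjugation\<close>

lemma ip_cj: "ip (cj \<alpha>) (cj \<beta>) = cnj (ip \<alpha> \<beta>)"
proof -
  have "ip (cj \<alpha>) (cj \<beta>) = (\<Sum>I\<in>UNIV. \<Sum>J\<in>UNIV. cnj (\<alpha> J I) * \<beta> J I)"
    unfolding ip_def by (intro sum.cong refl) (simp add: cj_def mult_ac flip: power_add)
  also have "\<dots> = cnj (ip \<alpha> \<beta>)" unfolding ip_def by (subst sum.swap) simp
  finally show ?thesis .
qed

lemma ext_inner_cj: "ext_inner w (cj \<alpha>) (cj \<beta>) = cnj (ext_inner w \<alpha> \<beta>)"
  unfolding ext_inner_eq Mop_def ap_pl cj_pull[symmetric] by (rule ip_cj)

text \<open>A Hermitian matrix means a real form: the sign of \<open>cj\<close> on type (1,1)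
  compensates the conjugation of the factor i.\<close>

lemma cj_metric:
  assumes w: "metric w"
  shows "cj w = w"
proof (intro ext)
  fix I J
  show "cj w I J = w I J"
  proof (cases "card I = 1 \<and> card J = 1")
    case True
    then obtain j k where "I = {j}" "J = {k}" by (meson card_1_singletonE)
    moreover have "cnj (w {k} {j}) = - w {j} {k}"
      using herm_cnj[OF w, of k j] by (simp add: herm_mat_def complex_eq_iff)
    ultimately show ?thesis by (simp add: cj_def)
  next
    case False
    then have "w I J = 0" "w J I = 0" using w unfolding metric_def by blast+
    then show ?thesis by (simp add: cj_def)
  qed
qed

text \<open>By \<open>ext_inner_cj\<close> conjugation turns the inner product into its conjugate,
  so it carries an adjoint pair to an adjoint pair.\<close>

lemma cj_adj:
  assumes w: "metric w" and p: "\<And>\<alpha>. cj (ap p \<alpha>) = ap p' (cj \<alpha>)"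
  shows "cj (ap (adj w p) \<alpha>) = ap (adj w p') (cj \<alpha>)"
proof (rule ext_inner_nondeg[OF w])
  fix \<gamma>
  have "ext_inner w (cj (cj \<gamma>)) (cj (ap (adj w p) \<alpha>)) = ext_inner w (cj (ap p (cj \<gamma>))) (cj \<alpha>)"
    unfolding ext_inner_cj ext_inner_adj[OF w, symmetric] ..
  then show "ext_inner w \<gamma> (cj (ap (adj w p) \<alpha>)) = ext_inner w \<gamma> (ap (adj w p') (cj \<alpha>))"
    unfolding p cj_simps(5) ext_inner_adj[OF w] .
qed

lemma cj_Lam:
  assumes w: "metric w"
  shows "cj (ap (Lam w) \<alpha>) = ap (Lam w) (cj \<alpha>)"
  unfolding Lam_def by (rule cj_adj[OF w]) (simp add: cj_wedge cj_metric[OF w])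

section \<open>The identity\<close>

lemma gcomm_simps:
  "gcomm 1 (- 1) P Q u = P (Q u) + Q (P u)" "gcomm 1 1 P Q u = P (Q u) + Q (P u)" "gcomm 2 (- 2) P Q u = P (Q u) - Q (P u)"
  by (simp_all add: gcomm_def fscale_def fun_eq_iff)

lemma oper_apply:
  fixes P Q :: "('a, 'n) oper"
  shows "(P + Q) u = P u + Q u" "(P - Q) u = P u - Q u"
  by simp_all

context hermitian
begin

lemma conj_form_omega: "conj_form \<omega> = \<omega>"
proof (rule smooth_form_eqI[OF smooth_form_conj[OF smooth_\<omega>] smooth_\<omega>])
  fix c x assume "c \<in> A" "x \<in> cdom c"
  then show "conj_form \<omega> c x = \<omega> c x" unfolding conj_form_apply by (intro cj_metric metric_\<omega>)
qed

lemma Lam_form_conj: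
  assumes u: "smooth_form A u"
  shows "Lam_form (conj_form u) = conj_form (Lam_form u)"
proof (rule smooth_form_eqI)
  fix c x assume c: "c \<in> A" "x \<in> cdom c"
  show "Lam_form (conj_form u) c x = conj_form (Lam_form u) c x"
    unfolding conj_form_apply Lam_form_apply[OF c] cj_Lam[OF metric_\<omega>[OF c]] ..
qed (intro smooth_form_Lam smooth_form_conj u)+

lemma L2_inner_conj: "L2_inner A \<omega> (conj_form u) (conj_form v) = cnj (L2_inner A \<omega> u v)"
  unfolding L2_inner_def inner_at_def Let_def conj_form_apply ext_inner_cj by simp

lemma Lam_form_add: "Lam_form (u + v) = Lam_form u + Lam_form v"
proof (rule ext, rule ext)
  fix c x
  show "Lam_form (u + v) c x = (Lam_form u + Lam_form v) c x"
    unfolding form_apply Lam_form_def opf_def by (simp add: ap_add)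
qed

context
  fixes \<eta> :: "'a \<Rightarrow> real"
  assumes \<eta>: "sreal \<eta>" "\<And>x. \<eta> x \<noteq> 0"
begin

private definition t1 :: "('a, 'n) oper" where "t1 = pointwise_adjoint A \<omega> (torsion A \<omega> \<eta>)"
private definition t2 :: "('a, 'n) oper" where "t2 = pointwise_adjoint A \<omega> (torsionbar_neg A \<omega> \<eta>)"
private definition g1 :: "('a, 'n) oper" where
  "g1 = mult_op (\<lambda>x. 1 / of_real (\<eta> x)) (gcomm 1 (- 2) (\<lambda>v. fscale (\<lambda>_. \<i>) (dbar_neg_eta A \<eta>) \<and>\<and> v) (lefschetz_adj A \<omega>))"
private definition g2 :: "('a, 'n) oper" where
  "g2 = mult_op (\<lambda>x. 1 / of_real (\<eta> x)) (gcomm 1 (- 2) (\<lambda>v. fscale (\<lambda>_. \<i>) (d_eta_eta A \<eta>) \<and>\<and> v) (lefschetz_adj A \<omega>))"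

private lemma minus: "sreal (\<lambda>x. - \<eta> x)" "- \<eta> x \<noteq> 0"
  using \<eta> sreal_minus by auto

private lemma s_inv: "c \<in> A \<Longrightarrow> sm c (\<lambda>x. 1 / of_real (\<eta> x))"
  using sreal_inverse[OF \<eta>] by (simp add: sreal_def)

private lemma smooth_D: "smooth_form A u \<Longrightarrow> smooth_form A (D_eta \<eta> u)"
  and smooth_B: "smooth_form A u \<Longrightarrow> smooth_form A (Dbar_neg \<eta> u)"
  by (rule smooth_form_D_eta[OF \<eta>] smooth_form_Dbar[OF \<eta>], assumption)+

context
  fixes u :: "('a, 'n) form"
  assumes u: "smooth_form A u"
begin

private lemma t1_eq: "t1 u = opf (\<lambda>c x. adj (\<omega> c x) (wd (D_eta \<eta> \<omega> c x)) * wd (\<omega> c x) - wd (\<omega> c x) * adj (\<omega> c x) (wd (D_eta \<eta> \<omega> c x))) u"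
  unfolding t1_def torsion_def by (rule torsion_adjoint[OF smooth_D[OF smooth_\<omega>] u])

private lemma t2_eq: "t2 u = opf (\<lambda>c x. adj (\<omega> c x) (wd (Dbar_neg \<eta> \<omega> c x)) * wd (\<omega> c x) - wd (\<omega> c x) * adj (\<omega> c x) (wd (Dbar_neg \<eta> \<omega> c x))) u"
  unfolding t2_def torsionbar_neg_def by (rule torsion_adjoint[OF smooth_B[OF smooth_\<omega>] u])

lemma smooth_t: "smooth_form A (t1 u)" "smooth_form A (t2 u)"
  unfolding t1_eq t2_eq
  by (intro smooth_form_opf tensor_simps tensor_mult tensor_adj tensor_wd smooth_D smooth_B smooth_\<omega> u)+

lemma smooth_g_form: "smooth_form A (fscale (\<lambda>_. \<i>) (dbar_neg_eta A \<eta>))" "smooth_form A (fscale (\<lambda>_. \<i>) (d_eta_eta A \<eta>))"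
  by (intro smooth_form_fscale_const smooth_form_dbar_neg_eta smooth_form_d_eta_eta \<eta>(1))+

lemma smooth_g: "smooth_form A (g1 u)" "smooth_form A (g2 u)"
proof -
  have "smooth_form A (opf (\<lambda>c x. wd (\<alpha> c x) * Lam (\<omega> c x) - Lam (\<omega> c x) * wd (\<alpha> c x)) u)" if "smooth_form A \<alpha>" for \<alpha>
    by (intro smooth_form_opf tensor_simps tensor_mult tensor_wd tensor_Lam that u)
  note o = this[OF smooth_g_form(1)] this[OF smooth_g_form(2)]
  show "smooth_form A (g1 u)" "smooth_form A (g2 u)"
    unfolding g1_def g2_def mult_op_def gcomm_wedge_Lam[OF smooth_g_form(1) u] gcomm_wedge_Lam[OF smooth_g_form(2) u]
    by (rule smooth_form_fscale[OF o(1) s_inv] smooth_form_fscale[OF o(2) s_inv]; assumption)+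
qed

private lemma g_apply:
  assumes c: "c \<in> A" "x \<in> cdom c"
  shows "g1 u c x = scl (1 / of_real (\<eta> x)) (scl \<i> (ap (gp \<eta> c x - sc (of_real (\<eta> x)) * gq \<eta> c x) (ap (Lam (\<omega> c x)) (u c x)))
      - scl \<i> (ap (Lam (\<omega> c x)) (ap (gp \<eta> c x - sc (of_real (\<eta> x)) * gq \<eta> c x) (u c x))))"
    and "g2 u c x = scl (1 / of_real (\<eta> x)) (scl \<i> (ap (sc (of_real (\<eta> x)) * gp \<eta> c x + gq \<eta> c x) (ap (Lam (\<omega> c x)) (u c x)))
      - scl \<i> (ap (Lam (\<omega> c x)) (ap (sc (of_real (\<eta> x)) * gp \<eta> c x + gq \<eta> c x) (u c x))))"
  unfolding g1_def g2_def mult_op_def gcomm_wedge_Lam[OF smooth_g_form(1) u] gcomm_wedge_Lam[OF smooth_g_form(2) u]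
    fscale_apply opf_apply[OF c] wd_scl wd_dbar_neg_eta[OF \<eta>(1) c]
  by (simp_all only: ap_simps(4,6,7) ap_scl)

lemma formal_adjoint_D_eta_eq:
  "formal_adjoint A \<omega> (D_eta \<eta>) u = fscale (\<lambda>_. \<i>) (Dbar_neg \<eta> (Lam_form u) - Lam_form (Dbar_neg \<eta> u)) - t1 u
     + fscale (\<lambda>_. of_nat CARD('n)) (g1 u)"
  unfolding formal_adjoint_D_eta[OF \<eta> u]
proof (rule smooth_form_eqI)
  show "smooth_form A (theta (\<lambda>x. 1 / \<eta> x) (codiff (theta \<eta> u)))"
    by (intro smooth_form_theta smooth_form_codiff sreal_inverse \<eta> u)
  show "smooth_form A (fscale (\<lambda>_. \<i>) (Dbar_neg \<eta> (Lam_form u) - Lam_form (Dbar_neg \<eta> u)) - t1 u + fscale (\<lambda>_. of_nat CARD('n)) (g1 u))"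
    by (intro smooth_form_add smooth_form_diff smooth_form_fscale_const smooth_form_Lam smooth_B smooth_t smooth_g u)
  fix c x assume c: "c \<in> A" "x \<in> cdom c"
  show "theta (\<lambda>x. 1 / \<eta> x) (codiff (theta \<eta> u)) c x =
    (fscale (\<lambda>_. \<i>) (Dbar_neg \<eta> (Lam_form u) - Lam_form (Dbar_neg \<eta> u)) - t1 u + fscale (\<lambda>_. of_nat CARD('n)) (g1 u)) c x"
    unfolding adjoint_D_eta_apply[OF \<eta> c u] form_apply fscale_apply t1_eq opf_apply[OF c] Lam_form_apply[OF c] g_apply[OF c] ..
qed

text \<open>\<open>Dbar_neg \<eta>\<close> is the conjugate of \<open>D_eta\<close> for
  \<open>- \<eta>\<close>, and conjugation of both arguments conjugates the inner product, so the
  adjoint is the conjugate of the one already known.\<close>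

private lemma formal_adjoint_Dbar:
  "formal_adjoint A \<omega> (Dbar_neg \<eta>) u = conj_form (theta (\<lambda>x. 1 / - \<eta> x) (codiff (theta (\<lambda>x. - \<eta> x) (conj_form u))))"
proof (rule formal_adjoint_eqI)
  let ?Y = "theta (\<lambda>x. 1 / - \<eta> x) (codiff (theta (\<lambda>x. - \<eta> x) (conj_form u)))"
  show "smooth_form A (conj_form ?Y)"
    by (intro smooth_form_conj smooth_form_theta smooth_form_codiff sreal_inverse minus u)
  fix v assume v: "smooth_form A v" "compactly_supported v"
  have "compactly_supported (conj_form v)"
    by (rule compactly_supported_mono[OF v(2)]) (simp only: conj_form_apply cj_simps)
  then have "L2_inner A \<omega> (D_eta (\<lambda>x. - \<eta> x) (conj_form v)) (conj_form u) = L2_inner A \<omega> (conj_form v) ?Y"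
    by (intro L2_inner_D_eta[OF minus] smooth_form_conj u v)
  then have "cnj (L2_inner A \<omega> (D_eta (\<lambda>x. - \<eta> x) (conj_form v)) (conj_form u)) = cnj (L2_inner A \<omega> (conj_form v) ?Y)" by simp
  then show "L2_inner A \<omega> (Dbar_neg \<eta> v) u = L2_inner A \<omega> v (conj_form ?Y)"
    unfolding L2_inner_conj[symmetric] conj_form_conj_form Dbar_neg_def conj_op_def .
qed

lemma formal_adjoint_Dbar_eq:
  "formal_adjoint A \<omega> (Dbar_neg \<eta>) u = fscale (\<lambda>_. - \<i>) (D_eta \<eta> (Lam_form u) - Lam_form (D_eta \<eta> u)) - t2 u
     - fscale (\<lambda>_. of_nat CARD('n)) (g2 u)"
  unfolding formal_adjoint_Dbar
proof (rule smooth_form_eqI)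
  let ?Y = "theta (\<lambda>x. 1 / - \<eta> x) (codiff (theta (\<lambda>x. - \<eta> x) (conj_form u)))"
  show "smooth_form A (conj_form ?Y)"
    by (intro smooth_form_conj smooth_form_theta smooth_form_codiff sreal_inverse minus u)
  show "smooth_form A (fscale (\<lambda>_. - \<i>) (D_eta \<eta> (Lam_form u) - Lam_form (D_eta \<eta> u)) - t2 u - fscale (\<lambda>_. of_nat CARD('n)) (g2 u))"
    by (intro smooth_form_diff smooth_form_fscale_const smooth_form_Lam smooth_D smooth_t smooth_g u)
  fix c x assume c: "c \<in> A" "x \<in> cdom c"
  note cu = smooth_form_conj[OF u] and m = metric_\<omega>[OF c]
  have B: "Dbar_neg (\<lambda>x. - \<eta> x) (conj_form v) = conj_form (D_eta \<eta> v)" for v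
    by (simp add: Dbar_neg_def conj_op_def)
  have D\<omega>: "cj (D_eta (\<lambda>x. - \<eta> x) \<omega> c x) = Dbar_neg \<eta> \<omega> c x"
    by (simp add: Dbar_neg_def conj_op_def conj_form_omega conj_form_apply)
  have S: "cj (ap (adj (\<omega> c x) (wd (D_eta (\<lambda>x. - \<eta> x) \<omega> c x))) \<alpha>) = ap (adj (\<omega> c x) (wd (Dbar_neg \<eta> \<omega> c x))) (cj \<alpha>)" for \<alpha>
    by (rule cj_adj[OF m]) (simp add: cj_wedge D\<omega>)
  have W: "cj (ap (wd (\<omega> c x)) \<alpha>) = ap (wd (\<omega> c x)) (cj \<alpha>)" for \<alpha>
    by (simp add: cj_wedge cj_metric[OF m])
  have SW: "cj (ap (adj (\<omega> c x) (wd (D_eta (\<lambda>x. - \<eta> x) \<omega> c x)) * wd (\<omega> c x) - wd (\<omega> c x) * adj (\<omega> c x) (wd (D_eta (\<lambda>x. - \<eta> x) \<omega> c x))) \<alpha>) =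
      ap (adj (\<omega> c x) (wd (Dbar_neg \<eta> \<omega> c x)) * wd (\<omega> c x) - wd (\<omega> c x) * adj (\<omega> c x) (wd (Dbar_neg \<eta> \<omega> c x))) (cj \<alpha>)" for \<alpha>
    unfolding ap_simps(4,6) cj_simps S W ..
  \<comment> \<open>Under conjugation and the change from \<open>\<eta>\<close> to
    \<open>- \<eta>\<close>, the form \<open>dbar_neg_eta\<close> becomes minus
    \<open>d_eta_eta\<close>. With the signs from \<open>1 / - \<eta>\<close> and from the conjugate
    of i this makes three, hence the minus sign in front of \<open>g2\<close>.\<close>
  have F: "cj (ap (gp (\<lambda>x. - \<eta> x) c x - sc (of_real (- \<eta> x)) * gq (\<lambda>x. - \<eta> x) c x) \<alpha>) =
      - ap (sc (of_real (\<eta> x)) * gp \<eta> c x + gq \<eta> c x) (cj \<alpha>)" for \<alpha>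
    unfolding gp_minus[OF c \<eta>(1)] by (simp add: cj_simps cj_gp[OF c \<eta>(1)] cj_gq[OF c \<eta>(1)] scl_simps)
  show "conj_form ?Y c x = (fscale (\<lambda>_. - \<i>) (D_eta \<eta> (Lam_form u) - Lam_form (D_eta \<eta> u)) - t2 u - fscale (\<lambda>_. of_nat CARD('n)) (g2 u)) c x"
    unfolding conj_form_apply[of ?Y] adjoint_D_eta_apply[OF minus c cu] Lam_form_conj[OF u] B conj_form_apply cj_simps cj_Lam[OF m] F
      SW form_apply fscale_apply t2_eq opf_apply[OF c] Lam_form_apply[OF c] g_apply[OF c]
    by (simp add: scl_simps ap_minus del: ap_simps(3))
qed

end

lemma D_eta_const:
  assumes u: "smooth_form A u"
  shows "D_eta \<eta> (fscale (\<lambda>_. k) u) = fscale (\<lambda>_. k) (D_eta \<eta> u)" "Dbar_neg \<eta> (fscale (\<lambda>_. k) u) = fscale (\<lambda>_. k) (Dbar_neg \<eta> u)"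
proof -
  have ku: "smooth_form A (fscale (\<lambda>_. k) u)" by (rule smooth_form_fscale_const[OF u])
  have d: "del (fscale (\<lambda>_. k) u) c x = scl k (del u c x)" "delbar (fscale (\<lambda>_. k) u) c x = scl k (delbar u c x)"
    if c: "c \<in> A" and x: "x \<in> cdom c" for c x
  proof -
    note ch = chartA[OF c]
    have fs: "fscale (\<lambda>_. k) u c = (\<lambda>y. scl k (u c y))" by (rule ext) (simp only: fscale_apply)
    have "DE D (fscale (\<lambda>_. k) u c) = scl k (DE D (u c))" if D: "dv c x D" for D
      using DE_simps(4)[OF ch D sm_const[OF ch] sf_smE[OF u c], of k] unfolding fs by (simp only: dv_simps(3)[OF ch D] scl_simps(7) add_0_left)
    note this[OF dv_wirt[OF ch x]] this[OF dv_wirtbar[OF ch x]]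
    then show "del (fscale (\<lambda>_. k) u) c x = scl k (del u c x)" "delbar (fscale (\<lambda>_. k) u) c x = scl k (delbar u c x)"
      unfolding del_apply[OF x] delbar_apply[OF x] by (simp_all only: ap_scl scl_sum)
  qed
  show "D_eta \<eta> (fscale (\<lambda>_. k) u) = fscale (\<lambda>_. k) (D_eta \<eta> u)"
  proof (rule smooth_form_eqI)
    fix c x assume c: "c \<in> A" "x \<in> cdom c"
    show "D_eta \<eta> (fscale (\<lambda>_. k) u) c x = fscale (\<lambda>_. k) (D_eta \<eta> u) c x"
      unfolding fscale_apply D_eta_apply[OF c \<eta> ku] D_eta_apply[OF c \<eta> u] d[OF c] ap_scl by (simp only: scl_simps mult.commute)
  qed (intro smooth_D smooth_form_fscale_const u)+
  show "Dbar_neg \<eta> (fscale (\<lambda>_. k) u) = fscale (\<lambda>_. k) (Dbar_neg \<eta> u)"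
  proof (rule smooth_form_eqI)
    fix c x assume c: "c \<in> A" "x \<in> cdom c"
    show "Dbar_neg \<eta> (fscale (\<lambda>_. k) u) c x = fscale (\<lambda>_. k) (Dbar_neg \<eta> u) c x"
      unfolding fscale_apply Dbar_apply[OF c \<eta> ku] Dbar_apply[OF c \<eta> u] d[OF c] ap_scl by (simp only: scl_simps mult.commute)
  qed (intro smooth_B smooth_form_fscale_const u)+
qed

lemma D_eta_diff:
  assumes u: "smooth_form A u" and v: "smooth_form A v"
  shows "D_eta \<eta> (u - v) = D_eta \<eta> u - D_eta \<eta> v" "Dbar_neg \<eta> (u - v) = Dbar_neg \<eta> u - Dbar_neg \<eta> v"
proof -
  have e: "w - w' = w + fscale (\<lambda>_. - 1) w'" for w w' :: "('a, 'n) form" by (simp add: fscale_def fun_eq_iff)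
  note kv = smooth_form_fscale_const[OF v, of "- 1"]
  show "D_eta \<eta> (u - v) = D_eta \<eta> u - D_eta \<eta> v" "Dbar_neg \<eta> (u - v) = Dbar_neg \<eta> u - Dbar_neg \<eta> v"
    unfolding e D_eta_add[OF \<eta> u kv] Dbar_add[OF \<eta> u kv] D_eta_const[OF v] by (rule refl)+
qed

text \<open>Each variable stands for one word in \<open>D\<close> (for \<open>D_eta\<close>),
  \<open>B\<close> (for \<open>Dbar_neg\<close>), \<open>L\<close> (for \<open>Lam_form\<close>) and
  the correction operators, applied to \<open>u\<close>. On the right the words \<open>BDL\<close>
  and \<open>LDB\<close> cancel between the second Laplacian and the double commutator, as do the
  terms with \<open>t2\<close> and \<open>g2\<close>; the remaining words form the left-hand
  side.\<close>

private lemma form_identity: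
  fixes DBL :: "('a, 'n) form"
  shows "(fscale (\<lambda>_. \<i>) (DBL - DLB) - Dt1 + fscale (\<lambda>_. n) Dg1) + (fscale (\<lambda>_. \<i>) (BLD - LBD) - t1D + fscale (\<lambda>_. n) g1D) =
    (fscale (\<lambda>_. - \<i>) (BDL - BLD) - Bt2 - fscale (\<lambda>_. n) Bg2) + (fscale (\<lambda>_. - \<i>) (DLB - LDB) - t2B - fscale (\<lambda>_. n) g2B)
    + fscale (\<lambda>_. \<i>) ((DBL + BDL) - (LDB + LBD)) + (Bt2 + t2B) - (Dt1 + t1D)
    + fscale (\<lambda>_. n) (Dg1 + g1D) + fscale (\<lambda>_. n) (Bg2 + g2B)"
  by (simp add: fscale_def fun_eq_iff algebra_simps)

text \<open>The operators act on arbitrary families of coefficients, but additivity is available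
  only on smooth forms. The proof therefore expands the two outer applications of
  \<open>D_eta\<close> and \<open>Dbar_neg\<close> with smoothness checked for every summand, and
  leaves the rest to \<open>form_identity\<close>.\<close>

lemma bochner_kodaira_nakano:
  assumes u: "smooth_form A u"
  shows "Laplace_eta A \<omega> \<eta> u =
    (Laplacebar_neg A \<omega> \<eta>
     + mult_op (\<lambda>_. \<i>) (gcomm 2 (-2) (gcomm 1 1 (D_eta \<eta>) (Dbar_neg \<eta>)) (lefschetz_adj A \<omega>))
     + gcomm 1 (-1) (Dbar_neg \<eta>) (pointwise_adjoint A \<omega> (torsionbar_neg A \<omega> \<eta>))
     - gcomm 1 (-1) (D_eta \<eta>) (pointwise_adjoint A \<omega> (torsion A \<omega> \<eta>))
     + mult_op (\<lambda>_. of_nat CARD('n))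
         (gcomm 1 (-1) (D_eta \<eta>) (mult_op (\<lambda>x. 1 / of_real (\<eta> x))
           (gcomm 1 (-2) (\<lambda>v. fscale (\<lambda>_. \<i>) (dbar_neg_eta A \<eta>) \<and>\<and> v) (lefschetz_adj A \<omega>))))
     + mult_op (\<lambda>_. of_nat CARD('n))
         (gcomm 1 (-1) (Dbar_neg \<eta>) (mult_op (\<lambda>x. 1 / of_real (\<eta> x))
           (gcomm 1 (-2) (\<lambda>v. fscale (\<lambda>_. \<i>) (d_eta_eta A \<eta>) \<and>\<and> v) (lefschetz_adj A \<omega>))))) u"
proof -
  let ?D = "D_eta \<eta>" and ?B = "Dbar_neg \<eta>" and ?L = Lam_form and ?n = "of_nat CARD('n) :: complex"
  note Du = smooth_D[OF u] and Bu = smooth_B[OF u] and Lu = smooth_form_Lam[OF u]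
  note t = smooth_t[OF u] and g = smooth_g[OF u]
  have 1: "?D (formal_adjoint A \<omega> ?D u) = fscale (\<lambda>_. \<i>) (?D (?B (?L u)) - ?D (?L (?B u))) - ?D (t1 u) + fscale (\<lambda>_. ?n) (?D (g1 u))"
  proof -
    have s: "smooth_form A (?B (?L u) - ?L (?B u))" by (intro smooth_form_diff smooth_B smooth_form_Lam u)
    note s' = smooth_form_fscale_const[OF s, of \<i>] smooth_form_fscale_const[OF g(1), of ?n]
    show ?thesis
      unfolding formal_adjoint_D_eta_eq[OF u] D_eta_add[OF \<eta> smooth_form_diff[OF s'(1) t(1)] s'(2)] D_eta_diff(1)[OF s'(1) t(1)]
        D_eta_const(1)[OF s] D_eta_const(1)[OF g(1)] D_eta_diff(1)[OF smooth_B[OF Lu] smooth_form_Lam[OF Bu]] ..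
  qed
  have 2: "?B (formal_adjoint A \<omega> ?B u) = fscale (\<lambda>_. - \<i>) (?B (?D (?L u)) - ?B (?L (?D u))) - ?B (t2 u) - fscale (\<lambda>_. ?n) (?B (g2 u))"
  proof -
    have s: "smooth_form A (?D (?L u) - ?L (?D u))" by (intro smooth_form_diff smooth_D smooth_form_Lam u)
    note s' = smooth_form_fscale_const[OF s, of "- \<i>"] smooth_form_fscale_const[OF g(2), of ?n]
    show ?thesis
      unfolding formal_adjoint_Dbar_eq[OF u] D_eta_diff(2)[OF smooth_form_diff[OF s'(1) t(2)] s'(2)] D_eta_diff(2)[OF s'(1) t(2)]
        D_eta_const(2)[OF s] D_eta_const(2)[OF g(2)] D_eta_diff(2)[OF smooth_D[OF Lu] smooth_form_Lam[OF Du]] ..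
  qed
  have DB: "smooth_form A (?D (?B u) + ?B (?D u))" by (intro smooth_form_add smooth_D smooth_B u)
  show ?thesis
    unfolding oper_apply Laplace_eta_def Laplacebar_neg_def mult_op_def[of "\<lambda>_. _"] gcomm_simps lefschetz_adj_eq[OF u] lefschetz_adj_eq[OF DB] Lam_form_add
      t1_def[symmetric] t2_def[symmetric] g1_def[symmetric] g2_def[symmetric]
      1 2 formal_adjoint_D_eta_eq[OF Du] formal_adjoint_Dbar_eq[OF Bu]
    by (rule form_identity)
qed

end

end

theorem proposition3p6:
  fixes A :: "('a::{t2_space, second_countable_topology}, 'n::{finite, linorder}) chart set"
    and \<omega> :: "('a, 'n) form"
    and \<eta> :: "'a \<Rightarrow> real"
    and k :: nat
    and u :: "('a, 'n) form"
  assumes "complex_atlas A"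
    and "hermitian_metric A \<omega>"
    and "CARD('n) \<ge> 2"
    and "smooth_fun A \<eta>"
    and "(\<forall>x. \<eta> x > 0) \<or> (\<forall>x. \<eta> x < 0)"
    and "k \<le> 2 * CARD('n)"
    and "smooth_form A u"
    and "of_degree k u"
  shows "Laplace_eta A \<omega> \<eta> u =
    (Laplacebar_neg A \<omega> \<eta>
     + mult_op (\<lambda>_. \<i>) (gcomm 2 (-2) (gcomm 1 1 (D_eta \<eta>) (Dbar_neg \<eta>)) (lefschetz_adj A \<omega>))
     + gcomm 1 (-1) (Dbar_neg \<eta>) (pointwise_adjoint A \<omega> (torsionbar_neg A \<omega> \<eta>))
     - gcomm 1 (-1) (D_eta \<eta>) (pointwise_adjoint A \<omega> (torsion A \<omega> \<eta>))
     + mult_op (\<lambda>_. of_nat CARD('n))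
         (gcomm 1 (-1) (D_eta \<eta>) (mult_op (\<lambda>x. 1 / of_real (\<eta> x))
           (gcomm 1 (-2) (\<lambda>v. fscale (\<lambda>_. \<i>) (dbar_neg_eta A \<eta>) \<and>\<and> v) (lefschetz_adj A \<omega>))))
     + mult_op (\<lambda>_. of_nat CARD('n))
         (gcomm 1 (-1) (Dbar_neg \<eta>) (mult_op (\<lambda>x. 1 / of_real (\<eta> x))
           (gcomm 1 (-2) (\<lambda>v. fscale (\<lambda>_. \<i>) (d_eta_eta A \<eta>) \<and>\<and> v) (lefschetz_adj A \<omega>))))) u"
proof -
  interpret hermitian A \<omega> using assms(1,2) by unfold_locales
  have "sreal \<eta>"
    unfolding sreal_def using assms(4) sm_of_real[OF chartA] by (auto simp: smooth_fun_def)
  moreover have "\<eta> x \<noteq> 0" for x using assms(5) by (metis less_irrefl)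
  ultimately show ?thesis by (rule bochner_kodaira_nakano[OF _ _ assms(7)])
qed

end
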